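(* Let $D\subset\mathbb{C}$ be a domain, let $k\in\mathbb{N}$ be a positive integer, and let $n_0,n_1,\ldots,n_k$ be non-negative integers with $n_0\geq 2$ and $n_k\geq 1$. For a meromorphic function $f$ put $M[f]=\prod_{j=0}^{k}\bigl(f^{(j)}\bigr)^{n_j}$. Let $m\ge 1$ be an integer and let $h\not\equiv 0$ be a holomorphic function in $D$ all of whose zeros have multiplicity at most $m$. Let $\mathcal{F}\subset\mathcal{M}(D)$ be a family of meromorphic functions on $D$ such that all zeros of each $f\in\mathcal{F}$ have multiplicities at least $k+m+1$. If for every $f,g\in\mathcal{F}$, $M[f]$ and $M[g]$ share $h$ in $D$, then $\mathcal{F}$ is normal in $D$.
   Context: $\mathcal{M}(D)$ is the class of meromorphic functions on $D$. A family $\mathcal{F}\subset\mathcal{M}(D)$ is normal in $D$ if every sequence in $\mathcal{F}$ has a subsequence converging locally uniformly in $D$ with respect to the spherical metric; the limit is either meromorphic in $D$ or identically $\infty$. Two meromorphic functions $\varphi,\psi$ on $D$ share the function $h$ in $D$ if $\{\zeta\in D:\varphi(\zeta)-h(\zeta)=0\}=\{\zeta\in D:\psi(\zeta)-h(\zeta)=0\}$ as sets (multiplicities ignored). *)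

theory Defs
  imports "HOL-Complex_Analysis.Complex_Analysis"
begin

text \<open>
  A meromorphic function on \<open>D\<close> is represented by \<open>f nicely_meromorphic_on D\<close>: \<open>f\<close> has its true
  value at every point of \<open>D\<close> that is not a pole, and the placeholder value 0 at its poles.
  The definitions below therefore always separate poles by \<^const>\<open>is_pole\<close>.
\<close>

text \<open>
  The Riemann sphere is the unit sphere of \<^typ>\<open>complex \<times> real\<close>, whose \<^const>\<open>dist\<close> is the
  Euclidean one, with the point at infinity at the north pole. The spherical metric is the chordal
  one, i.e. the distance of the images under stereographic projection; the explicit formulas are
  given in \<open>dist_stereographic\<close> and \<open>dist_stereographic_infinity\<close>. (The great circle distance lies
  between the chordal distance and \<open>\<pi>/2\<close> times it, so uniform convergence is the same for both.)
\<close>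

definition sphere_infinity :: "complex \<times> real" where
  "sphere_infinity = (0, 1)"

definition stereographic :: "complex \<Rightarrow> complex \<times> real" where
  "stereographic z =
     (2 * z / of_real (1 + (cmod z)\<^sup>2), ((cmod z)\<^sup>2 - 1) / (1 + (cmod z)\<^sup>2))"

definition sphere_value :: "(complex \<Rightarrow> complex) \<Rightarrow> complex \<Rightarrow> complex \<times> real" where
  "sphere_value f z = (if is_pole f z then sphere_infinity else stereographic (f z))"

lemma dist_stereographic:
  "dist (stereographic z) (stereographic w) =
     2 * cmod (z - w) / (sqrt (1 + (cmod z)\<^sup>2) * sqrt (1 + (cmod w)\<^sup>2))"
proof -
  define a b where "a = 1 + (cmod z)\<^sup>2" and "b = 1 + (cmod w)\<^sup>2"
  have pos: "a > 0" "b > 0"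
    by (simp_all add: a_def b_def add_pos_nonneg)
  have a2: "a = 1 + (Re z)\<^sup>2 + (Im z)\<^sup>2" and b2: "b = 1 + (Re w)\<^sup>2 + (Im w)\<^sup>2"
    by (simp_all add: a_def b_def cmod_power2)
  have eq: "stereographic z = (2 * z / of_real a, (a - 2) / a)"
           "stereographic w = (2 * w / of_real b, (b - 2) / b)"
    by (simp_all add: stereographic_def a_def b_def)
  have "(dist (stereographic z) (stereographic w))\<^sup>2 =
          (2 * Re z / a - 2 * Re w / b)\<^sup>2 + (2 * Im z / a - 2 * Im w / b)\<^sup>2 +
          ((a - 2) / a - (b - 2) / b)\<^sup>2"
    unfolding eq dist_Pair_Pair by (simp add: dist_norm cmod_power2)
  also have "\<dots> = ((2 * Re z * b - 2 * Re w * a)\<^sup>2 + (2 * Im z * b - 2 * Im w * a)\<^sup>2 +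
                   ((a - 2) * b - (b - 2) * a)\<^sup>2) / (a * b)\<^sup>2"
    using pos by (simp add: diff_frac_eq power_divide add_divide_distrib)
  also have "(2 * Re z * b - 2 * Re w * a)\<^sup>2 + (2 * Im z * b - 2 * Im w * a)\<^sup>2 +
             ((a - 2) * b - (b - 2) * a)\<^sup>2 =
             4 * ((Re z - Re w)\<^sup>2 + (Im z - Im w)\<^sup>2) * (a * b)"
    unfolding a2 b2 by algebra
  also have "\<dots> / (a * b)\<^sup>2 = 4 * (cmod (z - w))\<^sup>2 / (a * b)"
    using pos by (simp add: cmod_power2 power2_eq_square [of "a * b"])
  also have "\<dots> = (2 * cmod (z - w) / (sqrt a * sqrt b))\<^sup>2"
    using pos by (simp add: power_divide power_mult_distrib)
  finally show ?thesis
    unfolding a_def [symmetric] b_def [symmetric]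
    using pos by (subst (asm) power2_eq_iff_nonneg) auto
qed

lemma dist_stereographic_infinity:
  "dist (stereographic z) sphere_infinity = 2 / sqrt (1 + (cmod z)\<^sup>2)"
proof -
  define a where "a = 1 + (cmod z)\<^sup>2"
  have pos: "a > 0"
    by (simp add: a_def add_pos_nonneg)
  have eq: "stereographic z = (2 * z / of_real a, (a - 2) / a)"
    by (simp add: stereographic_def a_def)
  have "(dist (stereographic z) sphere_infinity)\<^sup>2 =
          (2 * cmod z / a)\<^sup>2 + ((a - 2) / a - 1)\<^sup>2"
    unfolding eq sphere_infinity_def dist_Pair_Pair using pos
    by (simp add: dist_norm norm_divide norm_mult power2_commute)
  also have "(a - 2) / a - 1 = - 2 / a"
    using pos by (simp add: field_simps)
  also have "(2 * cmod z / a)\<^sup>2 + (- 2 / a)\<^sup>2 = 4 * a / a\<^sup>2"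
    by (simp add: power_divide power_mult_distrib a_def add_divide_distrib)
  also have "\<dots> = (2 / sqrt a)\<^sup>2"
    using pos by (simp add: power_divide power2_eq_square)
  finally show ?thesis
    unfolding a_def [symmetric] using pos by (subst (asm) power2_eq_iff_nonneg) auto
qed

definition spherical_locally_uniform_limit ::
    "complex set \<Rightarrow> (nat \<Rightarrow> complex \<Rightarrow> complex) \<Rightarrow> (complex \<Rightarrow> complex \<times> real) \<Rightarrow> bool" where
  "spherical_locally_uniform_limit D f g \<longleftrightarrow>
     (\<forall>z\<in>D. \<exists>r>0. cball z r \<subseteq> D \<and>
        uniform_limit (cball z r) (\<lambda>n. sphere_value (f n)) g sequentially)"

definition normal_family :: "complex set \<Rightarrow> (complex \<Rightarrow> complex) set \<Rightarrow> bool" where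
  "normal_family D F \<longleftrightarrow>
     (\<forall>f :: nat \<Rightarrow> complex \<Rightarrow> complex. range f \<subseteq> F \<longrightarrow>
        (\<exists>s :: nat \<Rightarrow> nat. strict_mono s \<and>
           ((\<exists>g. g nicely_meromorphic_on D \<and>
                 spherical_locally_uniform_limit D (f \<circ> s) (sphere_value g)) \<or>
            spherical_locally_uniform_limit D (f \<circ> s) (\<lambda>_. sphere_infinity))))"

definition zeros_in :: "complex set \<Rightarrow> (complex \<Rightarrow> complex) \<Rightarrow> complex set" where
  "zeros_in D f = {z \<in> D. \<not> is_pole f z \<and> f z = 0}"

definition share_function ::
    "complex set \<Rightarrow> (complex \<Rightarrow> complex) \<Rightarrow> (complex \<Rightarrow> complex) \<Rightarrow> (complex \<Rightarrow> complex) \<Rightarrow> bool" where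
  "share_function D h \<phi> \<psi> \<longleftrightarrow>
     zeros_in D (\<lambda>z. \<phi> z - h z) = zeros_in D (\<lambda>z. \<psi> z - h z)"

text \<open>
  At a pole of \<open>f\<close> the values \<open>(deriv ^^ j) f\<close> are unspecified. This is harmless as soon as
  some \<open>n j\<close> with \<open>j \<le> k\<close> is positive: the poles of the monomial are then exactly the poles of \<open>f\<close>,
  and they are excluded in \<^const>\<open>zeros_in\<close>.
\<close>

definition diff_monomial ::
    "nat \<Rightarrow> (nat \<Rightarrow> nat) \<Rightarrow> (complex \<Rightarrow> complex) \<Rightarrow> complex \<Rightarrow> complex" where
  "diff_monomial k n f z = (\<Prod>j\<le>k. ((deriv ^^ j) f z) ^ n j)"

text \<open>
  \<^const>\<open>zorder\<close> is the multiplicity at an isolated zero. On a domain, the only meromorphic function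
  with a non-isolated zero is the zero function, whose zeros have infinite multiplicity; it satisfies
  the condition below for every \<open>p\<close>.
\<close>

definition zeros_mult_ge :: "complex set \<Rightarrow> nat \<Rightarrow> (complex \<Rightarrow> complex) \<Rightarrow> bool" where
  "zeros_mult_ge D p f \<longleftrightarrow> (\<forall>z\<in>D. isolated_zero f z \<longrightarrow> zorder f z \<ge> int p)"

end

theory Submission
 imports Defs
begin

text \<open>
 Let \<open>M[f] = \<Prod>j\<le>k. (f^(j))^(n j)\<close>, of degree \<open>\<Sum> n j\<close> and weight \<open>\<Sum> j * n j\<close>. By Marty's criterion
 (\<open>normal_of_locally_bounded\<close>) it suffices to bound the spherical derivatives of all \<open>f \<in> F\<close> near each point
 a. Write h z = (z - a)^t * b z with \<open>b a ~= 0\<close> and \<open>t <= m\<close>. Since all M[f] - h have the same zeros, and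
 those of a single one are isolated or fill a neighbourhood, near a either no M[f] equals h away from a,
 or every M[f] equals h. Both cases run in parallel: the Boolean eqn says which one holds.

 If the spherical derivatives are unbounded near a, Zalcman's lemma (zalcman), with the exponent \<open>\<alpha>\<close> for which
 \<open>\<alpha> * degree = weight + t\<close>, gives points \<open>z i \<rightarrow> a\<close> and scales \<open>\<rho> i \<rightarrow> 0\<close> such that
 \<open>(\<rho> i)^(-\<alpha>) * f i (z i + \<rho> i * \<zeta>)\<close> converges to a nonconstant meromorphic g on the plane whose spherical value is
 Lipschitz and whose zeros have multiplicity at least k + m + 1. There are two cases.

 If \<open>(z i - a) / \<rho> i\<close> stays bounded along a subsequence, with limit w, then by Hurwitz M[g] omits
 \<open>b a * (\<zeta> + w)^t\<close> away from -w or coincides with it (\<open>blowup_constant\<close>), contradicting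
 \<open>value_distribution\<close>. If it tends to infinity, rescaling by \<open>\<bar>z i - a\<bar>\<close> instead turns a into a point at distance
 1, where the right-hand side has no zero; the case t = 0 bounds the spherical derivatives there, and this forces
 a derivative of g to vanish or g to be infinite (\<open>far_blowup_constant\<close>).

 The theorem \<open>value_distribution\<close> is a Nevanlinna argument. The Lipschitz condition gives quadratic growth of the
 characteristic chi g. With \<open>\<Psi> = M[g] / (c * (z - a0)^t) - 1\<close>, which has no zeros except perhaps at a0, and
 \<open>K = \<Psi>' / \<Psi>\<close>, Jensen's formula for g and K bounds chi g by logarithms
 (\<open>main_inequality\<close>): a zero of g of high order is a zero of K of almost degree times that order.
 Hence g has finitely many zeros and poles, and the constants rule out even these.
\<close>

section \<open>Means over circles\<close>

definition cmean :: "complex => real => (complex => 'a::banach) => 'a" where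
 "cmean z r u = integral {0..1} (%t. u (z + of_real r * cis (2 * pi * t)))"

lemma circle_point_in_sphere: "0 <= r ==> z + of_real r * cis x \<in> sphere z r"
 by (simp add: dist_norm norm_mult)

lemma circle_param_continuous: "continuous_on A (%t. z + of_real r * cis (2 * pi * t))"
 by (intro continuous_intros)

lemma cmean_integrable:
 fixes u :: "complex => 'a::banach"
 assumes "continuous_on (sphere z r) u" "0 <= r"
 shows "(%t. u (z + of_real r * cis (2 * pi * t))) integrable_on {0..1}"
proof (rule integrable_continuous_real)
 show "continuous_on {0..1} (%t. u (z + of_real r * cis (2 * pi * t)))"
  by (rule continuous_on_compose2[OF assms(1) circle_param_continuous])
    (use circle_point_in_sphere[OF assms(2)] in auto)
qed

lemma cmean_cong:
 assumes "0 <= r" "!!w. w \<in> sphere z r ==> u w = v w"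
 shows "cmean z r u = cmean z r v"
 unfolding cmean_def using assms circle_point_in_sphere by (intro integral_cong) blast

lemma cmean_const [simp]: "cmean z r (%_. c) = c"
 by (simp add: cmean_def)

lemma cmean_add:
 assumes "continuous_on (sphere z r) u" "continuous_on (sphere z r) v" "0 <= r"
 shows "cmean z r (%w. u w + v w) = cmean z r u + cmean z r v"
 unfolding cmean_def using assms by (intro integral_add cmean_integrable)

lemma cmean_cmult:
 fixes u :: "complex => real"
 shows "cmean z r (%w. c * u w) = c * cmean z r u"
 unfolding cmean_def by simp

lemma cmean_diff:
 assumes "continuous_on (sphere z r) u" "continuous_on (sphere z r) v" "0 <= r"
 shows "cmean z r (%w. u w - v w) = cmean z r u - cmean z r v"
 unfolding cmean_def using assms by (intro integral_diff cmean_integrable)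

lemma cmean_mono:
 fixes u :: "complex => real"
 assumes "continuous_on (sphere z r) u" "continuous_on (sphere z r) v" "0 <= r"
  and "!!w. w \<in> sphere z r ==> u w <= v w"
 shows "cmean z r u <= cmean z r v"
 unfolding cmean_def using assms circle_point_in_sphere
 by (intro integral_le cmean_integrable) blast+

lemma cmean_le_const:
 fixes u :: "complex => real"
 assumes "continuous_on (sphere z r) u" "0 <= r" "!!w. w \<in> sphere z r ==> u w <= c"
 shows "cmean z r u <= c"
 using cmean_mono[of z r u "%_. c"] assms by simp

lemma cmean_nonneg:
 fixes u :: "complex => real"
 assumes "continuous_on (sphere z r) u" "0 <= r" "!!w. w \<in> sphere z r ==> 0 <= u w"
 shows "0 <= cmean z r u"
 using cmean_mono[of z r "%_. 0" u] assms by simp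

lemma cmean_sum:
 fixes u :: "'b => complex => 'a::banach"
 assumes "finite S" "!!a. a \<in> S ==> continuous_on (sphere z r) (u a)" "0 <= r"
 shows "cmean z r (%w. \<Sum>a\<in>S. u a w) = (\<Sum>a\<in>S. cmean z r (u a))"
 unfolding cmean_def using assms by (intro integral_sum cmean_integrable) auto

lemma norm_cmean_le:
 fixes u :: "complex => 'a::banach"
 assumes "continuous_on (sphere z r) u" "continuous_on (sphere z r) v" "0 <= r"
  and "!!w. w \<in> sphere z r ==> norm (u w) <= v w"
 shows "norm (cmean z r u) <= cmean z r v"
 unfolding cmean_def using assms circle_point_in_sphere
 by (intro integral_norm_bound_integral cmean_integrable) blast+

lemma cmean_eq_contour_integral:
 assumes "continuous_on (sphere z r) f" "0 < r"
 shows "contour_integral (circlepath z r) (%w. f w / (w - z)) = 2 * of_real pi * \<i> * cmean z r f"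
proof -
 have *: "circlepath z r t = z + of_real r * cis (2 * pi * t)" for t
  by (simp add: circlepath cis_conv_exp mult_ac)
 have "contour_integral (circlepath z r) (%w. f w / (w - z)) =
    integral {0..1} (%t. f (z + of_real r * cis (2 * pi * t)) / (of_real r * cis (2 * pi * t)) *
      (2 * pi * \<i> * (of_real r * cis (2 * pi * t))))"
  unfolding contour_integral_integral
  by (intro integral_cong)
    (simp add: vector_derivative_circlepath *, simp add: cis_conv_exp mult_ac)
 also have "... = integral {0..1} (%t. (2 * pi * \<i>) * f (z + of_real r * cis (2 * pi * t)))"
  using assms by (intro integral_cong) auto
 also have "... = 2 * of_real pi * \<i> * cmean z r f"
  by (simp add: cmean_def)
 finally show ?thesis .
qed

lemma cmean_holomorphic:
 assumes "continuous_on (cball z r) f" "f holomorphic_on ball z r" "0 < r"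
 shows "cmean z r f = f z"
proof -
 have "contour_integral (circlepath z r) (%w. f w / (w - z)) = 2 * of_real pi * \<i> * f z"
  using Cauchy_integral_circlepath[OF assms(1,2), of z] assms(3)
  by (intro contour_integral_unique) auto
 moreover have "continuous_on (sphere z r) f"
  using assms(1) by (rule continuous_on_subset) auto
 ultimately show ?thesis
  using cmean_eq_contour_integral[of z r f] assms(3) by simp
qed

lemma Re_cmean:
 assumes "continuous_on (sphere z r) f" "0 <= r"
 shows "Re (cmean z r f) = cmean z r (%w. Re (f w))"
 unfolding cmean_def using integral_linear[OF cmean_integrable[OF assms] bounded_linear_Re]
 by (simp add: o_def)

lemma cnj_cmean:
 assumes "continuous_on (sphere z r) f" "0 <= r"
 shows "cnj (cmean z r f) = cmean z r (%w. cnj (f w))"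
 unfolding cmean_def using integral_linear[OF cmean_integrable[OF assms] bounded_linear_cnj]
 by (simp add: o_def)

lemma cmean_Re_holomorphic:
 assumes "continuous_on (cball z r) f" "f holomorphic_on ball z r" "0 < r"
 shows "cmean z r (%w. Re (f w)) = Re (f z)"
 using Re_cmean[of z r f] cmean_holomorphic[OF assms] assms
 by (metis continuous_on_subset less_imp_le sphere_cball)

lemma cmean_ln_cmod_holomorphic:
 assumes "f holomorphic_on ball z R" "0 < r" "r < R" "!!w. w \<in> ball z R ==> f w ~= 0"
 shows "cmean z r (%w. ln (cmod (f w))) = ln (cmod (f z))"
proof -
 obtain g where g: "g holomorphic_on ball z R" "!!w. w \<in> ball z R ==> f w = exp (g w)"
  using contractible_imp_holomorphic_log[OF assms(1) convex_imp_contractible assms(4)] by auto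
 have eq: "ln (cmod (f w)) = Re (g w)" if "w \<in> ball z R" for w
  using g(2)[OF that] by simp
 have "cmean z r (%w. ln (cmod (f w))) = cmean z r (%w. Re (g w))"
  by (rule cmean_cong) (use assms(2,3) eq in auto)
 also have "... = Re (g z)"
  by (rule cmean_Re_holomorphic)
    (use assms(2,3) g(1) in \<open>auto intro!: holomorphic_on_imp_continuous_on intro: holomorphic_on_subset\<close>)
 also have "... = ln (cmod (f z))"
  using eq[of z] assms(2,3) by simp
 finally show ?thesis .
qed

text \<open>
 For \<open>cmod a < r\<close> the kernel ln (cmod (z - a)) agrees on the circle with the harmonic ln (cmod (r - cnj a * z / r)).
\<close>

lemma cmean_ln_dist:
 assumes "0 < r" "cmod a ~= r"
 shows "cmean 0 r (%z. ln (cmod (z - a))) = ln (max r (cmod a))"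
proof (cases "cmod a < r")
 case False
 with assms have *: "r < cmod a" by simp
 have "cmean 0 r (%z. ln (cmod (z - a))) = ln (cmod (0 - a))"
  by (rule cmean_ln_cmod_holomorphic[where R = "cmod a"]) (use assms * in \<open>auto intro!: holomorphic_intros\<close>)
 thus ?thesis using * by simp
next
 case True
 have mod: "cmod (z - a) = cmod (of_real r - cnj a * z / of_real r)" if "cmod z = r" for z
 proof -
  have zz: "z * cnj z = of_real r * of_real r"
   using that by (simp add: complex_norm_square[symmetric] power2_eq_square)
  have "cmod (z - a) = cmod (cnj (z - a))" by (simp only: complex_mod_cnj)
  also have "... * r = cmod (cnj (z - a) * z)"
   using that by (simp only: norm_mult)
  also have "cnj (z - a) * z = of_real r * (of_real r - cnj a * z / of_real r)"
   using zz assms by (simp add: algebra_simps)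
  also have "cmod ... = r * cmod (of_real r - cnj a * z / of_real r)"
   using assms by (simp add: norm_mult)
  finally show ?thesis using assms by simp
 qed
 have R: "\<exists>R>r. R * cmod a < r * r"
 proof (cases "a = 0")
  case True
  thus ?thesis using assms by (intro exI[of _ "r+1"]) auto
 next
  case False
  hence "r < r * r / cmod a" using True assms by (simp add: field_simps)
  then obtain R where "r < R" "R < r * r / cmod a" using dense by blast
  thus ?thesis using False by (auto simp: field_simps)
 qed
 then obtain R where R: "r < R" "R * cmod a < r * r" by blast
 have nz: "of_real r - cnj a * z / of_real r ~= 0" if "z \<in> ball 0 R" for z
 proof
  assume "of_real r - cnj a * z / of_real r = 0"
  hence "cnj a * z = of_real r * of_real r" using assms by (simp add: field_simps)
  hence "cmod (cnj a * z) = r * r" using assms by (simp add: norm_mult)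
  hence "cmod a * cmod z = r * r" by (simp add: norm_mult)
  moreover have "cmod a * cmod z <= cmod a * R" using that by (intro mult_left_mono) auto
  ultimately show False using R by (simp add: mult.commute)
 qed
 have "cmean 0 r (%z. ln (cmod (z - a))) = cmean 0 r (%z. ln (cmod (of_real r - cnj a * z / of_real r)))"
  by (rule cmean_cong) (use assms mod in auto)
 also have "... = ln (cmod (of_real r - cnj a * 0 / of_real r))"
  by (rule cmean_ln_cmod_holomorphic[where R = R]) (use assms R nz in \<open>auto intro!: holomorphic_intros\<close>)
 finally show ?thesis using True assms by simp
qed

lemma cmean_abs_ln_dist_le:
 assumes "1 <= r" "cmod a ~= r" "cmod a <= s" "r <= s"
 shows "cmean 0 r (%z. \<bar>ln (cmod (z - a))\<bar>) <= 2 * ln (2 * s)"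
proof -
 have nz: "z - a ~= 0" if "z \<in> sphere 0 r" for z :: complex
  using that assms by auto
 have c: "continuous_on (sphere 0 r) (%z. ln (cmod (z - a)))"
  using nz by (intro continuous_intros) auto
 have "cmean 0 r (%z. \<bar>ln (cmod (z - a))\<bar>) <= cmean 0 r (%z. 2 * ln (2 * s) - ln (cmod (z - a)))"
 proof (rule cmean_mono)
  fix z :: complex assume z: "z \<in> sphere 0 r"
  have "cmod (z - a) <= 2 * s" using z assms norm_triangle_ineq4[of z a] by simp
  hence "ln (cmod (z - a)) <= ln (2 * s)"
   using nz[OF z] assms by (subst ln_le_cancel_iff) auto
  moreover have "0 <= ln (2 * s)" using assms by simp
  ultimately show "\<bar>ln (cmod (z - a))\<bar> <= 2 * ln (2 * s) - ln (cmod (z - a))"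
   by linarith
 qed (use c assms in \<open>auto intro!: continuous_intros\<close>)
 also have "... = 2 * ln (2 * s) - cmean 0 r (%z. ln (cmod (z - a)))"
  using assms c by (subst cmean_diff) (auto intro: continuous_intros)
 also have "... = 2 * ln (2 * s) - ln (max r (cmod a))"
  using assms by (subst cmean_ln_dist) auto
 also have "... <= 2 * ln (2 * s)" using assms by simp
 finally show ?thesis .
qed

text \<open>
 Schwarz's formula recovers H up to a constant from its real part on the circle. It is applied to H = ln F,
 of which only ln (cmod F) is under control.
\<close>

lemma deriv_bound_Re_mean:
 assumes H: "H holomorphic_on ball 0 R1" and R: "0 < R" "R < R1" and z: "cmod z < R"
 shows "cmod (deriv H z) <= 2 * R / (R - cmod z)^2 * cmean 0 R (%w. \<bar>Re (H w)\<bar>)"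
proof -
 have contH: "continuous_on (ball 0 R1) H"
  using H by (rule holomorphic_on_imp_continuous_on)
 have sub: "sphere (0::complex) R \<subseteq> ball 0 R1" "cball (0::complex) R \<subseteq> ball 0 R1" "ball (0::complex) R \<subseteq> ball 0 R1" using R by auto
 have nz: "w - z ~= 0" if "w \<in> sphere 0 R" for w using that z by auto
 define k where "k = (%w. w / (w - z)^2)"
 have ck: "continuous_on (sphere 0 R) k" unfolding k_def
  using nz by (intro continuous_intros) auto
 have cH: "continuous_on (sphere 0 R) H" using contH sub continuous_on_subset by blast
 have 1: "deriv H z = cmean 0 R (%w. H w * k w)"
 proof -
  have "contour_integral (circlepath 0 R) (%u. H u/(u-z)^2) = (2 * pi * \<i>) * deriv H z"
   by (rule Cauchy_contour_integral_circlepath_2)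
     (use contH H sub z in \<open>auto intro: continuous_on_subset holomorphic_on_subset\<close>)
  also have "contour_integral (circlepath 0 R) (%u. H u/(u-z)^2) =
        contour_integral (circlepath 0 R) (%u. (H u * k u) / (u - 0))"
   by (rule contour_integral_cong) (use R in \<open>auto simp: k_def\<close>)
  also have "... = 2 * of_real pi * \<i> * cmean 0 R (%w. H w * k w)"
   using cH ck R by (intro cmean_eq_contour_integral continuous_intros)
  finally show ?thesis by simp
 qed
 define G where "G = (%w. H w * (of_real (R^2) * w / (of_real (R^2) - cnj z * w)^2))"
 have nz2: "of_real (R^2) - cnj z * w ~= 0" if "cmod w <= R" for w
 proof
  assume "of_real (R^2) - cnj z * w = 0"
  hence "cmod (cnj z * w) = R^2" by (metis eq_iff_diff_eq_0 norm_of_real abs_power2)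
  moreover have "cmod z * cmod w <= cmod z * R" using that by (intro mult_left_mono) auto
  moreover have "cmod z * R < R * R" using z R by simp
  ultimately show False by (simp add: norm_mult power2_eq_square)
 qed
 have "cmean 0 R G = G 0"
 proof (rule cmean_holomorphic)
  have "continuous_on (cball 0 R) H" using contH sub continuous_on_subset by blast
  thus "continuous_on (cball 0 R) G" unfolding G_def
   using nz2 by (intro continuous_intros) auto
  have "H holomorphic_on ball 0 R" using H sub holomorphic_on_subset by blast
  thus "G holomorphic_on ball 0 R" unfolding G_def
   using nz2 by (intro holomorphic_intros) auto
 qed fact
 hence G0: "cmean 0 R G = 0" by (simp add: G_def)
 have eqG: "cnj (H w) * k w = cnj (G w)" if w: "w \<in> sphere 0 R" for w
 proof -
  have "cmod w = R" using w by simp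
  hence ww: "w * cnj w = of_real (R^2)"
   by (metis complex_norm_square of_real_power)
  have w0: "w ~= 0" using w R by auto
  have "of_real (R^2) - z * cnj w = cnj w * (w - z)"
   using ww by (simp add: algebra_simps)
  hence "cnj (G w) = cnj (H w) * (w * cnj w * cnj w / (cnj w * (w - z))^2)"
   by (simp add: G_def ww)
  also have "... = cnj (H w) * k w"
   using w0 by (simp add: k_def power2_eq_square)
  finally show ?thesis by simp
 qed
 have cG: "continuous_on (sphere 0 R) G" unfolding G_def
  using nz2 cH by (intro continuous_intros) auto
 have 2: "cmean 0 R (%w. cnj (H w) * k w) = 0"
 proof -
  have "cmean 0 R (%w. cnj (H w) * k w) = cmean 0 R (%w. cnj (G w))"
   by (rule cmean_cong) (use R eqG in auto)
  also have "... = cnj (cmean 0 R G)" using cG R by (simp add: cnj_cmean)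
  finally show ?thesis using G0 by simp
 qed
 have "deriv H z = cmean 0 R (%w. H w * k w) + cmean 0 R (%w. cnj (H w) * k w)"
  using 1 2 by simp
 also have "... = cmean 0 R (%w. H w * k w + cnj (H w) * k w)"
  using cH ck R by (subst cmean_add) (auto intro!: continuous_intros)
 also have "cmod ... <= cmean 0 R (%w. 2 * R / (R - cmod z)^2 * \<bar>Re (H w)\<bar>)"
 proof (rule norm_cmean_le)
  fix w :: complex assume w: "w \<in> sphere 0 R"
  have "H w * k w + cnj (H w) * k w = of_real (2 * Re (H w)) * k w"
   by (metis complex_add_cnj distrib_right)
  hence "cmod (H w * k w + cnj (H w) * k w) = 2 * \<bar>Re (H w)\<bar> * (R / (cmod (w - z))^2)"
   using w by (simp add: norm_mult k_def norm_divide norm_power)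
  also have "... <= 2 * \<bar>Re (H w)\<bar> * (R / (R - cmod z)^2)"
  proof -
   have "R - cmod z <= cmod (w - z)" using w norm_triangle_ineq2[of w z] by simp
   hence "(R - cmod z)^2 <= (cmod (w - z))^2" using z by (intro power_mono) auto
   hence "R / (cmod (w - z))^2 <= R / (R - cmod z)^2"
    using R z by (intro divide_left_mono mult_pos_pos) auto
   thus ?thesis by (intro mult_left_mono) auto
  qed
  finally show "cmod (H w * k w + cnj (H w) * k w) <= 2 * R / (R - cmod z)^2 * \<bar>Re (H w)\<bar>"
   by (simp add: mult_ac)
 qed (use cH ck R z in \<open>auto intro!: continuous_intros\<close>)
 also have "... = 2 * R / (R - cmod z)^2 * cmean 0 R (%w. \<bar>Re (H w)\<bar>)"
  by (rule cmean_cmult)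
 finally show ?thesis .
qed

section \<open>Divisors, Jensen formula and logarithmic derivatives\<close>

text \<open>
 The support of the divisor of a meromorphic F; removable singularities with a wrong value belong to it too.
\<close>

definition dv :: "(complex => complex) => complex set" where
 "dv F = {z. ~ (F analytic_on {z} & F z ~= 0)}"

text \<open>
 The Jensen weight of a point a in the disc of radius r; cut off at 0, so that points outside do not count.
\<close>

definition lam :: "real => complex => real" where
 "lam r a = max 0 (ln (r / cmod a))"

definition nn :: "(complex => complex) => real => real" where
 "nn F r = (\<Sum>a\<in>dv F Int ball 0 r. \<bar>real_of_int (zorder F a)\<bar>)"

text \<open>
 A symmetric Nevanlinna characteristic: it treats zeros and poles alike, so it is comparable to T(r, F) + T(r, 1/F).
\<close>

definition chi :: "(complex => complex) => real => real" where
 "chi F r = cmean 0 r (%z. \<bar>ln (cmod (F z))\<bar>) +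
       (\<Sum>a\<in>dv F Int ball 0 r. \<bar>real_of_int (zorder F a)\<bar> * lam r a)"

lemma lam_nonneg [simp]: "0 <= lam r a"
 by (simp add: lam_def)

lemma lam_eq: "a ~= 0 ==> cmod a < r ==> lam r a = ln r - ln (cmod a)"
proof -
 assume a: "a ~= 0" "cmod a < r"
 hence "0 < r" using norm_ge_zero[of a] by linarith
 with a show ?thesis by (simp add: lam_def ln_div max_def)
qed

lemma lam_eq_0: "0 < r ==> r <= cmod a ==> lam r a = 0"
 by (auto simp: lam_def max_def ln_div)

lemma dv_sparse:
 assumes "F meromorphic_on UNIV" "0 \<notin> dv F"
 shows "dv F sparse_in UNIV"
proof -
 have "eventually (%z. F z ~= 0) (cosparse UNIV)"
 proof -
  have "~ eventually (%z. F z = 0) (cosparse UNIV)"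
  proof
   assume "eventually (%z. F z = 0) (cosparse UNIV)"
   hence "eventually (%z. F z = 0) (at 0)"
    by (rule eventually_cosparse_imp_eventually_at) auto
   moreover have "eventually (%z. F z ~= 0) (at 0)"
    using assms(2) analytic_at_imp_isCont[of F 0]
    by (auto simp: dv_def isCont_def dest!: tendsto_imp_eventually_ne)
   ultimately have "eventually (%z::complex. False) (at 0)"
    by eventually_elim auto
   thus False by simp
  qed
  thus ?thesis
   using meromorphic_imp_constant_or_avoid[OF assms(1), of 0] by auto
 qed
 moreover have "eventually (%z. F analytic_on {z}) (cosparse UNIV)"
  using assms(1) by (rule meromorphic_on_imp_analytic_cosparse)
 ultimately have "eventually (%z. F analytic_on {z} & F z ~= 0) (cosparse UNIV)"
  by eventually_elim auto
 thus ?thesis by (simp add: eventually_cosparse dv_def)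
qed

lemma dv_finite:
 assumes "F meromorphic_on UNIV" "0 \<notin> dv F"
 shows "finite (dv F Int cball 0 r)" "finite (dv F Int ball 0 r)"
proof -
 have "dv F sparse_in cball 0 r"
  using dv_sparse[OF assms] sparse_in_subset by blast
 thus "finite (dv F Int cball 0 r)"
  using sparse_in_compact_finite[of "dv F" "cball 0 r"] by (simp add: Int_commute)
 thus "finite (dv F Int ball 0 r)"
  by (rule rev_finite_subset) auto
qed

lemma eventually_not_dv:
 assumes "F meromorphic_on UNIV" "0 \<notin> dv F"
 shows "eventually (%w. w \<notin> dv F) (at z)"
 using dv_sparse[OF assms] by (intro eventually_cosparse_imp_eventually_at[of _ UNIV])
  (auto simp: eventually_cosparse)

lemma frequently_nonzero_if_dv:
 assumes "F meromorphic_on UNIV" "0 \<notin> dv F"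
 shows "eventually (%w. F w ~= 0) (at z)" "frequently (%w. F w ~= 0) (at z)"
proof -
 show "eventually (%w. F w ~= 0) (at z)"
  using eventually_not_dv[OF assms] by eventually_elim (auto simp: dv_def)
 thus "frequently (%w. F w ~= 0) (at z)"
  by (rule eventually_frequently[rotated]) auto
qed

lemma zorder_not_dv:
 assumes "z \<notin> dv F"
 shows "zorder F z = 0"
proof -
 from assms have an: "F analytic_on {z}" and nz: "F z ~= 0" by (auto simp: dv_def)
 from an obtain S where "open S" "z \<in> S" "F holomorphic_on S"
  using analytic_at by blast
 thus ?thesis using nz by (intro zorder_eqI[of S z F]) auto
qed

lemma continuous_on_dv:
 assumes "A Int dv F = {}"
 shows "continuous_on A F" "!!z. z \<in> A ==> F z ~= 0"
proof -
 show "continuous_on A F"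
  using assms by (intro analytic_imp_holomorphic holomorphic_on_imp_continuous_on)
    (auto simp: dv_def analytic_on_analytic_at[of F A])
qed (use assms in \<open>auto simp: dv_def\<close>)

lemma continuous_on_ln_cmod_dv:
 assumes "A Int dv F = {}"
 shows "continuous_on A (%z. ln (cmod (F z)))"
 using continuous_on_dv[OF assms] by (intro continuous_intros) auto

lemma good_radius_neighbourhood:
 assumes "F meromorphic_on UNIV" "0 \<notin> dv F" "0 < R" "sphere 0 R Int dv F = {}"
 obtains R1 where "R < R1" "dv F Int ball 0 R1 = dv F Int ball 0 R"
proof -
 define T where "T = norm ` {a \<in> dv F Int cball 0 (R+1). R < norm a}"
 have fin: "finite T" unfolding T_def
  by (intro finite_imageI finite_subset[OF _ dv_finite(1)[OF assms(1,2), of "R+1"]]) auto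
 define R1 where "R1 = Min (insert (R+1) T)"
 have "R < R1" unfolding R1_def using fin by (subst Min_gr_iff) (auto simp: T_def)
 moreover have "dv F Int ball 0 R1 \<subseteq> ball 0 R"
 proof
  fix a assume a: "a \<in> dv F Int ball 0 R1"
  show "a \<in> ball 0 R"
  proof (rule ccontr)
   assume "a \<notin> ball 0 R"
   moreover have "norm a ~= R" using a assms(4) by auto
   ultimately have "R < norm a" by auto
   moreover have "R1 <= R + 1" unfolding R1_def using fin by auto
   ultimately have "norm a \<in> T" using a by (auto simp: T_def)
   hence "R1 <= norm a" unfolding R1_def using fin by auto
   thus False using a by auto
  qed
 qed
 ultimately have "dv F Int ball 0 R1 = dv F Int ball 0 R" by auto
 with \<open>R < R1\<close> show ?thesis using that[of R1] by blast
qed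

lemma remove_divisor_at:
 assumes F: "F meromorphic_on UNIV" "0 \<notin> dv F" and S: "finite S" "b \<in> S"
 defines "G \<equiv> %z. F z * (\<Prod>a\<in>S. (z - a) powi (- zorder F a))"
 shows "remove_sings G analytic_on {b}" "remove_sings G b ~= 0"
proof -
 have mero: "F meromorphic_on {b}" using F(1) meromorphic_on_subset by blast
 have iso: "isolated_singularity_at F b" "not_essential F b"
  using mero by (auto simp: meromorphic_at_iff)
 obtain r where r: "zor_poly F b b ~= 0" "0 < r" "zor_poly F b holomorphic_on cball b r"
   "!!w. w \<in> cball b r - {b} ==> F w = zor_poly F b w * (w - b) powi zorder F b & zor_poly F b w ~= 0"
  using zorder_exist[OF iso frequently_nonzero_if_dv(2)[OF F]] by blast
 define q where "q = zor_poly F b"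
 define E where "E = (%z. q z * (\<Prod>a\<in>S-{b}. (z - a) powi (- zorder F a)))"
 have qan: "q analytic_on {b}"
  using r(2,3) unfolding q_def
  by (meson analytic_at ball_subset_cball centre_in_ball holomorphic_on_subset open_ball)
 have Ean: "E analytic_on {b}"
  unfolding E_def using S by (intro analytic_intros qan) auto
 have Enz: "E b ~= 0"
  unfolding E_def using S r(1) by (auto simp: q_def)
 have inU: "eventually (%w. w \<in> ball b r - {b}) (at b)"
  using r(2) by (intro eventually_at_in_open) auto
 have eqU: "G w = E w" if elim: "w \<in> ball b r - {b}" for w
 proof -
   have *: "F w = q w * (w - b) powi zorder F b" using r(4)[of w] elim by (auto simp: q_def)
   have "G w = F w * ((w - b) powi (- zorder F b) * (\<Prod>a\<in>S-{b}. (w - a) powi (- zorder F a)))"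
    unfolding G_def using S by (subst prod.remove[of S b]) auto
   also have "... = E w"
    using elim unfolding * E_def by (simp add: power_int_minus field_simps)
   finally show ?thesis .
 qed
 have eq: "eventually (%w. G w = E w) (at b)"
  using inU by eventually_elim (rule eqU)
 have rs: "remove_sings G b = E b"
 proof (rule remove_sings_eqI)
  have "E \<midarrow>b\<rightarrow> E b"
   using analytic_at_imp_isCont[OF Ean] by (simp add: isCont_def)
  thus "G \<midarrow>b\<rightarrow> E b"
   using tendsto_cong[OF eq] by simp
 qed
 thus "remove_sings G b ~= 0" using Enz by simp
 have "eventually (%w. remove_sings G w = remove_sings E w) (nhds b)"
 proof -
  have "remove_sings G w = remove_sings E w" if "w = b" for w
   using rs Ean that by simp
  moreover have "eventually (%w. remove_sings G w = remove_sings E w) (at b)"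
  proof -
   have "eventually (%w. eventually (%u. G u = E u) (nhds w)) (at b)"
    using inU
   proof eventually_elim
    case (elim w)
    hence "eventually (%u. u \<in> ball b r - {b}) (nhds w)"
     by (intro eventually_nhds_in_open) auto
    thus ?case by eventually_elim (rule eqU)
   qed
   thus ?thesis
   proof eventually_elim
    case (elim w)
    hence "eventually (%u. G u = E u) (at w)"
     by (simp add: eventually_nhds_conv_at)
    thus ?case by (rule remove_sings_cong) simp
   qed
  qed
  ultimately show ?thesis by (simp add: eventually_nhds_conv_at)
 qed
 moreover have "eventually (%w. remove_sings E w = E w) (nhds b)"
  using eventually_remove_sings_eq_nhds[OF Ean] .
 ultimately have "eventually (%w. remove_sings G w = E w) (nhds b)"
  by eventually_elim simp
 thus "remove_sings G analytic_on {b}"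
  using Ean by (subst analytic_at_cong) auto
qed

text \<open>
 After dividing out the finitely many zeros and poles in a disc, the quotient has a holomorphic logarithm H.
\<close>

lemma divisor_factorization:
 assumes F: "F meromorphic_on UNIV" "0 \<notin> dv F" and R: "0 < R" "sphere 0 R Int dv F = {}"
 obtains R1 H where "R < R1" "H holomorphic_on ball 0 R1" "dv F Int ball 0 R1 = dv F Int ball 0 R"
  "!!z. z \<in> ball 0 R1 - dv F ==>
    F z = (\<Prod>a\<in>dv F Int ball 0 R. (z - a) powi zorder F a) * exp (H z)"
proof -
 obtain R1 where R1: "R < R1" "dv F Int ball 0 R1 = dv F Int ball 0 R"
  using good_radius_neighbourhood[OF F R] by blast
 define S where "S = dv F Int ball 0 R"
 have finS: "finite S" unfolding S_def using dv_finite[OF F] by auto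
 define G where "G = (%z. F z * (\<Prod>a\<in>S. (z - a) powi (- zorder F a)))"
 have good: "G analytic_on {z} & G z ~= 0" if "z \<in> ball 0 R1 - dv F" for z
 proof -
  have "z \<notin> S" using that by (auto simp: S_def)
  thus ?thesis using that finS unfolding G_def
   by (auto simp: dv_def intro!: analytic_intros)
 qed
 have an: "remove_sings G analytic_on {z} & remove_sings G z ~= 0" if "z \<in> ball 0 R1" for z
 proof (cases "z \<in> dv F")
  case True
  hence "z \<in> S" using that R1 by (auto simp: S_def)
  thus ?thesis using remove_divisor_at[OF F finS] unfolding G_def by blast
 next
  case False
  hence g: "G analytic_on {z}" "G z ~= 0" using good[of z] that by auto
  have "eventually (%w. remove_sings G w = G w) (nhds z)"
   using eventually_remove_sings_eq_nhds[OF g(1)] .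
  hence "remove_sings G analytic_on {z}" using g(1) by (subst analytic_at_cong) auto
  thus ?thesis using g by simp
 qed
 have "remove_sings G holomorphic_on ball 0 R1"
  using an by (intro analytic_imp_holomorphic) (auto simp: analytic_on_analytic_at[of _ "ball 0 R1"])
 then obtain H where H: "H holomorphic_on ball 0 R1" "!!z. z \<in> ball 0 R1 ==> remove_sings G z = exp (H z)"
  using contractible_imp_holomorphic_log[of "remove_sings G" "ball 0 R1"] convex_imp_contractible an
  by (metis convex_ball)
 have "F z = (\<Prod>a\<in>S. (z - a) powi zorder F a) * exp (H z)" if z: "z \<in> ball 0 R1 - dv F" for z
 proof -
  have nz: "(\<Prod>a\<in>S. (z - a) powi zorder F a) ~= 0"
   using z finS by (auto simp: S_def)
  have "exp (H z) = G z" using H(2)[of z] good[OF z] z by simp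
  also have "... = F z / (\<Prod>a\<in>S. (z - a) powi zorder F a)"
   using prod_inversef[of "%a. (z - a) powi zorder F a" S]
   by (simp add: G_def power_int_minus divide_inverse o_def)
  finally show ?thesis using nz by (simp add: field_simps)
 qed
 thus ?thesis using that[of R1 H] R1 H by (auto simp: S_def)
qed

lemma ln_power_int_cmod: "0 < x ==> ln (x powi n) = real_of_int n * ln x" for x :: real
 by (simp add: power_int_def ln_realpow ln_inverse)

lemma ln_cmod_factorization:
 assumes "finite S" "z \<notin> S" "F z = (\<Prod>a\<in>S. (z - a) powi e a) * exp (h z)"
 shows "ln (cmod (F z)) = (\<Sum>a\<in>S. real_of_int (e a) * ln (cmod (z - a))) + Re (h z)"
proof -
 have "cmod (F z) = (\<Prod>a\<in>S. cmod (z - a) powi e a) * exp (Re (h z))"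
  by (simp add: assms(3) norm_mult norm_power_int flip: prod_norm)
 also have "ln ... = ln (\<Prod>a\<in>S. cmod (z - a) powi e a) + Re (h z)"
  using assms by (subst ln_mult) (auto intro!: prod_pos zero_less_power_int)
 also have "ln (\<Prod>a\<in>S. cmod (z - a) powi e a) = (\<Sum>a\<in>S. ln (cmod (z - a) powi e a))"
  using assms by (intro ln_prod) (auto intro!: zero_less_power_int)
 also have "... = (\<Sum>a\<in>S. real_of_int (e a) * ln (cmod (z - a)))"
  using assms by (intro sum.cong refl ln_power_int_cmod) auto
 finally show ?thesis .
qed

theorem jensen_formula:
 assumes F: "F meromorphic_on UNIV" "0 \<notin> dv F" and R: "0 < R" "sphere 0 R Int dv F = {}"
  and X: "finite X" "dv F Int ball 0 R \<subseteq> X"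
 shows "cmean 0 R (%z. ln (cmod (F z))) =
      ln (cmod (F 0)) + (\<Sum>a\<in>X. real_of_int (zorder F a) * lam R a)"
proof -
 obtain R1 H where H: "R < R1" "H holomorphic_on ball 0 R1" "dv F Int ball 0 R1 = dv F Int ball 0 R"
  "!!z. z \<in> ball 0 R1 - dv F ==>
    F z = (\<Prod>a\<in>dv F Int ball 0 R. (z - a) powi zorder F a) * exp (H z)"
  using divisor_factorization[OF F R] by blast
 define S where "S = dv F Int ball 0 R"
 have finS: "finite S" unfolding S_def using dv_finite[OF F] by auto
 have S0: "a ~= 0" "cmod a < R" if "a \<in> S" for a using that F(2) by (auto simp: S_def)
 have eq: "ln (cmod (F z)) = (\<Sum>a\<in>S. real_of_int (zorder F a) * ln (cmod (z - a))) + Re (H z)"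
  if "z \<in> ball 0 R1 - dv F" for z
  using that H(4)[OF that] finS by (intro ln_cmod_factorization) (auto simp: S_def)
 have sph: "z \<in> ball 0 R1 - dv F" if "z \<in> sphere 0 R" for z
  using that R H(1) by auto
 have nz: "z - a ~= 0" if "z \<in> sphere 0 R" "a \<in> S" for z a
  using that by (auto simp: S_def)
 have cH: "continuous_on (sphere 0 R) (%z. Re (H z))"
  using H(1,2) by (intro continuous_intros holomorphic_on_imp_continuous_on) (auto intro: holomorphic_on_subset)
 have cln: "continuous_on (sphere 0 R) (%z. real_of_int (zorder F a) * ln (cmod (z - a)))" if "a \<in> S" for a
  using nz that by (intro continuous_intros) auto
 have "cmean 0 R (%z. ln (cmod (F z))) =
    cmean 0 R (%z. (\<Sum>a\<in>S. real_of_int (zorder F a) * ln (cmod (z - a))) + Re (H z))"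
  using R eq sph by (intro cmean_cong) auto
 also have "... = (\<Sum>a\<in>S. cmean 0 R (%z. real_of_int (zorder F a) * ln (cmod (z - a)))) + cmean 0 R (%z. Re (H z))"
  using cH cln R finS by (subst cmean_add) (auto intro!: continuous_on_sum cmean_sum)
 also have "cmean 0 R (%z. Re (H z)) = Re (H 0)"
  by (rule cmean_Re_holomorphic) (use H R in \<open>auto intro!: holomorphic_on_imp_continuous_on intro: holomorphic_on_subset\<close>)
 also have "(\<Sum>a\<in>S. cmean 0 R (%z. real_of_int (zorder F a) * ln (cmod (z - a)))) =
       (\<Sum>a\<in>S. real_of_int (zorder F a) * ln R)"
 proof (rule sum.cong)
  fix a assume "a \<in> S"
  thus "cmean 0 R (%z. real_of_int (zorder F a) * ln (cmod (z - a))) = real_of_int (zorder F a) * ln R"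
   using S0[of a] R by (simp add: cmean_cmult cmean_ln_dist)
 qed simp
 also have "Re (H 0) = ln (cmod (F 0)) - (\<Sum>a\<in>S. real_of_int (zorder F a) * ln (cmod a))"
  using eq[of 0] F(2) R H(1) by simp
 also have "(\<Sum>a\<in>S. real_of_int (zorder F a) * ln R) + (ln (cmod (F 0)) - (\<Sum>a\<in>S. real_of_int (zorder F a) * ln (cmod a))) =
       ln (cmod (F 0)) + (\<Sum>a\<in>S. real_of_int (zorder F a) * lam R a)"
  using S0 by (simp add: lam_eq right_diff_distrib sum_subtractf)
 also have "(\<Sum>a\<in>S. real_of_int (zorder F a) * lam R a) = (\<Sum>a\<in>X. real_of_int (zorder F a) * lam R a)"
 proof (rule sum.mono_neutral_left)
  show "\<forall>a\<in>X - S. real_of_int (zorder F a) * lam R a = 0"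
   using R by (auto simp: S_def zorder_not_dv lam_eq_0)
 qed (use X in \<open>auto simp: S_def\<close>)
 finally show ?thesis .
qed

lemma nn_nonneg: "0 <= nn F r"
 unfolding nn_def by (intro sum_nonneg) auto

lemma nn_le_chi:
 assumes F: "F meromorphic_on UNIV" "0 \<notin> dv F" and R: "0 < r" "r <= R" "sphere 0 R Int dv F = {}"
 shows "nn F r * ln (R / r) <= chi F R"
proof -
 have "nn F r * ln (R / r) = (\<Sum>a\<in>dv F Int ball 0 r. \<bar>real_of_int (zorder F a)\<bar> * ln (R / r))"
  by (simp add: nn_def sum_distrib_right)
 also have "... <= (\<Sum>a\<in>dv F Int ball 0 r. \<bar>real_of_int (zorder F a)\<bar> * lam R a)"
 proof (intro sum_mono mult_left_mono)
  fix a assume a: "a \<in> dv F Int ball 0 r"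
  hence "a ~= 0" "cmod a < r" using F by auto
  thus "ln (R / r) <= lam R a" using R by (simp add: lam_eq ln_div)
 qed auto
 also have "... <= (\<Sum>a\<in>dv F Int ball 0 R. \<bar>real_of_int (zorder F a)\<bar> * lam R a)"
  using R dv_finite[OF F] by (intro sum_mono2) auto
 also have "... <= chi F R"
 proof -
  have "0 <= cmean 0 R (%z. \<bar>ln (cmod (F z))\<bar>)"
   using R by (intro cmean_nonneg continuous_intros continuous_on_ln_cmod_dv) auto
  thus ?thesis by (simp add: chi_def)
 qed
 finally show ?thesis .
qed

text \<open>
 Away from the divisor F' / F splits by \<open>divisor_factorization\<close>: the rational part is bounded by the distance
 \<open>\<eta>\<close> to the divisor, and deriv H by the mean of ln (cmod F) through \<open>deriv_bound_Re_mean\<close>.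
\<close>

theorem logarithmic_derivative_bound:
 assumes F: "F meromorphic_on UNIV" "0 \<notin> dv F" and R: "1 <= R" "sphere 0 R Int dv F = {}"
  and z: "cmod z <= r" "r < R" "0 < \<eta>" "!!a. a \<in> dv F ==> \<eta> <= cmod (z - a)"
 shows "cmod (deriv F z / F z) <= nn F R / \<eta> +
      2 * R / (R - r)^2 * (chi F R + 2 * nn F R * ln (2 * R))"
proof -
 have R0: "0 < R" using R by simp
 obtain R1 H where H: "R < R1" "H holomorphic_on ball 0 R1" "dv F Int ball 0 R1 = dv F Int ball 0 R"
  "!!z. z \<in> ball 0 R1 - dv F ==>
    F z = (\<Prod>a\<in>dv F Int ball 0 R. (z - a) powi zorder F a) * exp (H z)"
  using divisor_factorization[OF F R0 R(2)] by blast
 define S where "S = dv F Int ball 0 R"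
 have finS: "finite S" unfolding S_def using dv_finite[OF F] by auto
 have zdv: "z \<notin> dv F" using z(3) z(4)[of z] by auto
 have zS: "z \<notin> S" using zdv by (auto simp: S_def)
 have zR: "z \<in> ball 0 R1" using z H(1) by auto
 define P where "P = (%w. (\<Prod>a\<in>S. (w - a) powi zorder F a) * exp (H w))"
 have op: "open (ball 0 R1 - S)" using finS by (simp add: open_Diff finite_imp_closed)
 have ld: "deriv F z / F z = (\<Sum>a\<in>S. of_int (zorder F a) / (z - a)) + deriv H z"
 proof -
  have "eventually (%w. w \<in> ball 0 R1 - S) (nhds z)"
   using op zR zS by (intro eventually_nhds_in_open) auto
  hence "eventually (%w. F w = P w) (nhds z)"
   using H(3,4) by (auto simp: P_def S_def elim!: eventually_mono)
  hence "deriv F z = deriv P z" by (rule deriv_cong_ev) simp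
  moreover have "F z = P z" using H(4)[of z] zR zdv by (simp add: P_def S_def)
  moreover have "(P has_field_derivative P z * ((\<Sum>a\<in>S. of_int (zorder F a) / (z - a)) + deriv H z)) (at z)"
  proof -
   have Hd: "(H has_field_derivative deriv H z) (at z)"
    using H(2) zR holomorphic_derivI open_ball by blast
   have 1: "((%w. \<Prod>a\<in>S. (w - a) powi zorder F a) has_field_derivative
      (\<Prod>a\<in>S. (z - a) powi zorder F a) * (\<Sum>a\<in>S. of_int (zorder F a) / (z - a))) (at z)"
    using finS zS
   proof (induction S rule: finite_induct)
    case (insert b T)
    have zb: "z - b ~= 0" using insert by auto
    have "((%w. (w - b) powi zorder F b) has_field_derivative
       of_int (zorder F b) * (z - b) powi (zorder F b - 1) * 1) (at z)"
     using zb by (auto intro!: derivative_eq_intros)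
    hence "((%w. (w - b) powi zorder F b) has_field_derivative
       (z - b) powi zorder F b * (of_int (zorder F b) / (z - b))) (at z)"
     using zb by (simp add: power_int_diff field_simps)
    from DERIV_mult[OF this insert.IH] insert show ?case
     by (simp add: algebra_simps)
   qed simp
   have 2: "((%w. exp (H w)) has_field_derivative exp (H z) * deriv H z) (at z)"
    using Hd by (auto intro!: derivative_eq_intros)
   show ?thesis unfolding P_def
    using DERIV_mult[OF 1 2] by (simp add: algebra_simps)
  qed
  hence "deriv P z = P z * ((\<Sum>a\<in>S. of_int (zorder F a) / (z - a)) + deriv H z)"
   by (rule DERIV_imp_deriv)
  moreover have "F z ~= 0" using zdv by (auto simp: dv_def)
  ultimately show ?thesis by simp
 qed
 have b1: "cmod (\<Sum>a\<in>S. of_int (zorder F a) / (z - a)) <= nn F R / \<eta>"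
 proof -
  have "cmod (\<Sum>a\<in>S. of_int (zorder F a) / (z - a)) <= (\<Sum>a\<in>S. \<bar>real_of_int (zorder F a)\<bar> / \<eta>)"
  proof (rule sum_norm_le)
   fix a assume "a \<in> S"
   hence "\<eta> <= cmod (z - a)" using z(4) by (auto simp: S_def)
   thus "cmod (of_int (zorder F a) / (z - a)) <= \<bar>real_of_int (zorder F a)\<bar> / \<eta>"
    using z(3) by (auto simp: norm_divide intro!: divide_left_mono mult_pos_pos)
  qed
  thus ?thesis by (simp add: nn_def S_def sum_divide_distrib)
 qed
 have nz: "w - a ~= 0" if "w \<in> sphere 0 R" "a \<in> S" for w a
  using that by (auto simp: S_def)
 have sph: "w \<in> ball 0 R1 - dv F" if "w \<in> sphere 0 R" for w
  using that R H(1) by auto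
 have eq: "ln (cmod (F w)) = (\<Sum>a\<in>S. real_of_int (zorder F a) * ln (cmod (w - a))) + Re (H w)"
  if "w \<in> ball 0 R1 - dv F" for w
  using that H(4)[OF that] finS by (intro ln_cmod_factorization) (auto simp: S_def)
 have cH: "continuous_on (sphere 0 R) (%z. Re (H z))"
  using H(1,2) by (intro continuous_intros holomorphic_on_imp_continuous_on) (auto intro: holomorphic_on_subset)
 have cln: "continuous_on (sphere 0 R) (%z. \<bar>real_of_int (zorder F a)\<bar> * \<bar>ln (cmod (z - a))\<bar>)" if "a \<in> S" for a
  using nz that by (intro continuous_intros) auto
 have cF: "continuous_on (sphere 0 R) (%z. \<bar>ln (cmod (F z))\<bar>)"
  using R by (intro continuous_intros continuous_on_ln_cmod_dv) auto
 have b2: "cmean 0 R (%w. \<bar>Re (H w)\<bar>) <= chi F R + 2 * nn F R * ln (2 * R)"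
 proof -
  have "cmean 0 R (%w. \<bar>Re (H w)\<bar>) <=
     cmean 0 R (%w. \<bar>ln (cmod (F w))\<bar> + (\<Sum>a\<in>S. \<bar>real_of_int (zorder F a)\<bar> * \<bar>ln (cmod (w - a))\<bar>))"
  proof (rule cmean_mono)
   fix w :: complex assume w: "w \<in> sphere 0 R"
   have "Re (H w) = ln (cmod (F w)) - (\<Sum>a\<in>S. real_of_int (zorder F a) * ln (cmod (w - a)))"
    using eq[OF sph[OF w]] by simp
   moreover have "\<bar>\<Sum>a\<in>S. real_of_int (zorder F a) * ln (cmod (w - a))\<bar> <=
     (\<Sum>a\<in>S. \<bar>real_of_int (zorder F a)\<bar> * \<bar>ln (cmod (w - a))\<bar>)"
    by (rule order_trans[OF sum_abs]) (simp add: abs_mult)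
   ultimately show "\<bar>Re (H w)\<bar> <= \<bar>ln (cmod (F w))\<bar> + (\<Sum>a\<in>S. \<bar>real_of_int (zorder F a)\<bar> * \<bar>ln (cmod (w - a))\<bar>)"
    by linarith
  next
   show "continuous_on (sphere 0 R) (%w. \<bar>Re (H w)\<bar>)"
    using cH by (rule continuous_on_rabs)
   show "continuous_on (sphere 0 R) (%w. \<bar>ln (cmod (F w))\<bar> + (\<Sum>a\<in>S. \<bar>real_of_int (zorder F a)\<bar> * \<bar>ln (cmod (w - a))\<bar>))"
    using cF cln by (intro continuous_on_add continuous_on_sum)
  qed (use R in auto)
  also have "... = cmean 0 R (%w. \<bar>ln (cmod (F w))\<bar>) +
    (\<Sum>a\<in>S. cmean 0 R (%w. \<bar>real_of_int (zorder F a)\<bar> * \<bar>ln (cmod (w - a))\<bar>))"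
   using cF cln R finS by (subst cmean_add) (auto intro!: continuous_on_sum cmean_sum)
  also have "(\<Sum>a\<in>S. cmean 0 R (%w. \<bar>real_of_int (zorder F a)\<bar> * \<bar>ln (cmod (w - a))\<bar>)) <=
        (\<Sum>a\<in>S. \<bar>real_of_int (zorder F a)\<bar> * (2 * ln (2 * R)))"
  proof (rule sum_mono)
   fix a assume "a \<in> S"
   hence "cmean 0 R (%w. \<bar>ln (cmod (w - a))\<bar>) <= 2 * ln (2 * R)"
    using R by (intro cmean_abs_ln_dist_le) (auto simp: S_def)
   thus "cmean 0 R (%w. \<bar>real_of_int (zorder F a)\<bar> * \<bar>ln (cmod (w - a))\<bar>) <=
     \<bar>real_of_int (zorder F a)\<bar> * (2 * ln (2 * R))"
    unfolding cmean_cmult by (intro mult_left_mono) auto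
  qed
  also have "(\<Sum>a\<in>S. \<bar>real_of_int (zorder F a)\<bar> * (2 * ln (2 * R))) = 2 * nn F R * ln (2 * R)"
   by (simp add: nn_def S_def sum_distrib_right sum_distrib_left mult_ac)
  also have "cmean 0 R (%w. \<bar>ln (cmod (F w))\<bar>) <= chi F R"
   unfolding chi_def using R by (auto intro!: sum_nonneg)
  finally show ?thesis by simp
 qed
 have "cmod (deriv H z) <= 2 * R / (R - cmod z)^2 * cmean 0 R (%w. \<bar>Re (H w)\<bar>)"
  using H R0 z by (intro deriv_bound_Re_mean) auto
 also have "... <= 2 * R / (R - r)^2 * (chi F R + 2 * nn F R * ln (2 * R))"
 proof (intro mult_mono)
  have "(R - r)^2 <= (R - cmod z)^2" using z by (intro power_mono) auto
  thus "2 * R / (R - cmod z)^2 <= 2 * R / (R - r)^2"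
   using R z by (intro divide_left_mono mult_pos_pos) auto
  show "0 <= cmean 0 R (%w. \<bar>Re (H w)\<bar>)"
   using cH R by (intro cmean_nonneg) (auto intro!: continuous_intros)
 qed (use b2 R in auto)
 finally have b3: "cmod (deriv H z) <= 2 * R / (R - r)^2 * (chi F R + 2 * nn F R * ln (2 * R))" .
 show ?thesis unfolding ld using norm_triangle_mono[OF b1 b3] .
qed

section \<open>Growth of functions with Lipschitz spherical value\<close>

lemma integral_periodic_shift:
 fixes f :: "real => real"
 assumes cont: "continuous_on UNIV f" and per: "!!t. f (t + 1) = f t" and c: "0 <= c" "c <= 1"
 shows "integral {0..1} (%t. f (t + c)) = integral {0..1} f"
proof -
 have int: "f integrable_on {a..b}" for a b
  by (intro integrable_continuous_real continuous_on_subset[OF cont]) auto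
 have "integral {0..1} (%t. f (t + c)) = integral {c..1+c} f"
  using integral_shift_Icc_real[of 0 1 f c] unfolding o_def by (simp add: add.commute)
 also have "... = integral {c..1} f + integral {1..1+c} f"
  using c int by (intro Henstock_Kurzweil_Integration.integral_combine[symmetric]) auto
 also have "integral {1..1+c} f = integral {0..c} (%t. f (t + 1))"
  using integral_shift_Icc_real[of 0 c f 1] unfolding o_def by (simp add: add.commute)
 also have "... = integral {0..c} f" by (simp add: per)
 also have "integral {c..1} f + integral {0..c} f = integral {0..1} f"
  using c int Henstock_Kurzweil_Integration.integral_combine[of 0 c 1 f] by simp
 finally show ?thesis .
qed

lemma circle_mean_shift:
 fixes w :: "complex => real"
 assumes "continuous_on (sphere z r) w" "0 <= r" "0 <= c" "c <= 1"
 shows "integral {0..1} (%t. w (z + of_real r * cis (2 * pi * (t + c)))) = cmean z r w"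
 unfolding cmean_def
proof (rule integral_periodic_shift)
 show "continuous_on UNIV (%t. w (z + of_real r * cis (2 * pi * t)))"
  by (rule continuous_on_compose2[OF assms(1) circle_param_continuous])
    (use circle_point_in_sphere[OF assms(2)] in auto)
 show "w (z + of_real r * cis (2 * pi * (t + 1))) = w (z + of_real r * cis (2 * pi * t))" for t
  by (simp add: distrib_left cis_mult[symmetric])
qed (use assms in auto)

lemma unit_parameter:
 obtains s where "0 <= s" "s <= 1" "z = of_real (cmod z) * cis (2 * pi * s)"
proof -
 have "0 <= Arg2pi z / (2 * pi)" "Arg2pi z / (2 * pi) <= 1"
  using Arg2pi[of z] by (auto simp: field_simps)
 moreover have "z = of_real (cmod z) * cis (2 * pi * (Arg2pi z / (2 * pi)))"
  using Arg2pi_eq[of z] by (simp add: cis_conv_exp)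
 ultimately show ?thesis using that by blast
qed

lemma cmean_square:
 assumes "0 < \<epsilon>"
 shows "cmean z \<epsilon> (%w. (cmod w)\<^sup>2) = (cmod z)^2 + \<epsilon>^2"
proof -
 have "cmean z \<epsilon> (%w. (cmod w)\<^sup>2) = cmean z \<epsilon> (%w. Re (of_real ((cmod z)^2 + \<epsilon>^2) + 2 * cnj z * (w - z)))"
 proof (rule cmean_cong)
  fix w assume "w \<in> sphere z \<epsilon>"
  hence "(cmod (w - z))^2 = \<epsilon>^2" by (simp add: dist_norm norm_minus_commute)
  hence "\<epsilon>^2 = (Re w - Re z)^2 + (Im w - Im z)^2" by (simp add: cmod_power2)
  thus "(cmod w)^2 = Re (of_real ((cmod z)^2 + \<epsilon>^2) + 2 * cnj z * (w - z))"
   by (simp add: cmod_power2) (simp add: power2_eq_square algebra_simps)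
 qed (use assms in auto)
 also have "... = Re (of_real ((cmod z)^2 + \<epsilon>^2) + 2 * cnj z * (z - z))"
  using assms by (intro cmean_Re_holomorphic) (auto intro!: continuous_intros holomorphic_intros)
 finally show ?thesis by simp
qed

text \<open>
 A maximum principle: w has Laplacian at most 4 * c in the sense of small circle means, so its rotation average minus (c + 1) * |z|^2
 has no interior minimum. Only continuity of w is used.
\<close>

theorem circle_mean_growth:
 fixes w :: "complex => real"
 assumes cont: "continuous_on (ball 0 R) w" and r: "0 < r" "r < R" and e: "0 < \<epsilon>0"
  and loc: "!!z \<epsilon>. 0 < \<epsilon> ==> \<epsilon> <= \<epsilon>0 ==> cball z \<epsilon> \<subseteq> ball 0 R ==> cmean z \<epsilon> w <= w z + c * \<epsilon>^2"
 shows "cmean 0 r w <= w 0 + (c + 1) * r^2"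
proof -
 define A where "A = (%z. integral {0..1} (%s. w (cis (2 * pi * s) * z)))"
 define B where "B = (%z. A z - (c + 1) * (cmod z)^2)"
 have cw: "continuous_on X (%x. w (f x))" if "continuous_on X f" "f ` X \<subseteq> ball 0 R" for X and f :: "'z::topological_space => complex"
  using continuous_on_compose2[OF cont that] .
 have contA: "continuous_on (ball 0 R) A"
 proof -
  have "continuous_on (ball 0 R) (%z. integral (cbox 0 1) (%s::real. w (cis (2 * pi * s) * z)))"
  proof (rule integral_continuous_on_param)
   show "continuous_on (ball 0 R \<times> cbox 0 1) (%(z, s). w (cis (2 * pi * s) * z))"
    unfolding case_prod_beta
    by (rule cw) (auto intro!: continuous_intros simp: norm_mult)
  qed
  thus ?thesis by (simp add: A_def)
 qed
 hence contB: "continuous_on (ball 0 R) B" unfolding B_def by (intro continuous_intros)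
 have "continuous_on (cball 0 r) B"
  using r by (intro continuous_on_subset[OF contB]) auto
 then obtain z0 where z0: "z0 \<in> cball 0 r" "!!z. z \<in> cball 0 r ==> B z0 <= B z"
  using continuous_attains_inf[of "cball 0 r" B] r by auto
 show ?thesis
 proof (cases "cmod z0 = r")
  case True
  obtain s where s: "0 <= s" "s <= 1" "z0 = of_real r * cis (2 * pi * s)"
   using unit_parameter[of z0] True by metis
  have "A z0 = integral {0..1} (%t. w (0 + of_real r * cis (2 * pi * (t + s))))"
   unfolding A_def s(3) by (simp add: distrib_left cis_mult[symmetric] mult_ac)
  also have "... = cmean 0 r w"
   using s r by (intro circle_mean_shift continuous_on_subset[OF cont]) auto
  finally have "A z0 = cmean 0 r w" .
  moreover have "A 0 = w 0" by (simp add: A_def)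
  moreover have "B z0 <= B 0" using r by (intro z0(2)) auto
  ultimately show ?thesis using True by (simp add: B_def)
 next
  case False
  hence lt: "cmod z0 < r" using z0(1) by auto
  define \<epsilon> where "\<epsilon> = min \<epsilon>0 (r - cmod z0)"
  have eps: "0 < \<epsilon>" "\<epsilon> <= \<epsilon>0" "cmod z0 + \<epsilon> <= r" using e lt by (auto simp: \<epsilon>_def)
  have rot: "cball (cis x * z0) \<epsilon> \<subseteq> ball 0 R" for x
  proof
   fix y assume "y \<in> cball (cis x * z0) \<epsilon>"
   hence "cmod (y - cis x * z0) <= \<epsilon>" by (simp add: dist_norm norm_minus_commute)
   moreover have "cmod y <= cmod (y - cis x * z0) + cmod (cis x * z0)"
    using norm_triangle_sub[of y "cis x * z0"] by linarith
   ultimately show "y \<in> ball 0 R" using eps r by (simp add: norm_mult)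
  qed
  have sub: "cball z0 \<epsilon> \<subseteq> cball 0 r"
  proof
   fix y assume "y \<in> cball z0 \<epsilon>"
   hence "cmod (y - z0) <= \<epsilon>" by (simp add: dist_norm norm_minus_commute)
   thus "y \<in> cball 0 r" using eps norm_triangle_sub[of y z0] by simp
  qed
  have subR: "sphere z0 \<epsilon> \<subseteq> ball 0 R" using sub r by auto
  have cA: "continuous_on (sphere z0 \<epsilon>) A" using contA subR continuous_on_subset by blast
  have "cmean z0 \<epsilon> A = integral (cbox 0 1) (%t. integral (cbox 0 1) (%s. w (cis (2 * pi * s) * (z0 + of_real \<epsilon> * cis (2 * pi * t)))))"
   by (simp add: cmean_def A_def)
  also have "... = integral (cbox 0 1) (%s. integral (cbox 0 1) (%t. w (cis (2 * pi * s) * (z0 + of_real \<epsilon> * cis (2 * pi * t)))))"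
  proof (rule integral_swap_continuous)
   have "cmod (z0 + of_real \<epsilon> * cis x) < R" for x
    using norm_triangle_ineq[of z0 "of_real \<epsilon> * cis x"] eps r by (simp add: norm_mult)
   thus "continuous_on (cbox (0, 0) (1, 1)) (%(t, s). w (cis (2 * pi * s) * (z0 + of_real \<epsilon> * cis (2 * pi * t))))"
    unfolding case_prod_beta by (intro cw) (auto intro!: continuous_intros simp: norm_mult)
  qed
  also have "... = integral {0..1} (%s. cmean (cis (2 * pi * s) * z0) \<epsilon> w)"
  proof -
   have "integral {0..1} (%t. w (cis (2 * pi * s) * (z0 + of_real \<epsilon> * cis (2 * pi * t)))) =
      cmean (cis (2 * pi * s) * z0) \<epsilon> w" if "s \<in> {0..1}" for s
   proof -
    have "integral {0..1} (%t. w (cis (2 * pi * s) * (z0 + of_real \<epsilon> * cis (2 * pi * t)))) =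
       integral {0..1} (%t. w (cis (2 * pi * s) * z0 + of_real \<epsilon> * cis (2 * pi * (t + s))))"
     by (simp add: distrib_left cis_mult[symmetric] mult_ac)
    also have "... = cmean (cis (2 * pi * s) * z0) \<epsilon> w"
    proof (rule circle_mean_shift)
     show "continuous_on (sphere (cis (2 * pi * s) * z0) \<epsilon>) w"
      using rot[of "2 * pi * s"] by (intro continuous_on_subset[OF cont]) auto
    qed (use that eps in auto)
    finally show ?thesis .
   qed
   thus ?thesis by (auto intro!: integral_cong)
  qed
  also have "... <= integral {0..1} (%s. w (cis (2 * pi * s) * z0) + c * \<epsilon>^2)"
  proof (rule integral_le)
   show "(%s. w (cis (2 * pi * s) * z0) + c * \<epsilon>^2) integrable_on {0..1}"
    using lt r by (intro integrable_continuous_real continuous_intros cw) (auto simp: norm_mult)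
   show "(%s. cmean (cis (2 * pi * s) * z0) \<epsilon> w) integrable_on {0..1}"
   proof -
    have "continuous_on {0..1} (%s. integral (cbox 0 1) (%t::real. w (cis (2 * pi * s) * z0 + of_real \<epsilon> * cis (2 * pi * t))))"
    proof (rule integral_continuous_on_param)
     have "cmod (cis x * z0 + of_real \<epsilon> * cis y) < R" for x y
      using norm_triangle_ineq[of "cis x * z0" "of_real \<epsilon> * cis y"] eps r by (simp add: norm_mult)
     thus "continuous_on ({0..1} \<times> cbox 0 1) (%(s, t). w (cis (2 * pi * s) * z0 + of_real \<epsilon> * cis (2 * pi * t)))"
      unfolding case_prod_beta by (intro cw) (auto intro!: continuous_intros)
    qed
    thus ?thesis by (intro integrable_continuous_real) (simp add: cmean_def)
   qed
  qed (use loc eps rot in auto)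
  also have "... = A z0 + c * \<epsilon>^2"
  proof -
   have "(%s. w (cis (2 * pi * s) * z0)) integrable_on {0..1}"
    using lt r by (intro integrable_continuous_real cw) (auto intro!: continuous_intros simp: norm_mult)
   from integral_add[OF this integrable_const_ivl, of "c * \<epsilon>^2"] show ?thesis by (simp add: A_def)
  qed
  finally have 1: "cmean z0 \<epsilon> A <= A z0 + c * \<epsilon>^2" .
  have "cmean z0 \<epsilon> B = cmean z0 \<epsilon> A - (c + 1) * ((cmod z0)^2 + \<epsilon>^2)"
   unfolding B_def using cA eps
   by (subst cmean_diff) (auto intro!: continuous_intros simp: cmean_cmult cmean_square)
  also have "... <= B z0 - \<epsilon>\<^sup>2" using 1 by (simp add: B_def algebra_simps)
  also have "... < B z0" using eps by simp
  finally have "cmean z0 \<epsilon> B < B z0" .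
  moreover have "B z0 <= cmean z0 \<epsilon> B"
  proof -
   have "cmean z0 \<epsilon> (%_. B z0) <= cmean z0 \<epsilon> B"
    using sub eps subR contB by (intro cmean_mono z0(2)) (auto intro: continuous_on_subset)
   thus ?thesis by simp
  qed
  ultimately show ?thesis by simp
 qed
qed

lemma zorder_neg_iff_pole:
 assumes "g meromorphic_on UNIV" "0 \<notin> dv g"
 shows "zorder g z < 0 \<longleftrightarrow> is_pole g z"
proof
 have m: "g meromorphic_on {z}" using assms(1) meromorphic_on_subset by blast
 show "is_pole g z" if "zorder g z < 0"
  using zorder_neg_imp_is_pole[OF m frequently_nonzero_if_dv(1)[OF assms] that] .
 show "zorder g z < 0" if "is_pole g z"
  using isolated_pole_imp_neg_zorder[OF _ that] m by (simp add: meromorphic_at_iff)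
qed

text \<open>
 Writing g = P / Q without common zeros makes ln (sqrt (|P|^2 + |Q|^2)) continuous across the poles.
\<close>

lemma homogeneous_coordinates:
 assumes g: "g nicely_meromorphic_on UNIV" "0 \<notin> dv g" and r: "0 < r" "sphere 0 r Int dv g = {}"
 defines "B \<equiv> {b \<in> dv g Int ball 0 r. is_pole g b}"
 defines "Q \<equiv> %z. \<Prod>b\<in>B. (z - b) ^ nat (- zorder g b)"
 obtains R P where "r < R" "P holomorphic_on ball 0 R"
  "!!z. z \<in> ball 0 R ==> Q z = 0 \<longleftrightarrow> is_pole g z" "!!z. z \<in> ball 0 R ==> Q z = 0 ==> P z ~= 0"
  "!!z. z \<in> ball 0 R ==> Q z ~= 0 ==> g z = P z / Q z"
proof -
 have gm: "g meromorphic_on UNIV" using g by (simp add: nicely_meromorphic_on_def)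
 obtain R H where H: "r < R" "H holomorphic_on ball 0 R" "dv g Int ball 0 R = dv g Int ball 0 r"
  "!!z. z \<in> ball 0 R - dv g ==>
    g z = (\<Prod>a\<in>dv g Int ball 0 r. (z - a) powi zorder g a) * exp (H z)"
  using divisor_factorization[OF gm g(2) r] by blast
 define S where "S = dv g Int ball 0 r"
 have finS: "finite S" unfolding S_def using dv_finite[OF gm g(2)] by auto
 define Z where "Z = S - B"
 have "B \<subseteq> S" by (auto simp: B_def S_def)
 hence finZ: "finite Z" "finite B" "S = Z \<union> B" "Z Int B = {}"
  using finS finite_subset[of B S] by (auto simp: Z_def)
 have ordB: "zorder g b < 0" if "b \<in> B" for b
  using that zorder_neg_iff_pole[OF gm g(2)] by (auto simp: B_def)
 have ordZ: "zorder g a >= 0" "g a = 0" if "a \<in> Z" for a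
 proof -
  have np: "~ is_pole g a" using that by (auto simp: Z_def B_def S_def)
  thus "zorder g a >= 0" using zorder_neg_iff_pole[OF gm g(2), of a] by auto
  have "g analytic_on {a}" using g(1) np by (auto intro: nicely_meromorphic_on_imp_analytic_at)
  moreover have "a \<in> dv g" using that by (auto simp: Z_def S_def)
  ultimately show "g a = 0" by (auto simp: dv_def)
 qed
 have ordZ1: "zorder g a > 0" if "a \<in> Z" for a
 proof -
  have "~ is_pole g a" using that by (auto simp: Z_def B_def S_def)
  moreover have "isolated_zero g a | is_pole g a"
   using g(1) ordZ(2)[OF that] frequently_nonzero_if_dv(1)[OF gm g(2), of a]
   by (auto simp: nicely_meromorphic_on_def isolated_zero_def)
  ultimately have "isolated_zero g a" by blast
  moreover have "isolated_singularity_at g a"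
   using meromorphic_on_subset[OF gm, of "{a}"] by (simp add: meromorphic_at_iff)
  ultimately show ?thesis using zorder_isolated_zero_pos' by blast
 qed
 define P where "P = (%z. (\<Prod>a\<in>Z. (z - a) ^ nat (zorder g a)) * exp (H z))"
 have PH: "P holomorphic_on ball 0 R" unfolding P_def by (intro holomorphic_intros H(2))
 have Q0: "Q z = 0 \<longleftrightarrow> z \<in> B" for z
  unfolding Q_def using finZ ordB by (fastforce simp: prod_zero_iff)
 have P0: "P z = 0 \<longleftrightarrow> z \<in> Z" for z
  unfolding P_def using finZ ordZ1 by (fastforce simp: prod_zero_iff)
 have 1: "Q z = 0 \<longleftrightarrow> is_pole g z" if "z \<in> ball 0 R" for z
 proof -
  have "is_pole g z ==> z \<in> dv g"
   using analytic_at_imp_no_pole by (auto simp: dv_def)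
  thus ?thesis using that H(3) unfolding Q0 B_def by blast
 qed
 have 3: "g z = P z / Q z" if z: "z \<in> ball 0 R" "Q z ~= 0" for z
 proof (cases "z \<in> dv g")
  case False
  have "g z = (\<Prod>a\<in>S. (z - a) powi zorder g a) * exp (H z)"
   using H(4)[of z] False z by (simp add: S_def)
  also have "(\<Prod>a\<in>S. (z - a) powi zorder g a) = (\<Prod>a\<in>Z. (z - a) powi zorder g a) * (\<Prod>a\<in>B. (z - a) powi zorder g a)"
   using finZ by (simp add: prod.union_disjoint)
  also have "(\<Prod>a\<in>Z. (z - a) powi zorder g a) = (\<Prod>a\<in>Z. (z - a) ^ nat (zorder g a))"
   using ordZ by (intro prod.cong refl) (auto simp: power_int_def)
  also have "(\<Prod>a\<in>B. (z - a) powi zorder g a) = (\<Prod>a\<in>B. inverse ((z - a) ^ nat (- zorder g a)))"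
  proof (intro prod.cong refl)
   fix x assume "x \<in> B"
   with ordB[of x] show "(z - x) powi zorder g x = inverse ((z - x) ^ nat (- zorder g x))"
    by (simp add: power_int_def power_inverse)
  qed
  also have "... = inverse (Q z)"
   unfolding Q_def using prod_inversef[of "%a. (z - a) ^ nat (- zorder g a)" B] by (simp add: o_def)
  finally show ?thesis by (simp add: P_def divide_inverse)
 next
  case True
  hence "z \<in> Z" using z H(3) finZ by (auto simp: Q0 S_def)
  thus ?thesis using P0 ordZ by simp
 qed
 show ?thesis
 proof (rule that[OF H(1) PH 1 _ 3])
  fix z assume "Q z = 0"
  thus "P z ~= 0" using Q0 P0 finZ by auto
 qed auto
qed

lemma chordal_homogeneous:
 assumes "Q z ~= 0 ==> ~ is_pole g z & g z = P z / Q z" "Q w ~= 0 ==> ~ is_pole g w & g w = P w / Q w"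
  and "Q z = 0 ==> is_pole g z & P z ~= 0" "Q w = 0 ==> is_pole g w & P w ~= 0"
 shows "dist (sphere_value g z) (sphere_value g w) =
   2 * cmod (P z * Q w - P w * Q z) /
    (sqrt ((cmod (P z))^2 + (cmod (Q z))^2) * sqrt ((cmod (P w))^2 + (cmod (Q w))^2))"
proof -
 have N: "sqrt (1 + (cmod (p / q))^2) = sqrt ((cmod p)^2 + (cmod q)^2) / cmod q" if "q ~= 0" for p q :: complex
 proof -
  have "1 + (cmod (p / q))^2 = ((cmod p)^2 + (cmod q)^2) / (cmod q)^2"
   using that by (simp add: norm_divide power_divide field_simps)
  thus ?thesis by (simp add: real_sqrt_divide)
 qed
 consider "Q z ~= 0" "Q w ~= 0" | "Q z ~= 0" "Q w = 0" | "Q z = 0" "Q w ~= 0" | "Q z = 0" "Q w = 0" by blast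
 thus ?thesis
 proof cases
  case 1
  have "P z / Q z - P w / Q w = (P z * Q w - P w * Q z) / (Q z * Q w)"
   using 1 by (simp add: diff_frac_eq)
  hence "cmod (P z / Q z - P w / Q w) = cmod (P z * Q w - P w * Q z) / (cmod (Q z) * cmod (Q w))"
   by (simp add: norm_divide norm_mult)
  thus ?thesis using 1 assms(1,2)
   by (simp add: sphere_value_def dist_stereographic N)
 next
  case 2
  thus ?thesis using assms(1,4)
   by (simp add: sphere_value_def dist_stereographic_infinity N norm_mult)
 next
  case 3
  thus ?thesis using assms(2,3)
   by (subst dist_commute) (simp add: sphere_value_def dist_stereographic_infinity N norm_mult)
 next
  case 4
  thus ?thesis using assms(3,4) by (simp add: sphere_value_def)
 qed
qed

lemma ln_one_minus_bound: "0 <= x ==> x <= 1/2 ==> - ln (1 - x) <= 2 * x" for x :: real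
proof -
 assume x: "0 <= x" "x <= 1/2"
 have "ln (1 / (1 - x)) <= 1 / (1 - x) - 1" using x by (intro ln_le_minus_one) auto
 also have "1 / (1 - x) - 1 = x / (1 - x)" using x by (simp add: field_simps)
 also have "... <= x / (1/2)" using x by (intro divide_left_mono) auto
 finally show ?thesis using x by (simp add: ln_div)
qed

text \<open>
 The Laplacian of v is, up to a factor, the square of the spherical derivative. This is read off from circle means: after a unitary change
 of coordinates, v is the logarithm of the modulus of a zero-free holomorphic function minus 1/2 * ln (1 - (d / 2)^2),
 where d is the chordal distance from the value at z.
\<close>

lemma chordal_local_mean:
 assumes P: "P holomorphic_on ball 0 R" and Q: "Q holomorphic_on ball 0 R"
  and nz: "!!z. z \<in> ball 0 R ==> P z ~= 0 | Q z ~= 0" and L: "0 < L"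
  and lip: "!!z w. z \<in> ball 0 R ==> w \<in> ball 0 R ==>
    2 * cmod (P z * Q w - P w * Q z) /
    (sqrt ((cmod (P z))^2 + (cmod (Q z))^2) * sqrt ((cmod (P w))^2 + (cmod (Q w))^2)) <= L * cmod (z - w)"
 defines "v \<equiv> %z. ln (sqrt ((cmod (P z))^2 + (cmod (Q z))^2))"
 assumes e: "0 < \<epsilon>" "\<epsilon> <= 1 / (2 * L)" "cball z \<epsilon> \<subseteq> ball 0 R"
 shows "cmean z \<epsilon> v <= v z + L^2 / 4 * \<epsilon>^2"
proof -
 define N where "N = (%z. sqrt ((cmod (P z))^2 + (cmod (Q z))^2))"
 have N2: "(N w)^2 = (cmod (P w))^2 + (cmod (Q w))^2" for w by (simp add: N_def)
 have Npos: "0 < N w" if "w \<in> ball 0 R" for w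
  using nz[OF that] by (auto simp: N_def add_pos_nonneg add_nonneg_pos)
 have "z \<in> cball z \<epsilon>" using e by simp
 hence zR: "z \<in> ball 0 R" using e by blast
 define s where "s = N z"
 have s: "0 < s" using Npos[OF zR] by (simp add: s_def)
 define P1 where "P1 = (%w. (Q z * P w - P z * Q w) / of_real s)"
 define Q1 where "Q1 = (%w. (cnj (P z) * P w + cnj (Q z) * Q w) / of_real s)"
 have id: "(cmod (q * a - p * b))^2 + (cmod (cnj p * a + cnj q * b))^2 =
   ((cmod p)^2 + (cmod q)^2) * ((cmod a)^2 + (cmod b)^2)" for p q a b :: complex
  unfolding cmod_power2 by simp (simp add: power2_eq_square algebra_simps)
 have unit: "(cmod (P1 w))^2 + (cmod (Q1 w))^2 = (N w)^2" for w
 proof -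
  have "(cmod (P1 w))^2 + (cmod (Q1 w))^2 =
    ((cmod (Q z * P w - P z * Q w))^2 + (cmod (cnj (P z) * P w + cnj (Q z) * Q w))^2) / s^2"
   using s by (simp add: P1_def Q1_def norm_divide power_divide flip: add_divide_distrib)
  also have "... = s^2 * (N w)^2 / s^2" unfolding id by (simp add: s_def N2)
  finally show ?thesis using s by simp
 qed
 have P1b: "2 * cmod (P1 w) <= L * cmod (z - w) * N w" if "w \<in> ball 0 R" for w
 proof -
  have "2 * cmod (P z * Q w - P w * Q z) / (s * N w) <= L * cmod (z - w)"
   using lip[OF zR that] by (simp add: s_def N_def)
  hence "2 * cmod (P z * Q w - P w * Q z) <= L * cmod (z - w) * (s * N w)"
   using s Npos[OF that] by (subst (asm) pos_divide_le_eq) auto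
  moreover have "s * cmod (P1 w) = cmod (P z * Q w - P w * Q z)"
   using s by (simp add: P1_def norm_divide norm_minus_commute mult.commute)
  ultimately have "s * (2 * cmod (P1 w)) <= s * (L * cmod (z - w) * N w)"
   by (simp only: mult_ac)
  thus ?thesis using s by (simp only: mult_le_cancel_left_pos)
 qed
 define R' where "R' = min (1 / L) (R - cmod z)"
 have eR: "cmod z + \<epsilon> < R"
 proof -
  obtain x where x: "0 <= x" "x <= 1" "z = of_real (cmod z) * cis (2 * pi * x)"
   using unit_parameter[of z] by blast
  define y where "y = z + of_real \<epsilon> * cis (2 * pi * x)"
  have "y = of_real (cmod z + \<epsilon>) * cis (2 * pi * x)"
   using x(3) by (metis distrib_right of_real_add y_def)
  hence "cmod y = cmod z + \<epsilon>" using e by (simp add: norm_mult del: of_real_add)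
  moreover have "y \<in> cball z \<epsilon>" using e by (simp add: y_def dist_norm norm_mult)
  ultimately show ?thesis using e by auto
 qed
 have R': "\<epsilon> < R'" "R' <= 1 / L" "R' <= R - cmod z"
  using e L eR by (auto simp: R'_def field_simps)
 have sub: "ball z R' \<subseteq> ball 0 R"
 proof
  fix w assume "w \<in> ball z R'"
  hence "cmod (w - z) < R'" by (simp add: dist_norm norm_minus_commute)
  thus "w \<in> ball 0 R" using R' norm_triangle_sub[of w z] by simp
 qed
 have small: "(cmod (P1 w))^2 <= (L * cmod (z - w))^2 / 4 * (N w)^2" if "w \<in> ball 0 R" for w
 proof -
  have "(2 * cmod (P1 w))^2 <= (L * cmod (z - w) * N w)^2"
   using P1b[OF that] by (intro power_mono) auto
  thus ?thesis by (simp add: power_mult_distrib)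
 qed
 have Q1nz: "Q1 w ~= 0" if "w \<in> ball z R'" for w
 proof
  assume "Q1 w = 0"
  hence "(N w)^2 <= (L * cmod (z - w))^2 / 4 * (N w)^2"
   using unit[of w] small[of w] that sub by auto
  moreover have "(L * cmod (z - w))^2 <= 1\<^sup>2"
  proof (rule power_mono)
   have "L * cmod (z - w) <= L * R'" using that L by (simp add: dist_norm)
   also have "L * R' <= 1" using R' L by (simp add: field_simps)
   finally show "L * cmod (z - w) <= 1" .
  qed (use L in simp)
  moreover have "0 < (N w)\<^sup>2" using Npos[of w] that sub by auto
  ultimately show False
   using mult_right_mono[of "(L * cmod (z - w))^2 / 4" "1/4" "(N w)^2"] by auto
 qed
 have Q1h: "Q1 holomorphic_on ball 0 R" unfolding Q1_def using s by (intro holomorphic_intros P Q) auto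
 have m: "cmean z \<epsilon> (%w. ln (cmod (Q1 w))) = ln (cmod (Q1 z))"
  using Q1h sub e R' Q1nz by (intro cmean_ln_cmod_holomorphic[where R = R']) (auto intro: holomorphic_on_subset)
 have Q1z: "cmod (Q1 z) = N z"
 proof -
  have "P1 z = 0" by (simp add: P1_def mult.commute)
  hence "(cmod (Q1 z))^2 = (N z)^2" using unit[of z] by simp
  thus ?thesis using Npos[OF zR] by (simp add: power2_eq_iff_nonneg)
 qed
 have sph: "sphere z \<epsilon> \<subseteq> ball 0 R" "sphere z \<epsilon> \<subseteq> ball z R'" using e R' by auto
 have contN: "continuous_on (sphere z \<epsilon>) N" unfolding N_def
  using holomorphic_on_imp_continuous_on[OF P] holomorphic_on_imp_continuous_on[OF Q] sph(1)
  by (intro continuous_intros) (auto intro: continuous_on_subset)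
 have contQ: "continuous_on (sphere z \<epsilon>) (%w. ln (cmod (Q1 w)))"
  using holomorphic_on_imp_continuous_on[OF Q1h] sph Q1nz
  by (intro continuous_intros) (auto intro: continuous_on_subset)
 have "cmean z \<epsilon> v <= cmean z \<epsilon> (%w. ln (cmod (Q1 w)) + L^2 / 4 * \<epsilon>^2)"
 proof (rule cmean_mono)
  have "v = (%w. ln (N w))" by (simp add: v_def N_def)
  moreover have "continuous_on (sphere z \<epsilon>) (%w. ln (N w))"
   using contN Npos sph by (intro continuous_intros) fastforce+
  ultimately show "continuous_on (sphere z \<epsilon>) v" by simp
  show "continuous_on (sphere z \<epsilon>) (%w. ln (cmod (Q1 w)) + L^2 / 4 * \<epsilon>^2)"
   by (rule continuous_on_add[OF contQ continuous_on_const])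
  fix w assume w: "w \<in> sphere z \<epsilon>"
  hence wR: "w \<in> ball 0 R" "w \<in> ball z R'" and d: "cmod (z - w) = \<epsilon>" using sph by (auto simp: dist_norm)
  define x where "x = (L * \<epsilon>)^2 / 4"
  have "L * \<epsilon> <= 1/2" using e L by (simp add: field_simps)
  hence "(L * \<epsilon>)^2 <= (1/2)^2" using e L by (intro power_mono) auto
  moreover have "(1/2)^2 = (1/4 :: real)" by (simp add: power2_eq_square)
  ultimately have x: "0 <= x" "x <= 1/2" unfolding x_def using zero_le_power2[of "L * \<epsilon>"] by linarith+
  have Np: "0 < N w" using Npos wR by auto
  have "(N w)^2 * (1 - x) <= (cmod (Q1 w))^2"
   using small[OF wR(1)] unit[of w] d by (simp add: x_def algebra_simps)
  hence "ln ((N w)^2 * (1 - x)) <= ln ((cmod (Q1 w))^2)"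
   using Np x Q1nz[OF wR(2)] by (subst ln_le_cancel_iff) auto
  hence "2 * ln (N w) + ln (1 - x) <= 2 * ln (cmod (Q1 w))"
   using Np x by (simp add: ln_mult ln_realpow)
  hence "ln (N w) <= ln (cmod (Q1 w)) + x"
   using ln_one_minus_bound[OF x] by simp
  thus "v w <= ln (cmod (Q1 w)) + L^2 / 4 * \<epsilon>^2"
   by (simp add: v_def N_def x_def power_mult_distrib)
 qed (use e in auto)
 also have "... = ln (cmod (Q1 z)) + L^2 / 4 * \<epsilon>^2"
  using cmean_add[OF contQ continuous_on_const] e by (simp add: m)
 finally show ?thesis by (simp add: Q1z v_def N_def)
qed

text \<open>
 The Ahlfors-Shimizu characteristic of a function with bounded spherical derivative grows at most quadratically; with Jensen's
 formula the same follows for chi g.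
\<close>

theorem lipschitz_growth:
 assumes g: "g nicely_meromorphic_on UNIV" "0 \<notin> dv g" and L: "0 < L" "L-lipschitz_on UNIV (sphere_value g)"
  and r: "0 < r" "sphere 0 r Int dv g = {}"
 shows "chi g r <= ln (1 + (cmod (g 0))^2) + \<bar>ln (cmod (g 0))\<bar> + 2 * (L^2 / 4 + 1) * r^2"
proof -
 have gm: "g meromorphic_on UNIV" using g by (simp add: nicely_meromorphic_on_def)
 define B where "B = {b \<in> dv g Int ball 0 r. is_pole g b}"
 define Q where "Q = (%z. \<Prod>b\<in>B. (z - b) ^ nat (- zorder g b))"
 obtain R P where RP: "r < R" "P holomorphic_on ball 0 R"
  "!!z. z \<in> ball 0 R ==> Q z = 0 \<longleftrightarrow> is_pole g z" "!!z. z \<in> ball 0 R ==> Q z = 0 ==> P z ~= 0"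
  "!!z. z \<in> ball 0 R ==> Q z ~= 0 ==> g z = P z / Q z"
  using homogeneous_coordinates[OF g r] unfolding Q_def B_def by blast
 have Qh: "Q holomorphic_on ball 0 R" unfolding Q_def by (intro holomorphic_intros)
 define v where "v = (%z. ln (sqrt ((cmod (P z))^2 + (cmod (Q z))^2)))"
 have Npos: "0 < (cmod (P z))\<^sup>2 + (cmod (Q z))^2" if "z \<in> ball 0 R" for z
  using RP(4)[OF that] by (cases "Q z = 0") (auto intro: add_pos_nonneg add_nonneg_pos)
 have contv: "continuous_on (ball 0 R) v" unfolding v_def
  using holomorphic_on_imp_continuous_on[OF RP(2)] holomorphic_on_imp_continuous_on[OF Qh] Npos
  by (intro continuous_intros) force+
 have mv: "cmean 0 r v <= v 0 + (L^2 / 4 + 1) * r^2"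
 proof (rule circle_mean_growth[OF contv r(1) RP(1)])
  show "0 < 1 / (2 * L)" using L by simp
  fix z :: complex and \<epsilon> assume e: "0 < \<epsilon>" "\<epsilon> <= 1 / (2 * L)" "cball z \<epsilon> \<subseteq> ball 0 R"
  show "cmean z \<epsilon> v <= v z + L^2 / 4 * \<epsilon>^2"
   unfolding v_def
  proof (rule chordal_local_mean[OF RP(2) Qh _ L(1) _ e])
   show "P z ~= 0 | Q z ~= 0" if "z \<in> ball 0 R" for z using RP(4)[OF that] by blast
   fix z w :: complex assume zw: "z \<in> ball 0 R" "w \<in> ball 0 R"
   have "dist (sphere_value g z) (sphere_value g w) <= L * dist z w"
    using L(2) by (auto simp: lipschitz_on_def)
   moreover have "dist (sphere_value g z) (sphere_value g w) =
     2 * cmod (P z * Q w - P w * Q z) /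
     (sqrt ((cmod (P z))^2 + (cmod (Q z))^2) * sqrt ((cmod (P w))^2 + (cmod (Q w))^2))"
    using RP(3-5) zw by (intro chordal_homogeneous) auto
   ultimately show "2 * cmod (P z * Q w - P w * Q z) /
     (sqrt ((cmod (P z))^2 + (cmod (Q z))^2) * sqrt ((cmod (P w))^2 + (cmod (Q w))^2)) <= L * cmod (z - w)"
    by (simp add: dist_norm)
  qed
 qed
 define u where "u = (%z. ln (1 + (cmod (g z))^2) / 2)"
 have vu: "v z = ln (cmod (Q z)) + u z" if "z \<in> ball 0 R" "Q z ~= 0" for z
 proof -
  have "P z = Q z * g z" using that RP(5)[OF that] by simp
  hence "(cmod (P z))^2 + (cmod (Q z))^2 = (cmod (Q z))^2 * (1 + (cmod (g z))^2)"
   by (simp add: norm_mult power_mult_distrib algebra_simps)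
  moreover have "0 < 1 + (cmod (g z))^2" by (simp add: add_pos_nonneg)
  ultimately show ?thesis using that
   by (simp add: v_def u_def ln_sqrt ln_mult ln_realpow add_divide_distrib)
 qed
 have finB: "finite B" unfolding B_def
  using dv_finite(2)[OF gm g(2), of r] by (rule rev_finite_subset) auto
 have B0: "b ~= 0" "cmod b < r" if "b \<in> B" for b using that g(2) by (auto simp: B_def)
 have lnQ: "ln (cmod (Q z)) = (\<Sum>b\<in>B. real (nat (- zorder g b)) * ln (cmod (z - b)))" if "z \<notin> B" for z
 proof -
  have "ln (cmod (Q z)) = ln (\<Prod>b\<in>B. cmod (z - b) ^ nat (- zorder g b))"
   by (simp add: Q_def norm_power flip: prod_norm)
  also have "... = (\<Sum>b\<in>B. ln (cmod (z - b) ^ nat (- zorder g b)))"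
   using that finB by (intro ln_prod) auto
  finally show ?thesis by (simp add: ln_realpow)
 qed
 have sphB: "z \<notin> B" "z \<in> ball 0 R" if "z \<in> sphere 0 r" for z using that RP(1) by (auto simp: B_def)
 have Qnz: "Q z ~= 0" if "z \<in> sphere 0 r" for z
  unfolding Q_def using finB sphB[OF that] by auto
 define Np where "Np = (\<Sum>b\<in>B. real (nat (- zorder g b)) * lam r b)"
 have cQ: "continuous_on (sphere 0 r) (%z. ln (cmod (Q z)))"
  using Qnz by (intro continuous_intros holomorphic_on_imp_continuous_on holomorphic_on_subset[OF Qh]) (use RP(1) in auto)
 have mQ: "cmean 0 r (%z. ln (cmod (Q z))) = ln (cmod (Q 0)) + Np"
 proof -
  have "cmean 0 r (%z. ln (cmod (Q z))) = cmean 0 r (%z. \<Sum>b\<in>B. real (nat (- zorder g b)) * ln (cmod (z - b)))"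
   using r sphB lnQ by (intro cmean_cong) auto
  also have "... = (\<Sum>b\<in>B. cmean 0 r (%z. real (nat (- zorder g b)) * ln (cmod (z - b))))"
   using finB r sphB by (intro cmean_sum continuous_intros) auto
  also have "... = (\<Sum>b\<in>B. real (nat (- zorder g b)) * ln r)"
  proof (rule sum.cong)
   fix b assume "b \<in> B"
   thus "cmean 0 r (%z. real (nat (- zorder g b)) * ln (cmod (z - b))) = real (nat (- zorder g b)) * ln r"
    using B0[of b] r by (simp add: cmean_cmult cmean_ln_dist)
  qed simp
  also have "... = ln (cmod (Q 0)) + Np"
   using lnQ[of 0] B0 by (fastforce simp: Np_def lam_eq right_diff_distrib sum_subtractf)
  finally show ?thesis .
 qed
 have cg: "continuous_on (sphere 0 r) g" using continuous_on_dv(1)[OF r(2)] .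
 have cu: "continuous_on (sphere 0 r) u" unfolding u_def
  using cg by (intro continuous_intros) (auto simp: add_nonneg_eq_0_iff)
 have "cmean 0 r v = cmean 0 r (%z. ln (cmod (Q z)) + u z)"
  using r vu sphB Qnz by (intro cmean_cong) auto
 also have "... = cmean 0 r (%z. ln (cmod (Q z))) + cmean 0 r u"
  using cQ cu r by (intro cmean_add) auto
 finally have 1: "ln (cmod (Q 0)) + Np + cmean 0 r u <= v 0 + (L^2 / 4 + 1) * r^2"
  using mv mQ by simp
 have "Q 0 ~= 0" unfolding Q_def using finB B0 by fastforce
 hence "v 0 = ln (cmod (Q 0)) + u 0" using vu[of 0] RP(1) r by auto
 with 1 have 2: "cmean 0 r u + Np <= u 0 + (L^2 / 4 + 1) * r^2" by simp
 define S where "S = dv g Int ball 0 r"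
 have finS: "finite S" unfolding S_def using dv_finite[OF gm g(2)] by auto
 have J: "cmean 0 r (%z. ln (cmod (g z))) = ln (cmod (g 0)) + (\<Sum>a\<in>S. real_of_int (zorder g a) * lam r a)"
  using jensen_formula[OF gm g(2) r finS] by (simp add: S_def)
 have clg: "continuous_on (sphere 0 r) (%z. ln (cmod (g z)))"
  using continuous_on_ln_cmod_dv[OF r(2)] .
 have "cmean 0 r (%z. \<bar>ln (cmod (g z))\<bar>) <= cmean 0 r (%z. 2 * u z - ln (cmod (g z)))"
 proof (rule cmean_mono)
  fix z :: complex assume z: "z \<in> sphere 0 r"
  have gz: "g z ~= 0" using continuous_on_dv(2)[OF r(2) z] .
  have "0 <= ln (1 + (cmod (g z))^2)" by simp
  moreover have "ln ((cmod (g z))^2) <= ln (1 + (cmod (g z))^2)"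
   using gz by (subst ln_le_cancel_iff) (auto simp: add_pos_nonneg)
  moreover have "ln ((cmod (g z))^2) = 2 * ln (cmod (g z))"
   using gz by (simp add: ln_realpow)
  ultimately show "\<bar>ln (cmod (g z))\<bar> <= 2 * u z - ln (cmod (g z))"
   by (auto simp: u_def abs_le_iff)
 next
  show "continuous_on (sphere 0 r) (%z. \<bar>ln (cmod (g z))\<bar>)"
   by (rule continuous_on_rabs[OF clg])
  show "continuous_on (sphere 0 r) (%z. 2 * u z - ln (cmod (g z)))"
   by (rule continuous_on_diff[OF continuous_on_mult[OF continuous_on_const cu] clg])
 qed (use r in simp)
 also have "... = 2 * cmean 0 r u - cmean 0 r (%z. ln (cmod (g z)))"
  using cmean_diff[OF continuous_on_mult[OF continuous_on_const cu] clg] r by (simp add: cmean_cmult)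
 finally have 3: "cmean 0 r (%z. \<bar>ln (cmod (g z))\<bar>) <= 2 * cmean 0 r u - cmean 0 r (%z. ln (cmod (g z)))" .
 have "(\<Sum>a\<in>S. \<bar>real_of_int (zorder g a)\<bar> * lam r a) =
    (\<Sum>a\<in>S. real_of_int (zorder g a) * lam r a) + 2 * (\<Sum>a\<in>S. real (nat (- zorder g a)) * lam r a)"
  unfolding sum_distrib_left sum.distrib[symmetric]
 proof (rule sum.cong)
  fix a assume "a \<in> S"
  have "\<bar>real_of_int (zorder g a)\<bar> = real_of_int (zorder g a) + 2 * real (nat (- zorder g a))"
   by (cases "0 <= zorder g a") auto
  thus "\<bar>real_of_int (zorder g a)\<bar> * lam r a =
    real_of_int (zorder g a) * lam r a + 2 * (real (nat (- zorder g a)) * lam r a)"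
   by (simp add: distrib_right)
 qed simp
 also have "(\<Sum>a\<in>S. real (nat (- zorder g a)) * lam r a) = Np"
  unfolding Np_def
 proof (rule sum.mono_neutral_right)
  show "\<forall>i\<in>S - B. real (nat (- zorder g i)) * lam r i = 0"
  proof
   fix i assume "i \<in> S - B"
   hence "~ is_pole g i" by (auto simp: S_def B_def)
   hence "0 <= zorder g i" using zorder_neg_iff_pole[OF gm g(2), of i] by auto
   thus "real (nat (- zorder g i)) * lam r i = 0" by simp
  qed
 qed (use finS in \<open>auto simp: S_def B_def\<close>)
 finally have 4: "(\<Sum>a\<in>S. \<bar>real_of_int (zorder g a)\<bar> * lam r a) = cmean 0 r (%z. ln (cmod (g z))) - ln (cmod (g 0)) + 2 * Np"
  using J by simp
 have "chi g r <= 2 * (cmean 0 r u + Np) - ln (cmod (g 0))"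
  using 3 4 by (simp add: chi_def S_def)
 also have "... <= 2 * (u 0 + (L^2 / 4 + 1) * r^2) + \<bar>ln (cmod (g 0))\<bar>"
 proof -
  have "2 * x - l <= 2 * y + \<bar>l\<bar>" if "x <= y" for x y l :: real
   using that by linarith
  from this[OF 2] show ?thesis .
 qed
 finally show ?thesis by (simp add: u_def algebra_simps)
qed

section \<open>Pointwise bounds for differential monomials\<close>

text \<open>
 Finitely many points cannot crowd every circle of an annulus: by counting, some radius keeps a distance inverse to their number.
\<close>

lemma separated_radius:
 assumes "finite S" "finite T" "0 < \<rho>"
 obtains r where "\<rho> <= r" "r <= 2 * \<rho>" "!!a. a \<in> S ==> \<rho> / (4 * (real (card S) + 1)) <= \<bar>cmod a - r\<bar>"
  "!!a. a \<in> T ==> cmod a ~= r"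
proof -
 define N where "N = card S"
 define \<eta> where "\<eta> = \<rho> / (2 * (real N + 1))"
 have eta: "0 < \<eta>" "2 * (real N + 1) * \<eta> = \<rho>" using assms by (auto simp: \<eta>_def field_simps)
 define c where "c = (%j. \<rho> + \<eta> * (2 * real j + 1))"
 have "\<exists>j\<le>N. \<forall>a\<in>S. \<eta> <= \<bar>cmod a - c j\<bar>"
 proof (rule ccontr)
  assume "~ ?thesis"
  hence "\<forall>j\<le>N. \<exists>a\<in>S. \<bar>cmod a - c j\<bar> < \<eta>" by (metis not_le)
  then obtain f where f: "!!j. j <= N ==> f j \<in> S" "!!j. j <= N ==> \<bar>cmod (f j) - c j\<bar> < \<eta>"
   by metis
  have "inj_on f {..N}"
  proof (rule inj_onI)
   fix i j assume ij: "i \<in> {..N}" "j \<in> {..N}" "f i = f j"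
   have lt: "\<bar>c i - c j\<bar> < 2 * \<eta>" using f(2)[of i] f(2)[of j] ij by auto
   have "c i - c j = \<eta> * (2 * (real i - real j))" by (simp add: c_def algebra_simps)
   hence "\<eta> * (2 * \<bar>real i - real j\<bar>) < 2 * \<eta>" using lt eta by (simp add: abs_mult)
   hence "\<bar>real i - real j\<bar> < 1" using eta by simp
   thus "i = j" by linarith
  qed
  hence "card {..N} <= card S" using f(1) assms(1) by (intro card_inj_on_le[of f]) auto
  thus False by (simp add: N_def)
 qed
 then obtain j where j: "j <= N" "!!a. a \<in> S ==> \<eta> <= \<bar>cmod a - c j\<bar>" by blast
 have "\<eta> * (2 * real j + 2) <= \<eta> * (2 * real N + 2)" using eta j by (intro mult_left_mono) auto
 moreover have "\<eta> * (2 * real N + 2) = \<rho>" using eta by (simp add: algebra_simps)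
 moreover have "c j + \<eta> = \<rho> + \<eta> * (2 * real j + 2)" by (simp add: c_def algebra_simps)
 ultimately have up: "c j + \<eta> <= 2 * \<rho>" by linarith
 have lo: "\<rho> <= c j" using eta by (simp add: c_def)
 have "infinite ({c j<..<c j + \<eta> / 2} - cmod ` T)"
  using assms(2) eta by (intro Diff_infinite_finite finite_imageI) (auto simp: infinite_Ioo)
 then obtain r where r: "c j < r" "r < c j + \<eta> / 2" "r \<notin> cmod ` T"
  by (metis (no_types, lifting) DiffE finite.emptyI equals0I greaterThanLessThan_iff)
 show ?thesis
 proof (rule that[of r])
  fix a assume "a \<in> S"
  hence "\<eta> / 2 <= \<bar>cmod a - r\<bar>" using j(2)[of a] r by linarith
  thus "\<rho> / (4 * (real (card S) + 1)) <= \<bar>cmod a - r\<bar>" by (simp add: \<eta>_def N_def)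
 qed (use r up lo eta in auto)
qed

definition weight_const :: "nat => (nat => nat) => real" where
 "weight_const k n = (\<Prod>j\<le>k. (fact j * exp 1 * 4 ^ j) ^ n j)"

lemma weight_const_pos: "0 < weight_const k n"
 unfolding weight_const_def by (intro prod_pos) auto

lemma growth_near:
 assumes g: "g holomorphic_on ball z \<eta>" "!!w. w \<in> ball z \<eta> ==> g w ~= 0"
  and B: "!!w. w \<in> ball z \<eta> ==> cmod (deriv g w / g w) <= B" and Y: "0 < \<eta>" "0 <= B" "Y = B + 1 / \<eta>"
  and w: "w \<in> ball z (1 / Y)"
 shows "cmod (g w) <= exp 1 * cmod (g z)" "1 / Y <= \<eta>"
proof -
 have Ypos: "0 < Y" using Y by (simp add: add_nonneg_pos)
 have "1 / \<eta> <= Y" using Y by simp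
 thus le: "1 / Y <= \<eta>" using Y(1) Ypos by (simp add: field_simps)
 obtain h where h: "h holomorphic_on ball z \<eta>" "!!w. w \<in> ball z \<eta> ==> g w = exp (h w)"
  using contractible_imp_holomorphic_log[OF g(1) convex_imp_contractible g(2)] by auto
 have hd: "(h has_field_derivative deriv h x) (at x within ball z \<eta>)" "cmod (deriv h x) <= B" if x: "x \<in> ball z \<eta>" for x
 proof -
  have d: "(h has_field_derivative deriv h x) (at x)"
   using holomorphic_derivI[OF h(1) open_ball x] .
  thus "(h has_field_derivative deriv h x) (at x within ball z \<eta>)" by (rule has_field_derivative_at_within)
  have "((%w. exp (h w)) has_field_derivative exp (h x) * deriv h x) (at x)"
   using d by (auto intro!: derivative_eq_intros)
  hence "(g has_field_derivative exp (h x) * deriv h x) (at x)"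
   by (rule DERIV_cong_ev[THEN iffD1, rotated -1])
     (use x h(2) in \<open>auto intro!: eventually_mono[OF eventually_nhds_in_open[of "ball z \<eta>" x]]\<close>)
  hence "deriv g x = g x * deriv h x" using h(2)[OF x] DERIV_imp_deriv by auto
  thus "cmod (deriv h x) <= B" using B[OF x] g(2)[OF x] by simp
 qed
 have wz: "w \<in> ball z \<eta>" "z \<in> ball z \<eta>" using w le Y by auto
 have "cmod (h w - h z) <= B * cmod (w - z)"
  using hd wz by (intro field_differentiable_bound[OF convex_ball]) auto
 also have "... <= B * (1 / Y)" using w Y by (intro mult_left_mono) (auto simp: dist_norm norm_minus_commute)
 also have "... <= 1"
 proof -
  have "B <= Y" using Y by simp
  thus ?thesis using Ypos by simp
 qed
 finally have "Re (h w - h z) <= 1" using complex_Re_le_cmod order_trans by blast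
 hence "exp (Re (h w)) <= exp (1 + Re (h z))" by simp
 thus "cmod (g w) <= exp 1 * cmod (g z)"
  using h(2)[OF wz(1)] h(2)[OF wz(2)] by (simp add: exp_add)
qed

lemma diff_monomial_holomorphic:
 assumes "g holomorphic_on S" "open S"
 shows "diff_monomial k n g holomorphic_on S"
proof -
 have "(%z. \<Prod>j\<le>k. ((deriv ^^ j) g z) ^ n j) holomorphic_on S"
  by (intro holomorphic_intros holomorphic_higher_deriv assms)
 thus ?thesis by (simp add: diff_monomial_def[abs_def])
qed

text \<open>
 If g' / g is bounded near z then g is comparable to g z on a disc of radius 1 / Y, and Cauchy's estimates
 bound each f^(j) / f by a multiple of Y^j. This replaces the lemma on the logarithmic derivative.
\<close>

theorem diff_monomial_bound:
 assumes g: "g holomorphic_on ball z \<eta>" "!!w. w \<in> ball z \<eta> ==> g w ~= 0"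
  and B: "!!w. w \<in> ball z \<eta> ==> cmod (deriv g w / g w) <= B" and Y: "0 < \<eta>" "0 <= B" "Y = B + 1 / \<eta>"
 shows "cmod (diff_monomial k n g z) <= weight_const k n * Y ^ (\<Sum>j\<le>k. j * n j) * cmod (g z) ^ (\<Sum>j\<le>k. n j)"
  and "cmod (deriv (diff_monomial k n g) z) <=
      4 * weight_const k n * Y ^ ((\<Sum>j\<le>k. j * n j) + 1) * cmod (g z) ^ (\<Sum>j\<le>k. n j)"
proof -
 define s where "s = 1 / Y"
 have Ypos: "0 < Y" using Y by (simp add: add_nonneg_pos)
 have s: "0 < s" "s <= \<eta>"
  using Ypos growth_near(2)[OF g B Y, of z] by (auto simp: s_def)
 have gs: "cmod (g w) <= exp 1 * cmod (g z)" if "w \<in> ball z s" for w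
  using growth_near(1)[OF g B Y] that by (simp add: s_def)
 have hs: "g holomorphic_on ball z s" using g(1) s by (auto intro: holomorphic_on_subset)
 have d: "cmod ((deriv ^^ j) g w) <= fact j * exp 1 * 4 ^ j * Y ^ j * cmod (g z)" if w: "w \<in> ball z (s/2)" for j w
 proof -
  have sub: "cball w (s/4) \<subseteq> ball z s"
  proof
   fix x assume "x \<in> cball w (s/4)"
   thus "x \<in> ball z s" using w s dist_triangle[of z x w] by auto
  qed
  have "cmod ((deriv ^^ j) g w) <= fact j * (exp 1 * cmod (g z)) / (s/4) ^ j"
  proof (rule Cauchy_inequality)
   show "g holomorphic_on ball w (s/4)"
    by (rule holomorphic_on_subset[OF hs]) (use sub ball_subset_cball in blast)
   show "continuous_on (cball w (s/4)) g"
    using holomorphic_on_imp_continuous_on[OF hs] sub continuous_on_subset by blast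
   fix x assume "cmod (w - x) = s/4"
   thus "cmod (g x) <= exp 1 * cmod (g z)" using sub by (intro gs) (auto simp: dist_norm)
  qed (use s in auto)
  also have "... = fact j * exp 1 * 4 ^ j * Y ^ j * cmod (g z)"
   using Ypos by (simp add: s_def power_divide field_simps)
  finally show ?thesis .
 qed
 have M: "cmod (diff_monomial k n g w) <= weight_const k n * Y ^ (\<Sum>j\<le>k. j * n j) * cmod (g z) ^ (\<Sum>j\<le>k. n j)"
  if w: "w \<in> ball z (s/2)" for w
 proof -
  have "cmod (diff_monomial k n g w) = (\<Prod>j\<le>k. cmod ((deriv ^^ j) g w) ^ n j)"
   by (simp add: diff_monomial_def norm_power flip: prod_norm)
  also have "... <= (\<Prod>j\<le>k. (fact j * exp 1 * 4 ^ j * Y ^ j * cmod (g z)) ^ n j)"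
   using d[OF w] by (intro prod_mono) (auto intro!: power_mono)
  also have "... = weight_const k n * (\<Prod>j\<le>k. Y ^ (j * n j)) * (\<Prod>j\<le>k. cmod (g z) ^ n j)"
   by (simp add: weight_const_def power_mult_distrib prod.distrib power_mult)
  finally show ?thesis by (simp add: power_sum)
 qed
 thus "cmod (diff_monomial k n g z) <= weight_const k n * Y ^ (\<Sum>j\<le>k. j * n j) * cmod (g z) ^ (\<Sum>j\<le>k. n j)"
  using s by simp
 have Mh: "diff_monomial k n g holomorphic_on ball z s" using hs by (rule diff_monomial_holomorphic) simp
 have sub: "cball z (s/4) \<subseteq> ball z s" "cball z (s/4) \<subseteq> ball z (s/2)" using s by auto
 have "cmod ((deriv ^^ 1) (diff_monomial k n g) z) <=
   fact 1 * (weight_const k n * Y ^ (\<Sum>j\<le>k. j * n j) * cmod (g z) ^ (\<Sum>j\<le>k. n j)) / (s/4) ^ 1"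
 proof (rule Cauchy_inequality)
  show "diff_monomial k n g holomorphic_on ball z (s/4)"
   by (rule holomorphic_on_subset[OF Mh]) (use sub ball_subset_cball in blast)
  show "continuous_on (cball z (s/4)) (diff_monomial k n g)"
   using holomorphic_on_imp_continuous_on[OF Mh] sub(1) continuous_on_subset by blast
  fix x assume "cmod (z - x) = s/4"
  thus "cmod (diff_monomial k n g x) <= weight_const k n * Y ^ (\<Sum>j\<le>k. j * n j) * cmod (g z) ^ (\<Sum>j\<le>k. n j)"
   using sub by (intro M) (auto simp: dist_norm)
 qed (use s in auto)
 thus "cmod (deriv (diff_monomial k n g) z) <=
      4 * weight_const k n * Y ^ ((\<Sum>j\<le>k. j * n j) + 1) * cmod (g z) ^ (\<Sum>j\<le>k. n j)"
  using Ypos by (simp add: s_def mult_ac)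
qed

section \<open>Orders of differential monomials\<close>

lemma frequently_nonzero_imp_eventually:
 assumes "f meromorphic_on {z}" "\<exists>\<^sub>F w in at z. f w ~= 0"
 shows "\<forall>\<^sub>F w in at z. f w ~= 0"
 using assms not_essential_frequently_0_imp_eventually_0[of f z]
 by (auto simp: meromorphic_at_iff frequently_def)

lemma frequently_deriv_nonzero:
 assumes "f meromorphic_on {z}" "\<exists>\<^sub>F w in at z. f w ~= 0" "zorder f z ~= 0"
 shows "\<exists>\<^sub>F w in at z. deriv f w ~= 0"
proof -
 obtain F where F: "(%w. f (z + w)) has_laurent_expansion F"
  using assms(1) by (auto simp: meromorphic_on_def)
 have "F ~= 0"
  using frequently_nonzero_imp_eventually[OF assms(1,2)] has_laurent_expansion_eventually_nonzero_iff[OF F] by simp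
 hence "fls_subdegree F = zorder f z"
  using has_laurent_expansion_zorder[OF F] by simp
 hence "fls_deriv F ~= 0" using assms(3) by (metis fls_deriv_eq_0_iff fls_const_subdegree)
 moreover have "deriv (%w. f (z + w)) has_laurent_expansion fls_deriv F"
  using F by (rule has_laurent_expansion_deriv)
 moreover have "deriv (%w. f (z + w)) = (%w. deriv f (z + w))"
  by (simp add: deriv_shift_0' add_ac o_def fun_eq_iff)
 ultimately have "\<forall>\<^sub>F w in at z. deriv f w ~= 0"
  using has_laurent_expansion_eventually_nonzero_iff[of "deriv f" z "fls_deriv F"] by auto
 thus ?thesis by (rule eventually_frequently[rotated]) auto
qed

lemma zorder_higher_deriv:
 assumes g: "g meromorphic_on {z}" "\<exists>\<^sub>F w in at z. g w ~= 0" and p: "zorder g z < 0 | int k <= zorder g z" and j: "j <= k"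
 shows "zorder ((deriv ^^ j) g) z = zorder g z - int j & (\<exists>\<^sub>F w in at z. (deriv ^^ j) g w ~= 0)"
 using j
proof (induction j)
 case 0
 thus ?case using g by simp
next
 case (Suc j)
 hence IH: "zorder ((deriv ^^ j) g) z = zorder g z - int j" "\<exists>\<^sub>F w in at z. (deriv ^^ j) g w ~= 0" by auto
 have m: "(deriv ^^ j) g meromorphic_on {z}" using g(1) by (rule meromorphic_on_higher_deriv)
 have nz: "zorder ((deriv ^^ j) g) z ~= 0" using IH(1) p Suc.prems by auto
 have "zorder (deriv ((deriv ^^ j) g)) z = zorder ((deriv ^^ j) g) z - 1"
  using m IH(2) nz by (intro zorder_deriv_minus_1) (auto simp: meromorphic_at_iff)
 moreover have "\<exists>\<^sub>F w in at z. deriv ((deriv ^^ j) g) w ~= 0"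
  using frequently_deriv_nonzero[OF m IH(2) nz] .
 ultimately show ?case using IH by simp
qed

lemma meromorphic_diff_monomial:
 assumes "g meromorphic_on A"
 shows "diff_monomial k n g meromorphic_on A"
proof -
 have "(%z. \<Prod>j\<le>k. ((deriv ^^ j) g z) ^ n j) meromorphic_on A"
  by (intro meromorphic_intros assms)
 thus ?thesis by (simp add: diff_monomial_def[abs_def])
qed

lemma zorder_diff_monomial:
 assumes g: "g meromorphic_on {z}" "\<exists>\<^sub>F w in at z. g w ~= 0" and p: "zorder g z < 0 | int k <= zorder g z"
 shows "zorder (diff_monomial k n g) z = int (\<Sum>j\<le>k. n j) * zorder g z - int (\<Sum>j\<le>k. j * n j)"
  and "\<forall>\<^sub>F w in at z. diff_monomial k n g w ~= 0"
proof -
 have h: "zorder ((deriv ^^ j) g) z = zorder g z - int j" "\<exists>\<^sub>F w in at z. (deriv ^^ j) g w ~= 0" if "j <= k" for j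
  using zorder_higher_deriv[OF g p that] by auto
 have m: "(deriv ^^ j) g meromorphic_on {z}" for j using g(1) by (rule meromorphic_on_higher_deriv)
 have "\<forall>\<^sub>F w in at z. \<forall>j\<in>{..k}. (deriv ^^ j) g w ~= 0"
  using frequently_nonzero_imp_eventually[OF m h(2)] by (intro eventually_ball_finite) auto
 hence ev: "\<forall>\<^sub>F w in at z. (\<Prod>j\<le>k. ((deriv ^^ j) g w) ^ n j) ~= 0"
  by eventually_elim auto
 thus "\<forall>\<^sub>F w in at z. diff_monomial k n g w ~= 0" by (simp add: diff_monomial_def)
 have "zorder (diff_monomial k n g) z = (\<Sum>j\<le>k. zorder (%w. ((deriv ^^ j) g w) ^ n j) z)"
  unfolding diff_monomial_def[abs_def] using m ev by (intro zorder_prod meromorphic_on_power) auto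
 also have "... = (\<Sum>j\<le>k. int (n j) * (zorder g z - int j))"
  using m h by (intro sum.cong refl) (simp add: zorder_power)
 also have "... = int (\<Sum>j\<le>k. n j) * zorder g z - int (\<Sum>j\<le>k. j * n j)"
  by (simp add: right_diff_distrib sum_subtractf sum_distrib_left sum_distrib_right mult_ac)
 finally show "zorder (diff_monomial k n g) z = int (\<Sum>j\<le>k. n j) * zorder g z - int (\<Sum>j\<le>k. j * n j)" .
qed

lemma diff_monomial_analytic:
 assumes "g analytic_on {z}"
 shows "diff_monomial k n g analytic_on {z}"
proof -
 obtain S where S: "open S" "z \<in> S" "g holomorphic_on S" using assms analytic_at by blast
 hence "diff_monomial k n g holomorphic_on S" by (intro diff_monomial_holomorphic)
 thus ?thesis using S analytic_at by blast
qed

lemma zorder_logarithmic_derivative: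
 assumes F: "F meromorphic_on {z}" "\<exists>\<^sub>F w in at z. F w ~= 0" "\<exists>\<^sub>F w in at z. deriv F w ~= 0"
 shows "-1 <= zorder (%w. deriv F w / F w) z" "zorder F z = 0 ==> 0 <= zorder (%w. deriv F w / F w) z"
proof -
 have m: "deriv F meromorphic_on {z}" using F(1) by (rule meromorphic_on_deriv)
 have q: "zorder (%w. deriv F w / F w) z = zorder (deriv F) z - zorder F z"
  using m F by (intro zorder_divide)
 have iso: "isolated_singularity_at F z" "not_essential F z" using F(1) by (auto simp: meromorphic_at_iff)
 have 0: "0 <= zorder (%w. deriv F w / F w) z" if "zorder F z = 0"
 proof -
  have "~ is_pole F z" using isolated_pole_imp_neg_zorder[OF iso(1)] that by force
  hence "~ is_pole (deriv F) z" using is_pole_deriv_iff[OF F(1)] by simp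
  hence "0 <= zorder (deriv F) z"
   using neg_zorder_imp_is_pole[of "deriv F" z] m F(3) by (force simp: meromorphic_at_iff)
  thus ?thesis using q that by simp
 qed
 thus "zorder F z = 0 ==> 0 <= zorder (%w. deriv F w / F w) z" .
 show "-1 <= zorder (%w. deriv F w / F w) z"
 proof (cases "zorder F z = 0")
  case False
  thus ?thesis using q zorder_deriv_minus_1[OF iso F(2)] by simp
 qed (use 0 in auto)
qed

section \<open>Local counting for an omitted value\<close>

definition reduced :: "nat => (nat => nat) => complex => complex => nat => (complex => complex) => complex => complex" where
 "reduced k n c a t g z = diff_monomial k n g z / (c * (z - a) ^ t) - 1"

text \<open>
 The only consequences of \<open>n 0 \<ge> 2\<close> and \<open>n k >= 1\<close> that the argument needs.
\<close>

lemma degree_weight_bound: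
 fixes k :: nat and n :: "nat => nat"
 assumes "1 <= k" "2 <= n 0" "1 <= n k"
 shows "3 <= (\<Sum>j\<le>k. n j)" "(\<Sum>j\<le>k. j * n j) + 2 * k <= k * (\<Sum>j\<le>k. n j)" "k <= (\<Sum>j\<le>k. j * n j)"
proof -
 have s: "(\<Sum>j\<le>k. f j) = f 0 + (\<Sum>j\<in>{1..k}. f j)" for f :: "nat => nat"
  by (simp add: atMost_atLeast0 sum.atLeast_Suc_atMost)
 have "n k <= (\<Sum>j\<in>{1..k}. n j)" using assms by (intro member_le_sum) auto
 thus "3 <= (\<Sum>j\<le>k. n j)" using assms s[of n] by simp
 have "(\<Sum>j\<in>{1..k}. j * n j) <= (\<Sum>j\<in>{1..k}. k * n j)" by (intro sum_mono) auto
 also have "... = k * (\<Sum>j\<in>{1..k}. n j)" by (simp add: sum_distrib_left)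
 finally have "(\<Sum>j\<le>k. j * n j) <= k * (\<Sum>j\<in>{1..k}. n j)" using s[of "%j. j * n j"] by simp
 moreover have "k * (\<Sum>j\<le>k. n j) = k * n 0 + k * (\<Sum>j\<in>{1..k}. n j)" using s[of n] by (simp add: distrib_left)
 moreover have "k * 2 <= k * n 0" using assms by simp
 ultimately show "(\<Sum>j\<le>k. j * n j) + 2 * k <= k * (\<Sum>j\<le>k. n j)" by linarith
 have "k * n k <= (\<Sum>j\<le>k. j * n j)" by (rule member_le_sum) auto
 moreover have "k <= k * n k" using assms by simp
 ultimately show "k <= (\<Sum>j\<le>k. j * n j)" by linarith
qed

text \<open>
 The situation to be refuted: M[g] omits c * (z - a0)^t away from a0. The conditions at 0 only normalise Jensen's formula
 and are achieved by a translation. E bounds what the exceptional point a0 adds to the pole order of K.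
\<close>

locale omitted_value =
 fixes g :: "complex => complex" and k m t :: nat and n :: "nat => nat" and c a0 :: complex
 assumes nice: "g nicely_meromorphic_on UNIV" and g0: "0 \<notin> dv g"
  and k1: "1 <= k" and n0: "2 <= n 0" and nk: "1 <= n k" and m1: "1 <= m" and tm: "t <= m"
  and zmult: "zeros_mult_ge UNIV (k + m + 1) g"
  and c: "c ~= 0" and a0: "a0 ~= 0"
  and omit: "!!z. z ~= a0 ==> ~ is_pole g z ==> diff_monomial k n g z ~= c * (z - a0) ^ t"
  and Psi0: "0 \<notin> dv (reduced k n c a0 t g)" and dPsi0: "deriv (reduced k n c a0 t g) 0 ~= 0"
begin

abbreviation "M \<equiv> diff_monomial k n g"

abbreviation "Psi \<equiv> reduced k n c a0 t g"

definition K :: "complex => complex" where "K z = deriv Psi z / Psi z"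

definition dg :: nat where "dg = (\<Sum>j\<le>k. n j)"

definition wt :: nat where "wt = (\<Sum>j\<le>k. j * n j)"

definition E :: nat where "E = (if zorder g a0 > 0 then t else 1)"

lemma degw: "3 <= dg" "wt + 2 * k <= k * dg" "k <= wt"
 using degree_weight_bound[OF k1 n0 nk] by (auto simp: dg_def wt_def)

lemma gm: "g meromorphic_on UNIV" using nice by (simp add: nicely_meromorphic_on_def)

lemma gmz: "g meromorphic_on {z}" using gm meromorphic_on_subset by blast

lemma gnz: "\<exists>\<^sub>F w in at z. g w ~= 0" using frequently_nonzero_if_dv(2)[OF gm g0] .

lemma Psim: "Psi meromorphic_on A"
proof -
 have "M meromorphic_on A" using gm by (intro meromorphic_diff_monomial) (auto intro: meromorphic_on_subset)
 thus ?thesis unfolding reduced_def[abs_def] by (intro meromorphic_intros)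
qed

lemma Psinz: "\<exists>\<^sub>F w in at z. Psi w ~= 0" using frequently_nonzero_if_dv(2)[OF Psim Psi0] .

lemma dPsi_dv: "0 \<notin> dv (deriv Psi)"
 using Psi0 dPsi0 by (auto simp: dv_def intro: analytic_deriv)

lemma dPsim: "deriv Psi meromorphic_on A" using Psim by (rule meromorphic_on_deriv)

lemma dPsinz: "\<exists>\<^sub>F w in at z. deriv Psi w ~= 0" using frequently_nonzero_if_dv(2)[OF dPsim dPsi_dv] .

lemma Km: "K meromorphic_on A" unfolding K_def[abs_def] using Psim dPsim by (intro meromorphic_intros)

lemma K_dv: "0 \<notin> dv K"
 using Psi0 dPsi_dv by (auto simp: dv_def K_def[abs_def] intro!: analytic_intros)

lemma analytic_if_not_pole: "~ is_pole g z ==> g analytic_on {z}"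
 using nice by (rule nicely_meromorphic_on_imp_analytic_at) auto

lemma not_pole_if_zorder: "~ zorder g z < 0 ==> ~ is_pole g z"
 using zorder_neg_iff_pole[OF gm g0] by blast

lemma zorder_zero: 
 assumes "z \<in> dv g" "~ is_pole g z"
 shows "zorder g z >= int (k + m + 1)"
proof -
 have "g analytic_on {z}" using analytic_if_not_pole assms by blast
 hence "g z = 0" using assms by (auto simp: dv_def)
 hence "isolated_zero g z"
  using \<open>g analytic_on {z}\<close> frequently_nonzero_if_dv(1)[OF gm g0, of z] isolated_zero_analytic_iff by blast
 thus ?thesis using zmult by (auto simp: zeros_mult_ge_def)
qed

lemma zorder_pos_ge: "zorder g z > 0 ==> zorder g z >= int (k + m + 1)"
 using zorder_zero[of z] zorder_not_dv[of z g] not_pole_if_zorder[of z] by force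

lemma zorder_dv_nonzero: "z \<in> dv g ==> zorder g z ~= 0"
 using zorder_zero[of z] zorder_neg_iff_pole[OF gm g0, of z] by force

lemma dv_Psi_sub: "z \<in> dv Psi ==> zorder g z < 0 | z = a0"
proof (rule ccontr)
 assume z: "z \<in> dv Psi" "~ (zorder g z < 0 | z = a0)"
 hence np: "~ is_pole g z" using not_pole_if_zorder by blast
 have "M analytic_on {z}" using analytic_if_not_pole[OF np] by (rule diff_monomial_analytic)
 hence "Psi analytic_on {z}" unfolding reduced_def[abs_def] using z c
  by (intro analytic_intros) auto
 moreover have "Psi z ~= 0" using omit[of z] np z c by (auto simp: reduced_def)
 ultimately show False using z by (auto simp: dv_def)
qed

lemma dv_Psi_sub': "dv Psi \<subseteq> insert a0 (dv g)"
 using dv_Psi_sub zorder_not_dv by fastforce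

lemma D_zorder: "zorder (%z. c * (z - a0) ^ t) a = (if a = a0 then int t else 0)"
proof (cases "a = a0")
 case True
 thus ?thesis using c by (intro zorder_eqI[of UNIV a "%_. c"]) auto
next
 case False
 thus ?thesis using c
  by (auto intro!: zorder_eqI[of UNIV a "%z. c * (z - a0) ^ t"] holomorphic_intros)
qed

lemma D_mero: "(%z. c * (z - a0) ^ t) meromorphic_on A"
 by (intro meromorphic_intros)

lemma D_nz: "\<exists>\<^sub>F w in at z. c * (w - a0) ^ t ~= 0"
proof -
 have "\<forall>\<^sub>F w in at z. w ~= a0" by (rule eventually_neq_at_within)
 hence "\<forall>\<^sub>F w in at z. c * (w - a0) ^ t ~= 0" by eventually_elim (use c in auto)
 thus ?thesis by (rule eventually_frequently[rotated]) auto
qed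

definition Phi where "Phi z = M z / (c * (z - a0) ^ t)"

lemma Psi_Phi: "Psi = (%z. Phi z - 1)" by (simp add: fun_eq_iff Phi_def reduced_def)

lemma Phi_mero: "Phi meromorphic_on A"
 unfolding Phi_def[abs_def]
 using meromorphic_diff_monomial[OF meromorphic_on_subset[OF gm, of A]] by (intro meromorphic_intros) auto

lemma zorder_Phi:
 assumes "zorder g a < 0 | zorder g a > 0"
 shows "zorder Phi a = int dg * zorder g a - int wt - (if a = a0 then int t else 0)"
  "\<exists>\<^sub>F w in at a. Phi w ~= 0"
proof -
 have p: "zorder g a < 0 | int k <= zorder g a" using assms zorder_pos_ge[of a] by auto
 have Mz: "zorder M a = int dg * zorder g a - int wt" "\<forall>\<^sub>F w in at a. M w ~= 0"
  using zorder_diff_monomial[OF gmz gnz p] by (auto simp: dg_def wt_def)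
 have Mf: "\<exists>\<^sub>F w in at a. M w ~= 0" using Mz(2) by (rule eventually_frequently[rotated]) auto
 have Mm: "M meromorphic_on {a}" using gmz by (rule meromorphic_diff_monomial)
 show "zorder Phi a = int dg * zorder g a - int wt - (if a = a0 then int t else 0)"
  unfolding Phi_def[abs_def] using zorder_divide[OF Mm Mf D_mero D_nz] Mz(1) D_zorder by simp
 have "\<forall>\<^sub>F w in at a. w ~= a0" by (rule eventually_neq_at_within)
 with Mz(2) have "\<forall>\<^sub>F w in at a. Phi w ~= 0" by eventually_elim (use c in \<open>auto simp: Phi_def\<close>)
 thus "\<exists>\<^sub>F w in at a. Phi w ~= 0" by (rule eventually_frequently[rotated]) auto
qed

lemma minus_one: "zorder (%_. -1 :: complex) a = 0"
 by (rule zorder_eqI[of UNIV _ "%_. -1"]) auto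

lemma zorder_Psi_pole:
 assumes "zorder g a < 0"
 shows "zorder Psi a = int dg * zorder g a - int wt - (if a = a0 then int t else 0)"
proof -
 have lt: "zorder Phi a < zorder (%_. -1 :: complex) a"
 proof -
  have "int dg * zorder g a <= 0" using assms by (simp add: mult_nonneg_nonpos)
  moreover have "0 < wt" using degw k1 by simp
  ultimately show ?thesis using zorder_Phi(1)[of a] assms minus_one[of a] by auto
 qed
 have "zorder (%z. Phi z + -1) a = zorder Phi a"
  using lt zorder_Phi(2)[of a] assms by (intro zorder_add1 Phi_mero) auto
 thus ?thesis using zorder_Phi(1)[of a] assms by (simp add: Psi_Phi)
qed

lemma zorder_Psi_ge: "- zorder Psi a <= int (dg + wt) * max 0 (- zorder g a) + (if a = a0 then int t else 0)"
proof (cases "zorder g a < 0")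
 case True
 have "int wt * 1 <= int wt * (- zorder g a)" using True by (intro mult_left_mono) auto
 thus ?thesis using zorder_Psi_pole[OF True] True by (auto simp: algebra_simps max_def)
next
 case False
 show ?thesis
 proof (cases "a = a0")
  case False
  hence "a \<notin> dv Psi" using dv_Psi_sub[of a] \<open>~ zorder g a < 0\<close> by auto
  thus ?thesis using zorder_not_dv[of a Psi] by simp
 next
  case True
  have np: "~ is_pole g a" using False not_pole_if_zorder by blast
  have Man: "M analytic_on {a}" using analytic_if_not_pole[OF np] by (rule diff_monomial_analytic)
  have "- int t <= zorder Psi a"
  proof (cases "\<exists>\<^sub>F w in at a. M w ~= 0")
   case Mnz: True
   have Mm: "M meromorphic_on {a}" using gmz by (rule meromorphic_diff_monomial)
   have M0: "0 <= zorder M a"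
   proof (rule ccontr)
    assume "~ ?thesis"
    hence "is_pole M a" using neg_zorder_imp_is_pole[of M a] Mm Mnz by (auto simp: meromorphic_at_iff)
    thus False using analytic_at_imp_no_pole[OF Man] by simp
   qed
   have Phz: "zorder Phi a = zorder M a - int t"
    unfolding Phi_def[abs_def] using zorder_divide[OF Mm Mnz D_mero D_nz] D_zorder[of a] True by simp
   have Phnz: "\<exists>\<^sub>F w in at a. Phi w ~= 0"
   proof -
    have "\<forall>\<^sub>F w in at a. w ~= a0" by (rule eventually_neq_at_within)
    from this frequently_nonzero_imp_eventually[OF Mm Mnz]
    have "\<forall>\<^sub>F w in at a. Phi w ~= 0" by eventually_elim (use c in \<open>auto simp: Phi_def\<close>)
    thus ?thesis by (rule eventually_frequently[rotated]) auto
   qed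
   have "\<exists>\<^sub>F w in at a. Phi w + -1 ~= 0" using Psinz[of a] by (simp add: Psi_Phi)
   hence "- int t <= zorder (%z. Phi z + -1) a"
    using Phnz Phz M0 minus_one[of a] by (intro zorder_add_ge Phi_mero) auto
   thus ?thesis by (simp add: Psi_Phi)
  next
   case False
   hence "\<forall>\<^sub>F w in at a. M w = 0" by (simp add: frequently_def)
   hence "\<forall>\<^sub>F w in at a. Psi w = -1" by eventually_elim (simp add: reduced_def)
   hence "zorder Psi a = zorder (%_. -1 :: complex) a" by (intro zorder_cong) auto
   thus ?thesis using minus_one[of a] by simp
  qed
  thus ?thesis using True False by auto
 qed
qed

lemma zorder_K_zero:
 assumes "zorder g a > 0"
 shows "zorder K a = int dg * zorder g a - int wt - (if a = a0 then int t else 0) - 1"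
proof -
 have ge: "zorder g a >= int (k + m + 1)" using zorder_pos_ge[OF assms] .
 have Ph: "zorder Phi a = int dg * zorder g a - int wt - (if a = a0 then int t else 0)"
   "\<exists>\<^sub>F w in at a. Phi w ~= 0" using zorder_Phi assms by auto
 have pos: "zorder Phi a > 0"
 proof -
  have "int dg * int (k + m + 1) <= int dg * zorder g a" using ge by (intro mult_left_mono) auto
  moreover have "int dg * int (k + m + 1) = int k * int dg + int dg * int (m + 1)" by (simp add: algebra_simps)
  ultimately have 1: "int k * int dg + int dg * int (m + 1) <= int dg * zorder g a" by linarith
  have 2: "int wt <= int k * int dg" using degw(2) by (metis add_leD1 of_nat_le_iff of_nat_mult)
  have 3: "int (m + 1) <= int dg * int (m + 1)"
  proof -
   have "1 <= int dg" using degw(1) by simp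
   from mult_right_mono[OF this, of "int (m + 1)"] show ?thesis by simp
  qed
  have "int wt + int m + 1 <= int dg * zorder g a" using 1 2 3 by linarith
  thus ?thesis using Ph(1) tm by (cases "a = a0") auto
 qed
 have "zorder (%z. Phi z + -1) a = zorder (%_. -1 :: complex) a"
  using pos Ph(2) minus_one[of a] by (intro zorder_add2 Phi_mero) auto
 hence Psi_0: "zorder Psi a = 0" using minus_one[of a] by (simp add: Psi_Phi)
 have d: "deriv Psi = deriv Phi"
 proof
  fix z
  have "deriv (%z. Phi z - 1) z = deriv Phi z"
  proof (cases "Phi field_differentiable at z")
   case True
   thus ?thesis by simp
  next
   case False
   hence "~ (%z. Phi z - 1) field_differentiable at z"
    using field_differentiable_add[of "%z. Phi z - 1" "at z" "%_. 1"] by auto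
   thus ?thesis using False
    by (auto simp: deriv_def field_differentiable_def)
  qed
  thus "deriv Psi z = deriv Phi z" by (simp add: Psi_Phi)
 qed
 have "zorder (deriv Phi) a = zorder Phi a - 1"
  using Phi_mero[of "{a}"] Ph(2) pos by (intro zorder_deriv_minus_1) (auto simp: meromorphic_at_iff)
 hence "zorder (deriv Psi) a = zorder Phi a - 1" using d by simp
 moreover have "zorder K a = zorder (deriv Psi) a - zorder Psi a"
  unfolding K_def[abs_def] by (intro zorder_divide dPsim Psim dPsinz Psinz)
 ultimately show ?thesis using Psi_0 Ph by simp
qed

lemma zorder_K_ge: "-1 <= zorder K a" "a \<notin> dv Psi ==> 0 <= zorder K a"
 using zorder_logarithmic_derivative[OF Psim Psinz dPsinz, of a] zorder_not_dv[of a Psi]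
 by (auto simp: K_def[abs_def])

text \<open>
 The local counting on which everything rests. A zero of g of order p is a zero of K of order about dg * p - wt - 1, so it
 costs only wt + 1, however large p; a pole of g is a simple pole of K; other poles of K could only come
 from zeros of Psi, hence lie at a0.
\<close>

lemma pointwise_count:
 "int dg * max 0 (zorder g a) - zorder K a <=
   (if zorder g a > 0 then int wt + 1 else 0) + max 0 (- zorder g a) + (if a = a0 then int E else 0)"
proof (cases "zorder g a > 0")
 case True
 thus ?thesis using zorder_K_zero[OF True] by (auto simp: E_def)
next
 case False
 show ?thesis
 proof (cases "a = a0 | zorder g a < 0")
  case True
  thus ?thesis using False zorder_K_ge(1)[of a] by (auto simp: E_def max_def)
 next
  case False
  hence "a \<notin> dv Psi" using dv_Psi_sub by blast
  thus ?thesis using zorder_K_ge(2)[of a] False \<open>~ zorder g a > 0\<close> by auto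
 qed
qed

end

section \<open>The main inequality\<close>

context omitted_value
begin

definition p0 :: nat where "p0 = k + m + 1"

text \<open>
 What remains of the degree after paying wt + 1 for each zero, as zeros have order at least p0.
\<close>

definition kap :: real where "kap = real p0 * (real dg - 1) - real wt - 1"

lemma kap_ge: "real p0 + real m <= kap"
proof -
 have "real wt + 2 * real k <= real k * real dg"
  using degw(2) by (metis of_nat_add of_nat_le_iff of_nat_mult of_nat_numeral)
 moreover have "3 * (real m + 1) <= real dg * (real m + 1)"
  using degw(1) by (intro mult_right_mono) auto
 ultimately show ?thesis by (simp add: kap_def p0_def algebra_simps)
qed

lemma E_le: "E <= m" using tm m1 by (auto simp: E_def)

lemma sphere_facts:
 assumes "1 + cmod a0 <= r" "sphere 0 r Int dv g = {}" "z \<in> sphere 0 r"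
 shows "g z ~= 0" "g analytic_on {z}" "z ~= a0" "1 <= cmod (z - a0)" "z \<notin> dv Psi"
proof -
 have z: "z \<notin> dv g" using assms by auto
 thus "g z ~= 0" "g analytic_on {z}" by (auto simp: dv_def)
 show *: "1 <= cmod (z - a0)" using assms norm_triangle_ineq2[of z a0] by simp
 thus "z ~= a0" by auto
 thus "z \<notin> dv Psi" using z dv_Psi_sub' by auto
qed

lemma deriv_Psi_eq:
 assumes "M analytic_on {z}" "z ~= a0"
 shows "c * (z - a0) ^ t * deriv Psi z = deriv M z - of_nat t * M z / (z - a0)"
proof -
 have Md: "(M has_field_derivative deriv M z) (at z)"
  using assms(1) analytic_on_imp_differentiable_at DERIV_deriv_iff_field_differentiable by blast
 have nz: "c * (z - a0) ^ t ~= 0" using c assms(2) by simp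
 have Dd: "((%z. c * (z - a0) ^ t) has_field_derivative c * (of_nat t * (z - a0) ^ (t - 1))) (at z)"
  by (auto intro!: derivative_eq_intros)
 have tt: "of_nat t * (z - a0) ^ (t - 1) = of_nat t * ((z - a0) ^ t / (z - a0))"
  using assms(2) by (cases t) auto
 have "(Psi has_field_derivative (deriv M z * (c * (z - a0) ^ t) - M z * (c * (of_nat t * (z - a0) ^ (t - 1)))) /
   (c * (z - a0) ^ t * (c * (z - a0) ^ t)) - 0) (at z)"
  unfolding reduced_def[abs_def] by (intro DERIV_diff DERIV_divide Md Dd nz DERIV_const)
 hence "deriv Psi z = (deriv M z * (c * (z - a0) ^ t) - M z * (c * (of_nat t * (z - a0) ^ (t - 1)))) /
   (c * (z - a0) ^ t * (c * (z - a0) ^ t))" using DERIV_imp_deriv by auto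
 moreover define D where "D = c * (z - a0) ^ t"
 ultimately have "deriv Psi z = (deriv M z * D - M z * (of_nat t * D / (z - a0))) / (D * D)"
  unfolding tt by (simp add: mult_ac)
 moreover have "D * ((u * D - v * (s * D / w)) / (D * D)) = u - s * v / w" if "w ~= 0" for u v s w
  using nz that by (simp add: D_def[symmetric] field_simps)
 ultimately show ?thesis using assms(2) by (simp add: D_def)
qed

definition counting_set :: "real => complex set" where
 "counting_set r = (dv g \<union> dv K \<union> {a0}) Int ball 0 r"

lemma finite_counting_set: "finite (counting_set r)"
 by (rule finite_subset[of _ "dv g Int ball 0 r \<union> dv K Int ball 0 r \<union> {a0}"])
   (use dv_finite(2)[OF gm g0, of r] dv_finite(2)[OF Km K_dv, of r] in \<open>auto simp: counting_set_def\<close>)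

lemma continuous_max_ln: 
 assumes "sphere 0 r Int dv F = {}"
 shows "continuous_on (sphere 0 r) (%z. max 0 (ln (cmod (F z))))"
  "continuous_on (sphere 0 r) (%z. max 0 (- ln (cmod (F z))))"
  "continuous_on (sphere 0 r) (%z. \<bar>ln (cmod (F z))\<bar>)"
 using continuous_on_ln_cmod_dv[OF assms]
 by (intro continuous_on_max continuous_on_const continuous_on_minus continuous_on_rabs; assumption)+

lemma max_ln_split:
 assumes "sphere 0 r Int dv F = {}" "0 <= r"
 shows "cmean 0 r (%z. max 0 (- ln (cmod (F z)))) =
      cmean 0 r (%z. max 0 (ln (cmod (F z)))) - cmean 0 r (%z. ln (cmod (F z)))"
  and "cmean 0 r (%z. \<bar>ln (cmod (F z))\<bar>) =
      2 * cmean 0 r (%z. max 0 (ln (cmod (F z)))) - cmean 0 r (%z. ln (cmod (F z)))"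
proof -
 have 1: "(%z. max 0 (- ln (cmod (F z)))) = (%z. max 0 (ln (cmod (F z))) - ln (cmod (F z)))"
  by (auto simp: max_def)
 show "cmean 0 r (%z. max 0 (- ln (cmod (F z)))) =
      cmean 0 r (%z. max 0 (ln (cmod (F z)))) - cmean 0 r (%z. ln (cmod (F z)))"
  unfolding 1 by (rule cmean_diff[OF continuous_max_ln(1)[OF assms(1)] continuous_on_ln_cmod_dv[OF assms(1)] assms(2)])
 have 2: "(%z. \<bar>ln (cmod (F z))\<bar>) = (%z. 2 * max 0 (ln (cmod (F z))) - ln (cmod (F z)))"
  by (auto simp: max_def)
 show "cmean 0 r (%z. \<bar>ln (cmod (F z))\<bar>) =
      2 * cmean 0 r (%z. max 0 (ln (cmod (F z)))) - cmean 0 r (%z. ln (cmod (F z)))"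
  unfolding 2 using cmean_diff[OF continuous_on_mult[OF continuous_on_const[of _ 2] continuous_max_ln(1)[OF assms(1)]] continuous_on_ln_cmod_dv[OF assms(1)] assms(2)]
  by (simp add: cmean_cmult)
qed

lemma sum_neutral_dv:
 assumes F: "F meromorphic_on UNIV" "0 \<notin> dv F" and X: "finite X" "dv F Int ball 0 r \<subseteq> X" and r: "0 < r"
 shows "(\<Sum>a\<in>dv F Int ball 0 r. \<bar>real_of_int (zorder F a)\<bar> * lam r a) = (\<Sum>a\<in>X. \<bar>real_of_int (zorder F a)\<bar> * lam r a)"
proof (rule sum.mono_neutral_left)
 show "\<forall>a\<in>X - dv F Int ball 0 r. \<bar>real_of_int (zorder F a)\<bar> * lam r a = 0"
 proof
  fix a assume a: "a \<in> X - dv F Int ball 0 r"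
  show "\<bar>real_of_int (zorder F a)\<bar> * lam r a = 0"
   using a r by (cases "a \<in> dv F") (auto simp: zorder_not_dv lam_eq_0)
 qed
qed (use X in auto)

text \<open>
 From 1 = M / D - Psi with D = c * (z - a0)^t one gets \<open>1 / |g|^dg \<le> const * W / |K|\<close> on the circle, hence a bound for the
 proximity of g to 0 in terms of that of K. Jensen's formula for K exchanges the latter for zeros and poles of
 K, and \<open>pointwise_count\<close> and Jensen's formula for g finish.
\<close>

theorem main_inequality:
 "\<exists>C. \<forall>r W. 1 + cmod a0 <= r --> sphere 0 r Int dv g = {} --> sphere 0 r Int dv K = {} --> 1 <= W \<longrightarrow>
   (\<forall>z\<in>sphere 0 r. cmod (M z) <= W * cmod (g z) ^ dg &
    cmod (c * (z - a0) ^ t * deriv Psi z) <= W * cmod (g z) ^ dg & cmod (K z) <= W) \<longrightarrow>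
   kap * chi g r <= 2 * real p0 * real E * ln r + C * (1 + ln W)"
proof -
 define lg where "lg = ln (cmod (g 0))"
 define C0 where "C0 = ln 2 + \<bar>ln (cmod c)\<bar> + \<bar>ln (cmod (K 0))\<bar> + 2"
 define C where "C = 2 * real p0 * C0 + 2 * real p0 * \<bar>lg\<bar> + 2 * real p0 * real E * \<bar>ln (cmod a0)\<bar> + \<bar>kap * lg\<bar>"
 have C0: "2 <= C0" by (simp add: C0_def)
 show ?thesis
 proof (intro exI[of _ C] allI impI)
  fix r W :: real
  assume r: "1 + cmod a0 <= r" and sg: "sphere 0 r Int dv g = {}" and sK: "sphere 0 r Int dv K = {}" and W: "1 <= W"
   and bd: "\<forall>z\<in>sphere 0 r. cmod (M z) <= W * cmod (g z) ^ dg &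
    cmod (c * (z - a0) ^ t * deriv Psi z) <= W * cmod (g z) ^ dg & cmod (K z) <= W"
  have r0: "0 < r" "0 <= r" "1 <= r" using r norm_ge_zero[of a0] by linarith+
  have lnW: "0 <= ln W" using W by simp
  define X where "X = counting_set r"
  have "finite X" unfolding X_def by (rule finite_counting_set)
  moreover have "dv g Int ball 0 r \<subseteq> X" "dv K Int ball 0 r \<subseteq> X" "a0 \<in> X"
   using r by (auto simp: X_def counting_set_def)
  ultimately have X: "finite X" "dv g Int ball 0 r \<subseteq> X" "dv K Int ball 0 r \<subseteq> X" "a0 \<in> X" by blast+
  define mq where "mq = cmean 0 r (%z. max 0 (- ln (cmod (g z))))"
  define mp where "mp = cmean 0 r (%z. max 0 (ln (cmod (g z))))"
  define Nz where "Nz = (\<Sum>a\<in>X. real_of_int (max 0 (zorder g a)) * lam r a)"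
  define Np where "Np = (\<Sum>a\<in>X. real_of_int (max 0 (- zorder g a)) * lam r a)"
  have nonneg: "0 <= mq" "0 <= mp" "0 <= Nz" "0 <= Np"
   unfolding mq_def mp_def Nz_def Np_def using continuous_max_ln[OF sg] r0
   by (auto intro!: cmean_nonneg sum_nonneg mult_nonneg_nonneg)
  have pw: "real dg * max 0 (- ln (cmod (g z))) <= ln W + ln 2 + \<bar>ln (cmod c)\<bar> + max 0 (- ln (cmod (K z)))"
   if z: "z \<in> sphere 0 r" for z
  proof -
   note f = sphere_facts[OF r sg z]
   define D where "D = c * (z - a0) ^ t"
   have D: "cmod c <= cmod D" "D ~= 0" using f(3,4) c by (auto simp: D_def norm_mult norm_power mult_le_cancel_left1)
   have Knz: "K z ~= 0" using sK z by (auto simp: dv_def)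
   have Psinz': "Psi z ~= 0" using f(5) by (auto simp: dv_def)
   have "M z = D * (Psi z + 1)" using D by (simp add: reduced_def D_def)
   moreover have "D * Psi z = D * deriv Psi z / K z" using Knz Psinz' by (simp add: K_def)
   ultimately have "D = M z - D * deriv Psi z / K z" by (simp add: algebra_simps)
   hence "cmod D <= cmod (M z) + cmod (D * deriv Psi z / K z)" by (metis norm_triangle_ineq4)
   also have "... <= W * cmod (g z) ^ dg + W * cmod (g z) ^ dg / cmod (K z)"
    using bd z by (auto simp: norm_divide D_def intro!: add_mono divide_right_mono)
   also have "... = W * cmod (g z) ^ dg * (1 + 1 / cmod (K z))" by (simp add: algebra_simps)
   also have "... <= W * cmod (g z) ^ dg * (2 * exp (max 0 (- ln (cmod (K z)))))"
   proof (intro mult_left_mono)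
    have "1 / cmod (K z) = exp (- ln (cmod (K z)))" using Knz by (simp add: exp_minus divide_inverse)
    also have "... <= exp (max 0 (- ln (cmod (K z))))" by simp
    finally have "1 / cmod (K z) <= exp (max 0 (- ln (cmod (K z))))" .
    moreover have "1 <= exp (max 0 (- ln (cmod (K z))))" by simp
    ultimately show "1 + 1 / cmod (K z) <= 2 * exp (max 0 (- ln (cmod (K z))))" by linarith
   qed (use W in auto)
   finally have "ln (cmod D) <= ln (W * cmod (g z) ^ dg * (2 * exp (max 0 (- ln (cmod (K z))))))"
    using D W f(1) by (subst ln_le_cancel_iff) auto
   also have "... = ln W + real dg * ln (cmod (g z)) + ln 2 + max 0 (- ln (cmod (K z)))"
    using W f(1) by (simp add: ln_mult ln_realpow)
   finally have 1: "ln (cmod D) <= ln W + real dg * ln (cmod (g z)) + ln 2 + max 0 (- ln (cmod (K z)))" .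
   have 2: "ln (cmod c) <= ln (cmod D)" using D c by (subst ln_le_cancel_iff) auto
   have 3: "- (real dg * ln (cmod (g z))) <= ln W + ln 2 + \<bar>ln (cmod c)\<bar> + max 0 (- ln (cmod (K z)))"
    using 1 2 by linarith
   have 4: "0 <= ln W + ln 2 + \<bar>ln (cmod c)\<bar> + max 0 (- ln (cmod (K z)))"
    using lnW by (intro add_nonneg_nonneg) auto
   show ?thesis
   proof (cases "ln (cmod (g z)) <= 0")
    case True
    thus ?thesis using 3 by (simp add: max_def)
   next
    case False
    thus ?thesis using 4 by (simp add: max_def)
   qed
  qed
  have cK: "continuous_on (sphere 0 r) (%z. max 0 (- ln (cmod (K z))))" using continuous_max_ln(2)[OF sK] .
  have "real dg * mq = cmean 0 r (%z. real dg * max 0 (- ln (cmod (g z))))"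
   by (simp add: mq_def cmean_cmult)
  also have "... <= cmean 0 r (%z. (ln W + ln 2 + \<bar>ln (cmod c)\<bar>) + max 0 (- ln (cmod (K z))))"
   using pw r0 by (intro cmean_mono continuous_on_mult continuous_on_add continuous_on_const cK continuous_max_ln(2)[OF sg]) auto
  also have "... = (ln W + ln 2 + \<bar>ln (cmod c)\<bar>) + cmean 0 r (%z. max 0 (- ln (cmod (K z))))"
   using cmean_add[OF continuous_on_const cK r0(2)] by simp
  also have "cmean 0 r (%z. max 0 (- ln (cmod (K z)))) =
    cmean 0 r (%z. max 0 (ln (cmod (K z)))) - cmean 0 r (%z. ln (cmod (K z)))"
   using max_ln_split(1)[OF sK r0(2)] .
  also have "cmean 0 r (%z. ln (cmod (K z))) = ln (cmod (K 0)) + (\<Sum>a\<in>X. real_of_int (zorder K a) * lam r a)"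
   by (rule jensen_formula[OF Km K_dv r0(1) sK X(1,3)])
  also have "cmean 0 r (%z. max 0 (ln (cmod (K z)))) <= ln W"
  proof (rule cmean_le_const)
   fix z :: complex assume z: "z \<in> sphere 0 r"
   hence "K z ~= 0" using sK by (auto simp: dv_def)
   hence "ln (cmod (K z)) <= ln W" using bd z W by (subst ln_le_cancel_iff) auto
   thus "max 0 (ln (cmod (K z))) <= ln W" using lnW by simp
  qed (use continuous_max_ln(1)[OF sK] r0 in auto)
  finally have a: "real dg * mq <= ln W + ln 2 + \<bar>ln (cmod c)\<bar> +
    (ln W - (ln (cmod (K 0)) + (\<Sum>a\<in>X. real_of_int (zorder K a) * lam r a)))" by simp
  have 1: "real dg * mq + (\<Sum>a\<in>X. real_of_int (zorder K a) * lam r a) <= C0 * (1 + ln W)"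
  proof -
   have "C0 <= C0 * (1 + ln W) - 2 * ln W"
    using mult_right_mono[OF C0 lnW] by (simp add: algebra_simps)
   thus ?thesis using a by (simp add: C0_def)
  qed
  have cnt: "real dg * Nz - (\<Sum>a\<in>X. real_of_int (zorder K a) * lam r a) <=
        (real wt + 1) / real p0 * Nz + Np + real E * lam r a0"
  proof -
   have "real dg * Nz - (\<Sum>a\<in>X. real_of_int (zorder K a) * lam r a) =
      (\<Sum>a\<in>X. real_of_int (int dg * max 0 (zorder g a) - zorder K a) * lam r a)"
    by (simp add: Nz_def sum_distrib_left algebra_simps sum_subtractf del: of_int_max)
   also have "... <= (\<Sum>a\<in>X. ((real wt + 1) / real p0 * real_of_int (max 0 (zorder g a)) +
      real_of_int (max 0 (- zorder g a)) + (if a = a0 then real E else 0)) * lam r a)"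
   proof (intro sum_mono mult_right_mono)
    fix a
    have "real_of_int (if zorder g a > 0 then int wt + 1 else 0) <= (real wt + 1) / real p0 * real_of_int (max 0 (zorder g a))"
    proof (cases "zorder g a > 0")
     case True
     hence "real p0 <= real_of_int (zorder g a)" using zorder_pos_ge[OF True] unfolding p0_def
      by (metis of_int_le_iff of_int_of_nat_eq)
     hence "(real wt + 1) / real p0 * real p0 <= (real wt + 1) / real p0 * real_of_int (zorder g a)"
      by (intro mult_left_mono) auto
     moreover have "0 < real p0" by (simp add: p0_def)
     ultimately have "real wt + 1 <= (real wt + 1) / real p0 * real_of_int (zorder g a)"
      by simp
     thus ?thesis using True by simp
    qed simp
    moreover have "real_of_int (int dg * max 0 (zorder g a) - zorder K a) <=
      real_of_int ((if zorder g a > 0 then int wt + 1 else 0) + max 0 (- zorder g a) + (if a = a0 then int E else 0))"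
     using pointwise_count[of a] by (simp only: of_int_le_iff)
    ultimately show "real_of_int (int dg * max 0 (zorder g a) - zorder K a) <=
      (real wt + 1) / real p0 * real_of_int (max 0 (zorder g a)) +
      real_of_int (max 0 (- zorder g a)) + (if a = a0 then real E else 0)"
     by (auto simp del: of_int_max)
   qed simp
   also have "... = (real wt + 1) / real p0 * Nz + Np + (\<Sum>a\<in>X. (if a = a0 then real E else 0) * lam r a)"
    by (simp only: Nz_def Np_def sum_distrib_left distrib_right sum.distrib mult.assoc)
   also have "(\<Sum>a\<in>X. (if a = a0 then real E else 0) * lam r a) = real E * lam r a0"
    using X(1,4) by (simp add: if_distrib[of "%x. x * _"] sum.delta cong: if_cong)
   finally show ?thesis .
  qed
  have J: "mp - mq = lg + Nz - Np"
  proof -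
   have "cmean 0 r (%z. ln (cmod (g z))) = lg + (\<Sum>a\<in>X. real_of_int (zorder g a) * lam r a)"
    unfolding lg_def by (rule jensen_formula[OF gm g0 r0(1) sg X(1,2)])
   moreover have "(\<Sum>a\<in>X. real_of_int (zorder g a) * lam r a) = Nz - Np"
    unfolding Nz_def Np_def sum_subtractf[symmetric] left_diff_distrib[symmetric] of_int_diff[symmetric]
    by (intro sum.cong) (auto simp: max_def)
   moreover have "mq = mp - cmean 0 r (%z. ln (cmod (g z)))"
    using max_ln_split(1)[OF sg r0(2)] by (simp add: mq_def mp_def)
   ultimately show ?thesis by simp
  qed
  define T where "T = mq + Nz"
  have T: "0 <= T" using nonneg by (simp add: T_def)
  have chi: "chi g r = 2 * T + lg"
  proof -
   have "cmean 0 r (%z. \<bar>ln (cmod (g z))\<bar>) = mp + mq"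
    using max_ln_split[OF sg r0(2)] by (simp add: mp_def mq_def)
   moreover have "(\<Sum>a\<in>dv g Int ball 0 r. \<bar>real_of_int (zorder g a)\<bar> * lam r a) = Nz + Np"
    unfolding sum_neutral_dv[OF gm g0 X(1,2) r0(1)] Nz_def Np_def sum.distrib[symmetric]
     distrib_right[symmetric] of_int_add[symmetric]
    by (intro sum.cong) (auto simp: max_def abs_if)
   ultimately show ?thesis using J by (simp add: chi_def T_def)
  qed
  have Np: "Np <= lg + T" using J nonneg by (simp add: T_def)
  have p0pos: "0 < real p0" by (simp add: p0_def)
  have "real dg * T <= C0 * (1 + ln W) + (real wt + 1) / real p0 * T + (lg + T) + real E * lam r a0"
  proof -
   have "(real wt + 1) / real p0 * Nz <= (real wt + 1) / real p0 * T"
    using nonneg by (intro mult_left_mono) (auto simp: T_def)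
   thus ?thesis using 1 cnt Np by (simp add: T_def distrib_left)
  qed
  hence "real p0 * (real dg * T) <= real p0 * (C0 * (1 + ln W) + (real wt + 1) / real p0 * T + (lg + T) + real E * lam r a0)"
   by (intro mult_left_mono) auto
  also have "... = real p0 * C0 * (1 + ln W) + (real wt + 1) * T + real p0 * lg + real p0 * T + real p0 * real E * lam r a0"
   using p0pos by (simp add: distrib_left)
  finally have 2: "kap * T <= real p0 * C0 * (1 + ln W) + real p0 * lg + real p0 * real E * lam r a0"
   by (simp add: kap_def algebra_simps)
  have lam0: "real p0 * real E * lam r a0 <= real p0 * real E * (ln r + \<bar>ln (cmod a0)\<bar>)"
  proof (rule mult_left_mono)
   have "cmod a0 < r" using r by simp
   thus "lam r a0 <= ln r + \<bar>ln (cmod a0)\<bar>" using a0 by (simp add: lam_eq)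
  qed simp
  have "kap * chi g r = 2 * (kap * T) + kap * lg" by (simp add: chi algebra_simps)
  also have "... <= 2 * (real p0 * C0 * (1 + ln W) + real p0 * \<bar>lg\<bar> + real p0 * real E * (ln r + \<bar>ln (cmod a0)\<bar>)) + \<bar>kap * lg\<bar>"
  proof -
   have "real p0 * lg <= real p0 * \<bar>lg\<bar>" by (intro mult_left_mono) auto
   thus ?thesis using 2 lam0 by (smt (verit) abs_ge_self)
  qed
  also have "... = 2 * real p0 * real E * ln r + 2 * real p0 * C0 * (1 + ln W) +
    (2 * real p0 * \<bar>lg\<bar> + 2 * real p0 * real E * \<bar>ln (cmod a0)\<bar> + \<bar>kap * lg\<bar>)"
   by (simp add: algebra_simps)
  also have "... <= 2 * real p0 * real E * ln r + 2 * real p0 * C0 * (1 + ln W) +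
    (2 * real p0 * \<bar>lg\<bar> + 2 * real p0 * real E * \<bar>ln (cmod a0)\<bar> + \<bar>kap * lg\<bar>) * (1 + ln W)"
  proof -
   have "0 <= 2 * real p0 * \<bar>lg\<bar> + 2 * real p0 * real E * \<bar>ln (cmod a0)\<bar> + \<bar>kap * lg\<bar>" by simp
   from mult_left_mono[OF _ this, of 1 "1 + ln W"] lnW show ?thesis by simp
  qed
  also have "... = 2 * real p0 * real E * ln r + C * (1 + ln W)" by (simp add: C_def algebra_simps)
  finally show "kap * chi g r <= 2 * real p0 * real E * ln r + C * (1 + ln W)" .
 qed
qed

lemma chi_lower_bound:
 assumes b: "b \<in> dv g" and r: "0 < r" "cmod b < r" "sphere 0 r Int dv g = {}"
 shows "2 * \<bar>real_of_int (zorder g b)\<bar> * (ln r - ln (cmod b)) - \<bar>ln (cmod (g 0))\<bar> <= chi g r"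
proof -
 define X where "X = dv g Int ball 0 r"
 have X: "finite X" "b \<in> X" using dv_finite(2)[OF gm g0, of r] b r by (auto simp: X_def)
 have b0: "b ~= 0" using b g0 by auto
 define N where "N = (\<Sum>a\<in>X. real_of_int (zorder g a) * lam r a)"
 have J: "cmean 0 r (%z. ln (cmod (g z))) = ln (cmod (g 0)) + N"
  unfolding N_def using jensen_formula[OF gm g0 r(1,3) X(1)] by (simp add: X_def)
 have c: "continuous_on (sphere 0 r) (%z. ln (cmod (g z)))" using continuous_on_ln_cmod_dv[OF r(3)] .
 have m: "\<bar>cmean 0 r (%z. ln (cmod (g z)))\<bar> <= cmean 0 r (%z. \<bar>ln (cmod (g z))\<bar>)"
  using norm_cmean_le[OF c continuous_on_rabs[OF c]] r by simp
 have s: "\<bar>real_of_int (zorder g b)\<bar> * lam r b <= (\<Sum>a\<in>X. real_of_int (max 0 (s * zorder g a)) * lam r a)"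
  if "s * zorder g b = \<bar>zorder g b\<bar>" for s
  using member_le_sum[of b X "%a. real_of_int (max 0 (s * zorder g a)) * lam r a"] X that by simp
 define P where "P = (\<Sum>a\<in>X. real_of_int (max 0 (1 * zorder g a)) * lam r a)"
 define Q where "Q = (\<Sum>a\<in>X. real_of_int (max 0 ((-1) * zorder g a)) * lam r a)"
 have N: "N = P - Q"
  unfolding N_def P_def Q_def sum_subtractf[symmetric] left_diff_distrib[symmetric] of_int_diff[symmetric]
  by (intro sum.cong) (auto simp: max_def)
 have A: "(\<Sum>a\<in>X. \<bar>real_of_int (zorder g a)\<bar> * lam r a) = P + Q"
  unfolding P_def Q_def sum.distrib[symmetric] distrib_right[symmetric] of_int_add[symmetric]
  by (intro sum.cong) (auto simp: max_def abs_if)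
 have "\<bar>real_of_int (zorder g b)\<bar> * lam r b <= P | \<bar>real_of_int (zorder g b)\<bar> * lam r b <= Q"
  using s[of 1] s[of "-1"] unfolding P_def Q_def by (cases "0 <= zorder g b") (simp_all del: of_int_max)
 hence "2 * (\<bar>real_of_int (zorder g b)\<bar> * lam r b) <= P + Q + \<bar>N\<bar>" using N by linarith
 moreover have "chi g r = cmean 0 r (%z. \<bar>ln (cmod (g z))\<bar>) + (P + Q)" using A by (simp add: chi_def X_def)
 ultimately have "2 * (\<bar>real_of_int (zorder g b)\<bar> * lam r b) - \<bar>ln (cmod (g 0))\<bar> <= chi g r" using J m by linarith
 thus ?thesis using lam_eq[OF b0 r(2)] by (simp add: mult.assoc)
qed

end

section \<open>Estimates on well-placed circles\<close>

lemma nn_mono: 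
 assumes "F meromorphic_on UNIV" "0 \<notin> dv F" "r <= R"
 shows "nn F r <= nn F R"
 unfolding nn_def using dv_finite[OF assms(1,2)] assms(3) by (intro sum_mono2) auto

text \<open>
 Circles at comparable scales with controlled characteristic; V dominates every quantity, so that all later bounds are powers of V.
\<close>

locale omitted_value_scale = omitted_value +
 fixes \<rho> \<eta> X V R2 R3 :: real
 assumes rho: "1 <= \<rho>" "1 + cmod a0 <= \<rho>" and eta: "0 < \<eta>" "\<eta> <= 1"
  and R2: "16 * \<rho> <= R2" "R2 <= 32 * \<rho>" "sphere 0 R2 Int dv g = {}" "chi g R2 <= X"
  and R3: "64 * \<rho> <= R3" "sphere 0 R3 Int dv g = {}" "chi g R3 <= X"
  and V: "1 <= V" "X <= V" "1 / \<eta> <= V" "ln (128 * \<rho>) <= V"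
begin

lemma nn_R2: "nn g R2 <= 2 * V"
proof -
 have "2 * R2 <= R3" using R2 R3 by simp
 hence "ln 2 <= ln (R3 / R2)" using R2 R3 rho by (subst ln_le_cancel_iff) (auto simp: field_simps)
 moreover have "1 / 2 <= ln (2::real)" using ln2_ge_two_thirds by linarith
 ultimately have "nn g R2 * (1 / 2) <= nn g R2 * ln (R3 / R2)" by (intro mult_left_mono nn_nonneg) auto
 also have "... <= chi g R3" using R2 R3 rho by (intro nn_le_chi[OF gm g0]) auto
 finally show ?thesis using R3(3) V(2) by simp
qed

lemma V2: "V <= V^2" "1 <= V^2"
 using V(1) by (simp_all add: self_le_power one_le_power)

lemma log_derivative_bound:
 assumes z: "cmod z <= 9 * \<rho>" "!!a. a \<in> dv g ==> \<eta> / 2 <= cmod (z - a)"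
 shows "cmod (deriv g z / g z) <= 14 * V^2"
proof -
 have "cmod (deriv g z / g z) <= nn g R2 / (\<eta> / 2) + 2 * R2 / (R2 - 9 * \<rho>)^2 * (chi g R2 + 2 * nn g R2 * ln (2 * R2))"
  using R2 rho eta z by (intro logarithmic_derivative_bound[OF gm g0]) auto
 also have "nn g R2 / (\<eta> / 2) <= 4 * V^2"
 proof -
  have "nn g R2 / (\<eta> / 2) = 2 * (nn g R2 * (1 / \<eta>))" by simp
  also have "... <= 2 * (2 * V * V)" using nn_R2 V eta nn_nonneg by (intro mult_left_mono mult_mono) auto
  finally show ?thesis by (simp add: power2_eq_square)
 qed
 also have "2 * R2 / (R2 - 9 * \<rho>)^2 * (chi g R2 + 2 * nn g R2 * ln (2 * R2)) <= 2 * (V + 2 * (2 * V) * V)"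
 proof (rule mult_mono)
  have "(7 * \<rho>)^2 <= (R2 - 9 * \<rho>)^2" using R2 rho by (intro power_mono) auto
  hence "2 * R2 / (R2 - 9 * \<rho>)^2 <= 2 * (32 * \<rho>) / (7 * \<rho>)^2"
   using R2 rho by (intro frac_le) auto
  also have "... <= 2" using rho by (simp add: power2_eq_square field_simps)
  finally show "2 * R2 / (R2 - 9 * \<rho>)^2 <= 2" .
  have l: "ln (2 * R2) <= V" "0 <= ln (2 * R2)"
  proof -
   have "ln (2 * R2) <= ln (128 * \<rho>)" using R2 rho by (subst ln_le_cancel_iff) auto
   thus "ln (2 * R2) <= V" using V by simp
  qed (use R2 rho in simp)
  have "2 * nn g R2 * ln (2 * R2) <= 2 * (2 * V) * V"
   using nn_R2 l nn_nonneg[of g R2] V by (intro mult_mono mult_left_mono) auto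
  thus "chi g R2 + 2 * nn g R2 * ln (2 * R2) <= V + 2 * (2 * V) * V"
   using R2(4) V(2) by simp
  have "0 <= chi g R2"
   unfolding chi_def using continuous_max_ln(3)[OF R2(3)] R2 rho
   by (intro add_nonneg_nonneg cmean_nonneg sum_nonneg) auto
  thus "0 <= chi g R2 + 2 * nn g R2 * ln (2 * R2)" using l nn_nonneg[of g R2] by simp
 qed simp
 also have "4 * V^2 + 2 * (V + 2 * (2 * V) * V) <= 14 * V^2" using V2 by (simp add: power2_eq_square)
 finally show ?thesis by simp
qed

end

context omitted_value
begin

definition wc :: real where "wc = 4 * weight_const k n * 16 ^ (wt + 1)"

definition q0 :: nat where "q0 = 2 * (wt + 1)"

definition A1 :: real where "A1 = 2 * (1 + (1 + wc / cmod c) + real dg) + \<bar>ln (cmod (Psi 0))\<bar> + 2 * (real (dg + wt) + real t * (1 + \<bar>ln (cmod a0)\<bar>))"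

definition N1 :: real where "N1 = 2 * real (dg + wt) + \<bar>real_of_int (zorder Psi a0)\<bar>"

definition W1 :: real where "W1 = 1 + (1 + real t) * wc + 9 * N1 + 4 * A1"

lemma wc_pos: "0 < wc" using weight_const_pos[of k n] by (simp add: wc_def)

end

context omitted_value_scale
begin

lemma V_pow: "V ^ i <= V ^ q0" if "i <= q0"
 using V(1) that by (intro power_increasing) auto

lemma monomial_bound:
 assumes z: "cmod z <= 8 * \<rho>" "!!a. a \<in> dv g ==> \<eta> <= \<bar>cmod a - cmod z\<bar>"
 shows "cmod (M z) <= wc * V ^ q0 * cmod (g z) ^ dg" "cmod (deriv M z) <= wc * V ^ q0 * cmod (g z) ^ dg"
proof -
 have sep: "\<eta> / 2 <= cmod (w - a)" if "w \<in> ball z (\<eta>/2)" "a \<in> dv g" for w a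
 proof -
  have "\<eta> <= cmod (z - a)" using z(2)[OF that(2)] norm_triangle_ineq3[of a z] by (simp add: norm_minus_commute)
  moreover have "cmod (z - a) <= cmod (z - w) + cmod (w - a)" using norm_triangle_ineq[of "z - w" "w - a"] by simp
  ultimately show ?thesis using that(1) by (simp add: dist_norm)
 qed
 have notdv: "w \<notin> dv g" if "w \<in> ball z (\<eta>/2)" for w using sep[OF that, of w] eta by auto
 have hol: "g holomorphic_on ball z (\<eta>/2)"
  using notdv by (intro analytic_imp_holomorphic) (auto simp: analytic_on_analytic_at[of g "ball z (\<eta>/2)"] dv_def)
 have nz: "g w ~= 0" if "w \<in> ball z (\<eta>/2)" for w using notdv[OF that] by (auto simp: dv_def)
 have B: "cmod (deriv g w / g w) <= 14 * V^2" if w: "w \<in> ball z (\<eta>/2)" for w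
 proof (rule log_derivative_bound)
  have "cmod w <= cmod z + \<eta> / 2" using w norm_triangle_sub[of w z] by (simp add: dist_norm norm_minus_commute)
  thus "cmod w <= 9 * \<rho>" using z(1) eta rho by linarith
 qed (use sep w in auto)
 define Y where "Y = 14 * V^2 + 1 / (\<eta> / 2)"
 have Y: "1 <= Y" "Y <= 16 * V^2"
 proof -
  have "0 < 1 / (\<eta> / 2)" using eta by simp
  thus "1 <= Y" using V2(2) unfolding Y_def by linarith
  have e: "1 / (\<eta> / 2) = 2 * (1 / \<eta>)" by simp
  show "Y <= 16 * V^2" using V(3) V2(1) unfolding Y_def e by linarith
 qed
 have eta2: "0 < \<eta> / 2" using eta by simp
 have B0: "0 <= 14 * V^2" by simp
 note bd = diff_monomial_bound[OF hol nz B eta2 B0 Y_def, of k n, folded dg_def wt_def]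
 have Yp: "Y ^ (wt + 1) <= 16 ^ (wt + 1) * V ^ q0"
 proof -
  have "Y ^ (wt + 1) <= (16 * V^2) ^ (wt + 1)" using Y by (intro power_mono) auto
  thus ?thesis by (simp only: power_mult_distrib q0_def power_mult)
 qed
 have wpos: "0 < weight_const k n" by (rule weight_const_pos)
 have "Y ^ wt <= 4 * Y ^ (wt + 1)"
 proof -
  have "Y ^ wt <= Y ^ (wt + 1)" using Y(1) by (intro power_increasing) auto
  moreover have "0 <= Y ^ (wt + 1)" using Y by simp
  ultimately show ?thesis by linarith
 qed
 hence 1: "weight_const k n * Y ^ wt <= wc * V ^ q0"
 proof -
  assume "Y ^ wt <= 4 * Y ^ (wt + 1)"
  hence "Y ^ wt <= 4 * (16 ^ (wt + 1) * V ^ q0)" using Yp by linarith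
  hence "weight_const k n * Y ^ wt <= weight_const k n * (4 * (16 ^ (wt + 1) * V ^ q0))" using wpos by (intro mult_left_mono) auto
  thus ?thesis by (simp only: wc_def mult_ac)
 qed
 have 2: "4 * weight_const k n * Y ^ (wt + 1) <= wc * V ^ q0"
 proof -
  have "4 * weight_const k n * Y ^ (wt + 1) <= 4 * weight_const k n * (16 ^ (wt + 1) * V ^ q0)"
   using Yp wpos by (intro mult_left_mono) auto
  thus ?thesis by (simp only: wc_def mult_ac)
 qed
 show "cmod (M z) <= wc * V ^ q0 * cmod (g z) ^ dg"
  using bd(1) mult_right_mono[OF 1, of "cmod (g z) ^ dg"] by simp
 show "cmod (deriv M z) <= wc * V ^ q0 * cmod (g z) ^ dg"
  using bd(2) mult_right_mono[OF 2, of "cmod (g z) ^ dg"] by simp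
qed

lemma reduced_derivative_bound:
 assumes z: "\<rho> <= cmod z" "cmod z <= 8 * \<rho>" "!!a. a \<in> dv g ==> \<eta> <= \<bar>cmod a - cmod z\<bar>"
 shows "cmod (c * (z - a0) ^ t * deriv Psi z) <= (1 + real t) * wc * V ^ q0 * cmod (g z) ^ dg"
proof -
 have sph: "sphere 0 (cmod z) Int dv g = {}" using z(3) eta by fastforce
 note f = sphere_facts[OF _ sph, of z]
 have z0: "1 + cmod a0 <= cmod z" using z rho by linarith
 have a: "M analytic_on {z}" using f(2) z0 by (intro diff_monomial_analytic) auto
 have d1: "1 <= cmod (z - a0)" "z ~= a0" using f(3,4) z0 by auto
 have "cmod (c * (z - a0) ^ t * deriv Psi z) = cmod (deriv M z - of_nat t * M z / (z - a0))"
  using deriv_Psi_eq[OF a d1(2)] by simp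
 also have "... <= cmod (deriv M z) + real t * cmod (M z) / cmod (z - a0)"
  using norm_triangle_ineq4[of "deriv M z" "of_nat t * M z / (z - a0)"] by (simp add: norm_mult norm_divide)
 also have "real t * cmod (M z) / cmod (z - a0) <= real t * cmod (M z) / 1"
  using d1 by (intro divide_left_mono) auto
 also have "cmod (deriv M z) + real t * cmod (M z) / 1 <=
   wc * V ^ q0 * cmod (g z) ^ dg + real t * (wc * V ^ q0 * cmod (g z) ^ dg)"
  using monomial_bound[OF z(2,3)] by (simp add: add_mono mult_left_mono)
 finally show ?thesis by (simp add: algebra_simps)
qed

lemma Psi_bounds:
 assumes R1: "4 * \<rho> <= R1" "R1 <= 8 * \<rho>" "!!a. a \<in> dv g ==> \<eta> <= \<bar>cmod a - R1\<bar>" "chi g R1 <= X"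
 shows "nn Psi R1 <= N1 * V" "chi Psi R1 <= A1 * V ^ q0" "sphere 0 R1 Int dv Psi = {}"
proof -
 have R1pos: "0 < R1" "0 <= R1" "1 <= R1" "1 + cmod a0 <= R1" using R1 rho by auto
 have sg: "sphere 0 R1 Int dv g = {}" using R1(3) eta by fastforce
 note f = sphere_facts[OF R1pos(4) sg]
 show sP: "sphere 0 R1 Int dv Psi = {}" using f(5) by blast
 define S where "S = dv Psi Int ball 0 R1"
 define G where "G = dv g Int ball 0 R1"
 have fin: "finite S" "finite G" unfolding S_def G_def using dv_finite[OF Psim Psi0] dv_finite[OF gm g0] by auto
 have SG: "S \<subseteq> insert a0 G" using dv_Psi_sub' R1pos by (auto simp: S_def G_def)
 have neg: "max 0 (- real_of_int (zorder Psi a)) <=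
   real (dg + wt) * \<bar>real_of_int (zorder g a)\<bar> + (if a = a0 then real t else 0)" for a
 proof -
  have "- real_of_int (zorder Psi a) <= real_of_int (int (dg + wt) * max 0 (- zorder g a) + (if a = a0 then int t else 0))"
   using zorder_Psi_ge[of a] by (metis of_int_le_iff of_int_minus)
  also have "... = real (dg + wt) * real_of_int (max 0 (- zorder g a)) + (if a = a0 then real t else 0)"
   by (auto simp del: of_int_max)
  also have "real (dg + wt) * real_of_int (max 0 (- zorder g a)) <= real (dg + wt) * \<bar>real_of_int (zorder g a)\<bar>"
   by (intro mult_left_mono) auto
  finally have "- real_of_int (zorder Psi a) <= real (dg + wt) * \<bar>real_of_int (zorder g a)\<bar> + (if a = a0 then real t else 0)"
   by simp
  moreover have "0 <= real (dg + wt) * \<bar>real_of_int (zorder g a)\<bar> + (if a = a0 then real t else 0)" by simp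
  ultimately show ?thesis by simp
 qed
 show "nn Psi R1 <= N1 * V"
 proof -
  have "nn Psi R1 = (\<Sum>a\<in>S. \<bar>real_of_int (zorder Psi a)\<bar>)" by (simp add: nn_def S_def)
  also have "... <= (\<Sum>a\<in>insert a0 G. \<bar>real_of_int (zorder Psi a)\<bar>)"
   using fin SG by (intro sum_mono2) auto
  also have "... <= \<bar>real_of_int (zorder Psi a0)\<bar> + (\<Sum>a\<in>G - {a0}. \<bar>real_of_int (zorder Psi a)\<bar>)"
   using fin by (simp add: sum.insert_remove)
  also have "(\<Sum>a\<in>G - {a0}. \<bar>real_of_int (zorder Psi a)\<bar>) <= (\<Sum>a\<in>G - {a0}. real (dg + wt) * \<bar>real_of_int (zorder g a)\<bar>)"
  proof (rule sum_mono)
   fix a assume a: "a \<in> G - {a0}"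
   have "zorder Psi a <= 0"
   proof (cases "a \<in> dv Psi")
    case True
    hence "zorder g a < 0" using dv_Psi_sub[of a] a by auto
    moreover have "int dg * zorder g a <= 0" using \<open>zorder g a < 0\<close> by (simp add: mult_nonneg_nonpos)
    ultimately show ?thesis using zorder_Psi_pole[of a] a by auto
   qed (simp add: zorder_not_dv)
   thus "\<bar>real_of_int (zorder Psi a)\<bar> <= real (dg + wt) * \<bar>real_of_int (zorder g a)\<bar>"
    using neg[of a] a by auto
  qed
  also have "... <= (\<Sum>a\<in>G. real (dg + wt) * \<bar>real_of_int (zorder g a)\<bar>)"
   using fin by (intro sum_mono2) auto
  also have "... = real (dg + wt) * nn g R1" by (simp add: nn_def G_def sum_distrib_left)
  also have "... <= real (dg + wt) * (2 * V)"
   using nn_mono[OF gm g0, of R1 R2] nn_R2 R1 R2 rho by (intro mult_left_mono) auto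
  also have "\<bar>real_of_int (zorder Psi a0)\<bar> + real (dg + wt) * (2 * V) <= N1 * V"
   using V(1) mult_left_mono[of 1 V "\<bar>real_of_int (zorder Psi a0)\<bar>"] by (simp add: N1_def algebra_simps)
  finally show ?thesis by simp
 qed
 show "chi Psi R1 <= A1 * V ^ q0"
 proof -
  have V1: "1 <= V ^ q0" "V <= V ^ q0" using V_pow[of 0] V_pow[of 1] by (auto simp: q0_def)
  define W where "W = (1 + wc / cmod c) * V ^ q0"
  have cc: "0 < wc / cmod c" using wc_pos c by simp
  have W1: "1 <= W" unfolding W_def using cc V1 by (metis add_increasing2 less_imp_le mult_le_one mult_mono' mult.right_neutral one_le_mult_iff order.refl zero_le_one le_add_same_cancel1)
  have pw: "max 0 (ln (cmod (Psi z))) <= 1 + W + real dg * \<bar>ln (cmod (g z))\<bar>" if z: "z \<in> sphere 0 R1" for z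
  proof -
   note fz = f[OF z]
   have Psinz': "Psi z ~= 0" using fz(5) by (auto simp: dv_def)
   define G1 where "G1 = exp (real dg * \<bar>ln (cmod (g z))\<bar>)"
   have G1: "1 <= G1" "cmod (g z) ^ dg <= G1"
   proof -
    have "cmod (g z) ^ dg = exp (real dg * ln (cmod (g z)))" using fz(1) by (simp add: exp_of_nat_mult)
    also have "... <= G1" unfolding G1_def by (simp add: mult_left_mono)
    finally show "cmod (g z) ^ dg <= G1" .
   qed (simp add: G1_def)
   have D: "cmod c <= cmod (c * (z - a0) ^ t)" using fz(4) by (simp add: norm_mult norm_power mult_le_cancel_left1)
   have "cmod (Psi z) <= cmod (M z) / cmod (c * (z - a0) ^ t) + 1"
    unfolding reduced_def using norm_triangle_ineq4[of "M z / (c * (z - a0) ^ t)" 1] by (simp add: norm_divide)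
   also have "cmod (M z) / cmod (c * (z - a0) ^ t) <= (wc * V ^ q0 * cmod (g z) ^ dg) / cmod c"
   proof (rule frac_le)
    show "cmod (M z) <= wc * V ^ q0 * cmod (g z) ^ dg" using R1 z by (intro monomial_bound(1)) auto
    thus "0 <= wc * V ^ q0 * cmod (g z) ^ dg" using norm_ge_zero order_trans by blast
   qed (use D c in auto)
   also have "... = wc / cmod c * V ^ q0 * cmod (g z) ^ dg" by simp
   also have "... <= W * G1"
    unfolding W_def using G1 cc V1 by (intro mult_mono) auto
   also have "W * G1 + 1 <= 2 * (W * G1)"
    using W1 G1(1) mult_mono[of 1 W 1 G1] by (simp add: mult.commute)
   finally have le: "cmod (Psi z) <= 2 * (W * G1)" by simp
   have "ln (cmod (Psi z)) <= ln (2 * (W * G1))" using le Psinz' W1 G1 by (subst ln_le_cancel_iff) auto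
   also have "... = ln 2 + ln W + real dg * \<bar>ln (cmod (g z))\<bar>" using W1 by (simp add: ln_mult G1_def)
   also have "... <= 1 + W + real dg * \<bar>ln (cmod (g z))\<bar>"
    using ln_bound[of W] ln_2_less_1 W1 by (intro add_mono) auto
   finally have "ln (cmod (Psi z)) <= 1 + W + real dg * \<bar>ln (cmod (g z))\<bar>" .
   moreover have "0 <= 1 + W + real dg * \<bar>ln (cmod (g z))\<bar>" using W1 by simp
   ultimately show ?thesis by simp
  qed
  have cg: "continuous_on (sphere 0 R1) (%z. real dg * \<bar>ln (cmod (g z))\<bar>)"
   by (rule continuous_on_mult[OF continuous_on_const continuous_max_ln(3)[OF sg]])
  define mP where "mP = cmean 0 R1 (%z. max 0 (ln (cmod (Psi z))))"
  have "mP <= cmean 0 R1 (%z. 1 + W + real dg * \<bar>ln (cmod (g z))\<bar>)"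
   unfolding mP_def using pw R1pos
   by (intro cmean_mono continuous_max_ln(1)[OF sP] continuous_on_add[OF continuous_on_const cg]) auto
  also have "... = 1 + W + real dg * cmean 0 R1 (%z. \<bar>ln (cmod (g z))\<bar>)"
   using cmean_add[OF continuous_on_const cg R1pos(2)] by (simp add: cmean_cmult)
  also have "cmean 0 R1 (%z. \<bar>ln (cmod (g z))\<bar>) <= X"
  proof -
   have "0 <= (\<Sum>a\<in>dv g Int ball 0 R1. \<bar>real_of_int (zorder g a)\<bar> * lam R1 a)" by (intro sum_nonneg) auto
   thus ?thesis using R1(4) by (simp add: chi_def)
  qed
  finally have "mP <= 1 + W + real dg * X" by (simp add: mult_left_mono)
  moreover have "real dg * X <= real dg * V" using V(2) by (intro mult_left_mono) auto
  ultimately have mP: "mP <= 1 + W + real dg * V" by linarith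
  have J: "cmean 0 R1 (%z. ln (cmod (Psi z))) = ln (cmod (Psi 0)) + (\<Sum>a\<in>S. real_of_int (zorder Psi a) * lam R1 a)"
   using jensen_formula[OF Psim Psi0 R1pos(1) sP fin(1)] by (simp add: S_def)
  have ab: "(\<Sum>a\<in>S. \<bar>real_of_int (zorder Psi a)\<bar> * lam R1 a) =
    (\<Sum>a\<in>S. real_of_int (zorder Psi a) * lam R1 a) + 2 * (\<Sum>a\<in>S. max 0 (- real_of_int (zorder Psi a)) * lam R1 a)"
   unfolding sum_distrib_left sum.distrib[symmetric]
   by (intro sum.cong refl) (auto simp: max_def abs_if algebra_simps)
  have chiP: "chi Psi R1 = 2 * mP - ln (cmod (Psi 0)) + 2 * (\<Sum>a\<in>S. max 0 (- real_of_int (zorder Psi a)) * lam R1 a)"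
   using max_ln_split(2)[OF sP R1pos(2)] J ab by (simp add: chi_def S_def mP_def)
  have l0: "lam R1 a0 <= (1 + \<bar>ln (cmod a0)\<bar>) * V"
  proof -
   have "cmod a0 < R1" using R1pos by simp
   hence "lam R1 a0 <= ln R1 + \<bar>ln (cmod a0)\<bar>" using a0 by (simp add: lam_eq)
   also have "ln R1 <= V"
   proof -
    have "ln R1 <= ln (128 * \<rho>)" using R1 R1pos rho by (subst ln_le_cancel_iff) auto
    thus ?thesis using V by simp
   qed
   also have "\<bar>ln (cmod a0)\<bar> <= \<bar>ln (cmod a0)\<bar> * V" using V(1) by (simp add: mult_le_cancel_left1)
   finally show ?thesis by (simp add: algebra_simps)
  qed
  have "(\<Sum>a\<in>S. max 0 (- real_of_int (zorder Psi a)) * lam R1 a) <=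
     (\<Sum>a\<in>S. (real (dg + wt) * \<bar>real_of_int (zorder g a)\<bar> + (if a = a0 then real t else 0)) * lam R1 a)"
   using neg by (intro sum_mono mult_right_mono) auto
  also have "... <= (\<Sum>a\<in>insert a0 G. (real (dg + wt) * \<bar>real_of_int (zorder g a)\<bar> + (if a = a0 then real t else 0)) * lam R1 a)"
   using fin SG by (intro sum_mono2) auto
  also have "... = real (dg + wt) * (\<Sum>a\<in>insert a0 G. \<bar>real_of_int (zorder g a)\<bar> * lam R1 a) +
     (\<Sum>a\<in>insert a0 G. (if a = a0 then real t else 0) * lam R1 a)"
   by (simp only: distrib_right sum.distrib sum_distrib_left mult.assoc)
  also have "(\<Sum>a\<in>insert a0 G. (if a = a0 then real t else 0) * lam R1 a) = real t * lam R1 a0"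
   using fin by (simp add: if_distrib[of "%x. x * _"] sum.delta cong: if_cong)
  also have "(\<Sum>a\<in>insert a0 G. \<bar>real_of_int (zorder g a)\<bar> * lam R1 a) =
    (\<Sum>a\<in>dv g Int ball 0 R1. \<bar>real_of_int (zorder g a)\<bar> * lam R1 a)"
   using fin R1pos by (intro sum_neutral_dv[OF gm g0, symmetric]) (auto simp: G_def)
  also have "... <= V"
  proof -
   have "0 <= cmean 0 R1 (%z. \<bar>ln (cmod (g z))\<bar>)"
    using continuous_max_ln(3)[OF sg] R1pos by (intro cmean_nonneg) auto
   thus ?thesis using R1(4) V(2) by (simp add: chi_def)
  qed
  finally have neg_sum: "(\<Sum>a\<in>S. max 0 (- real_of_int (zorder Psi a)) * lam R1 a) <=
    real (dg + wt) * V + real t * ((1 + \<bar>ln (cmod a0)\<bar>) * V)"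
   using l0 by (smt (verit) mult_left_mono of_nat_0_le_iff)
  have "chi Psi R1 <= 2 * (1 + W + real dg * V) + \<bar>ln (cmod (Psi 0))\<bar> +
    2 * (real (dg + wt) * V + real t * ((1 + \<bar>ln (cmod a0)\<bar>) * V))"
  proof -
   have "x <= 2 * a' + \<bar>l\<bar> + 2 * s'" if "x = 2 * a - l + 2 * s" "a <= a'" "s <= s'" for x a a' l s s' :: real
    using that by linarith
   from this[OF chiP mP neg_sum] show ?thesis .
  qed
  also have "... <= 2 * (V ^ q0 + W + real dg * V ^ q0) + \<bar>ln (cmod (Psi 0))\<bar> * V ^ q0 +
    2 * (real (dg + wt) * V ^ q0 + real t * ((1 + \<bar>ln (cmod a0)\<bar>) * V ^ q0))"
   using V1 by (intro add_mono mult_left_mono order_refl) (auto simp: mult_le_cancel_left1)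
  also have "... = A1 * V ^ q0" by (simp add: A1_def W_def algebra_simps)
  finally show ?thesis .
 qed
qed

lemma W1_ge: "0 <= N1" "0 <= A1" "1 + (1 + real t) * wc <= W1" "9 * N1 + 4 * A1 <= W1" "1 <= W1"
proof -
 show n: "0 <= N1" by (simp add: N1_def)
 show a: "0 <= A1" using wc_pos by (simp add: A1_def)
 have "0 <= (1 + real t) * wc" using wc_pos by simp
 thus "1 + (1 + real t) * wc <= W1" "9 * N1 + 4 * A1 <= W1" "1 <= W1"
  unfolding W1_def using n a by linarith+
qed

lemma all_bounds:
 assumes R1: "4 * \<rho> <= R1" "R1 <= 8 * \<rho>" "!!a. a \<in> dv g ==> \<eta> <= \<bar>cmod a - R1\<bar>" "chi g R1 <= X"
  and r: "\<rho> <= cmod z" "cmod z <= 2 * \<rho>" "!!a. a \<in> insert a0 (dv g) ==> \<eta> <= \<bar>cmod a - cmod z\<bar>"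
 shows "cmod (M z) <= W1 * V ^ q0 * cmod (g z) ^ dg"
  "cmod (c * (z - a0) ^ t * deriv Psi z) <= W1 * V ^ q0 * cmod (g z) ^ dg"
  "cmod (K z) <= W1 * V ^ q0"
proof -
 note PB = Psi_bounds[OF R1]
 have Vq: "0 <= V ^ q0 * cmod (g z) ^ dg" using V(1) by simp
 have wc1: "wc <= W1" "(1 + real t) * wc <= W1"
  using W1_ge(3) wc_pos by (auto simp: algebra_simps) (smt (verit) mult_nonneg_nonneg of_nat_0_le_iff)
 have "cmod (M z) <= wc * (V ^ q0 * cmod (g z) ^ dg)"
  using monomial_bound(1)[of z] r rho by (simp add: mult.assoc)
 also have "... <= W1 * (V ^ q0 * cmod (g z) ^ dg)" using wc1 Vq by (intro mult_right_mono)
 finally show "cmod (M z) <= W1 * V ^ q0 * cmod (g z) ^ dg" by (simp add: mult.assoc)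
 have "cmod (c * (z - a0) ^ t * deriv Psi z) <= (1 + real t) * wc * (V ^ q0 * cmod (g z) ^ dg)"
  using reduced_derivative_bound[of z] r rho by (simp add: mult.assoc)
 also have "... <= W1 * (V ^ q0 * cmod (g z) ^ dg)" using wc1 Vq by (intro mult_right_mono)
 finally show "cmod (c * (z - a0) ^ t * deriv Psi z) <= W1 * V ^ q0 * cmod (g z) ^ dg" by (simp add: mult.assoc)
 have lR: "ln (2 * R1) <= V" "0 <= ln (2 * R1)"
 proof -
  have "ln (2 * R1) <= ln (128 * \<rho>)" using R1 rho by (subst ln_le_cancel_iff) auto
  thus "ln (2 * R1) <= V" using V by simp
 qed (use R1 rho in simp)
 have sepz: "\<eta> <= cmod (z - a)" if "a \<in> dv Psi" for a
 proof -
  have "\<eta> <= \<bar>cmod a - cmod z\<bar>" using that dv_Psi_sub' by (intro r(3)) auto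
  thus ?thesis using norm_triangle_ineq3[of a z] by (simp add: norm_minus_commute)
 qed
 have "cmod (K z) <= nn Psi R1 / \<eta> + 2 * R1 / (R1 - 2 * \<rho>)^2 * (chi Psi R1 + 2 * nn Psi R1 * ln (2 * R1))"
  unfolding K_def using R1 rho r eta PB(3) sepz by (intro logarithmic_derivative_bound[OF Psim Psi0]) auto
 also have "nn Psi R1 / \<eta> <= N1 * V * V"
 proof -
  have "nn Psi R1 / \<eta> = nn Psi R1 * (1 / \<eta>)" by simp
  also have "... <= N1 * V * V" using PB(1) V nn_nonneg eta W1_ge(1) by (intro mult_mono) auto
  finally show ?thesis .
 qed
 also have "2 * R1 / (R1 - 2 * \<rho>)^2 * (chi Psi R1 + 2 * nn Psi R1 * ln (2 * R1)) <= 4 * (A1 * V ^ q0 + 2 * (N1 * V) * V)"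
 proof (rule mult_mono)
  have "(2 * \<rho>)^2 <= (R1 - 2 * \<rho>)^2" using R1 rho by (intro power_mono) auto
  hence "2 * R1 / (R1 - 2 * \<rho>)^2 <= 2 * (8 * \<rho>) / (2 * \<rho>)^2"
   using R1 rho by (intro frac_le) auto
  also have "... <= 4" using rho by (simp add: power2_eq_square field_simps)
  finally show "2 * R1 / (R1 - 2 * \<rho>)^2 <= 4" .
  have "2 * nn Psi R1 * ln (2 * R1) <= 2 * (N1 * V) * V"
   using PB(1) lR nn_nonneg[of Psi R1] V W1_ge(1) by (intro mult_mono mult_left_mono) auto
  thus "chi Psi R1 + 2 * nn Psi R1 * ln (2 * R1) <= A1 * V ^ q0 + 2 * (N1 * V) * V"
   using PB(2) by simp
  have "0 <= chi Psi R1"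
   unfolding chi_def using continuous_max_ln(3)[OF PB(3)] R1 rho
   by (intro add_nonneg_nonneg cmean_nonneg sum_nonneg) auto
  thus "0 <= chi Psi R1 + 2 * nn Psi R1 * ln (2 * R1)" using lR nn_nonneg[of Psi R1] by simp
 qed simp
 also have "N1 * V * V + 4 * (A1 * V ^ q0 + 2 * (N1 * V) * V) = 9 * N1 * V ^ 2 + 4 * A1 * V ^ q0"
  by (simp add: algebra_simps power2_eq_square)
 also have "... <= 9 * N1 * V ^ q0 + 4 * A1 * V ^ q0"
  using V_pow[of 2] W1_ge(1,2) V(1) by (intro add_mono mult_left_mono) (auto simp: q0_def)
 also have "... = (9 * N1 + 4 * A1) * V ^ q0" by (simp add: algebra_simps)
 also have "... <= W1 * V ^ q0" using W1_ge(4) V(1) by (intro mult_right_mono) auto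
 finally show "cmod (K z) <= W1 * V ^ q0" by simp
qed

end

section \<open>Logarithmic growth and the contradiction\<close>

lemma ln_le_linear: "0 < z ==> 0 < e ==> ln z <= e * z - ln e" for z e :: real
proof -
 assume "0 < z" "0 < e"
 hence "ln (e * z) <= e * z - 1" by (intro ln_le_minus_one) auto
 thus ?thesis using \<open>0 < z\<close> \<open>0 < e\<close> by (simp add: ln_mult)
qed

context omitted_value
begin

text \<open>
 A circle of radius between \<open>\<rho>\<close> and \<open>2 * \<rho>\<close> that stays away from all singularities and on which the characteristic is known.
\<close>

definition circ :: "real => real => real => real => bool" where
 "circ \<rho> \<eta> X R \<longleftrightarrow> \<rho> <= R & R <= 2 * \<rho> & (\<forall>a\<in>insert a0 (dv g). \<eta> <= \<bar>cmod a - R\<bar>) &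
   sphere 0 R Int dv K = {} & chi g R <= X"

lemma circ_good: "circ \<rho> \<eta> X R ==> 0 < \<eta> ==> sphere 0 R Int dv g = {}"
 by (fastforce simp: circ_def)

theorem scale_inequality:
 "\<exists>C\<ge>0. \<forall>\<rho> \<eta> X r R1 R2 R3. 1 <= \<rho> --> 1 + cmod a0 <= \<rho> --> 0 < \<eta> --> \<eta> <= 1 --> 1 <= X \<longrightarrow>
   circ \<rho> \<eta> X r --> circ (4 * \<rho>) \<eta> X R1 --> circ (16 * \<rho>) \<eta> X R2 --> circ (64 * \<rho>) \<eta> X R3 \<longrightarrow>
   kap * chi g r <= 2 * real p0 * real E * ln r + C * (1 + ln (X + 1 / \<eta> + ln (128 * \<rho>)))"
proof -
 obtain C where C: "!!r W. 1 + cmod a0 <= r ==> sphere 0 r Int dv g = {} ==> sphere 0 r Int dv K = {} ==> 1 <= W ==>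
   (!!z. z\<in>sphere 0 r ==> cmod (M z) <= W * cmod (g z) ^ dg &
    cmod (c * (z - a0) ^ t * deriv Psi z) <= W * cmod (g z) ^ dg & cmod (K z) <= W) ==>
   kap * chi g r <= 2 * real p0 * real E * ln r + C * (1 + ln W)"
  using main_inequality by blast
 define C' where "C' = \<bar>C\<bar> * (1 + \<bar>ln W1\<bar> + real q0)"
 show ?thesis
 proof (intro exI[of _ C'] conjI allI impI)
  show "0 <= C'" by (simp add: C'_def)
  fix \<rho> \<eta> X r R1 R2 R3 :: real
  assume a: "1 <= \<rho>" "1 + cmod a0 <= \<rho>" "0 < \<eta>" "\<eta> <= 1" "1 <= X"
   and c: "circ \<rho> \<eta> X r" "circ (4 * \<rho>) \<eta> X R1" "circ (16 * \<rho>) \<eta> X R2" "circ (64 * \<rho>) \<eta> X R3"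
  define V where "V = X + 1 / \<eta> + ln (128 * \<rho>)"
  have ln0: "0 <= ln (128 * \<rho>)" "0 < 1 / \<eta>" using a by auto
  interpret S: omitted_value_scale g k m t n c a0 \<rho> \<eta> X V R2 R3
  proof
   show "sphere 0 R2 Int dv g = {}" "sphere 0 R3 Int dv g = {}" using circ_good c(3,4) a(3) by blast+
   show "1 <= V" "X <= V" "1 / \<eta> <= V" "ln (128 * \<rho>) <= V" using a(5) ln0 unfolding V_def by linarith+
  qed (use a c in \<open>auto simp: circ_def\<close>)
  define W where "W = W1 * V ^ q0"
  have V1: "1 <= V" "1 <= V ^ q0" using S.V(1) by auto
  have W: "1 <= W" using mult_mono[of 1 W1 1 "V ^ q0"] S.W1_ge(5) V1 by (simp add: W_def)
  have sp: "sphere 0 r Int dv g = {}" "sphere 0 r Int dv K = {}" "\<rho> <= r" "r <= 2 * \<rho>"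
   using circ_good[OF c(1) a(3)] c(1) by (auto simp: circ_def)
  have "kap * chi g r <= 2 * real p0 * real E * ln r + C * (1 + ln W)"
  proof (rule C[OF _ sp(1,2) W])
   show "1 + cmod a0 <= r" using a(2) sp(3) by linarith
   fix z :: complex assume "z \<in> sphere 0 r"
   hence z: "cmod z = r" by simp
   have "cmod (M z) <= W1 * V ^ q0 * cmod (g z) ^ dg"
    "cmod (c * (z - a0) ^ t * deriv Psi z) <= W1 * V ^ q0 * cmod (g z) ^ dg"
    "cmod (K z) <= W1 * V ^ q0"
    using S.all_bounds[of R1 z] c(1,2) z by (auto simp: circ_def)
   thus "cmod (M z) <= W * cmod (g z) ^ dg &
    cmod (c * (z - a0) ^ t * deriv Psi z) <= W * cmod (g z) ^ dg & cmod (K z) <= W"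
    by (simp add: W_def)
  qed
  also have "C * (1 + ln W) <= C' * (1 + ln V)"
  proof -
   have lV: "0 <= ln V" using V1 by simp
   have "ln W = ln W1 + real q0 * ln V"
    using V1 S.W1_ge(5) by (simp add: W_def ln_mult ln_realpow)
   hence "1 + ln W <= 1 + \<bar>ln W1\<bar> + real q0 * ln V" by simp
   also have "... <= (1 + \<bar>ln W1\<bar> + real q0) * (1 + ln V)"
    using lV by (simp add: algebra_simps)
   finally have "1 + ln W <= (1 + \<bar>ln W1\<bar> + real q0) * (1 + ln V)" .
   moreover have "0 <= 1 + ln W" using W by (simp add: add_nonneg_nonneg)
   ultimately have "\<bar>C\<bar> * (1 + ln W) <= \<bar>C\<bar> * ((1 + \<bar>ln W1\<bar> + real q0) * (1 + ln V))"
    by (intro mult_left_mono) auto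
   moreover have "C * (1 + ln W) <= \<bar>C\<bar> * (1 + ln W)" using \<open>0 <= 1 + ln W\<close> by (intro mult_right_mono) auto
   ultimately show ?thesis by (simp add: C'_def mult.assoc)
  qed
  finally show "kap * chi g r <= 2 * real p0 * real E * ln r + C' * (1 + ln (X + 1 / \<eta> + ln (128 * \<rho>)))"
   by (simp add: V_def)
 qed
qed

lemma card_le_nn: "real (card (dv g Int ball 0 r)) <= nn g r"
proof -
 have "real (card (dv g Int ball 0 r)) = (\<Sum>a\<in>dv g Int ball 0 r. 1)" by simp
 also have "... <= nn g r" unfolding nn_def
 proof (rule sum_mono)
  fix a assume "a \<in> dv g Int ball 0 r"
  hence "zorder g a ~= 0" using zorder_dv_nonzero by blast
  thus "1 <= \<bar>real_of_int (zorder g a)\<bar>" by linarith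
 qed
 finally show ?thesis .
qed

lemma kap_pos: "1 <= kap" using kap_ge m1 by (auto simp: p0_def)

text \<open>
 Quadratic growth makes all the factors W in \<open>main_inequality\<close> polynomial in \<open>\<rho>\<close>, so their logarithms are \<open>O(ln \<rho>)\<close>.
\<close>

theorem logarithmic_growth:
 assumes B: "0 <= B" "!!R. 1 <= R ==> sphere 0 R Int dv g = {} ==> chi g R <= B * R^2"
 obtains C where "1 <= C" "!!\<rho>. 1 + cmod a0 <= \<rho> ==> \<exists>r. \<exists>\<eta>>0. circ \<rho> \<eta> (C * (1 + ln \<rho>)) r"
proof -
 obtain C where C: "0 <= C" "!!\<rho> \<eta> X r R1 R2 R3. 1 <= \<rho> ==> 1 + cmod a0 <= \<rho> ==> 0 < \<eta> ==> \<eta> <= 1 ==> 1 <= X ==>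
   circ \<rho> \<eta> X r ==> circ (4 * \<rho>) \<eta> X R1 ==> circ (16 * \<rho>) \<eta> X R2 ==> circ (64 * \<rho>) \<eta> X R3 ==>
   kap * chi g r <= 2 * real p0 * real E * ln r + C * (1 + ln (X + 1 / \<eta> + ln (128 * \<rho>)))"
  using scale_inequality by blast
 define B1 where "B1 = 2 * B * 1024\<^sup>2"
 define B2 where "B2 = (B * 128\<^sup>2 + 1) + 4 * (B1 + 2) + 128"
 define C' where "C' = 1 + 2 * real p0 * real E * 2 + C * (3 + ln B2)"
 have B1: "0 <= B1" using B by (simp add: B1_def)
 have B2: "1 <= B2" using B B1 by (simp add: B2_def)
 show ?thesis
 proof (rule that[of C'])
  have "0 <= C * (3 + ln B2)" using C(1) B2 by (intro mult_nonneg_nonneg) (auto simp: add_nonneg_nonneg)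
  thus "1 <= C'" unfolding C'_def by simp
  fix \<rho> :: real assume rho: "1 + cmod a0 <= \<rho>"
  have rho1: "1 <= \<rho>" using rho norm_ge_zero[of a0] by linarith
  have rho2: "\<rho> <= \<rho>^2" "1 <= \<rho>^2" using rho1 by (simp_all add: self_le_power one_le_power)
  have fin: "finite (dv g Int cball 0 x)" "finite (dv K Int cball 0 x)" for x
   using dv_finite(1)[OF gm g0] dv_finite(1)[OF Km K_dv] by auto
  obtain R' where R': "512 * \<rho> <= R'" "R' <= 2 * (512 * \<rho>)" "!!a. a \<in> dv g Int cball 0 (1024 * \<rho>) ==> cmod a ~= R'"
   using separated_radius[of "{}" "dv g Int cball 0 (1024 * \<rho>)" "512 * \<rho>"] fin rho1 by auto
  have gR': "sphere 0 R' Int dv g = {}"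
  proof -
   have "x \<notin> dv g" if "cmod x = R'" for x
    using R'(3)[of x] R'(2) that by auto
   thus ?thesis by auto
  qed
  have nnb: "nn g (256 * \<rho>) <= B1 * \<rho>^2"
  proof -
   have "ln 2 <= ln (R' / (256 * \<rho>))" using R' rho1 by (subst ln_le_cancel_iff) (auto simp: field_simps)
   hence "1 / 2 <= ln (R' / (256 * \<rho>))" using ln2_ge_two_thirds by linarith
   hence "nn g (256 * \<rho>) * (1 / 2) <= nn g (256 * \<rho>) * ln (R' / (256 * \<rho>))"
    by (intro mult_left_mono nn_nonneg)
   also have "... <= chi g R'" using R' rho1 gR' by (intro nn_le_chi[OF gm g0]) auto
   also have "... <= B * R'\<^sup>2" using R' rho1 gR' by (intro B(2)) auto
   also have "... <= B * (1024 * \<rho>)^2" using R' rho1 B(1) by (intro mult_left_mono power_mono) auto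
   finally show ?thesis by (simp add: B1_def power_mult_distrib)
  qed
  define S where "S = insert a0 (dv g Int ball 0 (256 * \<rho>))"
  have finS: "finite S" unfolding S_def using dv_finite(2)[OF gm g0] by simp
  have "card S <= card (dv g Int ball 0 (256 * \<rho>)) + 1"
   unfolding S_def using dv_finite(2)[OF gm g0, of "256 * \<rho>"] by (simp add: card_insert_if)
  hence "real (card S) <= real (card (dv g Int ball 0 (256 * \<rho>))) + 1" by linarith
  hence cS: "real (card S) + 1 <= (B1 + 2) * \<rho>^2"
   using card_le_nn[of "256 * \<rho>"] nnb rho2 by (simp add: distrib_right)
  define \<eta> where "\<eta> = 1 / (4 * (B1 + 2) * \<rho>)"
  have eta: "0 < \<eta>" "\<eta> <= 1"
  proof -
   have "1 <= 4 * (B1 + 2) * \<rho>" using B1 rho1 mult_mono[of 1 "4 * (B1 + 2)" 1 \<rho>] by simp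
   thus "\<eta> <= 1" "0 < \<eta>" by (auto simp: \<eta>_def)
  qed
  define X where "X = (B * 128\<^sup>2 + 1) * \<rho>^2"
  have X1: "1 <= X" unfolding X_def using B rho2 mult_mono[of 1 "B * 128\<^sup>2 + 1" 1 "\<rho>^2"] by simp
  have circle: "\<exists>R. circ b \<eta> X R" if b: "\<rho> <= b" "b <= 64 * \<rho>" for b
  proof -
   have b0: "0 < b" using b rho1 by linarith
   obtain R where R: "b <= R" "R <= 2 * b" "!!a. a \<in> S ==> b / (4 * (real (card S) + 1)) <= \<bar>cmod a - R\<bar>"
    "!!a. a \<in> dv K Int cball 0 (256 * \<rho>) ==> cmod a ~= R"
    using separated_radius[OF finS fin(2) b0] by blast
   have sep: "\<eta> <= \<bar>cmod a - R\<bar>" if "a \<in> insert a0 (dv g)" for a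
   proof (cases "a \<in> S")
    case True
    have "\<eta> = \<rho> / (4 * ((B1 + 2) * \<rho>^2))"
    proof -
     have "\<rho> / (4 * ((B1 + 2) * \<rho>^2)) = (\<rho> * 1) / (\<rho> * (4 * (B1 + 2) * \<rho>))"
      by (simp add: power2_eq_square mult_ac)
     also have "... = 1 / (4 * (B1 + 2) * \<rho>)"
      using rho1 by (subst mult_divide_mult_cancel_left) auto
     finally show ?thesis by (simp add: \<eta>_def)
    qed
    also have "... <= b / (4 * (real (card S) + 1))"
     using b cS rho1 by (intro frac_le) auto
    also have "... <= \<bar>cmod a - R\<bar>" using R(3)[OF True] .
    finally show ?thesis .
   next
    case False
    hence "256 * \<rho> <= cmod a" using that by (auto simp: S_def)
    thus ?thesis using R(2) b eta rho1 by linarith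
   qed
   have "sphere 0 R Int dv g = {}" using sep eta by fastforce
   hence "chi g R <= B * R^2" using R(1) b rho1 by (intro B(2)) auto
   also have "... <= B * (128 * \<rho>)^2" using R b rho1 B(1) by (intro mult_left_mono power_mono) auto
   also have "... <= X" by (simp add: X_def power_mult_distrib distrib_right)
   finally have "chi g R <= X" .
   moreover have "sphere 0 R Int dv K = {}"
   proof -
    have "R <= 256 * \<rho>" using R b by linarith
    thus ?thesis using R(4) by fastforce
   qed
   ultimately show ?thesis using R sep by (auto simp: circ_def)
  qed
  obtain r R1 R2 R3 where cc: "circ \<rho> \<eta> X r" "circ (4 * \<rho>) \<eta> X R1" "circ (16 * \<rho>) \<eta> X R2" "circ (64 * \<rho>) \<eta> X R3"
   using circle[of \<rho>] circle[of "4 * \<rho>"] circle[of "16 * \<rho>"] circle[of "64 * \<rho>"] rho1 by auto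
  define V where "V = X + 1 / \<eta> + ln (128 * \<rho>)"
  have main: "kap * chi g r <= 2 * real p0 * real E * ln r + C * (1 + ln V)"
   unfolding V_def by (rule C(2)[OF rho1 rho eta X1 cc])
  have V: "1 <= V" "V <= B2 * \<rho>^2"
  proof -
   have "0 <= ln (128 * \<rho>)" "0 < 1 / \<eta>" using rho1 eta by auto
   thus "1 <= V" using X1 unfolding V_def by linarith
   have "1 / \<eta> = 4 * (B1 + 2) * \<rho>" by (simp add: \<eta>_def)
   also have "... <= 4 * (B1 + 2) * \<rho>^2" using B1 rho2 by (intro mult_left_mono) auto
   finally have 1: "1 / \<eta> <= 4 * (B1 + 2) * \<rho>^2" .
   have "ln (128 * \<rho>) <= 128 * \<rho>" using rho1 by (intro ln_bound) auto
   hence 2: "ln (128 * \<rho>) <= 128 * \<rho>^2" using rho2 by linarith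
   have "V <= (B * 128\<^sup>2 + 1) * \<rho>^2 + 4 * (B1 + 2) * \<rho>^2 + 128 * \<rho>^2"
    unfolding V_def using 1 2 by (intro add_mono) (auto simp: X_def)
   thus "V <= B2 * \<rho>^2" by (simp only: B2_def distrib_right)
  qed
  have lnr: "0 <= ln \<rho>" using rho1 by simp
  have lnV: "ln V <= ln B2 + 2 * ln \<rho>"
  proof -
   have "ln V <= ln (B2 * \<rho>^2)" using V B2 rho1 by (subst ln_le_cancel_iff) auto
   thus ?thesis using B2 rho1 by (simp add: ln_mult ln_realpow)
  qed
  have r: "\<rho> <= r" "r <= 2 * \<rho>" using cc(1) by (auto simp: circ_def)
  have lr: "ln r <= 1 + ln \<rho>"
  proof -
   have "ln r <= ln (2 * \<rho>)" using r rho1 by (subst ln_le_cancel_iff) auto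
   thus ?thesis using rho1 ln_2_less_1 by (simp add: ln_mult)
  qed
  have "kap * chi g r <= 2 * real p0 * real E * (1 + ln \<rho>) + C * ((3 + ln B2) * (1 + ln \<rho>))"
  proof -
   have "2 * real p0 * real E * ln r <= 2 * real p0 * real E * (1 + ln \<rho>)" using lr by (intro mult_left_mono) auto
   moreover have "1 + ln V <= (3 + ln B2) * (1 + ln \<rho>)"
   proof -
    have "0 <= ln B2 * ln \<rho>" using lnr B2 by (intro mult_nonneg_nonneg) auto
    thus ?thesis using lnV lnr by (simp add: algebra_simps)
   qed
   hence "C * (1 + ln V) <= C * ((3 + ln B2) * (1 + ln \<rho>))" using C(1) by (intro mult_left_mono)
   ultimately show ?thesis using main by linarith
  qed
  also have "... <= C' * (1 + ln \<rho>)"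
  proof -
   have "0 <= (1 + 2 * real p0 * real E) * (1 + ln \<rho>)" using lnr by (intro mult_nonneg_nonneg) auto
   thus ?thesis by (simp add: C'_def algebra_simps)
  qed
  finally have k: "kap * chi g r <= C' * (1 + ln \<rho>)" .
  have "chi g r <= C' * (1 + ln \<rho>)"
  proof (cases "0 <= chi g r")
   case True
   hence "1 * chi g r <= kap * chi g r" using kap_pos by (intro mult_right_mono) auto
   thus ?thesis using k by simp
  next
   case False
   moreover have "0 <= C' * (1 + ln \<rho>)" using lnr \<open>1 <= C'\<close> by (intro mult_nonneg_nonneg) auto
   ultimately show ?thesis by linarith
  qed
  hence "circ \<rho> \<eta> (C' * (1 + ln \<rho>)) r" using cc(1) by (simp add: circ_def)
  thus "\<exists>r. \<exists>\<eta>>0. circ \<rho> \<eta> (C' * (1 + ln \<rho>)) r" using eta by blast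
 qed
qed

text \<open>
 Logarithmic growth leaves finitely many zeros and poles. If there are none, g' / g is bounded by O(ln r / r), so g is constant,
 M[g] = 0 and Psi is constant, against dPsi0. Otherwise the distance \<open>\<eta>\<close> can be kept fixed, so the error term becomes
 O(ln (ln r)), and \<open>chi_lower_bound\<close> at one zero or pole contradicts the size of kap.
\<close>

theorem no_omitted_value:
 assumes L: "0 < L" "L-lipschitz_on UNIV (sphere_value g)"
 shows False
proof -
 define B where "B = ln (1 + (cmod (g 0))^2) + \<bar>ln (cmod (g 0))\<bar> + 2 * (L^2 / 4 + 1)"
 have B: "0 <= B" "!!R. 1 <= R ==> sphere 0 R Int dv g = {} ==> chi g R <= B * R^2"
 proof -
  have p: "0 <= ln (1 + (cmod (g 0))^2) + \<bar>ln (cmod (g 0))\<bar>" by simp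
  moreover have "0 <= 2 * (L^2 / 4 + 1)" by simp
  ultimately show "0 <= B" unfolding B_def by (rule add_nonneg_nonneg)
  fix R :: real assume R: "1 <= R" "sphere 0 R Int dv g = {}"
  have "chi g R <= (ln (1 + (cmod (g 0))^2) + \<bar>ln (cmod (g 0))\<bar>) + 2 * (L^2 / 4 + 1) * R^2"
   using R by (intro lipschitz_growth[OF nice g0 L]) auto
  moreover have "(ln (1 + (cmod (g 0))^2) + \<bar>ln (cmod (g 0))\<bar>) * 1 <= (ln (1 + (cmod (g 0))^2) + \<bar>ln (cmod (g 0))\<bar>) * R^2"
   using p R by (intro mult_left_mono one_le_power) auto
  moreover have "x <= (q + z) * y" if "x <= q + z * y" "q * 1 <= q * y" for x y z q :: real
   using that by (simp add: distrib_right)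
  ultimately show "chi g R <= B * R^2" unfolding B_def by blast
 qed
 obtain C where C: "1 <= C" "!!\<rho>. 1 + cmod a0 <= \<rho> ==> \<exists>r. \<exists>\<eta>>0. circ \<rho> \<eta> (C * (1 + ln \<rho>)) r"
  using logarithmic_growth[OF B] by blast
 have card_bound: "real (card (dv g Int ball 0 \<rho>)) <= 3 * C" if rho: "exp 1 + (1 + cmod a0) <= \<rho>" for \<rho>
 proof -
  have e: "exp 1 <= \<rho>" "1 + cmod a0 <= \<rho>" "1 <= \<rho>" using rho norm_ge_zero[of a0] exp_gt_zero[of "1::real"] by linarith+
  have l1: "1 <= ln \<rho>" using e by (simp add: ln_ge_iff)
  have r2: "\<rho> <= \<rho>^2" using e by (simp add: self_le_power)
  obtain r \<eta> where r: "0 < \<eta>" "circ (\<rho>^2) \<eta> (C * (1 + ln (\<rho>^2))) r" using C(2)[of "\<rho>^2"] e r2 by (meson order_trans)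
  have "nn g \<rho> * ln \<rho> <= nn g \<rho> * ln (r / \<rho>)"
  proof (intro mult_left_mono nn_nonneg)
   have le: "\<rho> * \<rho> <= r" using r by (simp add: circ_def power2_eq_square)
   hence "0 < r" using e mult_pos_pos[of \<rho> \<rho>] by linarith
   thus "ln \<rho> <= ln (r / \<rho>)" using le e by (subst ln_le_cancel_iff) (auto simp: field_simps)
  qed
  also have "... <= chi g r"
   using e r r2 circ_good[OF r(2,1)] by (intro nn_le_chi[OF gm g0]) (auto simp: circ_def)
  also have "... <= C * (1 + ln (\<rho>^2))" using r by (simp add: circ_def)
  also have "... <= C * (3 * ln \<rho>)" using l1 C(1) e by (intro mult_left_mono) (auto simp: ln_realpow)
  finally have "nn g \<rho> * ln \<rho> <= 3 * C * ln \<rho>" by simp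
  hence "nn g \<rho> <= 3 * C" using l1 by simp
  thus ?thesis using card_le_nn[of \<rho>] by linarith
 qed
 have findv: "finite (dv g)"
 proof (rule ccontr)
  assume "infinite (dv g)"
  then obtain A where A: "A \<subseteq> dv g" "finite A" "card A = nat \<lceil>3 * C\<rceil> + 1"
   using infinite_arbitrarily_large by blast
  obtain b where b: "!!a. a \<in> A ==> cmod a <= b" 
   using finite_imp_bounded[OF A(2)] by (auto simp: bounded_iff)
  define \<rho> where "\<rho> = exp 1 + (1 + cmod a0) + \<bar>b\<bar> + 1"
  have "A \<subseteq> dv g Int ball 0 \<rho>"
  proof
   fix a assume "a \<in> A"
   hence "cmod a <= b" "a \<in> dv g" using b A by auto
   moreover have "b < \<rho>" unfolding \<rho>_def using norm_ge_zero[of a0] exp_gt_zero[of "1::real"] by linarith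
   ultimately show "a \<in> dv g Int ball 0 \<rho>" by auto
  qed
  hence "card A <= card (dv g Int ball 0 \<rho>)" using dv_finite(2)[OF gm g0] by (intro card_mono) auto
  moreover have "real (card (dv g Int ball 0 \<rho>)) <= 3 * C" by (rule card_bound) (simp add: \<rho>_def)
  ultimately show False using A(3) by linarith
 qed
 obtain b where b: "!!a. a \<in> insert a0 (dv g) ==> cmod a <= b" "0 <= b"
 proof -
  obtain b where "\<forall>a\<in>insert a0 (dv g). cmod a <= b"
   using finite_imp_bounded[of "insert a0 (dv g)"] findv by (auto simp: bounded_iff)
  thus ?thesis using that[of b] norm_ge_zero[of a0] by (meson insertI1 order_trans)
 qed
 show False
 proof (cases "dv g = {}")
  case True
  have gan: "g analytic_on UNIV" using True by (auto simp: dv_def analytic_on_analytic_at[of g UNIV])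
  have d0: "deriv g z = 0" for z
  proof (rule ccontr)
   assume nz: "deriv g z ~= 0"
   have gz: "g z ~= 0" using True by (auto simp: dv_def)
   define d where "d = cmod (deriv g z / g z)"
   have d: "0 < d" using nz gz by (simp add: d_def)
   define \<rho> where "\<rho> = 1 + cmod a0 + 2 * cmod z + (16 * C / d + 1)^2"
   have rho: "1 + cmod a0 <= \<rho>" "2 * cmod z <= \<rho>" "(16 * C / d + 1)^2 <= \<rho>" "1 <= \<rho>"
    unfolding \<rho>_def using norm_ge_zero[of a0] norm_ge_zero[of z] zero_le_power2[of "16 * C / d + 1"] by linarith+
   obtain r \<eta> where r: "0 < \<eta>" "circ \<rho> \<eta> (C * (1 + ln \<rho>)) r" using C(2)[OF rho(1)] by blast
   have rr: "\<rho> <= r" "chi g r <= C * (1 + ln \<rho>)" using r by (auto simp: circ_def)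
   have "d <= nn g r / 1 + 2 * r / (r - cmod z)^2 * (chi g r + 2 * nn g r * ln (2 * r))"
    unfolding d_def using rr rho True by (intro logarithmic_derivative_bound[OF gm g0]) auto
   also have "... = 2 * r / (r - cmod z)^2 * chi g r" using True by (simp add: nn_def)
   also have "... <= 2 * r / (r / 2)^2 * (C * (1 + ln \<rho>))"
   proof (intro mult_mono rr)
    have "(r / 2)^2 <= (r - cmod z)^2" using rr rho by (intro power_mono) auto
    thus "2 * r / (r - cmod z)^2 <= 2 * r / (r / 2)^2" using rr rho by (intro frac_le) auto
    show "0 <= chi g r" using circ_good[OF r(2,1)] rr rho unfolding chi_def
     by (intro add_nonneg_nonneg cmean_nonneg sum_nonneg continuous_max_ln(3)) auto
   qed (use rr rho in auto)
   also have "2 * r / (r / 2)^2 = 8 / r" using rr rho by (simp add: power2_eq_square)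
   also have "8 / r * (C * (1 + ln \<rho>)) <= 8 / \<rho> * (C * (2 * sqrt \<rho>))"
   proof (intro mult_mono)
    show "8 / r <= 8 / \<rho>" using rr rho by (intro divide_left_mono) auto
    have "ln (sqrt \<rho>) <= sqrt \<rho> - 1" using rho by (intro ln_le_minus_one) auto
    thus "1 + ln \<rho> <= 2 * sqrt \<rho>" using rho by (simp add: ln_sqrt)
   qed (use rho C in auto)
   also have "... = 16 * C / sqrt \<rho>"
   proof -
    have "8 / \<rho> * (C * (2 * sqrt \<rho>)) = (16 * C * sqrt \<rho>) / (sqrt \<rho> * sqrt \<rho>)"
     using rho(4) by simp
    also have "... = 16 * C / sqrt \<rho>"
     using rho(4) by (subst mult_divide_mult_cancel_right) auto
    finally show ?thesis .
   qed
   finally have "d <= 16 * C / sqrt \<rho>" .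
   hence "d * sqrt \<rho> <= 16 * C" using rho by (simp add: field_simps)
   moreover have "16 * C / d + 1 <= sqrt \<rho>" using rho(3) by (rule real_le_rsqrt)
   hence "d * (16 * C / d + 1) <= d * sqrt \<rho>" using d by (intro mult_left_mono) auto
   hence "16 * C + d <= d * sqrt \<rho>" using d by (simp add: distrib_left)
   ultimately show False using d by linarith
  qed
  have "(deriv ^^ k) g z = 0" for z
  proof -
   have "(deriv ^^ Suc i) g = (%_. 0)" for i
   proof (induction i)
    case (Suc i)
    have "(deriv ^^ Suc (Suc i)) g = deriv ((deriv ^^ Suc i) g)" by simp
    also have "... = deriv (%_. 0)" by (simp only: Suc.IH)
    finally show ?case by (simp add: fun_eq_iff)
   qed (simp add: d0 fun_eq_iff)
   thus ?thesis using k1 by (metis Suc_le_D One_nat_def)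
  qed
  hence "M z = 0" for z unfolding diff_monomial_def using nk by (auto simp: prod_zero_iff intro!: bexI[of _ k])
  hence "Psi = (%_. -1)" by (simp add: reduced_def fun_eq_iff)
  thus False using dPsi0 by simp
 next
  case False
  obtain C2 where C2: "0 <= C2" "!!\<rho> \<eta> X r R1 R2 R3. 1 <= \<rho> ==> 1 + cmod a0 <= \<rho> ==> 0 < \<eta> ==> \<eta> <= 1 ==> 1 <= X ==>
    circ \<rho> \<eta> X r ==> circ (4 * \<rho>) \<eta> X R1 ==> circ (16 * \<rho>) \<eta> X R2 ==> circ (64 * \<rho>) \<eta> X R3 ==>
    kap * chi g r <= 2 * real p0 * real E * ln r + C2 * (1 + ln (X + 1 / \<eta> + ln (128 * \<rho>)))"
   using scale_inequality by blast
  obtain a p where a: "a \<in> dv g" "real p <= \<bar>real_of_int (zorder g a)\<bar>" "1 <= p" "real p0 * real E + real p <= kap * real p"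
  proof (cases "\<exists>a\<in>dv g. zorder g a > 0")
   case True
   then obtain a where a: "a \<in> dv g" "zorder g a > 0" by blast
   have "real p0 <= \<bar>real_of_int (zorder g a)\<bar>" using zorder_pos_ge[OF a(2)] a(2) unfolding p0_def
    by (metis abs_of_pos of_int_0_less_iff of_int_le_iff of_int_of_nat_eq)
   moreover have "real p0 * real E + real p0 <= kap * real p0"
   proof -
    have "real E + 1 <= kap" using kap_ge E_le k1 by (simp add: p0_def)
    hence "real p0 * (real E + 1) <= real p0 * kap" by (intro mult_left_mono) auto
    thus ?thesis by (simp add: algebra_simps)
   qed
   ultimately show ?thesis using that[of a p0] a by (simp add: p0_def)
  next
   case no: False
   obtain a where a: "a \<in> dv g" using \<open>dv g ~= {}\<close> by blast
   have "~ zorder g a0 > 0" using no zorder_not_dv[of a0 g] by fastforce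
   hence "E = 1" by (simp add: E_def)
   moreover have "real p0 + 1 <= kap" using kap_ge m1 by linarith
   moreover have "1 <= \<bar>real_of_int (zorder g a)\<bar>" using zorder_dv_nonzero[OF a] by linarith
   ultimately show ?thesis using that[of a 1] a by simp
  qed
  define lg where "lg = \<bar>ln (cmod (g 0))\<bar>"
  define F where "F = kap * (2 * real p * \<bar>ln (cmod a)\<bar> + lg)"
  define e where "e = 1 / (C2 * (2 * C + 2) + 1)"
  have CC: "0 <= C2 * (2 * C + 2)" using C C2 by simp
  have e: "0 < e" using CC by (simp add: e_def)
  define F2 where "F2 = F + C2 * (1 + (e * (2 * C + 2) * (1 + ln 128) - ln e))"
  have key: "2 * ln \<rho> <= F2 + ln \<rho>" if rho: "1 + cmod a0 + b + 1 <= \<rho>" for \<rho>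
  proof -
   have rho1: "1 <= \<rho>" "1 + cmod a0 <= \<rho>" "b + 1 <= \<rho>" using rho norm_ge_zero[of a0] b(2) by linarith+
   have lr: "0 <= ln \<rho>" using rho1 by simp
   define X where "X = C * (1 + ln (64 * \<rho>))"
   have X1: "1 <= X" unfolding X_def using C(1) rho1 mult_mono[of 1 C 1 "1 + ln (64 * \<rho>)"] by simp
   have circle: "\<exists>R. circ s 1 X R" if s: "\<rho> <= s" "s <= 64 * \<rho>" for s
   proof -
    have "1 + cmod a0 <= s" using s rho1 by linarith
    then obtain R \<eta> where R: "0 < \<eta>" "circ s \<eta> (C * (1 + ln s)) R" using C(2) by blast
    have "C * (1 + ln s) <= X" unfolding X_def using C(1) s rho1 by (intro mult_left_mono) auto
    moreover have "1 <= \<bar>cmod x - R\<bar>" if "x \<in> insert a0 (dv g)" for x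
    proof -
     have "s <= R" using R by (simp add: circ_def)
     thus ?thesis using b(1)[OF that] s rho1 by linarith
    qed
    ultimately show ?thesis using R by (auto simp: circ_def)
   qed
   obtain r R1 R2 R3 where cc: "circ \<rho> 1 X r" "circ (4 * \<rho>) 1 X R1" "circ (16 * \<rho>) 1 X R2" "circ (64 * \<rho>) 1 X R3"
    using circle[of \<rho>] circle[of "4 * \<rho>"] circle[of "16 * \<rho>"] circle[of "64 * \<rho>"] rho1 by auto
   define V where "V = X + 1 / 1 + ln (128 * \<rho>)"
   have main: "kap * chi g r <= 2 * real p0 * real E * ln r + C2 * (1 + ln V)"
    unfolding V_def by (rule C2(2)[OF rho1(1,2) _ _ X1 cc]) auto
   have r: "\<rho> <= r" "sphere 0 r Int dv g = {}" using cc(1) circ_good[OF cc(1)] by (auto simp: circ_def)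
   have ab: "cmod a < r" using b(1)[of a] a(1) rho1 r by auto
   have low: "2 * real p * (ln r - ln (cmod a)) - lg <= chi g r"
   proof -
    have "a ~= 0" using a(1) g0 by auto
    hence "0 <= ln r - ln (cmod a)" using ab rho1 r by simp
    hence "2 * real p * (ln r - ln (cmod a)) <= 2 * \<bar>real_of_int (zorder g a)\<bar> * (ln r - ln (cmod a))"
     using a(2) by (intro mult_right_mono) auto
    thus ?thesis using chi_lower_bound[OF a(1) _ ab r(2)] r rho1 by (simp add: lg_def)
   qed
   have "kap * (2 * real p * (ln r - \<bar>ln (cmod a)\<bar>) - lg) <= kap * chi g r"
   proof (intro mult_left_mono)
    have "2 * real p * (ln r - \<bar>ln (cmod a)\<bar>) <= 2 * real p * (ln r - ln (cmod a))"
     by (intro mult_left_mono) auto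
    thus "2 * real p * (ln r - \<bar>ln (cmod a)\<bar>) - lg <= chi g r" using low by linarith
   qed (use kap_pos in simp)
   hence "2 * (kap * real p) * ln r - F <= 2 * real p0 * real E * ln r + C2 * (1 + ln V)"
    using main by (simp add: F_def algebra_simps)
   moreover have "2 * (real p0 * real E + real p) * ln r <= 2 * (kap * real p) * ln r"
    using a(4) r rho1 by (intro mult_right_mono) auto
   ultimately have 1: "2 * real p * ln r <= F + C2 * (1 + ln V)" by (simp add: algebra_simps)
   have 2: "2 * ln \<rho> <= 2 * real p * ln r"
   proof -
    have "ln \<rho> <= ln r" using r rho1 by simp
    moreover have "1 * ln r <= real p * ln r" using a(3) r rho1 by (intro mult_right_mono) auto
    ultimately show ?thesis by linarith
   qed
   have V: "0 < V" "V <= (2 * C + 2) * (1 + ln 128 + ln \<rho>)"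
   proof -
    have l: "0 <= ln (128 * \<rho>)" "ln (64 * \<rho>) <= ln (128 * \<rho>)" "ln (128 * \<rho>) = ln 128 + ln \<rho>"
     using rho1 by (auto simp: ln_mult)
    thus "0 < V" using X1 unfolding V_def by linarith
    have "X <= C * (1 + ln (128 * \<rho>))" unfolding X_def using l C(1) by (intro mult_left_mono) auto
    moreover have "0 <= C * (1 + ln (128 * \<rho>))" using l C(1) by (intro mult_nonneg_nonneg) auto
    moreover have "x + 1 / 1 + u <= 2 * y + 2 * (1 + u)" if "x <= y" "0 <= y" "0 <= u" for x y u :: real
     using that by simp
    ultimately have "V <= 2 * (C * (1 + ln (128 * \<rho>))) + 2 * (1 + ln (128 * \<rho>))" unfolding V_def using l(1) by blast
    thus "V <= (2 * C + 2) * (1 + ln 128 + ln \<rho>)" unfolding l(3) by (simp add: algebra_simps)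
   qed
   have "ln V <= e * V - ln e" using V e by (intro ln_le_linear)
   also have "... <= e * ((2 * C + 2) * (1 + ln 128 + ln \<rho>)) - ln e" using V e by (intro diff_right_mono mult_left_mono) auto
   finally have "1 + ln V <= (1 + (e * (2 * C + 2) * (1 + ln 128) - ln e)) + e * (2 * C + 2) * ln \<rho>"
    by (simp add: algebra_simps)
   hence "C2 * (1 + ln V) <= C2 * ((1 + (e * (2 * C + 2) * (1 + ln 128) - ln e)) + e * (2 * C + 2) * ln \<rho>)"
    using C2 by (intro mult_left_mono) auto
   also have "... = C2 * (1 + (e * (2 * C + 2) * (1 + ln 128) - ln e)) + (e * (C2 * (2 * C + 2))) * ln \<rho>"
    by (simp add: algebra_simps)
   also have "(e * (C2 * (2 * C + 2))) * ln \<rho> <= 1 * ln \<rho>"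
    using lr CC by (intro mult_right_mono) (auto simp: e_def)
   finally show ?thesis using 1 2 by (simp add: F2_def)
  qed
  define \<rho> where "\<rho> = (1 + cmod a0 + b + 1) * exp (\<bar>F2\<bar> + 1)"
  have big: "1 <= 1 + cmod a0 + b + 1" using b(2) norm_ge_zero[of a0] by linarith
  have "(1 + cmod a0 + b + 1) * 1 <= \<rho>" unfolding \<rho>_def using big by (intro mult_left_mono) auto
  hence "2 * ln \<rho> <= F2 + ln \<rho>" by (intro key) auto
  moreover have "\<bar>F2\<bar> + 1 <= ln \<rho>"
  proof -
   have "exp (\<bar>F2\<bar> + 1) <= \<rho>" unfolding \<rho>_def using big by (simp add: mult_le_cancel_right1)
   thus ?thesis by (meson exp_gt_zero ln_ge_iff less_le_trans)
  qed
  ultimately show False by linarith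
 qed
qed

end

section \<open>Affine substitutions and zero-free functions\<close>

lemma affine_filterlim:
 fixes a r :: complex
 assumes "r ~= 0"
 shows "filterlim (%w. a + r * w) (at (a + r * z)) (at z)"
proof (rule filterlim_atI)
 show "((%w. a + r * w) \<longlongrightarrow> a + r * z) (at z)" by (intro tendsto_intros)
 show "\<forall>\<^sub>F w in at z. a + r * w ~= a + r * z"
  using eventually_neq_at_within[of z z UNIV] by eventually_elim (use assms in auto)
qed

lemma is_pole_affine:
 fixes a r s :: complex
 assumes "r ~= 0" "s ~= 0"
 shows "is_pole (%z. s * f (a + r * z)) z \<longleftrightarrow> is_pole f (a + r * z)"
proof
 assume "is_pole f (a + r * z)"
 hence "is_pole (%z. f (a + r * z)) z"
  unfolding is_pole_def using filterlim_compose affine_filterlim[OF assms(1)] by blast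
 thus "is_pole (%z. s * f (a + r * z)) z" using assms by simp
next
 assume "is_pole (%z. s * f (a + r * z)) z"
 hence 1: "is_pole (%z. f (a + r * z)) z" using assms by simp
 have "filterlim (%w. - a / r + (1 / r) * w) (at (- a / r + (1 / r) * (a + r * z))) (at (a + r * z))"
  by (rule affine_filterlim) (use assms in simp)
 moreover have "- a / r + (1 / r) * (a + r * z) = z" using assms by (simp add: field_simps)
 ultimately have "filterlim (%w. - a / r + (1 / r) * w) (at z) (at (a + r * z))" by simp
 from filterlim_compose[OF 1[unfolded is_pole_def] this]
 have "filterlim (%w. f (a + r * (- a / r + (1 / r) * w))) at_infinity (at (a + r * z))" .
 moreover have "a + r * (- a / r + (1 / r) * w) = w" for w using assms by (simp add: field_simps)
 ultimately show "is_pole f (a + r * z)" by (simp add: is_pole_def)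
qed

lemma isolated_zero_affine:
 fixes a r s :: complex
 assumes "r ~= 0" "s ~= 0"
 shows "isolated_zero (%z. s * f (a + r * z)) z \<longleftrightarrow> isolated_zero f (a + r * z)"
 using is_pole_affine[of r "inverse s" "%z. inverse (f z)" a z] assms
 by (simp add: is_pole_inverse_iff[symmetric])

lemma nicely_meromorphic_affine:
 fixes a r s :: complex
 assumes f: "f nicely_meromorphic_on A" and rs: "r ~= 0" "s ~= 0"
 shows "(%z. s * f (a + r * z)) nicely_meromorphic_on {z. a + r * z \<in> A}"
 unfolding nicely_meromorphic_on_def
proof (intro conjI ballI)
 have "f meromorphic_on A" using f by (simp add: nicely_meromorphic_on_def)
 hence "(%z. f (a + r * z)) meromorphic_on {z. a + r * z \<in> A}"
  by (rule meromorphic_on_compose) (auto intro!: analytic_intros)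
 thus "(%z. s * f (a + r * z)) meromorphic_on {z. a + r * z \<in> A}" by (intro meromorphic_intros)
 fix z assume "z \<in> {z. a + r * z \<in> A}"
 hence "(is_pole f (a + r * z) & f (a + r * z) = 0) | f \<midarrow>(a + r * z)\<rightarrow> f (a + r * z)"
  using f by (auto simp: nicely_meromorphic_on_def)
 thus "is_pole (%z. s * f (a + r * z)) z & s * f (a + r * z) = 0 \<or>
   (%z. s * f (a + r * z)) \<midarrow>z\<rightarrow> s * f (a + r * z)"
 proof
  assume "f \<midarrow>(a + r * z)\<rightarrow> f (a + r * z)"
  hence "(%z. f (a + r * z)) \<midarrow>z\<rightarrow> f (a + r * z)"
   using filterlim_compose affine_filterlim[OF rs(1)] by blast
  thus ?thesis by (intro disjI2 tendsto_intros)
 qed (use is_pole_affine[OF rs] in auto)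
qed

lemma zorder_affine:
 fixes a r s :: complex
 assumes f: "f meromorphic_on {a + r * z}" and rs: "r ~= 0" "s ~= 0"
 shows "zorder (%z. s * f (a + r * z)) z = zorder f (a + r * z)"
proof -
 define h where "h = (%w. f (a + w))"
 have "h meromorphic_on {r * z}"
  unfolding h_def by (rule meromorphic_on_compose[OF f]) (auto intro!: analytic_intros)
 hence "zorder (%w. h (r * w)) z = zorder h (r * z)" using rs by (intro zorder_scale)
 also have "... = zorder (%u. h (u + r * z)) 0" by (rule zorder_shift)
 also have "(%u. h (u + r * z)) = (%u. f (u + (a + r * z)))" by (simp add: h_def add_ac)
 also have "zorder ... 0 = zorder f (a + r * z)" by (rule zorder_shift[symmetric])
 finally show ?thesis using rs by (simp add: zorder_cmult h_def)
qed

lemma zeros_mult_ge_affine: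
 fixes a r s :: complex
 assumes "zeros_mult_ge A p f" "f meromorphic_on A" "r ~= 0" "s ~= 0"
 shows "zeros_mult_ge {z. a + r * z \<in> A} p (%z. s * f (a + r * z))"
 unfolding zeros_mult_ge_def
proof safe
 fix z assume z: "a + r * z \<in> A" "isolated_zero (%z. s * f (a + r * z)) z"
 hence "int p <= zorder f (a + r * z)"
  using assms isolated_zero_affine[OF assms(3,4)] by (auto simp: zeros_mult_ge_def)
 also have "... = zorder (%z. s * f (a + r * z)) z"
  using assms z by (intro zorder_affine[symmetric]) (auto intro: meromorphic_on_subset)
 finally show "int p <= zorder (%z. s * f (a + r * z)) z" .
qed

lemma higher_deriv_affine:
 fixes a r s :: complex
 assumes f: "f analytic_on {a + r * z}"
 shows "(deriv ^^ j) (%z. s * f (a + r * z)) z = s * r ^ j * (deriv ^^ j) f (a + r * z)"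
proof -
 obtain T where T: "open T" "a + r * z \<in> T" "f holomorphic_on T" using f analytic_at by blast
 define S where "S = {w. r * w + a \<in> T}"
 have "S = (%w. r * w + a) -` T" by (auto simp: S_def)
 hence S: "open S" using T(1) by (simp add: continuous_open_vimage)
 have zS: "z \<in> S" using T by (simp add: S_def add.commute)
 have hol: "(%w. f (r * w + a)) holomorphic_on S"
 proof -
  have "(%w. r * w + a) holomorphic_on S" by (intro holomorphic_intros)
  moreover have "(%w. r * w + a) ` S \<subseteq> T" by (auto simp: S_def)
  ultimately show ?thesis
   using holomorphic_on_compose_gen[of "%w. r * w + a" S f T] T(3) by (simp add: o_def)
 qed
 have "(deriv ^^ j) (%w. f (r * w + a)) z = r ^ j * (deriv ^^ j) f (r * z + a)"
  by (rule higher_deriv_compose_linear'[OF T(3) S T(1) zS]) (simp add: S_def)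
 moreover have "(deriv ^^ j) (%w. s * f (r * w + a)) z = s * (deriv ^^ j) (%w. f (r * w + a)) z"
  using hol S zS by (intro higher_deriv_cmult)
 ultimately show ?thesis by (simp add: add.commute)
qed

lemma diff_monomial_affine:
 fixes a r s :: complex
 assumes f: "f analytic_on {a + r * z}"
 shows "diff_monomial k n (%z. s * f (a + r * z)) z =
      s ^ (\<Sum>j\<le>k. n j) * r ^ (\<Sum>j\<le>k. j * n j) * diff_monomial k n f (a + r * z)"
proof -
 have "diff_monomial k n (%z. s * f (a + r * z)) z =
   (\<Prod>j\<le>k. (s * r ^ j * (deriv ^^ j) f (a + r * z)) ^ n j)"
  unfolding diff_monomial_def by (intro prod.cong refl) (simp add: higher_deriv_affine[OF f])
 also have "... = (\<Prod>j\<le>k. s ^ n j) * (\<Prod>j\<le>k. r ^ (j * n j)) * (\<Prod>j\<le>k. ((deriv ^^ j) f (a + r * z)) ^ n j)"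
  by (simp add: power_mult_distrib prod.distrib power_mult)
 finally show ?thesis by (simp add: power_sum diff_monomial_def)
qed

lemma zero_free_polynomial_constant:
 fixes f :: "complex => complex"
 assumes "!!z. f z = (\<Sum>i\<le>N. a i * z ^ i)" "!!z. f z ~= 0"
 shows "f z = f 0"
proof -
 have z: "\<forall>i\<in>{1..N}. a i = 0"
 proof (rule ccontr)
  assume "~ ?thesis"
  then obtain w where "(\<Sum>i\<le>N. a i * w ^ i) = 0" using fundamental_theorem_of_algebra[of a N] by metis
  thus False using assms by metis
 qed
 have "f z = a 0" for z
 proof -
  have "(\<Sum>i\<le>N. a i * z ^ i) = (\<Sum>i\<in>{0}. a i * z ^ i)"
   using z by (intro sum.mono_neutral_right) auto
  thus ?thesis using assms(1)[of z] by simp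
 qed
 thus ?thesis by simp
qed

text \<open>
 Such a g is a polynomial of degree less than p, whereas a zero would need order p; so g has no zeros.
\<close>

lemma vanishing_derivative_imp_constant:
 assumes g: "g nicely_meromorphic_on UNIV" "zeros_mult_ge UNIV p g" and j: "j <= p"
  and d: "!!z. ~ is_pole g z ==> (deriv ^^ j) g z = 0"
 shows "\<exists>w. \<forall>z. g z = w"
proof -
 have gm: "g meromorphic_on A" for A using g(1) by (auto simp: nicely_meromorphic_on_def intro: meromorphic_on_subset)
 have no: False if "\<exists>\<^sub>F w in at b. g w ~= 0" "zorder g b < 0 | int j <= zorder g b" for b
 proof -
  have "\<exists>\<^sub>F w in at b. (deriv ^^ j) g w ~= 0" using zorder_higher_deriv[OF gm that] by blast
  moreover have "\<forall>\<^sub>F w in at b. ~ is_pole g w"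
   using gm[of "{b}"] by (intro eventually_not_pole) (auto simp: meromorphic_at_iff)
  hence "\<forall>\<^sub>F w in at b. (deriv ^^ j) g w = 0" by eventually_elim (rule d)
  ultimately show False by (simp add: frequently_def)
 qed
 have np: "~ is_pole g b" for b
 proof
  assume b: "is_pole g b"
  have "\<exists>\<^sub>F w in at b. g w ~= 0"
   using non_zero_neighbour_pole[OF b] by (rule eventually_frequently[rotated]) auto
  moreover have "zorder g b < 0" using isolated_pole_imp_neg_zorder[OF _ b] gm[of "{b}"] by (auto simp: meromorphic_at_iff)
  ultimately show False using no[of b] by blast
 qed
 have an: "g analytic_on A" for A
  using analytic_on_subset[OF nicely_meromorphic_without_singularities[OF g(1)], of A] np by simp
 have hol: "g holomorphic_on UNIV" using an[of UNIV] by (rule analytic_imp_holomorphic)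
 show ?thesis
 proof (cases "\<exists>b. g b = 0")
  case True
  then obtain b where b: "g b = 0" by blast
  show ?thesis
  proof (cases "isolated_zero g b")
   case True
   hence "int p <= zorder g b" using g(2) unfolding zeros_mult_ge_def by blast
   hence "int j <= zorder g b" using j by linarith
   moreover have "\<exists>\<^sub>F w in at b. g w ~= 0"
    using True eventually_frequently[of "at b"] unfolding isolated_zero_def by simp
   ultimately show ?thesis using no[of b] by blast
  next
   case False
   hence "\<forall>\<^sub>F w in at b. g w = 0" using non_isolated_zero_imp_eventually_zero[OF an b] by blast
   hence "\<exists>\<^sub>F w in at b. g w = 0" by (rule eventually_frequently[rotated]) auto
   hence "g w = 0" for w
    by (rule frequently_eq_meromorphic_imp_constant[OF _ g(1)]) auto
   thus ?thesis by blast
  qed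
 next
  case False
  have dz: "(deriv ^^ i) g z = 0" if "j <= i" for i z
  proof -
   have "(deriv ^^ (j + l)) g = (%_. 0)" for l
   proof (induction l)
    case 0
    thus ?case using d np by (simp add: fun_eq_iff)
   next
    case (Suc l)
    have "(deriv ^^ (j + Suc l)) g = deriv ((deriv ^^ (j + l)) g)" by simp
    also have "... = deriv (%_. 0)" by (simp only: Suc.IH)
    finally show ?case by (simp add: fun_eq_iff)
   qed
   from this[of "i - j"] show ?thesis using that by simp
  qed
  have "g z = (\<Sum>i\<le>j. ((deriv ^^ i) g 0 / fact i) * z ^ i)" for z
  proof -
   have "(%i. (deriv ^^ i) g 0 / fact i * (z - 0) ^ i) sums g z"
    using holomorphic_on_subset[OF hol, of "ball 0 (cmod z + 1)"]
    by (intro holomorphic_power_series[of g 0 "cmod z + 1"]) auto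
   moreover have "(%i. (deriv ^^ i) g 0 / fact i * (z - 0) ^ i) sums (\<Sum>i\<le>j. (deriv ^^ i) g 0 / fact i * (z - 0) ^ i)"
   proof (rule sums_finite)
    fix i :: nat assume "i \<notin> {..j}"
    thus "(deriv ^^ i) g 0 / fact i * (z - 0) ^ i = 0" using dz[of i 0] by simp
   qed simp
   ultimately show ?thesis by (simp add: sums_unique2)
  qed
  hence "g z = g 0" for z
   using zero_free_polynomial_constant[where f = g and N = j and a = "%i. (deriv ^^ i) g 0 / fact i"] False by blast
  thus ?thesis by blast
 qed
qed

lemma monomial_factor_vanishes:
 assumes g: "g nicely_meromorphic_on UNIV" and M: "!!z. ~ is_pole g z ==> diff_monomial k n g z = 0"
 obtains j where "j <= k" "!!z. ~ is_pole g z ==> (deriv ^^ j) g z = 0"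
proof -
 have gm: "g meromorphic_on UNIV" using g by (simp add: nicely_meromorphic_on_def)
 have pm: "(deriv ^^ j) g meromorphic_on UNIV" for j using gm by (rule meromorphic_on_higher_deriv)
 have np: "\<forall>\<^sub>\<approx>z\<in>UNIV. ~ is_pole g z" using meromorphic_on_imp_not_pole_cosparse[OF gm] .
 have "\<exists>j\<le>k. \<forall>\<^sub>\<approx>z\<in>UNIV. (deriv ^^ j) g z = 0"
 proof (rule ccontr)
  assume "~ ?thesis"
  hence n0: "~ (\<forall>\<^sub>\<approx>z\<in>UNIV. (deriv ^^ j) g z = 0)" if "j <= k" for j using that by blast
  have "\<forall>\<^sub>\<approx>z\<in>UNIV. (deriv ^^ j) g z ~= 0" if "j <= k" for j
   using meromorphic_imp_constant_or_avoid[OF pm[of j] open_UNIV connected_UNIV, of 0] n0[OF that] by blast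
  hence "\<forall>\<^sub>\<approx>z\<in>UNIV. \<forall>j\<in>{..k}. (deriv ^^ j) g z ~= 0"
   by (intro eventually_ball_finite) auto
  with np have "\<forall>\<^sub>\<approx>z::complex\<in>UNIV. False"
   by eventually_elim (use M in \<open>auto simp: diff_monomial_def\<close>)
  hence "\<forall>\<^sub>F z::complex in at 0. False" by (rule eventually_cosparse_imp_eventually_at) auto
  thus False by simp
 qed
 then obtain j where j: "j <= k" "\<forall>\<^sub>\<approx>z\<in>UNIV. (deriv ^^ j) g z = 0" by blast
 have "(deriv ^^ j) g z = 0" if z: "~ is_pole g z" for z
 proof -
  have "g analytic_on {z}" using nicely_meromorphic_on_imp_analytic_at[OF g _ z] by simp
  hence "(deriv ^^ j) g analytic_on {z}" by (rule analytic_higher_deriv)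
  hence "(deriv ^^ j) g \<midarrow>z\<rightarrow> (deriv ^^ j) g z" using analytic_at_imp_isCont isCont_def by blast
  moreover have "\<forall>\<^sub>F w in at z. (deriv ^^ j) g w = 0"
   using j(2) by (rule eventually_cosparse_imp_eventually_at) auto
  hence "(deriv ^^ j) g \<midarrow>z\<rightarrow> 0" by (rule tendsto_eventually)
  ultimately show ?thesis using tendsto_unique[of "at z"] by auto
 qed
 thus ?thesis using that j by blast
qed

text \<open>
 The logarithmic derivative of g grows at most linearly, so \<open>diff_monomial_bound\<close> bounds |z - a|^t by a polynomial times a power of |g|.
 Thus a power of 1 / g has polynomial growth and is a polynomial without zeros.
\<close>

lemma zero_free_monomial_constant:
 assumes g: "g nicely_meromorphic_on UNIV" and L: "0 < L" "L-lipschitz_on UNIV (sphere_value g)"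
  and dv: "dv g = {}" and c: "c ~= 0" and n: "1 <= (\<Sum>j\<le>k. n j)"
  and M: "!!z. diff_monomial k n g z = c * (z - a) ^ t"
 shows "\<exists>w. \<forall>z. g z = w"
proof -
 have gm: "g meromorphic_on UNIV" using g by (simp add: nicely_meromorphic_on_def)
 have gnz: "g z ~= 0" "g analytic_on {z}" for z using dv by (auto simp: dv_def)
 have hol: "g holomorphic_on UNIV" using gnz by (intro analytic_imp_holomorphic) (auto simp: analytic_on_analytic_at[of g UNIV])
 define B0 where "B0 = ln (1 + (cmod (g 0))^2) + \<bar>ln (cmod (g 0))\<bar> + 2 * (L^2 / 4 + 1)"
 have B0: "0 <= B0" unfolding B0_def by (intro add_nonneg_nonneg) auto
 have chi: "chi g R <= B0 * R^2" if R: "1 <= R" for R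
 proof -
  have "chi g R <= (ln (1 + (cmod (g 0))^2) + \<bar>ln (cmod (g 0))\<bar>) + 2 * (L^2 / 4 + 1) * R^2"
   using R dv by (intro lipschitz_growth[OF g _ L]) auto
  moreover have "(ln (1 + (cmod (g 0))^2) + \<bar>ln (cmod (g 0))\<bar>) * 1 <= (ln (1 + (cmod (g 0))^2) + \<bar>ln (cmod (g 0))\<bar>) * R^2"
   using R by (intro mult_left_mono one_le_power) auto
  moreover have "x <= (q + z) * y" if "x <= q + z * y" "q * 1 <= q * y" for x y z q :: real
   using that by (simp add: distrib_right)
  ultimately show ?thesis unfolding B0_def by blast
 qed
 have ld: "cmod (deriv g z / g z) <= 16 * B0 * (cmod z + 1)" for z
 proof -
  define R where "R = 2 * (cmod z + 1)"
  have R: "1 <= R" "cmod z < R" "R / 2 <= R - cmod z"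
   by (simp_all add: R_def add_nonneg_pos)
  have "cmod (deriv g z / g z) <= nn g R / 1 + 2 * R / (R - cmod z)^2 * (chi g R + 2 * nn g R * ln (2 * R))"
   using R dv by (intro logarithmic_derivative_bound[OF gm]) auto
  also have "... = 2 * R / (R - cmod z)^2 * chi g R" using dv by (simp add: nn_def)
  also have "... <= 2 * R / (R / 2)^2 * (B0 * R^2)"
  proof (intro mult_mono chi R)
   have "(R / 2)^2 <= (R - cmod z)^2" using R by (intro power_mono) auto
   thus "2 * R / (R - cmod z)^2 <= 2 * R / (R / 2)^2" using R by (intro frac_le) auto
   show "0 <= chi g R" unfolding chi_def using R dv
    by (intro add_nonneg_nonneg cmean_nonneg sum_nonneg continuous_on_rabs continuous_on_ln_cmod_dv) auto
  qed (use R in auto)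
  also have "... = 8 * B0 * R" using R by (simp add: power2_eq_square)
  also have "... = 16 * B0 * (cmod z + 1)" by (simp add: R_def algebra_simps)
  finally show ?thesis .
 qed
 define d where "d = (\<Sum>j\<le>k. n j)"
 define w where "w = (\<Sum>j\<le>k. j * n j)"
 define B1 where "B1 = 32 * B0 + 1"
 have Mb: "cmod (c * (z - a) ^ t) <= weight_const k n * (B1 * (cmod z + 1)) ^ w * cmod (g z) ^ d" for z
 proof -
  define B where "B = 16 * B0 * (cmod z + 2)"
  have bd: "cmod (deriv g x / g x) <= B" if "x \<in> ball z 1" for x
  proof -
   have "cmod x <= cmod z + 1" using that norm_triangle_sub[of x z] by (simp add: dist_norm norm_minus_commute)
   hence "16 * B0 * (cmod x + 1) <= B" unfolding B_def using B0 by (intro mult_left_mono) auto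
   thus ?thesis using ld[of x] by linarith
  qed
  have "0 <= B" unfolding B_def using B0 by (intro mult_nonneg_nonneg add_nonneg_nonneg) auto
  have "cmod (diff_monomial k n g z) <= weight_const k n * (B + 1 / 1) ^ w * cmod (g z) ^ d"
   unfolding w_def d_def using hol gnz bd \<open>0 <= B\<close>
   by (intro diff_monomial_bound(1)[where \<eta> = 1 and B = B]) (auto intro: holomorphic_on_subset)
  also have "... <= weight_const k n * (B1 * (cmod z + 1)) ^ w * cmod (g z) ^ d"
  proof (intro mult_right_mono mult_left_mono power_mono)
   have "B <= 16 * B0 * (2 * (cmod z + 1))" unfolding B_def using B0 by (intro mult_left_mono) auto
   thus "B + 1 / 1 <= B1 * (cmod z + 1)" by (simp add: B1_def algebra_simps add_increasing)
  qed (use \<open>0 <= B\<close> weight_const_pos[of k n] in auto)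
  finally show ?thesis by (simp add: M)
 qed
 define q where "q = (%z. inverse (g z) ^ d)"
 have qh: "q holomorphic_on UNIV" unfolding q_def using hol gnz by (intro holomorphic_intros) auto
 define B2 where "B2 = weight_const k n * (B1 * 2) ^ w / cmod c"
 have qb: "cmod (q z) <= B2 * cmod z ^ w" if z: "1 + cmod a <= cmod z" for z
 proof -
  have z1: "1 <= cmod (z - a)" "1 <= cmod z" using z norm_triangle_ineq2[of z a] norm_ge_zero[of a] by linarith+
  have "cmod c <= cmod (c * (z - a) ^ t)" using z1 by (simp add: norm_mult norm_power mult_le_cancel_left1)
  also have "... <= weight_const k n * (B1 * (cmod z + 1)) ^ w * cmod (g z) ^ d" by (rule Mb)
  also have "... <= weight_const k n * (B1 * (2 * cmod z)) ^ w * cmod (g z) ^ d"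
   using z1 B0 weight_const_pos[of k n]
   by (intro mult_right_mono mult_left_mono power_mono) (auto simp: B1_def)
  also have "... = (B2 * cmod c) * cmod z ^ w * cmod (g z) ^ d"
   using c by (simp add: B2_def power_mult_distrib mult_ac)
  finally have "cmod c * (1 / cmod (g z) ^ d) <= cmod c * (B2 * cmod z ^ w)"
   using gnz[of z] by (simp add: field_simps)
  hence "1 / cmod (g z) ^ d <= B2 * cmod z ^ w" by (rule mult_left_le_imp_le) (use c in simp)
  thus ?thesis by (simp add: q_def norm_power norm_inverse power_inverse divide_inverse)
 qed
 have "q z = (\<Sum>i\<le>w. ((deriv ^^ i) q 0 / fact i) * z ^ i)" for z
  by (rule Liouville_polynomial[OF qh qb])
 hence qc: "q z = q 0" for z
  by (rule zero_free_polynomial_constant) (use gnz in \<open>auto simp: q_def\<close>)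
 have dg: "deriv g z = 0" for z
 proof -
  have gd: "(g has_field_derivative deriv g z) (at z)" using hol holomorphic_derivI open_UNIV UNIV_I by blast
  have "((%z. g z ^ d) has_field_derivative of_nat d * g z ^ (d - 1) * deriv g z) (at z)"
   using gd by (auto intro!: derivative_eq_intros)
  moreover have "g z ^ d = g 0 ^ d" for z
   using qc[of z] by (simp add: q_def power_inverse)
  hence "(%z. g z ^ d) = (%_. g 0 ^ d)" by auto
  hence "((%z. g z ^ d) has_field_derivative 0) (at z)" by simp
  ultimately have "of_nat d * g z ^ (d - 1) * deriv g z = 0" by (rule DERIV_unique)
  moreover have "1 <= d" using n by (simp add: d_def)
  ultimately show ?thesis using gnz[of z] by auto
 qed
 have "(g has_field_derivative 0) (at x within UNIV)" for x
  using dg[of x] hol holomorphic_derivI[of g UNIV x] by simp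
 thus ?thesis using has_field_derivative_zero_constant[of UNIV g] by auto
qed

section \<open>Value distribution of differential monomials\<close>

lemma zorder_power_bounds:
 assumes "c ~= 0"
 shows "0 <= zorder (%z. c * (z - a) ^ t) b" "zorder (%z. c * (z - a) ^ t) b <= int t"
proof -
 have "zorder (%z. c * (z - a) ^ t) b = (if b = a then int t else 0)"
 proof (cases "b = a")
  case True
  thus ?thesis using assms by (intro zorder_eqI[of UNIV b "%_. c"]) auto
 next
  case False
  thus ?thesis using assms
   by (auto intro!: zorder_eqI[of UNIV b "%z. c * (z - a) ^ t"] holomorphic_intros)
 qed
 thus "0 <= zorder (%z. c * (z - a) ^ t) b" "zorder (%z. c * (z - a) ^ t) b <= int t" by auto
qed

lemma cosparse_exists: "\<forall>\<^sub>\<approx>z\<in>UNIV. P (z::complex) ==> \<exists>z. P z"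
proof -
 assume "\<forall>\<^sub>\<approx>z\<in>UNIV. P z"
 hence "\<forall>\<^sub>F z in at 0. P z" by (rule eventually_cosparse_imp_eventually_at) auto
 thus ?thesis using eventually_happens by fastforce
qed

lemma cosparse_neq: "\<forall>\<^sub>\<approx>z\<in>UNIV. z ~= (a::complex)"
proof -
 have "\<forall>\<^sub>\<approx>z\<in>UNIV. z - a = 0 | True" by simp
 have "(%z. z - a) meromorphic_on UNIV" by (intro meromorphic_intros)
 from meromorphic_imp_constant_or_avoid[OF this open_UNIV connected_UNIV, of 0] show ?thesis
 proof
  assume "\<forall>\<^sub>\<approx>z\<in>UNIV. z - a = 0"
  hence "\<forall>\<^sub>F z in at a. z - a = 0" by (rule eventually_cosparse_imp_eventually_at) auto
  moreover have "\<forall>\<^sub>F z in at a. z ~= a" by (rule eventually_neq_at_within)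
  ultimately have "\<forall>\<^sub>F z in at a. False" by eventually_elim auto
  thus ?thesis by simp
 qed simp
qed

lemma constant_if_deriv_vanishes:
 assumes F: "F meromorphic_on UNIV" and d: "\<forall>\<^sub>\<approx>z\<in>UNIV. deriv F z = 0"
 obtains w where "\<forall>\<^sub>\<approx>z\<in>UNIV. F z = w"
proof -
 have ev: "\<forall>\<^sub>\<approx>z\<in>UNIV. F analytic_on {z} & deriv F z = 0"
  using d meromorphic_on_imp_analytic_cosparse[OF F] by eventually_elim auto
 define P where "P = {z. ~ (F analytic_on {z} & deriv F z = 0)}"
 have P: "P sparse_in UNIV" using ev by (simp add: eventually_cosparse P_def)
 have op: "open (UNIV - P)" using sparse_in_UNIV_imp_closed[OF P] by (simp add: open_Diff)
 have con: "connected (UNIV - P)" using P by (intro sparse_imp_connected) auto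
 have D: "(F has_field_derivative 0) (at z)" if "z \<in> UNIV - P" for z
 proof -
  have "F analytic_on {z}" "deriv F z = 0" using that by (auto simp: P_def)
  thus ?thesis by (metis DERIV_deriv_iff_field_differentiable analytic_on_imp_differentiable_at insertI1)
 qed
 hence "continuous_on (UNIV - P) F"
  by (meson DERIV_isCont continuous_at_imp_continuous_on)
 then obtain w where w: "!!z. z \<in> UNIV - P ==> F z = w"
  using DERIV_zero_connected_constant[OF con op finite.emptyI, of F] D by auto
 have "\<forall>\<^sub>\<approx>z\<in>UNIV. F z = w"
  using ev by eventually_elim (rule w, simp add: P_def)
 thus ?thesis by (rule that)
qed

lemma lipschitz_translate:
 assumes "L-lipschitz_on UNIV (sphere_value g)"
 shows "L-lipschitz_on UNIV (sphere_value (%z. g (e + z)))"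
proof -
 have eq: "sphere_value (%z. g (e + z)) z = sphere_value g (e + z)" for z
  using is_pole_affine[of 1 1 g e z] by (simp add: sphere_value_def)
 have "dist (e + x) (e + y) = dist x y" for x y :: complex by (simp add: dist_norm)
 thus ?thesis using assms unfolding lipschitz_on_def eq by (metis UNIV_I)
qed

text \<open>
 If \<open>\<Psi>\<close> is not constant, a translation to a generic base point e leads to the locale \<open>omitted_value\<close>. If it is, M[g] is a constant
 multiple of (z - a0)^t. If the multiple is 0, some derivative of g vanishes; otherwise comparing orders excludes poles and
 zeros of g, a zero giving order more than t, and \<open>zero_free_monomial_constant\<close> applies.
\<close>

theorem value_distribution:
 fixes k m t :: nat and n :: "nat => nat"
 assumes g: "g nicely_meromorphic_on UNIV" and L: "L-lipschitz_on UNIV (sphere_value g)"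
  and kn: "1 <= k" "2 <= n 0" "1 <= n k" and m: "1 <= m" and t: "t <= m"
  and zm: "zeros_mult_ge UNIV (k + m + 1) g" and c: "c ~= 0"
  and omit: "(\<forall>z. z ~= a0 --> ~ is_pole g z --> diff_monomial k n g z ~= c * (z - a0) ^ t) \<or>
        (\<forall>z. ~ is_pole g z --> diff_monomial k n g z = c * (z - a0) ^ t)"
 shows "\<exists>w. \<forall>z. g z = w"
proof (rule ccontr)
 assume nc: "~ (\<exists>w. \<forall>z. g z = w)"
 define L' where "L' = L + 1"
 have L': "0 < L'" "L'-lipschitz_on UNIV (sphere_value g)"
 proof -
  have "0 <= L" using L by (simp add: lipschitz_on_def)
  thus "0 < L'" by (simp add: L'_def)
  show "L'-lipschitz_on UNIV (sphere_value g)" using L by (rule lipschitz_on_le) (simp add: L'_def)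
 qed
 have gm: "g meromorphic_on A" for A using g by (auto simp: nicely_meromorphic_on_def intro: meromorphic_on_subset)
 let ?M = "diff_monomial k n g"
 let ?Psi = "reduced k n c a0 t g"
 have Psim: "?Psi meromorphic_on UNIV"
  using meromorphic_diff_monomial[OF gm] unfolding reduced_def[abs_def] by (intro meromorphic_intros)
 have an: "g analytic_on {z}" if "~ is_pole g z" for z
  using nicely_meromorphic_on_imp_analytic_at[OF g _ that] by simp
 have ev: "\<forall>\<^sub>\<approx>z\<in>UNIV. g z ~= 0" "\<forall>\<^sub>\<approx>z\<in>UNIV. ~ is_pole g z" "\<forall>\<^sub>\<approx>z\<in>UNIV. ?Psi analytic_on {z}"
  using nicely_meromorphic_imp_constant_or_avoid[OF g, of 0] nc meromorphic_on_imp_not_pole_cosparse[OF gm]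
   meromorphic_on_imp_analytic_cosparse[OF Psim] by auto
 have gnz: "\<forall>\<^sub>F w in at b. g w ~= 0" for b
  using ev(1) by (rule eventually_cosparse_imp_eventually_at) auto
 have gfr: "\<exists>\<^sub>F w in at b. g w ~= 0" for b using gnz by (rule eventually_frequently[rotated]) auto
 show False
 proof (cases "(\<forall>\<^sub>\<approx>z\<in>UNIV. deriv ?Psi z ~= 0) & (\<forall>\<^sub>\<approx>z\<in>UNIV. ?Psi z ~= 0)")
  case True
  hence "\<forall>\<^sub>\<approx>z\<in>UNIV. deriv ?Psi z ~= 0" "\<forall>\<^sub>\<approx>z\<in>UNIV. ?Psi z ~= 0" by auto
  hence "\<forall>\<^sub>\<approx>z\<in>UNIV. deriv ?Psi z ~= 0 & ?Psi z ~= 0 & g z ~= 0 & ~ is_pole g z & ?Psi analytic_on {z} & z ~= a0"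
   using ev cosparse_neq[of a0] by eventually_elim auto
  then obtain e where e: "deriv ?Psi e ~= 0" "?Psi e ~= 0" "g e ~= 0" "~ is_pole g e" "?Psi analytic_on {e}" "e ~= a0"
   using cosparse_exists by blast
  have om: "diff_monomial k n g z ~= c * (z - a0) ^ t" if "z ~= a0" "~ is_pole g z" for z
  proof -
   have "~ (\<forall>z. ~ is_pole g z --> diff_monomial k n g z = c * (z - a0) ^ t)"
   proof
    assume "\<forall>z. ~ is_pole g z --> diff_monomial k n g z = c * (z - a0) ^ t"
    hence "?Psi e = 0" using e(4,6) c by (simp add: reduced_def)
    thus False using e(2) by simp
   qed
   thus ?thesis using omit that by blast
  qed
  define h where "h = (%z. g (e + z))"
  have ph: "is_pole h z \<longleftrightarrow> is_pole g (e + z)" for z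
   using is_pole_affine[of 1 1 g e z] by (simp add: h_def)
  have Mh: "diff_monomial k n h z = ?M (e + z)" if "~ is_pole g (e + z)" for z
   using diff_monomial_affine[of g e 1 z k n 1] an[OF that] by (simp add: h_def)
  let ?Ph = "reduced k n c (a0 - e) t h"
  have eq: "\<forall>\<^sub>F z in nhds 0. ?Ph z = ?Psi (e + z)"
  proof -
   obtain S where S: "open S" "e \<in> S" "g holomorphic_on S" using an[OF e(4)] analytic_at by blast
   have "\<forall>\<^sub>F z in nhds 0. z \<in> (%z. e + z) -` S"
    using S by (intro eventually_nhds_in_open) (auto intro!: continuous_open_vimage continuous_intros)
   thus ?thesis
   proof eventually_elim
    case (elim z)
    hence "~ is_pole g (e + z)" using S not_is_pole_holomorphic by auto
    thus ?case by (simp add: reduced_def Mh algebra_simps)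
   qed
  qed
  have "?Psi analytic_on {e + 1 * 0}" using e by simp
  have sh: "(%z. ?Psi (e + z)) analytic_on {0}"
  proof -
   have "(?Psi \<circ> (%z. e + z)) analytic_on {0}"
    using e(5) by (intro analytic_on_compose) (auto intro!: analytic_intros)
   thus ?thesis by (simp add: o_def)
  qed
  have "deriv ?Ph 0 = deriv (%z. ?Psi (e + z)) 0" using eq by (intro deriv_cong_ev) auto
  also have "... = deriv ?Psi e"
   using higher_deriv_affine[of ?Psi e 1 0 1 1] e(5) by simp
  finally have dP: "deriv ?Ph 0 = deriv ?Psi e" .
  have anP: "?Ph analytic_on {0}" using sh eq by (subst analytic_at_cong[of _ "%z. ?Psi (e + z)"]) auto
  have P0: "?Ph 0 = ?Psi e" using eventually_nhds_x_imp_x[OF eq] by simp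
  interpret omitted_value h k m t n c "a0 - e"
  proof
   show "h nicely_meromorphic_on UNIV"
    using nicely_meromorphic_affine[OF g, of 1 1 e] by (simp add: h_def)
   have "h analytic_on {0}"
    using nicely_meromorphic_on_imp_analytic_at[OF \<open>h nicely_meromorphic_on UNIV\<close>, of 0] ph[of 0] e(4) by simp
   thus "0 \<notin> dv h" using e(3) by (simp add: dv_def h_def)
   show "zeros_mult_ge UNIV (k + m + 1) h"
    using zeros_mult_ge_affine[OF zm gm, of 1 1 e] by (simp add: h_def)
   show "a0 - e ~= 0" using e by simp
   show "diff_monomial k n h z ~= c * (z - (a0 - e)) ^ t" if "z ~= a0 - e" "~ is_pole h z" for z
   proof -
    have "e + z ~= a0" using that(1) by (auto simp: algebra_simps)
    moreover have np: "~ is_pole g (e + z)" using that(2) ph by simp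
    ultimately have "?M (e + z) ~= c * (e + z - a0) ^ t" by (rule om)
    thus ?thesis using Mh[OF np] by (simp add: algebra_simps)
   qed
   show "0 \<notin> dv ?Ph" using anP P0 e(2) by (simp add: dv_def)
   show "deriv ?Ph 0 ~= 0" using dP e(1) by simp
  qed (use kn m t c in auto)
  show False using no_omitted_value[OF L'(1)] lipschitz_translate[OF L'(2), of e] by (simp add: h_def)
 next
  case False
  have "\<exists>w. \<forall>\<^sub>\<approx>z\<in>UNIV. ?Psi z = w"
  proof (cases "\<forall>\<^sub>\<approx>z\<in>UNIV. ?Psi z ~= 0")
   case True
   hence "~ (\<forall>\<^sub>\<approx>z\<in>UNIV. deriv ?Psi z ~= 0)" using False by blast
   hence "\<forall>\<^sub>\<approx>z\<in>UNIV. deriv ?Psi z = 0"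
    using meromorphic_imp_constant_or_avoid[OF meromorphic_on_deriv[OF Psim] open_UNIV connected_UNIV, of 0] by blast
   thus ?thesis using constant_if_deriv_vanishes[OF Psim] by blast
  next
   case False
   thus ?thesis using meromorphic_imp_constant_or_avoid[OF Psim open_UNIV connected_UNIV, of 0] by blast
  qed
  then obtain w where w: "\<forall>\<^sub>\<approx>z\<in>UNIV. ?Psi z = w" by blast
  define c1 where "c1 = (w + 1) * c"
  have Mw: "\<forall>\<^sub>\<approx>z\<in>UNIV. ?M z = c1 * (z - a0) ^ t"
   using w cosparse_neq[of a0]
  proof eventually_elim
   case (elim z)
   hence "?M z / (c * (z - a0) ^ t) = w + 1" by (simp add: reduced_def diff_eq_eq)
   thus ?case using elim(2) c by (simp add: c1_def field_simps)
  qed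
  have Mev: "\<forall>\<^sub>F z in at b. ?M z = c1 * (z - a0) ^ t" for b
   using Mw by (rule eventually_cosparse_imp_eventually_at) auto
  have M: "?M z = c1 * (z - a0) ^ t" if z: "~ is_pole g z" for z
  proof -
   have "?M \<midarrow>z\<rightarrow> ?M z"
    using diff_monomial_analytic[OF an[OF z], of k n] analytic_at_imp_isCont isCont_def by blast
   moreover have "(%z. c1 * (z - a0) ^ t) \<midarrow>z\<rightarrow> c1 * (z - a0) ^ t" by (intro tendsto_intros)
   hence "?M \<midarrow>z\<rightarrow> c1 * (z - a0) ^ t"
    using tendsto_cong[OF Mev[of z]] by simp
   ultimately show ?thesis using tendsto_unique[of "at z"] by auto
  qed
  show False
  proof (cases "c1 = 0")
   case True
   obtain j where "j <= k" "!!z. ~ is_pole g z ==> (deriv ^^ j) g z = 0"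
    using monomial_factor_vanishes[OF g, of k n] M True by auto
   thus False using vanishing_derivative_imp_constant[OF g zm, of j] nc by auto
  next
   case c1: False
   have zo: "zorder ?M b = zorder (%z. c1 * (z - a0) ^ t) b" for b
    using Mev by (intro zorder_cong) auto
   note dw = degree_weight_bound[OF kn]
   have pole: "~ is_pole g b" for b
   proof
    assume b: "is_pole g b"
    have neg: "zorder g b < 0" using isolated_pole_imp_neg_zorder[OF _ b] gm[of "{b}"] by (auto simp: meromorphic_at_iff)
    have "zorder ?M b = int (\<Sum>j\<le>k. n j) * zorder g b - int (\<Sum>j\<le>k. j * n j)"
     using zorder_diff_monomial(1)[OF gm gfr] neg by blast
    moreover have "int (\<Sum>j\<le>k. n j) * zorder g b <= 0" using neg by (intro mult_nonneg_nonpos of_nat_0_le_iff) auto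
    moreover have "0 < int (\<Sum>j\<le>k. j * n j)" using dw(3) kn(1) by linarith
    ultimately show False using zo[of b] zorder_power_bounds(1)[OF c1, of a0 t b] by linarith
   qed
   have zero: "g b ~= 0" for b
   proof
    assume b: "g b = 0"
    have "isolated_zero g b" using isolated_zero_analytic_iff[OF an[OF pole]] b gnz by blast
    hence p: "int (k + m + 1) <= zorder g b" using zm unfolding zeros_mult_ge_def by blast
    define d where "d = (\<Sum>j\<le>k. n j)"
    define u where "u = (\<Sum>j\<le>k. j * n j)"
    have "zorder ?M b = int d * zorder g b - int u"
     using zorder_diff_monomial(1)[OF gm gfr, of b k n] p by (simp add: d_def u_def)
    moreover have "int d * int (k + m + 1) <= int d * zorder g b" using p by (intro mult_left_mono) auto
    moreover have "int d * int (k + m + 1) = int k * int d + int d * int (m + 1)" by (simp add: algebra_simps)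
    moreover have "int u <= int k * int d"
     using dw(2) unfolding d_def[symmetric] u_def[symmetric] by (metis add_leD1 of_nat_le_iff of_nat_mult)
    moreover have "int (m + 1) <= int d * int (m + 1)"
    proof -
     have "1 <= int d" using dw(1) unfolding d_def[symmetric] by linarith
     from mult_right_mono[OF this, of "int (m + 1)"] show ?thesis by simp
    qed
    ultimately have "int (m + 1) <= zorder ?M b" by linarith
    thus False using zo[of b] zorder_power_bounds(2)[OF c1, of a0 t b] t by linarith
   qed
   have dv: "dv g = {}" using zero an[OF pole] by (auto simp: dv_def)
   have "1 <= (\<Sum>j\<le>k. n j)" using dw(1) by simp
   thus False
    using zero_free_monomial_constant[OF g L' dv c1, where k = k and n = n and a = a0 and t = t] M pole nc by auto
  qed
 qed
qed

section \<open>The sphere, spherical derivatives and equicontinuity\<close>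

text \<open>
 At a pole the spherical derivative is that of 1 / f, since inversion is an isometry of the sphere.
\<close>

definition sphderiv :: "(complex => complex) => complex => real" where
 "sphderiv f z = (if is_pole f z then cmod (deriv (%w. inverse (f w)) z)
          else cmod (deriv f z) / (1 + (cmod (f z))^2))"

text \<open>
 Inversion \<open>z \<mapsto> 1 / z\<close> on the sphere: a rotation, hence an isometry.
\<close>

definition sphere_reflection :: "complex \<times> real => complex \<times> real" where
 "sphere_reflection p = (cnj (fst p), - snd p)"

definition unproject :: "complex \<times> real => complex" where
 "unproject p = fst p / of_real (1 - snd p)"

lemma sphere_reflection_invol [simp]: "sphere_reflection (sphere_reflection p) = p"
 by (simp add: sphere_reflection_def)

lemma dist_sphere_reflection: "dist (sphere_reflection p) (sphere_reflection q) = dist p q"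
proof -
 have "dist (cnj a) (cnj b) = dist a b" for a b by (metis complex_cnj_diff complex_mod_cnj dist_norm)
 moreover have "dist (- a) (- b) = dist a b" for a b :: real by (simp add: dist_norm)
 ultimately show ?thesis by (simp add: sphere_reflection_def dist_prod_def)
qed

lemma one_plus_norm_sq_pos [simp]: "0 < 1 + (cmod z)^2" "1 + (cmod z)^2 ~= 0" "1 + (of_real (cmod z))^2 ~= (0 :: complex)"
proof -
 show "0 < 1 + (cmod z)^2" by (simp add: add_pos_nonneg)
 thus "1 + (cmod z)^2 ~= 0" by simp
 thus "1 + (of_real (cmod z))^2 ~= (0 :: complex)"
  by (metis of_real_1 of_real_add of_real_eq_0_iff of_real_power)
qed

lemma unproject_stereographic [simp]: "unproject (stereographic z) = z"
proof -
 define a where "a = 1 + (cmod z)^2"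
 have a: "0 < a" by (simp add: a_def)
 have "1 - (a - 2) / a = 2 / a" using a by (simp add: field_simps)
 moreover have "stereographic z = (2 * z / of_real a, (a - 2) / a)" by (simp add: stereographic_def a_def)
 ultimately show ?thesis using a by (simp add: unproject_def)
qed

lemma stereographic_ne_infinity [simp]: "stereographic z ~= sphere_infinity"
proof
 assume "stereographic z = sphere_infinity"
 hence "dist (stereographic z) sphere_infinity = 0" by simp
 hence "sqrt (1 + (cmod z)^2) = 0" unfolding dist_stereographic_infinity by simp
 thus False by simp
qed

lemma stereographic_inject [simp]: "stereographic z = stereographic w \<longleftrightarrow> z = w"
 by (metis unproject_stereographic)

lemma sphere_reflection_zero [simp]: "sphere_reflection (stereographic 0) = sphere_infinity"
 by (simp add: sphere_reflection_def stereographic_def sphere_infinity_def)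

lemma sphere_reflection_infinity [simp]: "sphere_reflection sphere_infinity = stereographic 0"
 by (simp add: sphere_reflection_def stereographic_def sphere_infinity_def)

lemma sphere_reflection_stereographic:
 assumes "z ~= 0"
 shows "sphere_reflection (stereographic z) = stereographic (inverse z)"
proof -
 define s where "s = (cmod z)^2"
 have s: "0 < s" using assms by (simp add: s_def)
 have si: "(cmod (inverse z))^2 = 1 / s" by (simp add: s_def norm_inverse power_inverse divide_inverse)
 have zc: "inverse z = cnj z / of_real s"
 proof -
  have "of_real s = z * cnj z" by (simp add: s_def complex_norm_square del: of_real_power)
  thus ?thesis using assms by (simp add: divide_inverse)
 qed
 have "2 * inverse z / of_real (1 + 1 / s) = cnj (2 * z / of_real (1 + s))"
  using s unfolding zc by (simp add: field_simps)
 moreover have "(1 / s - 1) / (1 + 1 / s) = - ((s - 1) / (1 + s))"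
 proof -
  have "1 / s - 1 = (1 - s) / s" "1 + 1 / s = (1 + s) / s"
   using s by (simp_all add: diff_divide_distrib add_divide_distrib)
  hence "(1 / s - 1) / (1 + 1 / s) = ((1 - s) / s) / ((1 + s) / s)" by simp
  also have "... = (1 - s) / (1 + s)" using s by simp
  also have "... = - ((s - 1) / (1 + s))" by (simp add: minus_divide_left)
  finally show ?thesis .
 qed
 ultimately show ?thesis
  unfolding sphere_reflection_def stereographic_def si s_def[symmetric] by simp
qed

lemma sphere_value_inverse:
 assumes "f nicely_meromorphic_on {z}" "is_pole f z | f z ~= 0"
 shows "sphere_value (%w. inverse (f w)) z = sphere_reflection (sphere_value f z)"
proof (cases "is_pole f z")
 case True
 hence "f z = 0" using assms(1) by (auto intro: is_pole_zero_at_nicely_mero)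
 moreover have "~ is_pole (%w. inverse (f w)) z"
  using True isolated_zero_inverse_iff[of f z] pole_is_not_zero by blast
 ultimately show ?thesis using True by (simp add: sphere_value_def)
next
 case False
 hence nz: "f z ~= 0" using assms(2) by simp
 hence "~ isolated_zero f z" using zero_isolated_zero_nicely_meromorphic[OF _ assms(1)] by blast
 hence "~ is_pole (%w. inverse (f w)) z" by (simp add: is_pole_inverse_iff)
 thus ?thesis using False nz by (simp add: sphere_value_def sphere_reflection_stereographic)
qed

lemma sphere_value_large:
 assumes "dist (sphere_value f z) sphere_infinity < 1"
 shows "is_pole f z | 1 < cmod (f z)"
proof (rule ccontr)
 assume a: "~ ?thesis"
 hence "dist (sphere_value f z) sphere_infinity = 2 / sqrt (1 + (cmod (f z))^2)"
  by (simp add: sphere_value_def dist_stereographic_infinity)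
 moreover have "(cmod (f z))^2 <= 1" using a by (simp add: power_le_one)
 hence "sqrt (1 + (cmod (f z))^2) <= sqrt 4" by (intro real_sqrt_le_mono) auto
 hence "sqrt (1 + (cmod (f z))^2) <= 2" by simp
 hence "1 <= 2 / sqrt (1 + (cmod (f z))^2)" by simp
 ultimately show False using assms by simp
qed

lemma sphere_value_bounded:
 assumes "d <= dist (sphere_value f z) sphere_infinity" "0 < d"
 shows "~ is_pole f z" "cmod (f z) <= 2 / d"
proof -
 show np: "~ is_pole f z" using assms by (auto simp: sphere_value_def)
 hence "d <= 2 / sqrt (1 + (cmod (f z))^2)" using assms(1) by (simp add: sphere_value_def dist_stereographic_infinity)
 hence "d * sqrt (1 + (cmod (f z))^2) <= 2" by (simp add: pos_le_divide_eq)
 moreover have "cmod (f z) <= sqrt (1 + (cmod (f z))^2)" by (rule real_le_rsqrt) simp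
 hence "d * cmod (f z) <= d * sqrt (1 + (cmod (f z))^2)" using assms(2) by (intro mult_left_mono) auto
 ultimately have "d * cmod (f z) <= 2" by linarith
 thus "cmod (f z) <= 2 / d" using assms(2) by (simp add: field_simps)
qed

lemma dist_stereographic_le: "dist (stereographic z) (stereographic w) <= 2 * cmod (z - w)"
proof -
 have "1 * 1 <= sqrt (1 + (cmod z)^2) * sqrt (1 + (cmod w)^2)" by (intro mult_mono) auto
 hence "2 * cmod (z - w) / (sqrt (1 + (cmod z)^2) * sqrt (1 + (cmod w)^2)) <= 2 * cmod (z - w) / 1"
  by (intro divide_left_mono) auto
 thus ?thesis by (simp add: dist_stereographic)
qed

lemma cmod_diff_le_dist_stereographic:
 assumes "cmod z <= B" "cmod w <= B"
 shows "cmod (z - w) <= (1 + B^2) * dist (stereographic z) (stereographic w)"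
proof -
 have s: "sqrt (1 + (cmod x)^2) <= sqrt (1 + B^2)" if "cmod x <= B" for x
  using that by (intro real_sqrt_le_mono add_left_mono power_mono) auto
 define q where "q = sqrt (1 + (cmod z)^2) * sqrt (1 + (cmod w)^2)"
 have "q <= sqrt (1 + B^2) * sqrt (1 + B^2)" unfolding q_def using s assms by (intro mult_mono) auto
 hence q: "q <= 1 + B^2" by (simp add: add_nonneg_nonneg)
 have qp: "0 < q" by (simp add: q_def)
 have "cmod (z - w) = q * dist (stereographic z) (stereographic w) / 2"
  using qp by (simp add: dist_stereographic q_def[symmetric])
 also have "... <= q * dist (stereographic z) (stereographic w)" using qp by simp
 also have "... <= (1 + B^2) * dist (stereographic z) (stereographic w)" using q by (intro mult_right_mono) auto
 finally show ?thesis .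
qed

lemma norm_sphere_value_le: "norm (sphere_value f z) <= 3"
proof -
 have "dist (sphere_value f z) sphere_infinity <= 2"
 proof (cases "is_pole f z")
  case False
  have "2 / sqrt (1 + (cmod (f z))^2) <= 2 / 1" by (intro divide_left_mono) auto
  thus ?thesis using False by (simp add: sphere_value_def dist_stereographic_infinity)
 qed (simp add: sphere_value_def)
 moreover have "norm sphere_infinity = 1" by (simp add: sphere_infinity_def norm_Pair)
 ultimately show ?thesis using norm_triangle_sub[of "sphere_value f z" sphere_infinity] by (simp add: dist_norm)
qed

text \<open>
 Bisection along a segment, with L + e in place of L; the pointwise bound makes sufficiently short pieces good.
\<close>

lemma pointwise_lipschitz_imp_lipschitz:
 fixes \<phi> :: "complex => 'b::metric_space"
 assumes S: "convex S" and L: "0 <= L"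
  and loc: "!!z e. z \<in> S ==> 0 < e ==> \<exists>d>0. \<forall>w. dist w z < d --> dist (\<phi> w) (\<phi> z) <= (L + e) * dist w z"
 shows "L-lipschitz_on S \<phi>"
proof (rule lipschitz_onI[OF _ L])
 fix x y assume xy: "x \<in> S" "y \<in> S"
 have le: "dist (\<phi> x) (\<phi> y) <= (L + e) * dist x y" if e: "0 < e" for e
 proof -
  define p where "p = (%s::real. x + of_real s * (y - x))"
  have dp: "dist (p s) (p u) = \<bar>s - u\<bar> * dist x y" for s u
  proof -
   have "p s - p u = of_real (s - u) * (y - x)" by (simp add: p_def algebra_simps)
   thus ?thesis unfolding dist_norm by (simp add: norm_mult norm_minus_commute del: of_real_diff)
  qed
  have pS: "p s \<in> S" if "0 <= s" "s <= 1" for s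
  proof -
   have "p s = (1 - s) *\<^sub>R x + s *\<^sub>R y" by (simp add: p_def scaleR_conv_of_real algebra_simps)
   thus ?thesis using S xy that by (simp add: convex_alt)
  qed
  have "dist (\<phi> (p 0)) (\<phi> (p 1)) <= (L + e) * ((1 - 0) * dist x y)"
  proof (rule Bolzano[where P = "%s u. dist (\<phi> (p s)) (\<phi> (p u)) <= (L + e) * ((u - s) * dist x y)"])
   fix a b c :: real
   assume "dist (\<phi> (p a)) (\<phi> (p b)) <= (L + e) * ((b - a) * dist x y)"
    "dist (\<phi> (p b)) (\<phi> (p c)) <= (L + e) * ((c - b) * dist x y)"
   moreover have "(L + e) * ((c - a) * dist x y) = (L + e) * ((b - a) * dist x y) + (L + e) * ((c - b) * dist x y)"
    by (simp add: algebra_simps)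
   ultimately show "dist (\<phi> (p a)) (\<phi> (p c)) <= (L + e) * ((c - a) * dist x y)"
    using dist_triangle[of "\<phi> (p a)" "\<phi> (p c)" "\<phi> (p b)"] by linarith
  next
   fix s :: real assume s: "0 <= s" "s <= 1"
   obtain d where d: "0 < d" "!!w. dist w (p s) < d ==> dist (\<phi> w) (\<phi> (p s)) <= (L + e) * dist w (p s)"
    using loc[OF pS[OF s] e] by blast
   define d' where "d' = d / (dist x y + 1)"
   have d': "0 < d'" "!!u. \<bar>u - s\<bar> < d' ==> dist (p u) (p s) < d"
   proof -
    have pos: "0 < dist x y + 1" by (simp add: add_nonneg_pos)
    thus "0 < d'" using d by (simp add: d'_def)
    fix u assume u: "\<bar>u - s\<bar> < d'"
    have "\<bar>u - s\<bar> * dist x y <= \<bar>u - s\<bar> * (dist x y + 1)" by (intro mult_left_mono) auto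
    also have "... < d" using u pos by (simp add: d'_def pos_less_divide_eq)
    finally show "dist (p u) (p s) < d" by (simp add: dp)
   qed
   show "\<exists>d>0. \<forall>a b. a <= s & s <= b & b - a < d --> dist (\<phi> (p a)) (\<phi> (p b)) <= (L + e) * ((b - a) * dist x y)"
   proof (intro exI[of _ d'] conjI allI impI)
    fix a b assume ab: "a <= s & s <= b & b - a < d'"
    have "dist (\<phi> (p a)) (\<phi> (p s)) <= (L + e) * ((s - a) * dist x y)"
    proof -
     have "\<bar>a - s\<bar> = s - a" using ab by simp
     thus ?thesis using d(2)[OF d'(2), of a] ab by (simp add: dp)
    qed
    moreover have "dist (\<phi> (p b)) (\<phi> (p s)) <= (L + e) * ((b - s) * dist x y)"
    proof -
     have "\<bar>b - s\<bar> = b - s" using ab by simp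
     thus ?thesis using d(2)[OF d'(2), of b] ab by (simp add: dp)
    qed
    moreover have "(L + e) * ((b - a) * dist x y) = (L + e) * ((s - a) * dist x y) + (L + e) * ((b - s) * dist x y)"
     by (simp add: algebra_simps)
    ultimately show "dist (\<phi> (p a)) (\<phi> (p b)) <= (L + e) * ((b - a) * dist x y)"
     using dist_triangle2[of "\<phi> (p a)" "\<phi> (p b)" "\<phi> (p s)"] by linarith
   qed (use d' in auto)
  qed simp
  thus ?thesis by (simp add: p_def)
 qed
 show "dist (\<phi> x) (\<phi> y) <= L * dist x y"
 proof (rule field_le_epsilon)
  fix e :: real assume e: "0 < e"
  define e' where "e' = e / (dist x y + 1)"
  have pos: "0 < dist x y + 1" by (simp add: add_nonneg_pos)
  have "dist (\<phi> x) (\<phi> y) <= (L + e') * dist x y" using e pos by (intro le) (simp add: e'_def)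
  also have "... = L * dist x y + e' * dist x y" by (simp add: algebra_simps)
  also have "e' * dist x y <= e" using e pos by (simp add: e'_def field_simps)
  finally show "dist (\<phi> x) (\<phi> y) <= L * dist x y + e" by simp
 qed
qed

lemma difference_quotient_tendsto:
 assumes "f analytic_on {z}"
 shows "((%w. cmod (f w - f z) / cmod (w - z)) \<longlongrightarrow> cmod (deriv f z)) (at z)"
proof -
 have "(f has_field_derivative deriv f z) (at z)"
  using assms by (metis DERIV_deriv_iff_field_differentiable analytic_on_imp_differentiable_at insertI1)
 hence "((%w. (f w - f z) / (w - z)) \<longlongrightarrow> deriv f z) (at z)" by (simp add: has_field_derivative_iff)
 hence "((%w. cmod ((f w - f z) / (w - z))) \<longlongrightarrow> cmod (deriv f z)) (at z)" by (rule tendsto_norm)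
 thus ?thesis by (simp add: norm_divide)
qed

lemma inverse_analytic_at_pole:
 assumes "f nicely_meromorphic_on {z}" "is_pole f z"
 shows "(%w. inverse (f w)) analytic_on {z}" "f z = 0"
proof -
 show "f z = 0" using assms by (auto intro: is_pole_zero_at_nicely_mero)
 have "~ is_pole (%w. inverse (f w)) z"
  using assms(2) isolated_zero_inverse_iff[of f z] pole_is_not_zero by blast
 thus "(%w. inverse (f w)) analytic_on {z}"
  using nicely_meromorphic_on_imp_analytic_at[OF nicely_meromorphic_on_inverse[OF assms(1)]] by simp
qed

lemma sphere_value_pointwise_lipschitz:
 assumes f: "f nicely_meromorphic_on {z}" and e: "0 < e"
 shows "\<exists>d>0. \<forall>w. dist w z < d \<longrightarrow>
   dist (sphere_value f w) (sphere_value f z) <= (2 * sphderiv f z + e) * dist w z"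
proof -
 have iso: "isolated_singularity_at f z" "not_essential f z"
  using f by (auto simp: nicely_meromorphic_on_def meromorphic_at_iff)
 have np: "\<forall>\<^sub>F w in at z. ~ is_pole f w" using iso(1) by (rule eventually_not_pole)
 have "\<forall>\<^sub>F w in at z. dist (sphere_value f w) (sphere_value f z) <= (2 * sphderiv f z + e) * dist w z"
 proof (cases "is_pole f z")
  case False
  have an: "f analytic_on {z}" using f False by (auto intro: nicely_meromorphic_on_imp_analytic_at)
  have cf: "(f \<longlongrightarrow> f z) (at z)" using analytic_at_imp_isCont[OF an] isCont_def by blast
  define N where "N = sqrt (1 + (cmod (f z))^2)"
  have N: "0 < N" "N * N = 1 + (cmod (f z))^2" by (auto simp: N_def add_nonneg_nonneg)
  have "((%w. 2 * (cmod (f w - f z) / cmod (w - z)) / (sqrt (1 + (cmod (f w))^2) * N)) \<longlongrightarrow>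
    2 * cmod (deriv f z) / (sqrt (1 + (cmod (f z))^2) * N)) (at z)"
   using N by (intro tendsto_intros difference_quotient_tendsto an cf) (auto simp: N_def)
  moreover have "2 * cmod (deriv f z) / (sqrt (1 + (cmod (f z))^2) * N) < 2 * sphderiv f z + e"
   using False e N by (simp add: sphderiv_def N_def[symmetric])
  ultimately have "\<forall>\<^sub>F w in at z. 2 * (cmod (f w - f z) / cmod (w - z)) / (sqrt (1 + (cmod (f w))^2) * N) < 2 * sphderiv f z + e"
   by (rule order_tendstoD(2))
  moreover have "\<forall>\<^sub>F w in at z. w ~= z" by (rule eventually_neq_at_within)
  ultimately show ?thesis using np
  proof eventually_elim
   case (elim w)
   have "dist (sphere_value f w) (sphere_value f z) =
     2 * (cmod (f w - f z) / cmod (w - z)) / (sqrt (1 + (cmod (f w))^2) * N) * cmod (w - z)"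
    using elim False by (simp add: sphere_value_def dist_stereographic N_def)
   also have "... <= (2 * sphderiv f z + e) * cmod (w - z)" using elim by (intro mult_right_mono) auto
   finally show ?case by (simp add: dist_norm)
  qed
 next
  case True
  define h where "h = (%w. inverse (f w))"
  have h: "h analytic_on {z}" "h z = 0" using inverse_analytic_at_pole[OF f True] by (auto simp: h_def)
  have "((%w. 2 * (cmod (h w - h z) / cmod (w - z))) \<longlongrightarrow> 2 * cmod (deriv h z)) (at z)"
   by (intro tendsto_intros difference_quotient_tendsto h)
  moreover have "2 * cmod (deriv h z) < 2 * sphderiv f z + e" using True e by (simp add: sphderiv_def h_def)
  ultimately have "\<forall>\<^sub>F w in at z. 2 * (cmod (h w - h z) / cmod (w - z)) < 2 * sphderiv f z + e"
   by (rule order_tendstoD(2))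
  moreover have "\<forall>\<^sub>F w in at z. w ~= z" by (rule eventually_neq_at_within)
  moreover have "\<forall>\<^sub>F w in at z. f w ~= 0" using non_zero_neighbour_pole[OF True] .
  ultimately show ?thesis using np
  proof eventually_elim
   case (elim w)
   have "dist (sphere_value f w) (sphere_value f z) = 2 / sqrt (1 + (cmod (f w))^2)"
    using elim True by (simp add: sphere_value_def dist_stereographic_infinity)
   also have "... <= 2 / cmod (f w)"
    using elim by (intro divide_left_mono real_le_rsqrt) auto
   also have "... = 2 * (cmod (h w - h z) / cmod (w - z)) * cmod (w - z)"
    using elim h by (simp add: h_def norm_inverse divide_inverse)
   also have "... <= (2 * sphderiv f z + e) * cmod (w - z)" using elim by (intro mult_right_mono) auto
   finally show ?case by (simp add: dist_norm)
  qed
 qed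
 then obtain d where "0 < d" "!!w. w ~= z ==> dist w z < d ==>
   dist (sphere_value f w) (sphere_value f z) <= (2 * sphderiv f z + e) * dist w z"
  by (auto simp: eventually_at)
 thus ?thesis by (intro exI[of _ d]) (metis dist_self mult_zero_right order_refl)
qed

theorem sphderiv_bound_imp_lipschitz:
 assumes f: "f nicely_meromorphic_on S" and S: "convex S" and L: "0 <= L" "!!z. z \<in> S ==> sphderiv f z <= L"
 shows "(2 * L)-lipschitz_on S (sphere_value f)"
proof (rule pointwise_lipschitz_imp_lipschitz[OF S])
 fix z and e :: real assume z: "z \<in> S" and e: "0 < e"
 have "f nicely_meromorphic_on {z}" using f z by (auto intro: nicely_meromorphic_on_subset)
 from sphere_value_pointwise_lipschitz[OF this e] obtain d where d: "0 < d"
  "!!w. dist w z < d ==> dist (sphere_value f w) (sphere_value f z) <= (2 * sphderiv f z + e) * dist w z" by blast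
 have "(2 * sphderiv f z + e) * dist w z <= (2 * L + e) * dist w z" for w
  using L(2)[OF z] by (intro mult_right_mono) auto
 thus "\<exists>d>0. \<forall>w. dist w z < d --> dist (sphere_value f w) (sphere_value f z) <= (2 * L + e) * dist w z"
  using d by (meson order_trans)
qed (use L in auto)

text \<open>
 The Arzela-Ascoli theorem, where the local Lipschitz bounds hold only from some index on.
\<close>

theorem lipschitz_subsequence:
 fixes \<phi> :: "nat => complex => 'b::euclidean_space"
 assumes bound: "!!n x. norm (\<phi> n x) <= B"
  and lip: "!!z. z \<in> D ==> \<exists>r>0. \<exists>L N. ball z r \<subseteq> D & (\<forall>n\<ge>N. L-lipschitz_on (ball z r) (\<phi> n))"
 obtains s :: "nat => nat" and \<psi> where "strict_mono s"
  "!!z. z \<in> D ==> \<exists>r>0. cball z r \<subseteq> D & uniform_limit (cball z r) (%n. \<phi> (s n)) \<psi> sequentially"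
proof -
 obtain Q :: "complex set" where Q: "countable Q" "closure Q = UNIV"
  using separable[of "UNIV :: complex set"] by (metis subset_antisym subset_UNIV)
 obtain s where s: "strict_mono (s :: nat => nat)" "!!x. x \<in> Q ==> \<exists>l. (%n. \<phi> (s n) x) \<longlonglongrightarrow> l"
  using function_convergent_subsequence[OF Q(1), of \<phi> B] bound by metis
 define \<psi> where "\<psi> = (%x. lim (%n. \<phi> (s n) x))"
 have "\<exists>r>0. cball z r \<subseteq> D & uniform_limit (cball z r) (%n. \<phi> (s n)) \<psi> sequentially" if z: "z \<in> D" for z
 proof -
  obtain r L N where r: "0 < r" "ball z r \<subseteq> D" "!!n. n >= N ==> L-lipschitz_on (ball z r) (\<phi> n)"
   using lip[OF z] by blast
  have L0: "0 <= L" using r(3)[of N] by (simp add: lipschitz_on_def)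
  have "uniformly_Cauchy_on (cball z (r/2)) (%n. \<phi> (s n))"
   unfolding uniformly_Cauchy_on_def
  proof (intro allI impI)
   fix e :: real assume e: "0 < e"
   define \<delta> where "\<delta> = e / (3 * (L + 1))"
   have del: "0 < \<delta>" "L * \<delta> < e / 3"
   proof -
    show "0 < \<delta>" using e L0 by (simp add: \<delta>_def)
    hence "L * \<delta> < (L + 1) * \<delta>" by simp
    also have "... = e / 3" using L0 by (simp add: \<delta>_def field_simps)
    finally show "L * \<delta> < e / 3" .
   qed
   have "cball z (r/2) \<subseteq> (\<Union>q\<in>Q Int ball z r. ball q \<delta>)"
   proof
    fix x assume x: "x \<in> cball z (r/2)"
    define \<delta>' where "\<delta>' = min \<delta> (r/2)"
    have "x \<in> closure Q" using Q by simp
    then obtain q where q: "q \<in> Q" "dist q x < \<delta>'"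
     using del r by (metis \<delta>'_def closure_approachable half_gt_zero min_less_iff_conj)
    have "dist z q <= dist z x + dist q x" using dist_triangle2[of z q x] by simp
    hence "q \<in> ball z r" using q x by (simp add: \<delta>'_def)
    thus "x \<in> (\<Union>q\<in>Q Int ball z r. ball q \<delta>)" using q by (auto simp: \<delta>'_def)
   qed
   then obtain C where C: "C \<subseteq> Q Int ball z r" "finite C" "cball z (r/2) \<subseteq> (\<Union>q\<in>C. ball q \<delta>)"
    using compactE_image[of "cball z (r/2)" "Q Int ball z r" "%q. ball q \<delta>"] by (metis compact_cball open_ball)
   have "\<forall>q\<in>C. \<exists>M. \<forall>m\<ge>M. \<forall>n\<ge>M. dist (\<phi> (s m) q) (\<phi> (s n) q) < e / 3"
   proof
    fix q assume "q \<in> C"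
    hence "Cauchy (%n. \<phi> (s n) q)" using s(2)[of q] C LIMSEQ_imp_Cauchy by blast
    thus "\<exists>M. \<forall>m\<ge>M. \<forall>n\<ge>M. dist (\<phi> (s m) q) (\<phi> (s n) q) < e / 3"
     using e unfolding Cauchy_def by (meson divide_pos_pos zero_less_numeral)
   qed
   then obtain M where M: "!!q m n. q \<in> C ==> m >= M q ==> n >= M q ==> dist (\<phi> (s m) q) (\<phi> (s n) q) < e / 3"
    by metis
   define M0 where "M0 = Max (insert N (M ` C))"
   have M0: "N <= M0" "!!q. q \<in> C ==> M q <= M0" unfolding M0_def using C(2) by auto
   show "\<exists>M. \<forall>x\<in>cball z (r/2). \<forall>m\<ge>M. \<forall>n\<ge>M. dist (\<phi> (s m) x) (\<phi> (s n) x) < e"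
   proof (intro exI[of _ M0] ballI allI impI)
    fix x m n assume x: "x \<in> cball z (r/2)" and mn: "M0 <= m" "M0 <= n"
    obtain q where q: "q \<in> C" "dist q x < \<delta>" using C(3) x by auto
    have qb: "q \<in> ball z r" "x \<in> ball z r" using q C(1) x r(1) by auto
    have Ls: "dist (\<phi> (s j) x) (\<phi> (s j) q) <= L * \<delta>" if "M0 <= j" for j
    proof -
     have "N <= s j" using M0(1) that seq_suble[OF s(1), of j] by linarith
     hence "dist (\<phi> (s j) x) (\<phi> (s j) q) <= L * dist x q" using r(3) qb by (auto simp: lipschitz_on_def)
     also have "... <= L * \<delta>" using q L0 by (intro mult_left_mono) (auto simp: dist_commute)
     finally show ?thesis .
    qed
    have "dist (\<phi> (s m) q) (\<phi> (s n) q) < e / 3" using M[OF q(1)] M0(2)[OF q(1)] mn by (meson order_trans)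
    moreover have "dist (\<phi> (s m) x) (\<phi> (s n) x) <=
      dist (\<phi> (s m) x) (\<phi> (s m) q) + dist (\<phi> (s m) q) (\<phi> (s n) q) + dist (\<phi> (s n) x) (\<phi> (s n) q)"
     using dist_triangle[of "\<phi> (s m) x" "\<phi> (s n) x" "\<phi> (s m) q"] dist_triangle[of "\<phi> (s m) q" "\<phi> (s n) x" "\<phi> (s n) q"]
      dist_commute[of "\<phi> (s n) x" "\<phi> (s n) q"] by linarith
    ultimately show "dist (\<phi> (s m) x) (\<phi> (s n) x) < e"
     using Ls[OF mn(1)] Ls[OF mn(2)] del(2) by linarith
   qed
  qed
  hence "uniformly_convergent_on (cball z (r/2)) (%n. \<phi> (s n))" by (rule Cauchy_uniformly_convergent)
  hence "uniform_limit (cball z (r/2)) (%n. \<phi> (s n)) \<psi> sequentially"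
   unfolding \<psi>_def by (simp add: uniformly_convergent_uniform_limit_iff)
  moreover have "cball z (r/2) \<subseteq> D" using r by (auto intro: order_trans[OF _ r(2)])
  ultimately show ?thesis using r(1) by (intro exI[of _ "r/2"]) auto
 qed
 thus ?thesis using that s by blast
qed

lemma uniform_limit_lipschitz:
 assumes "uniform_limit S (%n. \<phi> n) \<psi> sequentially" "!!n. n >= N ==> L-lipschitz_on S (\<phi> n)"
 shows "L-lipschitz_on S \<psi>"
proof (rule lipschitz_onI)
 show "0 <= L" using assms(2)[of N] by (simp add: lipschitz_on_def)
 fix x y assume xy: "x \<in> S" "y \<in> S"
 have "(%n. dist (\<phi> n x) (\<phi> n y)) \<longlonglongrightarrow> dist (\<psi> x) (\<psi> y)"
  using xy assms(1) by (intro tendsto_dist tendsto_uniform_limitI)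
 moreover have "\<forall>\<^sub>F n in sequentially. dist (\<phi> n x) (\<phi> n y) <= L * dist x y"
  using assms(2) xy by (auto simp: eventually_sequentially lipschitz_on_def)
 ultimately show "dist (\<psi> x) (\<psi> y) <= L * dist x y" by (rule tendsto_upperbound) simp
qed

section \<open>Selecting the rescaling\<close>

text \<open>
 By \<open>sphderiv_rescale\<close>, the spherical derivative at the base point of the rescaling of f at z with scale x. As a function of (x, z)
 it extends continuously by 0 to x = 0, which is what makes the selection of scales possible.
\<close>

definition zfun :: "real => (complex => complex) => real \<times> complex => real" where
 "zfun \<alpha> f p = (let x = fst p; z = snd p in
   if is_pole f z then x powr (1 + \<alpha>) * cmod (deriv (%w. inverse (f w)) z)
   else x powr (1 + \<alpha>) * cmod (deriv f z) / (x powr (2 * \<alpha>) + (cmod (f z))^2))"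

lemma zfun_zero [simp]: "zfun \<alpha> f (0, z) = 0"
 by (simp add: zfun_def Let_def)

lemma zfun_nonneg: "0 <= zfun \<alpha> f p"
 by (auto simp: zfun_def Let_def intro!: mult_nonneg_nonneg divide_nonneg_nonneg add_nonneg_nonneg)

lemma deriv_affine:
 fixes a r s :: complex
 assumes "f analytic_on {a + r * z}"
 shows "deriv (%z. s * f (a + r * z)) z = s * r * deriv f (a + r * z)"
 using higher_deriv_affine[OF assms, where j = 1] by simp

lemma sphderiv_rescale:
 assumes f: "f nicely_meromorphic_on {a + of_real x * \<zeta>}" and x: "0 < x"
 shows "sphderiv (%z. of_real (x powr (- \<alpha>)) * f (a + of_real x * z)) \<zeta> = zfun \<alpha> f (x, a + of_real x * \<zeta>)"
proof -
 let ?w = "a + of_real x * \<zeta>"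
 let ?s = "complex_of_real (x powr (- \<alpha>))"
 have s: "?s ~= 0" "complex_of_real x ~= 0" using x by auto
 have pole: "is_pole (%z. ?s * f (a + of_real x * z)) \<zeta> \<longleftrightarrow> is_pole f ?w" using s by (rule is_pole_affine[rotated])
 show ?thesis
 proof (cases "is_pole f ?w")
  case True
  have an: "(%w. inverse (f w)) analytic_on {?w}" using inverse_analytic_at_pole[OF f True] by blast
  have "(%z. inverse (?s * f (a + of_real x * z))) = (%z. inverse ?s * (%w. inverse (f w)) (a + of_real x * z))"
   by (simp add: fun_eq_iff)
  hence "deriv (%z. inverse (?s * f (a + of_real x * z))) \<zeta> = inverse ?s * of_real x * deriv (%w. inverse (f w)) ?w"
   using deriv_affine[OF an, of "inverse ?s"] by simp
  moreover have "inverse (x powr (- \<alpha>)) * x = x powr (1 + \<alpha>)"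
   using x by (simp add: powr_minus powr_add)
  moreover have "cmod (inverse ?s * of_real x * y) = inverse (x powr (- \<alpha>)) * x * cmod y" for y
   using x by (simp add: norm_mult norm_inverse)
  ultimately have "cmod (deriv (%z. inverse (?s * f (a + of_real x * z))) \<zeta>) =
    x powr (1 + \<alpha>) * cmod (deriv (%w. inverse (f w)) ?w)" by metis
  thus ?thesis using True pole by (simp only: sphderiv_def zfun_def Let_def fst_conv snd_conv if_True)
 next
  case False
  have an: "f analytic_on {?w}" using f False by (auto intro: nicely_meromorphic_on_imp_analytic_at)
  have d: "deriv (%z. ?s * f (a + of_real x * z)) \<zeta> = ?s * of_real x * deriv f ?w" using deriv_affine[OF an] .
  define u where "u = x powr \<alpha>"
  have u: "0 < u" "x powr (- \<alpha>) = 1 / u" "x powr (2 * \<alpha>) = u^2" "x powr (1 + \<alpha>) = x * u"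
  proof -
   show "0 < u" "x powr (- \<alpha>) = 1 / u" using x by (simp_all add: u_def powr_minus divide_inverse)
   show "x powr (2 * \<alpha>) = u^2" by (simp only: u_def mult_2 powr_add power2_eq_square)
   show "x powr (1 + \<alpha>) = x * u" using x by (simp only: u_def powr_add powr_one)
  qed
  have cs: "cmod ?s = 1 / u" "cmod (complex_of_real x) = x"
   unfolding norm_of_real u(2) using x u(1) by simp_all
  have p: "0 < u\<^sup>2 + (cmod (f ?w))^2" using u(1) by (intro add_pos_nonneg) auto
  have "sphderiv (%z. ?s * f (a + of_real x * z)) \<zeta> =
    cmod (?s * of_real x * deriv f ?w) / (1 + (cmod (?s * f ?w))^2)"
   using False pole d by (simp add: sphderiv_def)
  also have "... = ((1 / u) * x * cmod (deriv f ?w)) / (1 + ((1 / u) * cmod (f ?w))^2)"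
   by (simp only: norm_mult cs)
  also have "1 + ((1 / u) * cmod (f ?w))^2 = (u^2 + (cmod (f ?w))^2) / u^2"
   using u(1) by (simp add: power_mult_distrib power_divide field_simps)
  also have "((1 / u) * x * cmod (deriv f ?w)) / ((u^2 + (cmod (f ?w))^2) / u^2) =
    x * u * cmod (deriv f ?w) / (u^2 + (cmod (f ?w))^2)"
   using u(1) p by (simp add: field_simps power2_eq_square)
  also have "... = zfun \<alpha> f (x, ?w)" using False u by (simp add: zfun_def Let_def)
  finally show ?thesis .
 qed
qed

lemma continuous_on_local:
 fixes f :: "'a::metric_space => 'b::metric_space"
 assumes "!!x. x \<in> S ==> \<exists>U. open U & x \<in> U & continuous_on (S Int U) f"
 shows "continuous_on S f"
 unfolding continuous_on_eq_continuous_within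
proof
 fix x assume x: "x \<in> S"
 then obtain U where U: "open U" "x \<in> U" "continuous_on (S Int U) f" using assms by blast
 hence "continuous (at x within (S Int U)) f" using x by (auto simp: continuous_on_eq_continuous_within)
 moreover have "at x within (S Int U) = at x within S" using U by (intro at_within_nhd[of x U]) auto
 ultimately show "continuous (at x within S) f" by simp
qed

text \<open>
 The only delicate point of continuity is a zero z0 of f, of order \<open>q > \<alpha>\<close>. With \<open>s = \<bar>z - z0\<bar>\<close> the two regimes
 \<open>s^q <= x^\<alpha>\<close> and \<open>s^q >= x^\<alpha>\<close> both give \<open>x^(1 - \<alpha> / q)\<close>.
\<close>

lemma zfun_small_near_zero:
 assumes hol: "f holomorphic_on ball z0 r" "0 < r" and f0: "f z0 = 0"
  and mult: "isolated_zero f z0 ==> zorder f z0 >= int p" and \<alpha>: "0 < \<alpha>" "\<alpha> < real p"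
 obtains r' C \<beta> where "0 < r'" "0 < \<beta>" "!!x z. 0 <= x ==> z \<in> ball z0 r' ==> zfun \<alpha> f (x, z) <= C * x powr \<beta>"
proof (cases "\<exists>w\<in>ball z0 r. f w ~= 0")
 case False
 have "zfun \<alpha> f (x, z) <= 0 * x powr 1" if "z \<in> ball z0 r" for x z
 proof -
  have "~ is_pole f z" using not_is_pole_holomorphic[OF open_ball that hol(1)] .
  moreover have "deriv f z = deriv (%_. 0) z"
  proof (rule deriv_cong_ev)
   show "\<forall>\<^sub>F x in nhds z. f x = 0"
    using False that by (intro eventually_mono[OF eventually_nhds_in_open[of "ball z0 r" z]]) auto
  qed simp
  ultimately show ?thesis by (simp add: zfun_def Let_def)
 qed
 thus ?thesis using that[of r 1 0] hol(2) by auto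
next
 case True
 have an: "f analytic_on {z0}" using hol analytic_at by (metis centre_in_ball open_ball)
 define q where "q = nat (zorder f z0)"
 define h where "h = zor_poly f z0"
 obtain r1 where r1: "0 < r1" "cball z0 r1 \<subseteq> ball z0 r" "h holomorphic_on cball z0 r1"
  "!!w. w \<in> cball z0 r1 ==> f w = h w * (w - z0) ^ q & h w ~= 0" and zpos: "zorder f z0 > 0"
  using zorder_exist_zero[OF hol(1) open_ball connected_ball _ True] hol(2) f0
  unfolding q_def h_def by (metis centre_in_ball)
 have iz: "isolated_zero f z0"
 proof -
  have "\<forall>\<^sub>F w in at z0. w \<in> ball z0 r1 - {z0}" using r1(1) by (intro eventually_at_in_open) auto
  hence "\<forall>\<^sub>F w in at z0. f w ~= 0" by eventually_elim (use r1(4) in auto)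
  thus ?thesis using isolated_zero_analytic_iff[OF an] f0 by blast
 qed
 have q: "real p <= real q" "1 <= q" using mult[OF iz] zpos by (auto simp: q_def)
 define r2 where "r2 = r1 / 2"
 have r2: "0 < r2" "cball z0 r2 \<subseteq> ball z0 r1" using r1(1) by (auto simp: r2_def)
 have hb: "h holomorphic_on ball z0 r1" using r1(3) by (rule holomorphic_on_subset) auto
 have ch: "continuous_on (cball z0 r2) h" "continuous_on (cball z0 r2) (deriv h)"
  using holomorphic_on_imp_continuous_on[OF hb] holomorphic_on_imp_continuous_on[OF holomorphic_deriv[OF hb open_ball]]
   continuous_on_subset r2(2) by blast+
 have "bounded ((h) ` cball z0 r2)"
  by (rule compact_imp_bounded[OF compact_continuous_image[OF ch(1) compact_cball]])
 then obtain A where "\<forall>y\<in>(h) ` cball z0 r2. cmod y <= A" unfolding bounded_iff by blast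
 hence A: "!!w. w \<in> cball z0 r2 ==> cmod (h w) <= A" by blast
 have "bounded ((deriv h) ` cball z0 r2)"
  by (rule compact_imp_bounded[OF compact_continuous_image[OF ch(2) compact_cball]])
 then obtain A' where "\<forall>y\<in>(deriv h) ` cball z0 r2. cmod y <= A'" unfolding bounded_iff by blast
 hence A': "!!w. w \<in> cball z0 r2 ==> cmod (deriv h w) <= A'" by blast
 have "continuous_on (cball z0 r2) (%w. cmod (h w))" using ch(1) by (rule continuous_on_norm)
 then obtain w0 where w0: "w0 \<in> cball z0 r2" "!!w. w \<in> cball z0 r2 ==> cmod (h w0) <= cmod (h w)"
  using continuous_attains_inf[OF compact_cball, of z0 r2 "%w. cmod (h w)"] r2(1) by auto
 define c where "c = cmod (h w0)"
 have c: "0 < c" "!!w. w \<in> cball z0 r2 ==> c <= cmod (h w)"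
  using w0 r1(4)[of w0] r2(2) by (auto simp: c_def)
 define B where "B = r2 * A' + real q * A"
 have df: "cmod (deriv f w) <= B * cmod (w - z0) ^ (q - 1)" if w: "w \<in> ball z0 r2" for w
 proof -
  have wb: "w \<in> ball z0 r1" "w \<in> cball z0 r2" using w subsetD[OF r2(2)] by auto
  have hd: "(h has_field_derivative deriv h w) (at w)" using holomorphic_derivI[OF hb open_ball wb(1)] .
  have "((%w. h w * (w - z0) ^ q) has_field_derivative
    deriv h w * (w - z0) ^ q + h w * (of_nat q * (w - z0) ^ (q - 1))) (at w)"
   using hd by (auto intro!: derivative_eq_intros)
  hence "deriv (%w. h w * (w - z0) ^ q) w = deriv h w * (w - z0) ^ q + h w * (of_nat q * (w - z0) ^ (q - 1))"
   by (rule DERIV_imp_deriv)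
  moreover have "deriv f w = deriv (%w. h w * (w - z0) ^ q) w"
   using r1(4) wb(1) by (intro deriv_cong_ev refl eventually_mono[OF eventually_nhds_in_open[of "ball z0 r1" w]]) auto
  ultimately have "cmod (deriv f w) <= cmod (deriv h w * (w - z0) ^ q) + cmod (h w * (of_nat q * (w - z0) ^ (q - 1)))"
   using norm_triangle_ineq by simp
  also have "cmod (deriv h w * (w - z0) ^ q) = cmod (deriv h w) * cmod (w - z0) * cmod (w - z0) ^ (q - 1)"
   using q(2) by (cases q) (auto simp: norm_mult norm_power)
  also have "... <= A' * r2 * cmod (w - z0) ^ (q - 1)"
  proof (intro mult_right_mono mult_mono)
   show "cmod (w - z0) <= r2" using w by (simp add: dist_norm norm_minus_commute)
   show "0 <= A'" using A'[OF wb(2)] norm_ge_zero order_trans by blast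
  qed (use A' wb in auto)
  also have "cmod (h w * (of_nat q * (w - z0) ^ (q - 1))) <= A * (real q * cmod (w - z0) ^ (q - 1))"
   unfolding norm_mult norm_power using A[OF wb(2)] by (simp add: mult_right_mono)
  finally show ?thesis by (simp add: B_def algebra_simps)
 qed
 have B0: "0 <= B"
 proof -
  have "0 <= A" "0 <= A'" using A[of z0] A'[of z0] r2(1) norm_ge_zero order_trans by (metis centre_in_cball less_imp_le)+
  thus ?thesis using r2(1) by (simp add: B_def)
 qed
 define \<beta> where "\<beta> = 1 - \<alpha> / real q"
 have be: "0 < \<beta>" using \<alpha> q by (simp add: \<beta>_def)
 define C where "C = B + B / c^2"
 have bound: "zfun \<alpha> f (x, z) <= C * x powr \<beta>" if x: "0 <= x" and z: "z \<in> ball z0 r2" for x z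
 proof (cases "x = 0")
  case False
  hence x: "0 < x" using x by simp
  have zb: "z \<in> cball z0 r1" "z \<in> cball z0 r2" using z subsetD[OF r2(2), of z] by auto
  have np: "~ is_pole f z" using not_is_pole_holomorphic[OF open_ball _ hol(1)] zb r1(2) by blast
  define s where "s = cmod (z - z0)"
  have fz: "c * s ^ q <= cmod (f z)"
   using r1(4)[OF zb(1)] c(2)[OF zb(2)] by (simp add: norm_mult norm_power s_def mult_right_mono)
  have dz: "cmod (deriv f z) <= B * s ^ (q - 1)" using df[OF z] by (simp add: s_def)
  have E: "zfun \<alpha> f (x, z) = x powr (1 + \<alpha>) * cmod (deriv f z) / (x powr (2 * \<alpha>) + (cmod (f z))^2)"
   using np by (simp add: zfun_def Let_def)
  define y where "y = x powr (\<alpha> / real q)"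
  have y: "0 < y" using x by (simp add: y_def)
  have yq: "y ^ i = x powr (\<alpha> / real q * real i)" for i
   using x by (simp add: y_def powr_realpow[symmetric] powr_powr)
  show ?thesis
  proof (cases "s <= y")
   case True
   have "zfun \<alpha> f (x, z) <= x powr (1 + \<alpha>) * (B * y ^ (q - 1)) / x powr (2 * \<alpha>)"
    unfolding E
   proof (intro frac_le mult_left_mono)
    have "s ^ (q - 1) <= y ^ (q - 1)" using True by (intro power_mono) (auto simp: s_def)
    hence "B * s ^ (q - 1) <= B * y ^ (q - 1)" using B0 by (intro mult_left_mono)
    thus "cmod (deriv f z) <= B * y ^ (q - 1)" using dz by linarith
   qed (use B0 y x in auto)
   also have "... = B * (x powr (1 + \<alpha>) * x powr (\<alpha> / real q * real (q - 1)) / x powr (2 * \<alpha>))"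
    by (simp add: yq)
   also have "x powr (1 + \<alpha>) * x powr (\<alpha> / real q * real (q - 1)) / x powr (2 * \<alpha>) =
     x powr (1 + \<alpha> + \<alpha> / real q * real (q - 1) - 2 * \<alpha>)"
    by (simp only: powr_add powr_diff)
   also have "1 + \<alpha> + \<alpha> / real q * real (q - 1) - 2 * \<alpha> = \<beta>"
    using q(2) by (simp add: \<beta>_def of_nat_diff field_simps)
   also have "B * x powr \<beta> <= C * x powr \<beta>" using B0 c by (intro mult_right_mono) (auto simp: C_def)
   finally show ?thesis .
  next
   case False
   hence sy: "y <= s" "0 < s" using y by auto
   have "zfun \<alpha> f (x, z) <= x powr (1 + \<alpha>) * (B * s ^ (q - 1)) / (c * s ^ q)^2"
    unfolding E
   proof (intro frac_le mult_left_mono)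
    have "(c * s ^ q)^2 <= (cmod (f z))^2" using fz c sy by (intro power_mono) auto
    moreover have "0 <= x powr (2 * \<alpha>)" by simp
    ultimately show "(c * s ^ q)^2 <= x powr (2 * \<alpha>) + (cmod (f z))^2" by linarith
   qed (use dz B0 sy c in auto)
   also have "... = B / c^2 * (x powr (1 + \<alpha>) / s ^ (q + 1))"
   proof -
    have "(s ^ q)^2 = s ^ (q - 1) * s ^ (q + 1)"
     using q(2) by (cases q) (auto simp: power2_eq_square)
    thus ?thesis using sy c by (simp add: power_mult_distrib field_simps)
   qed
   also have "... <= B / c^2 * (x powr (1 + \<alpha>) / y ^ (q + 1))"
    using sy y B0 by (intro mult_left_mono divide_left_mono power_mono mult_pos_pos) auto
   also have "x powr (1 + \<alpha>) / y ^ (q + 1) = x powr (1 + \<alpha> - \<alpha> / real q * real (q + 1))"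
    using x unfolding yq by (simp add: powr_diff)
   also have "1 + \<alpha> - \<alpha> / real q * real (q + 1) = \<beta>" using q(2) by (simp add: \<beta>_def field_simps)
   also have "B / c^2 * x powr \<beta> <= C * x powr \<beta>" using B0 by (intro mult_right_mono) (auto simp: C_def)
   finally show ?thesis .
  qed
 qed simp
 show ?thesis using that[OF r2(1) be bound] .
qed

lemma zfun_continuous:
 assumes f: "f nicely_meromorphic_on D" and D: "open D" and zm: "zeros_mult_ge D p f" and \<alpha>: "0 < \<alpha>" "\<alpha> < real p"
 shows "continuous_on ({0..} \<times> D) (zfun \<alpha> f)"
proof (rule continuous_on_local)
 fix P assume "P \<in> ({0..} :: real set) \<times> D"
 then obtain x0 z0 where P: "P = (x0, z0)" "0 <= x0" "z0 \<in> D" by auto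
 have fz: "f nicely_meromorphic_on {z0}" using f P by (auto intro: nicely_meromorphic_on_subset)
 have pw: "continuous_on S (%q. fst q powr b)" if "S \<subseteq> {0..} \<times> UNIV" "0 < b" for S :: "(real \<times> complex) set" and b
  using that by (intro continuous_on_powr' continuous_intros) auto
 show "\<exists>U. open U & P \<in> U & continuous_on ({0..} \<times> D Int U) (zfun \<alpha> f)"
 proof (cases "is_pole f z0")
  case True
  define h where "h = (%w. inverse (f w))"
  have h: "h analytic_on {z0}" "f z0 = 0" using inverse_analytic_at_pole[OF fz True] by (auto simp: h_def)
  obtain r1 where r1: "0 < r1" "h holomorphic_on ball z0 r1" using h(1) analytic_at_ball by blast
  have iso: "isolated_singularity_at f z0" using fz by (auto simp: nicely_meromorphic_on_def meromorphic_at_iff)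
  obtain e where e: "0 < e" "f analytic_on ball z0 e - {z0}" using iso by (auto simp: isolated_singularity_at_def)
  have "\<forall>\<^sub>F w in at z0. w \<in> ball z0 e - {z0}" using e(1) by (intro eventually_at_in_open) auto
  hence "\<forall>\<^sub>F w in at z0. f w ~= 0 & f analytic_on {w}"
   using non_zero_neighbour_pole[OF True]
  proof eventually_elim
   case (elim w)
   have "f analytic_on {w}" by (rule analytic_on_subset[OF e(2)]) (use elim in simp)
   thus ?case using elim by simp
  qed
  then obtain r2 where r2: "0 < r2" "!!w. w ~= z0 ==> dist w z0 < r2 ==> f w ~= 0 & f analytic_on {w}"
   by (auto simp: eventually_at)
  define r where "r = min r1 r2"
  have r: "0 < r" using r1 r2 by (simp add: r_def)
  have hr: "h holomorphic_on ball z0 r" using r1(2) by (rule holomorphic_on_subset) (auto simp: r_def)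
  have ch: "continuous_on (ball z0 r) h" "continuous_on (ball z0 r) (deriv h)"
   using holomorphic_on_imp_continuous_on[OF hr] holomorphic_on_imp_continuous_on[OF holomorphic_deriv[OF hr open_ball]] by auto
  define F where "F = (%q :: real \<times> complex. fst q powr (1 + \<alpha>) * cmod (deriv h (snd q)) / (fst q powr (2 * \<alpha>) * (cmod (h (snd q)))^2 + 1))"
  define S :: "(real \<times> complex) set" where "S = {0..} \<times> D Int UNIV \<times> ball z0 r"
  have den: "0 < x * (cmod y)^2 + 1" if "0 <= x" for x y using that by (simp add: add_nonneg_pos)
  have cF: "continuous_on S F"
   unfolding F_def
  proof (intro continuous_on_divide continuous_on_mult continuous_on_add continuous_on_const continuous_on_power pw
     continuous_on_norm ballI)
   show "continuous_on S (%x. h (snd x))" "continuous_on S (%x. deriv h (snd x))"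
    by (rule continuous_on_compose2[OF ch(1)] continuous_on_compose2[OF ch(2)]; auto intro!: continuous_intros simp: S_def)+
   fix q assume "q \<in> S"
   thus "fst q powr (2 * \<alpha>) * (cmod (h (snd q)))^2 + 1 ~= 0" using den[of "fst q powr (2 * \<alpha>)" "h (snd q)"] by simp
  qed (use \<alpha> in \<open>auto simp: S_def\<close>)
  have eq: "zfun \<alpha> f q = F q" if "q \<in> S" for q
  proof -
   obtain x z where q0: "q = (x, z)" by (cases q)
   have q: "q = (x, z)" "0 <= x" "z \<in> ball z0 r" using that q0 by (auto simp: S_def)
   show ?thesis
   proof (cases "z = z0")
    case True
    thus ?thesis using \<open>is_pole f z0\<close> h(2) q by (simp add: zfun_def F_def h_def)
   next
    case False
    hence fzn: "f z ~= 0" "f analytic_on {z}" using r2(2)[of z] q by (auto simp: r_def dist_commute)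
    have np: "~ is_pole f z" using fzn by (auto dest: analytic_at_imp_no_pole)
    have fd: "f field_differentiable at z" using fzn analytic_on_imp_differentiable_at by blast
    have "deriv h z = - deriv f z / (f z)^2"
     unfolding h_def using fd fzn(1) by (simp add: deriv_inverse)
    hence dh: "cmod (deriv h z) = cmod (deriv f z) / (cmod (f z))^2" by (simp add: norm_divide norm_power)
    have hh: "(cmod (h z))^2 = 1 / (cmod (f z))^2" by (simp add: h_def norm_inverse power_inverse divide_inverse)
    have "x powr (2 * \<alpha>) + (cmod (f z))^2 ~= 0" using add_nonneg_pos[of "x powr (2 * \<alpha>)" "(cmod (f z))^2"] fzn(1) by simp
    moreover have "x powr (2 * \<alpha>) * (1 / (cmod (f z))^2) + 1 = (x powr (2 * \<alpha>) + (cmod (f z))^2) / (cmod (f z))^2"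
     using fzn(1) by (simp add: field_simps)
    ultimately show ?thesis using np fzn(1) unfolding q zfun_def F_def by (simp add: dh hh)
   qed
  qed
  have "continuous_on S (zfun \<alpha> f)" using cF eq by (simp cong: continuous_on_cong)
  thus ?thesis using r P by (intro exI[of _ "UNIV \<times> ball z0 r"]) (auto simp: S_def intro: open_Times)
 next
  case False
  have an: "f analytic_on {z0}" using fz False by (auto intro: nicely_meromorphic_on_imp_analytic_at)
  obtain r where r: "0 < r" "f holomorphic_on ball z0 r" using an analytic_at_ball by blast
  have cf: "continuous_on (ball z0 r) f" "continuous_on (ball z0 r) (deriv f)"
   using holomorphic_on_imp_continuous_on[OF r(2)] holomorphic_on_imp_continuous_on[OF holomorphic_deriv[OF r(2) open_ball]] by auto
  define F where "F = (%q :: real \<times> complex. fst q powr (1 + \<alpha>) * cmod (deriv f (snd q)) / (fst q powr (2 * \<alpha>) + (cmod (f (snd q)))^2))"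
  have eq: "zfun \<alpha> f q = F q" if "snd q \<in> ball z0 r" for q
   using not_is_pole_holomorphic[OF open_ball that r(2)] by (simp add: zfun_def F_def Let_def)
  have cF: "continuous_on S (zfun \<alpha> f)" if S: "S \<subseteq> {0..} \<times> ball z0 r" "!!q. q \<in> S ==> 0 < fst q | f (snd q) ~= 0" for S :: "(real \<times> complex) set"
  proof -
   have "continuous_on S F"
    unfolding F_def
   proof (intro continuous_on_divide continuous_on_mult continuous_on_add continuous_on_const continuous_on_power pw
      continuous_on_norm ballI)
    show "continuous_on S (%x. f (snd x))" "continuous_on S (%x. deriv f (snd x))"
     by (rule continuous_on_compose2[OF cf(1)] continuous_on_compose2[OF cf(2)]; use S(1) in \<open>auto intro!: continuous_intros\<close>)+
    fix q assume "q \<in> S"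
    hence "0 < fst q | f (snd q) ~= 0" by (rule S(2))
    hence "0 < fst q powr (2 * \<alpha>) + (cmod (f (snd q)))^2" by (auto intro: add_pos_nonneg add_nonneg_pos)
    thus "fst q powr (2 * \<alpha>) + (cmod (f (snd q)))^2 ~= 0" by simp
   qed (use \<alpha> S(1) in auto)
   moreover have "zfun \<alpha> f q = F q" if "q \<in> S" for q using that S(1) by (intro eq) auto
   ultimately show ?thesis by (simp cong: continuous_on_cong)
  qed
  consider "0 < x0" | "f z0 ~= 0" | "x0 = 0" "f z0 = 0" using P(2) by linarith
  thus ?thesis
  proof cases
   case 1
   have "continuous_on ({0..} \<times> D Int {0<..} \<times> ball z0 r) (zfun \<alpha> f)" by (rule cF) auto
   thus ?thesis using 1 P r by (intro exI[of _ "{0<..} \<times> ball z0 r"]) (auto intro: open_Times)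
  next
   case 2
   have "isCont f z0" using an by (rule analytic_at_imp_isCont)
   then obtain d where d: "0 < d" "!!w. dist w z0 < d ==> f w ~= 0"
    using continuous_at_avoid[of z0 f 0] 2 by (auto simp: dist_commute)
   define d' where "d' = min d r"
   have d': "0 < d'" using d r by (simp add: d'_def)
   have "continuous_on ({0..} \<times> D Int UNIV \<times> ball z0 d') (zfun \<alpha> f)"
    by (rule cF) (use d in \<open>auto simp: d'_def dist_commute\<close>)
   thus ?thesis using d' P by (intro exI[of _ "UNIV \<times> ball z0 d'"]) (auto intro: open_Times)
  next
   case 3
   have mm: "zorder f z0 >= int p" if "isolated_zero f z0" using zm P(3) that by (auto simp: zeros_mult_ge_def)
   obtain r' C \<beta> where e: "0 < r'" "0 < \<beta>" "!!x z. 0 <= x ==> z \<in> ball z0 r' ==> zfun \<alpha> f (x, z) <= C * x powr \<beta>"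
    by (rule zfun_small_near_zero[OF r(2,1) 3(2) mm \<alpha>]) (assumption, rule that)
   define d where "d = min r r'"
   have d: "0 < d" using e r by (simp add: d_def)
   define S :: "(real \<times> complex) set" where "S = {0..} \<times> D Int UNIV \<times> ball z0 d"
   have "continuous_on S (zfun \<alpha> f)"
    unfolding continuous_on_eq_continuous_within
   proof
    fix q assume q: "q \<in> S"
    show "continuous (at q within S) (zfun \<alpha> f)"
    proof (cases "0 < fst q | f (snd q) ~= 0")
     case True
     define U where "U = {q. 0 < fst q} \<union> {q :: real \<times> complex. snd q \<in> ball z0 r & f (snd q) ~= 0}"
     have o1: "open {q :: real \<times> complex. 0 < fst q}" by (intro open_Collect_less continuous_intros)
     have "open {z \<in> ball z0 r. f z ~= 0}"
     proof -
      have "open (ball z0 r Int f -` (- {0}))" by (rule continuous_open_preimage[OF cf(1) open_ball]) (intro open_Compl closed_singleton)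
      moreover have "ball z0 r Int f -` (- {0}) = {z \<in> ball z0 r. f z ~= 0}" by blast
      ultimately show ?thesis by (rule back_subst)
     qed
     hence "open (UNIV \<times> {z \<in> ball z0 r. f z ~= 0} :: (real \<times> complex) set)" by (intro open_Times) auto
     moreover have "{q :: real \<times> complex. snd q \<in> ball z0 r & f (snd q) ~= 0} = UNIV \<times> {z \<in> ball z0 r. f z ~= 0}" by auto
     ultimately have U: "open U" unfolding U_def using o1 by (intro open_Un) auto
     have "continuous_on (S Int U) (zfun \<alpha> f)"
      by (rule cF) (auto simp: S_def U_def d_def)
     moreover have "q \<in> U" using True q by (auto simp: U_def S_def d_def)
     ultimately have "continuous (at q within (S Int U)) (zfun \<alpha> f)" using q by (auto simp: continuous_on_eq_continuous_within)
     moreover have "at q within (S Int U) = at q within S" using U \<open>q \<in> U\<close> by (intro at_within_nhd[of q U]) auto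
     ultimately show ?thesis by simp
    next
     case False
     obtain x z where q0: "q = (x, z)" by (cases q)
     have qq: "q = (x, z)" "0 <= x" "z \<in> ball z0 r'" using q q0 by (auto simp: S_def d_def)
     hence x0: "x = 0" using False by auto
     have "((%q. C * fst q powr \<beta>) \<longlongrightarrow> C * fst q powr \<beta>) (at q within S)"
     proof (rule tendsto_mult[OF tendsto_const])
      have "continuous_on S (%q. fst q powr \<beta>)" by (rule pw[OF _ e(2)]) (auto simp: S_def)
      thus "((%q. fst q powr \<beta>) \<longlongrightarrow> fst q powr \<beta>) (at q within S)"
       using q unfolding continuous_on_def by blast
     qed
     hence lim: "((%q. C * fst q powr \<beta>) \<longlongrightarrow> 0) (at q within S)" using qq x0 by simp
     have "(zfun \<alpha> f \<longlongrightarrow> 0) (at q within S)"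
     proof (rule tendsto_sandwich[OF _ _ tendsto_const lim])
      show "\<forall>\<^sub>F q in at q within S. 0 <= zfun \<alpha> f q" by (simp add: zfun_nonneg)
      show "\<forall>\<^sub>F q in at q within S. zfun \<alpha> f q <= C * fst q powr \<beta>"
       unfolding eventually_at_filter
      proof (intro always_eventually allI impI)
       fix q' assume "q' \<in> S"
       thus "zfun \<alpha> f q' <= C * fst q' powr \<beta>"
        using e(3)[of "fst q'" "snd q'"] by (simp add: S_def d_def mem_Times_iff)
      qed
     qed
     thus ?thesis using qq x0 by (simp add: continuous_within)
    qed
   qed
   thus ?thesis using d P by (intro exI[of _ "UNIV \<times> ball z0 d"]) (auto simp: S_def intro: open_Times)
  qed
 qed
qed

text \<open>
 The least t for which the supremum over the disc of the function at scale \<open>t * (\<delta> - dist z a)\<close> reaches 1; it is attained by compactness.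
 The scale vanishes on the boundary of the disc, so the maximum lies inside.
\<close>

theorem zalcman_select:
 assumes f: "f nicely_meromorphic_on D" and D: "open D" and zm: "zeros_mult_ge D p f" and \<alpha>: "0 < \<alpha>" "\<alpha> < real p"
  and \<delta>: "0 < \<delta>" "cball a \<delta> \<subseteq> D" and big: "1 < zfun \<alpha> f (\<delta>, a)"
 obtains t z where "0 < t" "t <= 1" "z \<in> ball a \<delta>" "zfun \<alpha> f (t * (\<delta> - dist z a), z) = 1"
  "!!w. w \<in> ball a \<delta> ==> zfun \<alpha> f (t * (\<delta> - dist w a), w) <= 1"
proof -
 define K where "K = {0..1::real} \<times> cball a \<delta>"
 define W where "W = (%q. zfun \<alpha> f (fst q * (\<delta> - dist (snd q) a), snd q))"
 have cW: "continuous_on K W"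
  unfolding W_def
  by (rule continuous_on_compose2[OF zfun_continuous[OF f D zm \<alpha>]])
    (use \<delta> in \<open>auto intro!: continuous_intros mult_nonneg_nonneg simp: K_def dist_commute\<close>)
 have K: "compact K" unfolding K_def by (intro compact_Times) auto
 define S where "S = {q \<in> K. 1 <= W q}"
 have "closedin (top_of_set K) (K Int W -` {1..})"
  by (rule continuous_closedin_preimage[OF cW]) simp
 moreover have "K Int W -` {1..} = S" by (auto simp: S_def)
 ultimately have S: "compact S" using K closedin_compact by metis
 have "(1, a) \<in> S" using big \<delta> by (simp add: S_def K_def W_def)
 hence "\<exists>q\<in>S. \<forall>q'\<in>S. fst q <= fst q'"
  by (intro continuous_attains_inf[OF S] continuous_on_fst continuous_on_id) auto
 then obtain q where q: "q \<in> S" "!!q'. q' \<in> S ==> fst q <= fst q'" by metis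
 obtain t z where tz: "q = (t, z)" by (cases q)
 have t: "0 <= t" "t <= 1" "z \<in> cball a \<delta>" "1 <= W (t, z)" using q(1) tz by (auto simp: S_def K_def)
 have tpos: "0 < t" using t by (cases "t = 0") (auto simp: W_def)
 have zb: "z \<in> ball a \<delta>"
 proof (rule ccontr)
  assume "z \<notin> ball a \<delta>"
  hence "dist z a = \<delta>" using t(3) by (auto simp: dist_commute)
  thus False using t(4) by (simp add: W_def)
 qed
 have le: "W (t, w) <= 1" if w: "w \<in> ball a \<delta>" for w
 proof (rule ccontr)
  assume a: "~ W (t, w) <= 1"
  have "continuous_on {0..t} (%u. W (u, w))"
   by (rule continuous_on_compose2[OF cW]) (use w t in \<open>auto intro!: continuous_intros simp: K_def\<close>)
  moreover have "W (0, w) = 0" by (simp add: W_def)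
  ultimately obtain u where u: "0 <= u" "u <= t" "W (u, w) = 1"
   using IVT'[of "%u. W (u, w)" 0 1 t] a t(1) by auto
  hence "(u, w) \<in> S" using w t by (auto simp: S_def K_def)
  hence "t <= u" using q(2) tz by fastforce
  thus False using u a by auto
 qed
 show ?thesis
 proof (rule that[OF tpos t(2) zb])
  show "zfun \<alpha> f (t * (\<delta> - dist z a), z) = 1" using le[OF zb] t(4) by (simp add: W_def)
  show "zfun \<alpha> f (t * (\<delta> - dist w a), w) <= 1" if "w \<in> ball a \<delta>" for w using le[OF that] by (simp add: W_def)
 qed
qed

section \<open>Limits in the spherical metric\<close>

lemma higher_deriv_uniform_limit:
 assumes u: "uniform_limit (ball z r) f g sequentially" and f: "!!n. n >= N ==> f n holomorphic_on ball z r"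
  and g: "g holomorphic_on ball z r" and r: "0 < r"
 shows "uniform_limit (ball z (r/2)) (%n. (deriv ^^ j) (f n)) ((deriv ^^ j) g) sequentially"
proof (rule uniform_limitI)
 fix e :: real assume e: "0 < e"
 define d where "d = e * (r/4) ^ j / (2 * fact j)"
 have d: "0 < d" using e r by (simp add: d_def)
 have "\<forall>\<^sub>F n in sequentially. \<forall>x\<in>ball z r. dist (f n x) (g x) < d" using uniform_limitD[OF u d] .
 moreover have "\<forall>\<^sub>F n in sequentially. N <= n" by (rule eventually_ge_at_top)
 ultimately show "\<forall>\<^sub>F n in sequentially. \<forall>x\<in>ball z (r/2). dist ((deriv ^^ j) (f n) x) ((deriv ^^ j) g x) < e"
 proof eventually_elim
  case (elim n)
  show ?case
  proof
   fix x assume x: "x \<in> ball z (r/2)"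
   have sub: "cball x (r/4) \<subseteq> ball z r"
   proof
    fix y assume "y \<in> cball x (r/4)"
    thus "y \<in> ball z r" using x r dist_triangle[of z y x] by auto
   qed
   have fh: "f n holomorphic_on ball z r" using f elim by auto
   have hol: "(%w. f n w - g w) holomorphic_on ball z r" using fh g by (intro holomorphic_intros)
   have "cmod ((deriv ^^ j) (%w. f n w - g w) x) <= fact j * d / (r/4) ^ j"
   proof (rule Cauchy_inequality)
    show "(%w. f n w - g w) holomorphic_on ball x (r/4)"
     by (rule holomorphic_on_subset[OF hol]) (use sub ball_subset_cball in blast)
    show "continuous_on (cball x (r/4)) (%w. f n w - g w)"
     using holomorphic_on_imp_continuous_on[OF hol] sub continuous_on_subset by blast
    fix y assume "cmod (x - y) = r/4"
    hence "y \<in> ball z r" using sub by (auto simp: dist_norm)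
    hence "dist (f n y) (g y) < d" using elim by blast
    thus "cmod (f n y - g y) <= d" by (simp add: dist_norm)
   qed (use r in auto)
   also have "fact j * d / (r/4) ^ j = e / 2" using r by (simp add: d_def)
   finally have "cmod ((deriv ^^ j) (%w. f n w - g w) x) <= e / 2" .
   moreover have "(deriv ^^ j) (%w. f n w - g w) x = (deriv ^^ j) (f n) x - (deriv ^^ j) g x"
    using x r by (intro higher_deriv_diff[OF fh g open_ball]) auto
   ultimately show "dist ((deriv ^^ j) (f n) x) ((deriv ^^ j) g x) < e" using e by (simp add: dist_norm)
  qed
 qed
qed

lemma finite_limit:
 assumes r: "0 < r" and f: "!!n. n >= N ==> f n nicely_meromorphic_on ball z0 r"
  and u: "uniform_limit (ball z0 r) (%n. sphere_value (f n)) \<psi> sequentially"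
  and c: "continuous_on (ball z0 r) \<psi>" and fin: "\<psi> z0 ~= sphere_infinity"
 obtains r' F B N' where "0 < r'" "r' <= r" "F holomorphic_on ball z0 r'"
  "!!n. n >= N' ==> f n holomorphic_on ball z0 r'"
  "!!n z. n >= N' ==> z \<in> ball z0 r' ==> ~ is_pole (f n) z & cmod (f n z) <= B"
  "uniform_limit (ball z0 r') f F sequentially" "!!z. z \<in> ball z0 r' ==> \<psi> z = stereographic (F z)"
proof -
 define d where "d = dist (\<psi> z0) sphere_infinity / 3"
 have d: "0 < d" using fin by (simp add: d_def)
 have "continuous (at z0) \<psi>" using c r by (simp add: continuous_on_eq_continuous_at)
 then obtain r0 where r0: "0 < r0" "!!z. dist z z0 < r0 ==> dist (\<psi> z) (\<psi> z0) < d"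
  using d unfolding continuous_at_eps_delta by blast
 define r1 where "r1 = min r r0"
 have r1: "0 < r1" "r1 <= r" "r1 <= r0" using r r0 by (auto simp: r1_def)
 obtain N1 where N1: "!!n z. n >= N1 ==> z \<in> ball z0 r ==> dist (sphere_value (f n) z) (\<psi> z) < d"
  using uniform_limitD[OF u d] unfolding eventually_sequentially by blast
 define N' where "N' = max N N1"
 define B where "B = 2 / d"
 have far: "d <= dist (sphere_value (f n) z) sphere_infinity" if "n >= N'" "z \<in> ball z0 r1" for n z
 proof -
  have "dist (sphere_value (f n) z) (\<psi> z) < d" using N1 that r1 by (auto simp: N'_def)
  moreover have "dist (\<psi> z) (\<psi> z0) < d" using r0(2)[of z] that r1 by (auto simp: dist_commute)
  moreover have "dist (\<psi> z0) sphere_infinity <= dist (sphere_value (f n) z) (\<psi> z) + dist (\<psi> z) (\<psi> z0) + dist (sphere_value (f n) z) sphere_infinity"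
   using dist_triangle[of "\<psi> z0" sphere_infinity "\<psi> z"] dist_triangle[of "\<psi> z" sphere_infinity "sphere_value (f n) z"]
    dist_commute[of "\<psi> z" "\<psi> z0"] dist_commute[of "\<psi> z" "sphere_value (f n) z"] by linarith
  ultimately show ?thesis by (simp add: d_def)
 qed
 have bd: "~ is_pole (f n) z & cmod (f n z) <= B" if "n >= N'" "z \<in> ball z0 r1" for n z
  using sphere_value_bounded[OF far[OF that] d] by (simp add: B_def)
 have sv: "sphere_value (f n) z = stereographic (f n z)" if "n >= N'" "z \<in> ball z0 r1" for n z
  using bd[OF that] by (simp add: sphere_value_def)
 have hol: "f n holomorphic_on ball z0 r1" if "n >= N'" for n
 proof -
  have fn: "f n nicely_meromorphic_on ball z0 r" using f that by (auto simp: N'_def)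
  have "f n analytic_on {z}" if "z \<in> ball z0 r1" for z
   using nicely_meromorphic_on_imp_analytic_at[OF fn, of z] bd[OF \<open>n >= N'\<close> that] that r1 by auto
  thus ?thesis by (intro analytic_imp_holomorphic) (auto simp: analytic_on_analytic_at[of "f n" "ball z0 r1"])
 qed
 have uc: "uniformly_Cauchy_on (ball z0 r1) f"
  unfolding uniformly_Cauchy_on_def
 proof (intro allI impI)
  fix e :: real assume e: "0 < e"
  have B2: "0 < 1 + B^2" by (simp add: add_pos_nonneg)
  have "uniformly_convergent_on (ball z0 r) (%n. sphere_value (f n))" using u by (rule uniformly_convergentI)
  hence "uniformly_Cauchy_on (ball z0 r) (%n. sphere_value (f n))" by (rule uniformly_convergent_Cauchy)
  moreover have "0 < e / (1 + B^2)" using e B2 by simp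
  ultimately obtain M where M: "!!x m n. x \<in> ball z0 r ==> m >= M ==> n >= M ==>
    dist (sphere_value (f m) x) (sphere_value (f n) x) < e / (1 + B^2)"
   unfolding uniformly_Cauchy_on_def by meson
  show "\<exists>M. \<forall>x\<in>ball z0 r1. \<forall>m\<ge>M. \<forall>n\<ge>M. dist (f m x) (f n x) < e"
  proof (intro exI[of _ "max M N'"] ballI allI impI)
   fix x m n assume a: "x \<in> ball z0 r1" "max M N' <= m" "max M N' <= n"
   have "dist (f m x) (f n x) <= (1 + B^2) * dist (stereographic (f m x)) (stereographic (f n x))"
    using cmod_diff_le_dist_stereographic[of "f m x" B "f n x"] bd[of m x] bd[of n x] a by (simp add: dist_norm)
   also have "dist (stereographic (f m x)) (stereographic (f n x)) < e / (1 + B^2)"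
    using M[of x m n] a r1 sv[of m x] sv[of n x] by auto
   hence "(1 + B^2) * dist (stereographic (f m x)) (stereographic (f n x)) < (1 + B^2) * (e / (1 + B^2))"
    using B2 by (intro mult_strict_left_mono)
   also have "... = e" using B2 by simp
   finally show "dist (f m x) (f n x) < e" .
  qed
 qed
 then obtain F where F: "uniform_limit (ball z0 r1) f F sequentially"
  using Cauchy_uniformly_convergent uniformly_convergent_on_def by blast
 define r' where "r' = r1 / 2"
 have r': "0 < r'" "r' <= r" "cball z0 r' \<subseteq> ball z0 r1" "ball z0 r' \<subseteq> ball z0 r1" using r1 by (auto simp: r'_def)
 have Fh: "F holomorphic_on ball z0 r'"
 proof (rule holomorphic_uniform_limit[of z0 r' f sequentially F])
  have "continuous_on (cball z0 r') (f n) & f n holomorphic_on ball z0 r'" if "n >= N'" for n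
   using holomorphic_on_imp_continuous_on[OF hol[OF that]] holomorphic_on_subset[OF hol[OF that] r'(4)] continuous_on_subset r'(3) by blast
  thus "\<forall>\<^sub>F n in sequentially. continuous_on (cball z0 r') (f n) & f n holomorphic_on ball z0 r'"
   by (auto simp: eventually_sequentially)
  show "uniform_limit (cball z0 r') f F sequentially" using F r'(3) uniform_limit_on_subset by blast
 qed auto
 have psi: "\<psi> z = stereographic (F z)" if z: "z \<in> ball z0 r'" for z
 proof -
  have z1: "z \<in> ball z0 r1" "z \<in> ball z0 r" using z r' r1 by auto
  have 1: "(%n. sphere_value (f n) z) \<longlonglongrightarrow> \<psi> z" using tendsto_uniform_limitI[OF u z1(2)] .
  have fF: "(%n. f n z) \<longlonglongrightarrow> F z" using tendsto_uniform_limitI[OF F z1(1)] .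
  have "(%n. 2 * cmod (f n z - F z)) \<longlonglongrightarrow> 2 * cmod (F z - F z)" by (intro tendsto_intros fF)
  hence lim: "(%n. 2 * cmod (f n z - F z)) \<longlonglongrightarrow> 0" by simp
  have "(%n. dist (stereographic (f n z)) (stereographic (F z))) \<longlonglongrightarrow> 0"
   by (rule tendsto_sandwich[OF _ _ tendsto_const lim]) (auto simp: dist_stereographic_le)
  hence "(%n. stereographic (f n z)) \<longlonglongrightarrow> stereographic (F z)" by (rule iffD2[OF tendsto_dist_iff])
  moreover have "\<forall>\<^sub>F n in sequentially. stereographic (f n z) = sphere_value (f n) z"
   using sv[OF _ z1(1)] by (intro eventually_sequentiallyI[of N']) simp
  ultimately have "(%n. sphere_value (f n) z) \<longlonglongrightarrow> stereographic (F z)" by (simp add: tendsto_cong)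
  with 1 show ?thesis by (rule LIMSEQ_unique)
 qed
 show ?thesis
 proof (rule that[OF r'(1,2) Fh _ _ _ psi])
  show "f n holomorphic_on ball z0 r'" if "n >= N'" for n using holomorphic_on_subset[OF hol[OF that] r'(4)] .
  show "~ is_pole (f n) z & cmod (f n z) <= B" if "n >= N'" "z \<in> ball z0 r'" for n z using bd that r'(4) by blast
  show "uniform_limit (ball z0 r') f F sequentially" using F r'(4) uniform_limit_on_subset by blast
 qed
qed

lemma infinite_limit:
 assumes r: "0 < r" and f: "!!n. n >= N ==> f n nicely_meromorphic_on ball z0 r"
  and u: "uniform_limit (ball z0 r) (%n. sphere_value (f n)) \<psi> sequentially"
  and c: "continuous_on (ball z0 r) \<psi>" and inf: "\<psi> z0 = sphere_infinity"
 obtains r' F N' where "0 < r'" "r' <= r" "F holomorphic_on ball z0 r'" "F z0 = 0"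
  "!!n. n >= N' ==> (%w. inverse (f n w)) holomorphic_on ball z0 r'"
  "!!n z. n >= N' ==> z \<in> ball z0 r' ==> is_pole (f n) z | f n z ~= 0"
  "uniform_limit (ball z0 r') (%n w. inverse (f n w)) F sequentially"
  "!!z. z \<in> ball z0 r' ==> \<psi> z = sphere_reflection (stereographic (F z))"
proof -
 have "continuous (at z0) \<psi>" using c r by (simp add: continuous_on_eq_continuous_at)
 then obtain r0 where r0: "0 < r0" "!!z. dist z z0 < r0 ==> dist (\<psi> z) (\<psi> z0) < 1/2"
  unfolding continuous_at_eps_delta by (metis half_gt_zero zero_less_one)
 define r1 where "r1 = min r r0"
 have r1: "0 < r1" "r1 <= r" "r1 <= r0" "ball z0 r1 \<subseteq> ball z0 r" using r r0 by (auto simp: r1_def)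
 obtain N1 where N1: "!!n z. n >= N1 ==> z \<in> ball z0 r ==> dist (sphere_value (f n) z) (\<psi> z) < 1/2"
 proof -
  have "\<forall>\<^sub>F n in sequentially. \<forall>z\<in>ball z0 r. dist (sphere_value (f n) z) (\<psi> z) < 1/2"
   by (rule uniform_limitD[OF u]) simp
  thus ?thesis using that unfolding eventually_sequentially by blast
 qed
 define N' where "N' = max N N1"
 have large: "is_pole (f n) z | f n z ~= 0" if "n >= N'" "z \<in> ball z0 r1" for n z
 proof -
  have "dist (sphere_value (f n) z) (\<psi> z) < 1/2" using N1 that r1 by (auto simp: N'_def)
  moreover have "dist (\<psi> z) sphere_infinity < 1/2" using r0(2)[of z] that r1 inf by (auto simp: dist_commute)
  ultimately have "dist (sphere_value (f n) z) sphere_infinity < 1"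
   using dist_triangle[of "sphere_value (f n) z" sphere_infinity "\<psi> z"] by linarith
  thus ?thesis using sphere_value_large[of "f n" z] by auto
 qed
 have fz: "f n nicely_meromorphic_on {z}" if "n >= N'" "z \<in> ball z0 r1" for n z
  using f[of n] that r1(4) by (auto simp: N'_def intro: nicely_meromorphic_on_subset)
 have sv: "sphere_value (%w. inverse (f n w)) z = sphere_reflection (sphere_value (f n) z)"
  if "n >= N'" "z \<in> ball z0 r1" for n z
  using sphere_value_inverse[OF fz[OF that] large[OF that]] .
 have u1: "uniform_limit (ball z0 r1) (%n. sphere_value (%w. inverse (f n w))) (%z. sphere_reflection (\<psi> z)) sequentially"
 proof (rule uniform_limitI)
  fix e :: real assume "0 < e"
  hence "\<forall>\<^sub>F n in sequentially. \<forall>x\<in>ball z0 r. dist (sphere_value (f n) x) (\<psi> x) < e" using uniform_limitD[OF u] by blast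
  moreover have "\<forall>\<^sub>F n in sequentially. N' <= n" by (rule eventually_ge_at_top)
  ultimately show "\<forall>\<^sub>F n in sequentially. \<forall>x\<in>ball z0 r1. dist (sphere_value (%w. inverse (f n w)) x) (sphere_reflection (\<psi> x)) < e"
   by eventually_elim (use sv r1 in \<open>auto simp: dist_sphere_reflection\<close>)
 qed
 have c1: "continuous_on (ball z0 r1) (%z. sphere_reflection (\<psi> z))"
 proof -
  have "continuous_on (ball z0 r1) \<psi>" using c r1(4) by (rule continuous_on_subset)
  thus ?thesis unfolding sphere_reflection_def by (intro continuous_intros)
 qed
 have nf: "sphere_reflection (\<psi> z0) ~= sphere_infinity" unfolding inf by simp
 have f1: "(%w. inverse (f n w)) nicely_meromorphic_on ball z0 r1" if "n >= N'" for n
  using f[of n] that r1(4) by (intro nicely_meromorphic_on_inverse) (auto simp: N'_def intro: nicely_meromorphic_on_subset)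
 obtain r' F B N2 where R: "0 < r'" "r' <= r1" "F holomorphic_on ball z0 r'"
  "!!n. n >= N2 ==> (%w. inverse (f n w)) holomorphic_on ball z0 r'"
  "uniform_limit (ball z0 r') (%n w. inverse (f n w)) F sequentially"
  "!!z. z \<in> ball z0 r' ==> sphere_reflection (\<psi> z) = stereographic (F z)"
  using finite_limit[OF r1(1) f1 u1 c1 nf] by metis
 have "stereographic (F z0) = stereographic 0" using R(6)[of z0] R(1) inf by simp
 hence F0: "F z0 = 0" by simp
 have psi: "\<psi> z = sphere_reflection (stereographic (F z))" if "z \<in> ball z0 r'" for z
  using R(6)[OF that] by (metis sphere_reflection_invol)
 show ?thesis
 proof (rule that[of r' F "max N' N2", OF R(1) _ R(3) F0 _ _ R(5) psi])
  show "r' <= r" using R(2) r1(2) by simp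
  show "(%w. inverse (f n w)) holomorphic_on ball z0 r'" if "n >= max N' N2" for n using R(4) that by simp
  show "is_pole (f n) z | f n z ~= 0" if "n >= max N' N2" "z \<in> ball z0 r'" for n z using large[of n z] that R(2) by auto
 qed
qed

text \<open>
 Locally the limit or its inversion comes from a holomorphic limit. The points near which the limit is identically infinite form an open and
 closed set.
\<close>

theorem limit_meromorphic:
 assumes D: "open D" "connected D" and c: "continuous_on D \<psi>"
  and loc: "!!z. z \<in> D ==> \<exists>r>0. ball z r \<subseteq> D & (\<exists>N. \<forall>n\<ge>N. f n nicely_meromorphic_on ball z r) &
    uniform_limit (ball z r) (%n. sphere_value (f n)) \<psi> sequentially"
 shows "(\<forall>z\<in>D. \<psi> z = sphere_infinity) | (\<exists>g. g nicely_meromorphic_on D & (\<forall>z\<in>D. \<psi> z = sphere_value g z))"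
proof (cases "\<forall>z\<in>D. \<psi> z = sphere_infinity")
 case notall: False
 have fin: "\<exists>r F. 0 < r & ball z r \<subseteq> D & F holomorphic_on ball z r & (\<forall>w\<in>ball z r. \<psi> w = stereographic (F w))"
  if z: "z \<in> D" "\<psi> z ~= sphere_infinity" for z
 proof -
  obtain r N where r: "0 < r" "ball z r \<subseteq> D" "!!n. n >= N ==> f n nicely_meromorphic_on ball z r"
   "uniform_limit (ball z r) (%n. sphere_value (f n)) \<psi> sequentially" using loc[OF z(1)] by blast
  obtain r' F where "0 < r'" "r' <= r" "F holomorphic_on ball z r'" "!!w. w \<in> ball z r' ==> \<psi> w = stereographic (F w)"
   using finite_limit[OF r(1,3,4) continuous_on_subset[OF c r(2)] z(2)] by metis
  moreover have "ball z r' \<subseteq> D" using \<open>r' <= r\<close> r(2) by (meson order_trans subset_ball)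
  ultimately show ?thesis by blast
 qed
 have inf: "\<exists>r F. 0 < r & ball z r \<subseteq> D & F holomorphic_on ball z r & F z = 0 & (\<forall>w\<in>ball z r. \<psi> w = sphere_reflection (stereographic (F w)))"
  if z: "z \<in> D" "\<psi> z = sphere_infinity" for z
 proof -
  obtain r N where r: "0 < r" "ball z r \<subseteq> D" "!!n. n >= N ==> f n nicely_meromorphic_on ball z r"
   "uniform_limit (ball z r) (%n. sphere_value (f n)) \<psi> sequentially" using loc[OF z(1)] by blast
  obtain r' F where "0 < r'" "r' <= r" "F holomorphic_on ball z r'" "F z = 0"
    "!!w. w \<in> ball z r' ==> \<psi> w = sphere_reflection (stereographic (F w))"
   using infinite_limit[OF r(1,3,4) continuous_on_subset[OF c r(2)] z(2)] by metis
  moreover have "ball z r' \<subseteq> D" using \<open>r' <= r\<close> r(2) by (meson order_trans subset_ball)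
  ultimately show ?thesis by blast
 qed
 have refl_inf: "sphere_reflection (stereographic w) = sphere_infinity \<longleftrightarrow> w = 0" for w
  by (cases "w = 0") (auto simp: sphere_reflection_stereographic)
 define I where "I = {z \<in> D. \<forall>\<^sub>F w in nhds z. \<psi> w = sphere_infinity}"
 have oI: "open I"
 proof (subst open_subopen, intro ballI)
  fix z assume "z \<in> I"
  then obtain S where S: "open S" "z \<in> S" "!!w. w \<in> S ==> \<psi> w = sphere_infinity" "z \<in> D"
   by (auto simp: I_def eventually_nhds)
  have "S Int D \<subseteq> I" using S by (auto simp: I_def eventually_nhds)
  thus "\<exists>T. open T & z \<in> T & T \<subseteq> I" using S D(1) by (intro exI[of _ "S Int D"]) auto
 qed
 have oDI: "open (D - I)"
 proof (subst open_subopen, intro ballI)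
  fix z assume z: "z \<in> D - I"
  show "\<exists>T. open T & z \<in> T & T \<subseteq> D - I"
  proof (cases "\<psi> z = sphere_infinity")
   case False
   then obtain r F where r: "0 < r" "ball z r \<subseteq> D" "!!w. w \<in> ball z r ==> \<psi> w = stereographic (F w)"
    using fin z by blast
   have "w \<notin> I" if "w \<in> ball z r" for w
    using eventually_nhds_x_imp_x[of "%w. \<psi> w = sphere_infinity" w] r(3)[OF that] by (auto simp: I_def)
   thus ?thesis using r by (intro exI[of _ "ball z r"]) auto
  next
   case True
   then obtain r F where r: "0 < r" "ball z r \<subseteq> D" "F holomorphic_on ball z r" "F z = 0"
    "!!w. w \<in> ball z r ==> \<psi> w = sphere_reflection (stereographic (F w))"
    using inf z by blast
   have "w \<notin> I" if w: "w \<in> ball z r" for w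
   proof
    assume "w \<in> I"
    then obtain S where S: "open S" "w \<in> S" "!!x. x \<in> S ==> \<psi> x = sphere_infinity"
     by (auto simp: I_def eventually_nhds)
    have "F x = 0" if "x \<in> ball z r" for x
    proof (rule analytic_continuation_open[of "S Int ball z r" "ball z r" F "%_. 0"])
     show "S Int ball z r ~= {}" using S w by blast
     show "F y = 0" if "y \<in> S Int ball z r" for y
      using S(3)[of y] r(5)[of y] that refl_inf by auto
    qed (use S r that in auto)
    hence "\<psi> x = sphere_infinity" if "x \<in> ball z r" for x using r(5)[OF that] that by simp
    hence "z \<in> I" using z r(1) by (auto simp: I_def eventually_nhds intro!: exI[of _ "ball z r"])
    thus False using z by simp
   qed
   thus ?thesis using r by (intro exI[of _ "ball z r"]) auto
  qed
 qed
 have "I \<subseteq> D" by (auto simp: I_def)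
 hence "I = {} | I = D" using connectedD[OF D(2) oI oDI] by blast
 moreover have "I ~= D" using notall eventually_nhds_x_imp_x by (fastforce simp: I_def)
 ultimately have I: "I = {}" by blast
 define g where "g = (%z. if \<psi> z = sphere_infinity then 0 else unproject (\<psi> z))"
 have at: "g nicely_meromorphic_on {z} & \<psi> z = sphere_value g z" if z: "z \<in> D" for z
 proof (cases "\<psi> z = sphere_infinity")
  case False
  then obtain r F where r: "0 < r" "ball z r \<subseteq> D" "F holomorphic_on ball z r" "!!w. w \<in> ball z r ==> \<psi> w = stereographic (F w)"
   using fin z by blast
  have eq: "g w = F w" if "w \<in> ball z r" for w using r(4)[OF that] by (simp add: g_def)
  have "F analytic_on {z}" using r(1,3) analytic_at by (metis centre_in_ball open_ball)
  moreover have "\<forall>\<^sub>F w in nhds z. g w = F w"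
   using r(1) eq by (intro eventually_mono[OF eventually_nhds_in_open[of "ball z r" z]]) auto
  ultimately have an: "g analytic_on {z}" by (subst analytic_at_cong[of g F]) auto
  hence "~ is_pole g z" by (rule analytic_at_imp_no_pole)
  thus ?thesis using an r(4)[of z] eq[of z] r(1)
   by (auto simp: sphere_value_def intro: analytic_on_imp_nicely_meromorphic_on)
 next
  case True
  then obtain r F where r: "0 < r" "ball z r \<subseteq> D" "F holomorphic_on ball z r" "F z = 0"
    "!!w. w \<in> ball z r ==> \<psi> w = sphere_reflection (stereographic (F w))"
   using inf z by blast
  have eq: "g w = inverse (F w)" if "w \<in> ball z r" for w
   using r(5)[OF that] by (cases "F w = 0") (auto simp: g_def sphere_reflection_stereographic)
  have Fan: "F analytic_on {z}" using r(1,3) analytic_at by (metis centre_in_ball open_ball)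
  have iz: "isolated_zero F z"
  proof (rule ccontr)
   assume "~ isolated_zero F z"
   hence "\<forall>\<^sub>F w in nhds z. F w = 0" using non_isolated_zero_imp_eventually_zero'[OF Fan r(4)] by blast
   moreover have "\<forall>\<^sub>F w in nhds z. w \<in> ball z r" using r(1) by (intro eventually_nhds_in_open) auto
   ultimately have "\<forall>\<^sub>F w in nhds z. \<psi> w = sphere_infinity" by eventually_elim (use r(5) in simp)
   thus False using I z by (auto simp: I_def)
  qed
  have "(%w. inverse (F w)) nicely_meromorphic_on {z}"
   using Fan by (intro nicely_meromorphic_on_inverse analytic_on_imp_nicely_meromorphic_on)
  moreover have ev: "\<forall>\<^sub>F w in nhds z. g w = inverse (F w)"
   using r(1) eq by (intro eventually_mono[OF eventually_nhds_in_open[of "ball z r" z]]) auto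
  hence ev': "\<forall>\<^sub>F w in at z. g w = inverse (F w)" by (simp add: eventually_nhds_conv_at)
  have pole: "is_pole g z" using is_pole_cong[OF ev' refl] iz by (simp add: is_pole_inverse_iff)
  have "g nicely_meromorphic_on {z}"
   unfolding nicely_meromorphic_on_def
  proof (intro conjI ballI)
   have "(%w. inverse (F w)) meromorphic_on {z}" using calculation by (simp add: nicely_meromorphic_on_def)
   thus "g meromorphic_on {z}" using ev' by (subst meromorphic_on_cong[of "{z}" g "%w. inverse (F w)"]) auto
   show "is_pole g x & g x = 0 | g \<midarrow>x\<rightarrow> g x" if "x \<in> {z}" for x
    using that pole True by (simp add: g_def)
  qed
  thus ?thesis using pole True by (simp add: sphere_value_def)
 qed
 have "g nicely_meromorphic_on D"
  unfolding nicely_meromorphic_on_def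
 proof (intro conjI ballI)
  show "g meromorphic_on D" using at by (subst meromorphic_on_meromorphic_at) (auto simp: nicely_meromorphic_on_def)
  show "is_pole g z & g z = 0 | g \<midarrow>z\<rightarrow> g z" if "z \<in> D" for z using at[OF that] by (simp add: nicely_meromorphic_on_def)
 qed
 thus ?thesis using at by blast
qed simp

lemma sphderiv_inverse:
 assumes f: "f nicely_meromorphic_on {z}" "is_pole f z | f z ~= 0"
 shows "sphderiv (%w. inverse (f w)) z = sphderiv f z"
proof (cases "is_pole f z")
 case True
 have np: "~ is_pole (%w. inverse (f w)) z"
  using True isolated_zero_inverse_iff[of f z] pole_is_not_zero by blast
 have "f z = 0" using inverse_analytic_at_pole[OF f(1) True] by blast
 thus ?thesis using True np by (simp add: sphderiv_def)
next
 case False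
 hence nz: "f z ~= 0" using f(2) by simp
 have an: "f analytic_on {z}" using f(1) False by (auto intro: nicely_meromorphic_on_imp_analytic_at)
 have "~ isolated_zero f z" using nz zero_isolated_zero_nicely_meromorphic[OF _ f(1)] by blast
 hence np: "~ is_pole (%w. inverse (f w)) z" by (simp add: is_pole_inverse_iff)
 have fd: "f field_differentiable at z" using an analytic_on_imp_differentiable_at by blast
 have "deriv (%w. inverse (f w)) z = - deriv f z / (f z)^2" using fd nz by (simp add: deriv_inverse)
 hence d: "cmod (deriv (%w. inverse (f w)) z) = cmod (deriv f z) / (cmod (f z))^2" by (simp add: norm_divide norm_power)
 have s: "1 + (cmod (inverse (f z)))^2 = (1 + (cmod (f z))^2) / (cmod (f z))^2"
  using nz by (simp add: norm_inverse power_inverse divide_inverse distrib_right)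
 show ?thesis using False np nz unfolding sphderiv_def by (simp add: d s)
qed

lemma higher_deriv_zero_of_multiplicity:
 assumes an: "f analytic_on {z}" and f0: "f z = 0" and p: "isolated_zero f z ==> int p <= zorder f z" and j: "j < p"
 shows "(deriv ^^ j) f z = 0"
proof (cases "isolated_zero f z")
 case True
 show ?thesis
 proof (rule ccontr)
  assume nz: "(deriv ^^ j) f z ~= 0"
  define i where "i = (LEAST i. (deriv ^^ i) f z ~= 0)"
  have i: "(deriv ^^ i) f z ~= 0" "i <= j" "!!l. l < i ==> (deriv ^^ l) f z = 0"
   unfolding i_def using LeastI[of "%i. (deriv ^^ i) f z ~= 0" j, OF nz] Least_le[of "%i. (deriv ^^ i) f z ~= 0" j, OF nz]
    not_less_Least[of _ "%i. (deriv ^^ i) f z ~= 0"] by blast+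
  obtain S where S: "open S" "z \<in> S" "f holomorphic_on S" using an analytic_at by blast
  have "zorder f z = int i" using i by (intro zorder_zero_eqI[OF S(3,1,2)]) auto
  thus False using p[OF True] i(2) j by simp
 qed
next
 case False
 hence "\<forall>\<^sub>F w in nhds z. f w = 0" using non_isolated_zero_imp_eventually_zero'[OF an f0] by blast
 hence "(deriv ^^ j) f z = (deriv ^^ j) (%_. 0) z" by (intro higher_deriv_cong_ev) auto
 thus ?thesis by simp
qed

lemma multiplicity_of_higher_deriv_zero:
 assumes an: "f analytic_on {z}" and iz: "isolated_zero f z" and d: "!!j. j < p ==> (deriv ^^ j) f z = 0"
 shows "int p <= zorder f z"
proof (rule ccontr)
 assume a: "~ ?thesis"
 have pos: "0 < zorder f z" using zorder_isolated_zero_pos[OF iz an] .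
 define q where "q = nat (zorder f z)"
 have q: "zorder f z = int q" "q < p" using a pos by (auto simp: q_def)
 have m: "f meromorphic_on {z}" using an by (rule analytic_on_imp_meromorphic_on)
 have fr: "\<exists>\<^sub>F w in at z. f w ~= 0" using iz eventually_frequently[of "at z"] by (auto simp: isolated_zero_def)
 have h: "zorder ((deriv ^^ q) f) z = 0" "\<exists>\<^sub>F w in at z. (deriv ^^ q) f w ~= 0"
  using zorder_higher_deriv[OF m fr, of q q] q by auto
 have "(deriv ^^ q) f analytic_on {z}" using an by (rule analytic_higher_deriv)
 hence "(deriv ^^ q) f z ~= 0" using h zorder_pos_iff' by fastforce
 thus False using d[OF q(2)] by simp
qed

text \<open>
 By Hurwitz the functions have zeros converging to z. There all derivatives of order below p vanish, and so do their limits.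
\<close>

lemma limit_zero_multiplicity:
 assumes r: "0 < r" and hol: "!!n. n >= N ==> f n holomorphic_on ball z r"
  and u: "uniform_limit (ball z r) f g sequentially" and g: "g holomorphic_on ball z r"
  and iz: "isolated_zero g z"
  and mult: "!!n w. n >= N ==> w \<in> ball z r ==> isolated_zero (f n) w ==> int p <= zorder (f n) w"
 shows "int p <= zorder g z"
proof (rule multiplicity_of_higher_deriv_zero[OF _ iz])
 show an: "g analytic_on {z}" using g r analytic_at by (metis centre_in_ball open_ball)
 have gz: "g z = 0" using zero_isolated_zero_analytic[OF iz an] .
 have near: "\<exists>n\<ge>M. \<exists>w\<in>ball z d. f n w = 0" if d: "0 < d" "d <= r" for d M
 proof (rule ccontr)
  assume a: "~ ?thesis"
  define F where "F = (%n. f (n + max M N))"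
  have sub: "ball z d \<subseteq> ball z r" using d by auto
  have "g z ~= 0"
  proof (rule Hurwitz_no_zeros[of "ball z d" F g])
   show "F n holomorphic_on ball z d" for n unfolding F_def using holomorphic_on_subset[OF hol sub] by simp
   show "g holomorphic_on ball z d" using holomorphic_on_subset[OF g sub] .
   show "uniform_limit K F g sequentially" if "compact K" "K \<subseteq> ball z d" for K
   proof -
    have "uniform_limit K f g sequentially" using u that sub uniform_limit_on_subset by (meson order_trans)
    thus ?thesis unfolding F_def uniform_limit_iff by (subst (asm) eventually_sequentially_seg[symmetric, where k = "max M N"]) auto
   qed
   show "~ g constant_on ball z d"
   proof
    assume "g constant_on ball z d"
    hence g0: "g w = 0" if "w \<in> ball z d" for w using that gz d(1) by (metis centre_in_ball constant_on_def)
    have "\<forall>\<^sub>F w in at z. w \<in> ball z d" using d(1) by (intro eventually_at_in_open') auto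
    moreover have "\<forall>\<^sub>F w in at z. g w ~= 0" using iz by (simp add: isolated_zero_def)
    ultimately have "\<forall>\<^sub>F w in at z. False" by eventually_elim (use g0 in auto)
    thus False by simp
   qed
   show "F n w ~= 0" if "w \<in> ball z d" for n w using a that by (auto simp: F_def)
  qed (use d in auto)
  thus False using gz by simp
 qed
 fix j assume j: "j < p"
 show "(deriv ^^ j) g z = 0"
 proof (rule ccontr)
  assume nz: "(deriv ^^ j) g z ~= 0"
  define e where "e = cmod ((deriv ^^ j) g z) / 2"
  have e: "0 < e" using nz by (simp add: e_def)
  have "(deriv ^^ j) g analytic_on {z}" using an by (rule analytic_higher_deriv)
  hence "isCont ((deriv ^^ j) g) z" by (rule analytic_at_imp_isCont)
  then obtain d0 where d0: "0 < d0" "!!w. dist w z < d0 ==> dist ((deriv ^^ j) g w) ((deriv ^^ j) g z) < e"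
   using e unfolding continuous_at_eps_delta by blast
  obtain M where M: "!!n w. n >= M ==> w \<in> ball z (r/2) ==> dist ((deriv ^^ j) (f n) w) ((deriv ^^ j) g w) < e"
  proof -
   have "\<forall>\<^sub>F n in sequentially. \<forall>w\<in>ball z (r/2). dist ((deriv ^^ j) (f n) w) ((deriv ^^ j) g w) < e"
    by (rule uniform_limitD[OF higher_deriv_uniform_limit[OF u hol g r] e])
   thus ?thesis using that unfolding eventually_sequentially by blast
  qed
  define d where "d = min d0 (r/2)"
  have d: "0 < d" "d <= r" using d0 r by (auto simp: d_def)
  obtain n w where nw: "n >= max M N" "w \<in> ball z d" "f n w = 0" using near[OF d, of "max M N"] by blast
  have wr: "w \<in> ball z r" using nw d by auto
  have "f n analytic_on {w}" using hol[of n] nw wr analytic_at by (metis max.boundedE open_ball)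
  hence "(deriv ^^ j) (f n) w = 0"
   using mult[of n w] nw wr j by (intro higher_deriv_zero_of_multiplicity[of _ _ p]) auto
  moreover have "dist ((deriv ^^ j) (f n) w) ((deriv ^^ j) g w) < e" using M[of n w] nw by (auto simp: d_def)
  moreover have "dist ((deriv ^^ j) g w) ((deriv ^^ j) g z) < e" using d0(2)[of w] nw by (auto simp: d_def dist_commute)
  ultimately have "dist 0 ((deriv ^^ j) g z) < 2 * e" using dist_triangle[of 0 "(deriv ^^ j) g z" "(deriv ^^ j) g w"] by auto
  thus False by (simp add: e_def)
 qed
qed

section \<open>Zalcman's lemma\<close>

lemma zfun_ge:
 assumes x: "0 < x" "x <= 1" and \<alpha>: "0 < \<alpha>"
 shows "x powr (1 + \<alpha>) * sphderiv f z <= zfun \<alpha> f (x, z)"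
proof (cases "is_pole f z")
 case False
 have "x powr (2 * \<alpha>) <= 1" using x \<alpha> by (intro powr_le1) auto
 hence "x powr (1 + \<alpha>) * cmod (deriv f z) / (1 + (cmod (f z))^2)
   <= x powr (1 + \<alpha>) * cmod (deriv f z) / (x powr (2 * \<alpha>) + (cmod (f z))^2)"
  using x by (intro divide_left_mono mult_pos_pos add_pos_nonneg) auto
 thus ?thesis using False by (simp add: zfun_def sphderiv_def)
qed (simp add: zfun_def sphderiv_def)

lemma zfun_compare:
 assumes xy: "0 < x" "0 < y" "x <= 2 * y" "y <= 2 * x" and \<alpha>: "0 < \<alpha>"
 shows "zfun \<alpha> f (x, z) <= 2 powr (1 + 3 * \<alpha>) * zfun \<alpha> f (y, z)"
proof -
 have num: "x powr (1 + \<alpha>) <= 2 powr (1 + \<alpha>) * y powr (1 + \<alpha>)"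
 proof -
  have "x powr (1 + \<alpha>) <= (2 * y) powr (1 + \<alpha>)" using xy \<alpha> by (intro powr_mono2) auto
  thus ?thesis using xy by (simp add: powr_mult)
 qed
 have split: "2 powr (1 + 3 * \<alpha>) = 2 powr (1 + \<alpha>) * 2 powr (2 * \<alpha>)"
  by (simp add: powr_add[symmetric] algebra_simps)
 have one: "1 <= (2::real) powr (2 * \<alpha>)" using \<alpha> by (intro ge_one_powr_ge_zero) auto
 show ?thesis
 proof (cases "is_pole f z")
  case True
  have "x powr (1 + \<alpha>) <= 2 powr (1 + 3 * \<alpha>) * y powr (1 + \<alpha>)"
  proof -
   have "2 powr (1 + \<alpha>) * y powr (1 + \<alpha>) * 1 <= 2 powr (1 + \<alpha>) * y powr (1 + \<alpha>) * 2 powr (2 * \<alpha>)"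
    using one by (intro mult_left_mono) auto
   thus ?thesis using num unfolding split by (simp add: mult_ac)
  qed
  hence "x powr (1 + \<alpha>) * cmod (deriv (%w. inverse (f w)) z)
    <= 2 powr (1 + 3 * \<alpha>) * y powr (1 + \<alpha>) * cmod (deriv (%w. inverse (f w)) z)"
   by (rule mult_right_mono) simp
  thus ?thesis using True by (simp add: zfun_def mult.assoc)
 next
  case False
  define v where "v = (cmod (f z))^2"
  have v: "0 <= v" by (simp add: v_def)
  have py: "0 < y powr (2 * \<alpha>) + v" "0 < x powr (2 * \<alpha>) + v" using xy v by (auto intro: add_pos_nonneg)
  have "y powr (2 * \<alpha>) <= (2 * x) powr (2 * \<alpha>)" using xy \<alpha> by (intro powr_mono2) auto
  hence "y powr (2 * \<alpha>) <= 2 powr (2 * \<alpha>) * x powr (2 * \<alpha>)" using xy by (simp add: powr_mult)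
  moreover have "1 * v <= 2 powr (2 * \<alpha>) * v" using one v by (rule mult_right_mono)
  ultimately have den: "y powr (2 * \<alpha>) + v <= 2 powr (2 * \<alpha>) * (x powr (2 * \<alpha>) + v)"
   by (simp add: distrib_left)
  have "x powr (1 + \<alpha>) * cmod (deriv f z) / (x powr (2 * \<alpha>) + v) <=
    (2 powr (1 + \<alpha>) * y powr (1 + \<alpha>) * cmod (deriv f z)) / ((y powr (2 * \<alpha>) + v) / 2 powr (2 * \<alpha>))"
  proof (rule frac_le)
   show "x powr (1 + \<alpha>) * cmod (deriv f z) <= 2 powr (1 + \<alpha>) * y powr (1 + \<alpha>) * cmod (deriv f z)"
    using num by (rule mult_right_mono) simp
   show "0 < (y powr (2 * \<alpha>) + v) / 2 powr (2 * \<alpha>)" using py by simp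
   show "(y powr (2 * \<alpha>) + v) / 2 powr (2 * \<alpha>) <= x powr (2 * \<alpha>) + v"
    using den by (simp add: divide_le_eq mult.commute)
  qed simp
  also have "... = 2 powr (1 + 3 * \<alpha>) * (y powr (1 + \<alpha>) * cmod (deriv f z) / (y powr (2 * \<alpha>) + v))"
   unfolding split by (simp add: mult_ac)
  finally show ?thesis using False by (simp add: zfun_def v_def)
 qed
qed

lemma sphderiv_small_near_constant_limit:
 assumes r: "0 < r" and H: "!!i. i >= N ==> H i holomorphic_on ball z r"
  and u: "uniform_limit (ball z r) H F sequentially" and F: "F holomorphic_on ball z r"
  and const: "!!x. x \<in> ball z r ==> F x = w"
 obtains M where "!!i. i >= M ==> sphderiv (H i) z < 1"
proof -
 have F': "deriv F z = 0"
 proof -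
  have "deriv F z = deriv (%_. w) z"
   using r const by (intro deriv_cong_ev eventually_mono[OF eventually_nhds_in_open[of "ball z r" z]]) auto
  thus ?thesis by simp
 qed
 have "uniform_limit (ball z (r/2)) (%i. (deriv ^^ 1) (H i)) ((deriv ^^ 1) F) sequentially"
  by (rule higher_deriv_uniform_limit[OF u H F r])
 from uniform_limitD[OF this, of 1]
 have "\<forall>\<^sub>F i in sequentially. \<forall>x\<in>ball z (r/2). dist ((deriv ^^ 1) (H i) x) ((deriv ^^ 1) F x) < 1" by simp
 then obtain M where M: "!!i. i >= M ==> \<forall>x\<in>ball z (r/2). dist ((deriv ^^ 1) (H i) x) ((deriv ^^ 1) F x) < 1"
  unfolding eventually_sequentially by blast
 have "sphderiv (H i) z < 1" if i: "i >= max M N" for i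
 proof -
  have "dist ((deriv ^^ 1) (H i) z) ((deriv ^^ 1) F z) < 1" using M[of i] i r by (auto simp del: funpow.simps)
  hence d: "cmod (deriv (H i) z) < 1" using F' by simp
  have "~ is_pole (H i) z" using not_is_pole_holomorphic[OF open_ball _ H[of i], of z] r i by simp
  hence "sphderiv (H i) z = cmod (deriv (H i) z) / (1 + (cmod (H i z))^2)" by (simp add: sphderiv_def)
  also have "... <= cmod (deriv (H i) z) / 1"
   by (intro divide_left_mono) (auto intro: add_pos_nonneg)
  finally show ?thesis using d by simp
 qed
 thus ?thesis using that by blast
qed

text \<open>
 The data that the rescaling process delivers: g is the limit of f i rescaled at z i with scale \<open>\<rho> i\<close>, locally uniformly off
 the poles of g.
\<close>

definition blowup ::
  "complex set => real => nat => (nat => complex => complex) => (nat => complex) => (nat => real) => (complex => complex) => bool" where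
 "blowup D \<alpha> p f z \<rho> g \<longleftrightarrow>
   (\<forall>i. 0 < \<rho> i) & \<rho> \<longlonglongrightarrow> 0 & g nicely_meromorphic_on UNIV & zeros_mult_ge UNIV p g &
   (\<exists>L. L-lipschitz_on UNIV (sphere_value g)) &
   (\<forall>\<zeta>. ~ is_pole g \<zeta> --> (\<exists>r>0. \<exists>N. g holomorphic_on ball \<zeta> r &
    (\<forall>i\<ge>N. (%\<xi>. of_real (\<rho> i powr - \<alpha>) * f i (z i + of_real (\<rho> i) * \<xi>)) holomorphic_on ball \<zeta> r) &
    uniform_limit (ball \<zeta> r) (%i \<xi>. of_real (\<rho> i powr - \<alpha>) * f i (z i + of_real (\<rho> i) * \<xi>)) g sequentially &
    (\<forall>i\<ge>N. \<forall>\<xi>\<in>ball \<zeta> r. z i + of_real (\<rho> i) * \<xi> \<in> D & f i analytic_on {z i + of_real (\<rho> i) * \<xi>})))"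

text \<open>
 Zalcman's lemma with exponent (Pang). At the selected point the rescaled function has spherical derivative 1, and on every fixed disc it is
 eventually bounded, because the scale functions at nearby points are comparable. Arzela-Ascoli then gives a Lipschitz limit, which cannot be
 constant as the value 1 survives.
\<close>

theorem zalcman:
 assumes D: "open D" "z0 \<in> D" and f: "!!i. f i nicely_meromorphic_on D" and zm: "!!i. zeros_mult_ge D p (f i)"
  and \<alpha>: "0 < \<alpha>" "\<alpha> < real p"
  and x: "!!i. x i \<in> ball z0 (1 / real (Suc i))" "!!i. real i < sphderiv (f i) (x i)"
 obtains s :: "nat => nat" and z \<rho> g where "strict_mono s" "z \<longlonglongrightarrow> z0" "blowup D \<alpha> p (%i. f (s i)) z \<rho> g"
  "~ (\<exists>w. \<forall>\<zeta>. g \<zeta> = w)"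
proof -
 obtain d where d: "0 < d" "cball z0 d \<subseteq> D" using D open_contains_cball by blast
 define q where "q = 1 / (2 * (1 + \<alpha>))"
 have q: "0 < q" using \<alpha> by (simp add: q_def)
 have lim: "(%i. real i powr - q) \<longlonglongrightarrow> 0" using q by (intro tendsto_neg_powr filterlim_real_sequentially) simp
 have lim2: "(%i. 1 / real (Suc i)) \<longlonglongrightarrow> 0" using LIMSEQ_Suc[OF lim_1_over_n] by simp
 have "\<forall>\<^sub>F i in sequentially. real i powr - q < d / 2" "\<forall>\<^sub>F i in sequentially. real i powr - q < 1"
  "\<forall>\<^sub>F i in sequentially. 1 / real (Suc i) < d / 2"
  using order_tendstoD(2)[OF lim, of "d / 2"] order_tendstoD(2)[OF lim, of 1] order_tendstoD(2)[OF lim2, of "d/2"] d(1) by simp_all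
 hence "\<forall>\<^sub>F i in sequentially. real i powr - q < d / 2 & real i powr - q < 1 & 1 / real (Suc i) < d / 2 & 1 <= i"
  using eventually_ge_at_top[of 1] by eventually_elim simp
 then obtain N0 where N0: "!!i. i >= N0 ==> real i powr - q < d / 2 & real i powr - q < 1 & 1 / real (Suc i) < d / 2 & 1 <= i"
  unfolding eventually_sequentially by blast
 define fs where "fs = (%i. f (i + N0))"
 define a where "a = (%i. x (i + N0))"
 \<comment> \<open>The power \<open>q\<close> makes \<open>\<delta>^(1 + \<alpha>) * i\<close> equal to the square root of \<open>i\<close>: the radius shrinks, yet the product exceeds 1.\<close>
 define \<delta> where "\<delta> = (%i. real (i + N0) powr - q)"
 have \<delta>: "0 < \<delta> i" "\<delta> i < d / 2" "\<delta> i < 1" for i using N0[of "i + N0"] by (auto simp: \<delta>_def)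
 have \<delta>0: "\<delta> \<longlonglongrightarrow> 0" unfolding \<delta>_def using LIMSEQ_ignore_initial_segment[OF lim, of N0] .
 have az: "dist (a i) z0 < d / 2" for i
  using x(1)[of "i + N0"] N0[of "i + N0"] by (auto simp: a_def dist_commute)
 have a0: "a \<longlonglongrightarrow> z0"
 proof (rule metric_tendsto_imp_tendsto[OF LIMSEQ_ignore_initial_segment[OF lim2, of N0]])
  show "\<forall>\<^sub>F i in sequentially. dist (a i) z0 <= dist (1 / real (Suc (i + N0))) 0"
  proof (intro always_eventually allI)
   fix i show "dist (a i) z0 <= dist (1 / real (Suc (i + N0))) 0"
    using x(1)[of "i + N0"] unfolding a_def by (simp add: dist_commute less_imp_le)
  qed
 qed
 have sub: "cball (a i) (\<delta> i) \<subseteq> D" for i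
 proof
  fix y assume "y \<in> cball (a i) (\<delta> i)"
  hence "dist z0 y <= d" using az[of i] \<delta>(2)[of i] dist_triangle[of z0 y "a i"] by (simp add: dist_commute)
  thus "y \<in> D" using d(2) by auto
 qed
 have e: "\<delta> i powr (1 + \<alpha>) = 1 / sqrt (real (i + N0))" for i
 proof -
  have "- q * (1 + \<alpha>) = - (1/2)" using \<alpha> by (simp add: q_def field_simps)
  hence "\<delta> i powr (1 + \<alpha>) = real (i + N0) powr - (1/2)" by (simp only: \<delta>_def powr_powr)
  thus ?thesis by (simp only: powr_minus powr_half_sqrt of_nat_0_le_iff inverse_eq_divide)
 qed
 have ipos: "1 <= real (i + N0)" for i using N0[of "i + N0"] by simp
 have spos: "1 <= sqrt (real (i + N0))" for i using ipos[of i] by simp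
 have prod: "sqrt (real (i + N0)) < \<delta> i powr (1 + \<alpha>) * sphderiv (fs i) (a i)" for i
 proof -
  have "\<delta> i powr (1 + \<alpha>) * real (i + N0) < \<delta> i powr (1 + \<alpha>) * sphderiv (fs i) (a i)"
   using x(2)[of "i + N0"] \<delta>(1)[of i] unfolding fs_def a_def by (intro mult_strict_left_mono) auto
  moreover have "\<delta> i powr (1 + \<alpha>) * real (i + N0) = sqrt (real (i + N0))"
   unfolding e using real_div_sqrt[of "real (i + N0)"] by simp
  ultimately show ?thesis by simp
 qed
 have big: "1 < zfun \<alpha> (fs i) (\<delta> i, a i)" for i
  using zfun_ge[OF \<delta>(1)[of i] less_imp_le[OF \<delta>(3)[of i]] \<alpha>(1), of "fs i" "a i"] prod[of i] spos[of i] by linarith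
 have "\<exists>t z. 0 < t & t <= 1 & z \<in> ball (a i) (\<delta> i) & zfun \<alpha> (fs i) (t * (\<delta> i - dist z (a i)), z) = 1 &
   (\<forall>w\<in>ball (a i) (\<delta> i). zfun \<alpha> (fs i) (t * (\<delta> i - dist w (a i)), w) <= 1)" for i
 proof -
  have fi: "fs i nicely_meromorphic_on D" "zeros_mult_ge D p (fs i)" using f zm by (auto simp: fs_def)
  show ?thesis by (rule zalcman_select[OF fi(1) D(1) fi(2) \<alpha> \<delta>(1) sub big]) blast
 qed
 then obtain t z where t: "!!i. 0 < t i" "!!i. t i <= 1" and z: "!!i. z i \<in> ball (a i) (\<delta> i)"
  and one: "!!i. zfun \<alpha> (fs i) (t i * (\<delta> i - dist (z i) (a i)), z i) = 1"
  and le1: "!!i w. w \<in> ball (a i) (\<delta> i) ==> zfun \<alpha> (fs i) (t i * (\<delta> i - dist w (a i)), w) <= 1"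
  by metis
 \<comment> \<open>Comparing with the centre \<open>a i\<close>, where the spherical derivative is large, forces \<open>t i \<rightarrow> 0\<close>.\<close>
 have t\<delta>: "t i <= \<delta> i" for i
 proof (rule ccontr)
  assume "~ t i <= \<delta> i"
  hence "\<delta> i powr (1 + \<alpha>) < t i powr (1 + \<alpha>)" using \<delta>(1)[of i] \<alpha> by (intro powr_less_mono2) auto
  hence tp: "1 / sqrt (real (i + N0)) < t i powr (1 + \<alpha>)" unfolding e .
  have "t i * \<delta> i <= 1 * 1" using t[of i] \<delta>[of i] by (intro mult_mono) auto
  hence "(t i * \<delta> i) powr (1 + \<alpha>) * sphderiv (fs i) (a i) <= zfun \<alpha> (fs i) (t i * \<delta> i, a i)"
   using t(1)[of i] \<delta>(1)[of i] \<alpha> by (intro zfun_ge) auto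
  also have "... <= 1" using le1[of "a i" i] \<delta>(1)[of i] by simp
  also have "(t i * \<delta> i) powr (1 + \<alpha>) * sphderiv (fs i) (a i) = t i powr (1 + \<alpha>) * (\<delta> i powr (1 + \<alpha>) * sphderiv (fs i) (a i))"
   using t(1)[of i] \<delta>(1)[of i] by (simp add: powr_mult)
  finally have A: "t i powr (1 + \<alpha>) * (\<delta> i powr (1 + \<alpha>) * sphderiv (fs i) (a i)) <= 1" .
  have "1 = 1 / sqrt (real (i + N0)) * sqrt (real (i + N0))" using spos[of i] by simp
  also have "... < t i powr (1 + \<alpha>) * (\<delta> i powr (1 + \<alpha>) * sphderiv (fs i) (a i))"
   using tp prod[of i] spos[of i] by (intro mult_strict_mono) auto
  finally show False using A by linarith
 qed
 have t0: "t \<longlonglongrightarrow> 0"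
  by (rule tendsto_sandwich[OF _ _ tendsto_const \<delta>0]) (use t t\<delta> in \<open>auto intro!: always_eventually less_imp_le\<close>)
 define \<rho> where "\<rho> = (%i. t i * (\<delta> i - dist (z i) (a i)))"
 have \<rho>: "0 < \<rho> i" for i using t(1)[of i] z[of i] by (simp add: \<rho>_def dist_commute)
 have \<rho>\<delta>: "\<rho> i <= \<delta> i" for i
 proof -
  have "\<rho> i <= 1 * \<delta> i" unfolding \<rho>_def using t[of i] z[of i] by (intro mult_mono) (auto simp: dist_commute)
  thus ?thesis by simp
 qed
 have \<rho>0: "\<rho> \<longlonglongrightarrow> 0"
  by (rule tendsto_sandwich[OF _ _ tendsto_const \<delta>0]) (use \<rho> \<rho>\<delta> in \<open>auto intro!: always_eventually less_imp_le\<close>)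
 have z0: "z \<longlonglongrightarrow> z0"
 proof -
  have "(%i. dist (z i) (a i)) \<longlonglongrightarrow> 0"
   by (rule tendsto_sandwich[OF _ _ tendsto_const \<delta>0])
     (use z in \<open>auto intro!: always_eventually less_imp_le simp: dist_commute\<close>)
  hence "(%i. z i - a i) \<longlonglongrightarrow> 0" by (simp add: dist_norm tendsto_norm_zero_iff)
  from tendsto_add[OF this a0] show ?thesis by simp
 qed
 define G where "G = (%i \<zeta>. complex_of_real (\<rho> i powr - \<alpha>) * fs i (z i + of_real (\<rho> i) * \<zeta>))"
 define C where "C = 2 powr (1 + 3 * \<alpha>)"
 have C: "0 <= C" by (simp add: C_def)
 have loc: "z i + of_real (\<rho> i) * \<zeta> \<in> D & sphderiv (G i) \<zeta> <= C" if \<zeta>: "t i * cmod \<zeta> <= 1 / 2" for i \<zeta>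
 proof -
  define w where "w = z i + of_real (\<rho> i) * \<zeta>"
  define l where "l = \<delta> i - dist (z i) (a i)"
  have l: "0 < l" using z[of i] by (simp add: l_def dist_commute)
  have \<rho>l: "\<rho> i = t i * l" by (simp add: \<rho>_def l_def)
  have "dist w (z i) = l * (t i * cmod \<zeta>)" using \<rho>[of i] t(1)[of i] l by (simp add: w_def dist_norm norm_mult \<rho>l)
  hence dw: "dist w (z i) <= l * (1/2)" using \<zeta> l by (metis mult_left_mono less_imp_le)
  define l' where "l' = \<delta> i - dist w (a i)"
  have l': "l <= 2 * l'" "l' <= 2 * l"
   using dw dist_triangle[of w "a i" "z i"] dist_triangle[of "z i" "a i" w] dist_commute[of w "z i"] l unfolding l'_def l_def by argo+
  have wb: "w \<in> ball (a i) (\<delta> i)" using l' l by (simp add: l'_def dist_commute)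
  hence wD: "w \<in> D" using sub[of i] by auto
  have fw: "fs i nicely_meromorphic_on {z i + of_real (\<rho> i) * \<zeta>}"
   using f[of "i + N0"] wD by (auto simp: fs_def w_def intro: nicely_meromorphic_on_subset)
  have "sphderiv (G i) \<zeta> = zfun \<alpha> (fs i) (\<rho> i, w)" unfolding G_def w_def by (rule sphderiv_rescale[OF fw \<rho>])
  also have "... <= 2 powr (1 + 3 * \<alpha>) * zfun \<alpha> (fs i) (t i * l', w)"
  proof (rule zfun_compare[OF \<rho> _ _ _ \<alpha>(1)])
   show "0 < t i * l'" using t(1)[of i] l l' by (intro mult_pos_pos) auto
   show "\<rho> i <= 2 * (t i * l')" unfolding \<rho>l using mult_left_mono[OF l'(1), of "t i"] t(1)[of i] by simp
   show "t i * l' <= 2 * \<rho> i" unfolding \<rho>l using mult_left_mono[OF l'(2), of "t i"] t(1)[of i] by simp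
  qed
  also have "... <= C * 1" unfolding C_def using le1[OF wb] by (intro mult_left_mono) (auto simp: l'_def)
  finally show ?thesis using wD by (simp add: w_def)
 qed
 have evR: "\<exists>N. \<forall>i\<ge>N. \<forall>\<zeta>\<in>ball 0 R. t i * cmod \<zeta> <= 1 / 2" if R: "0 < R" for R
 proof -
  have "\<forall>\<^sub>F i in sequentially. t i < 1 / (2 * R)" using order_tendstoD(2)[OF t0, of "1 / (2 * R)"] R by simp
  then obtain N where N: "!!i. i >= N ==> t i < 1 / (2 * R)" unfolding eventually_sequentially by blast
  have "t i * cmod \<zeta> <= 1 / 2" if "i >= N" "\<zeta> \<in> ball 0 R" for i \<zeta>
  proof -
   have "t i * cmod \<zeta> <= 1 / (2 * R) * R" using N[OF that(1)] that(2) t(1)[of i] R by (intro mult_mono) auto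
   thus ?thesis using R by simp
  qed
  thus ?thesis by blast
 qed
 have fm: "fs i nicely_meromorphic_on D" "fs i meromorphic_on D" "zeros_mult_ge D p (fs i)" for i
  using f[of "i + N0"] zm[of "i + N0"] by (auto simp: fs_def nicely_meromorphic_on_def)
 have nz: "complex_of_real (\<rho> i) ~= 0" "complex_of_real (\<rho> i powr - \<alpha>) ~= 0" for i using \<rho>[of i] by auto
 have Gn: "G i nicely_meromorphic_on S" if "!!\<zeta>. \<zeta> \<in> S ==> z i + of_real (\<rho> i) * \<zeta> \<in> D" for i S
  unfolding G_def by (rule nicely_meromorphic_on_subset[OF nicely_meromorphic_affine[OF fm(1) nz]]) (use that in auto)
 have good: "\<exists>N. \<forall>i\<ge>N. (\<forall>\<zeta>\<in>ball 0 R. z i + of_real (\<rho> i) * \<zeta> \<in> D) & G i nicely_meromorphic_on ball 0 R &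
   (2 * C)-lipschitz_on (ball 0 R) (sphere_value (G i))" if R: "0 < R" for R
 proof -
  obtain N where N: "\<forall>i\<ge>N. \<forall>\<zeta>\<in>ball 0 R. t i * cmod \<zeta> <= 1 / 2" using evR[OF R] by blast
  have "(\<forall>\<zeta>\<in>ball 0 R. z i + of_real (\<rho> i) * \<zeta> \<in> D) & G i nicely_meromorphic_on ball 0 R &
   (2 * C)-lipschitz_on (ball 0 R) (sphere_value (G i))" if i: "i >= N" for i
  proof -
   have lc: "z i + of_real (\<rho> i) * \<zeta> \<in> D" "sphderiv (G i) \<zeta> <= C" if "\<zeta> \<in> ball 0 R" for \<zeta>
    using loc[of i \<zeta>] N i that by blast+
   have "G i nicely_meromorphic_on ball 0 R" by (rule Gn) (rule lc(1))
   thus ?thesis using lc sphderiv_bound_imp_lipschitz[OF _ convex_ball C] by blast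
  qed
  thus ?thesis by blast
 qed
 have inball: "ball \<zeta> 1 \<subseteq> ball 0 (cmod \<zeta> + 1)" for \<zeta> :: complex
 proof
  fix y assume "y \<in> ball \<zeta> 1"
  thus "y \<in> ball 0 (cmod \<zeta> + 1)" using dist_triangle[of 0 y \<zeta>] by simp
 qed
 have Rpos: "0 < cmod \<zeta> + 1" for \<zeta> by (simp add: add_nonneg_pos)
 obtain s \<psi> where s: "strict_mono s"
  and \<psi>: "!!\<zeta>. \<zeta> \<in> UNIV ==> \<exists>r>0. cball \<zeta> r \<subseteq> UNIV & uniform_limit (cball \<zeta> r) (%i. sphere_value (G (s i))) \<psi> sequentially"
 proof (rule lipschitz_subsequence[of "%i. sphere_value (G i)" 3 UNIV])
  show "norm (sphere_value (G i) \<zeta>) <= 3" for i \<zeta> by (rule norm_sphere_value_le)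
  fix \<zeta> :: complex
  obtain N where N: "\<forall>i\<ge>N. (2 * C)-lipschitz_on (ball 0 (cmod \<zeta> + 1)) (sphere_value (G i))" using good[OF Rpos] by blast
  hence "\<forall>i\<ge>N. (2 * C)-lipschitz_on (ball \<zeta> 1) (sphere_value (G i))" using inball lipschitz_on_subset by blast
  thus "\<exists>r>0. \<exists>L N. ball \<zeta> r \<subseteq> UNIV & (\<forall>i\<ge>N. L-lipschitz_on (ball \<zeta> r) (sphere_value (G i)))"
   by (intro exI[of _ 1] conjI exI[of _ "2 * C"] exI[of _ N]) auto
 qed (rule that)
 have si: "i <= s i" for i using s by (rule seq_suble)
 have conv: "\<exists>r>0. \<exists>N. (\<forall>i\<ge>N. G (s i) nicely_meromorphic_on ball \<zeta> r) &
   (\<forall>i\<ge>N. \<forall>\<xi>\<in>ball \<zeta> r. z (s i) + of_real (\<rho> (s i)) * \<xi> \<in> D) &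
   uniform_limit (ball \<zeta> r) (%i. sphere_value (G (s i))) \<psi> sequentially" for \<zeta>
 proof -
  obtain r where r: "0 < r" "uniform_limit (cball \<zeta> r) (%i. sphere_value (G (s i))) \<psi> sequentially" using \<psi>[of \<zeta>] by auto
  obtain N where N: "!!i. i >= N ==> (\<forall>\<xi>\<in>ball 0 (cmod \<zeta> + 1). z i + of_real (\<rho> i) * \<xi> \<in> D) & G i nicely_meromorphic_on ball 0 (cmod \<zeta> + 1)"
   using good[OF Rpos] by blast
  define r' where "r' = min r 1"
  have r': "0 < r'" "ball \<zeta> r' \<subseteq> cball \<zeta> r" "ball \<zeta> r' \<subseteq> ball 0 (cmod \<zeta> + 1)" using r(1) inball[of \<zeta>] by (auto simp: r'_def)
  have "N <= s i" if "N <= i" for i using that si[of i] by linarith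
  thus ?thesis using r' N uniform_limit_on_subset[OF r(2) r'(2)] nicely_meromorphic_on_subset[OF _ r'(3)]
   by (intro exI[of _ r'] conjI exI[of _ N]) blast+
 qed
 have pt: "(%i. sphere_value (G (s i)) \<zeta>) \<longlonglongrightarrow> \<psi> \<zeta>" for \<zeta>
 proof -
  obtain r where r: "0 < r" "uniform_limit (cball \<zeta> r) (%i. sphere_value (G (s i))) \<psi> sequentially" using \<psi>[of \<zeta>] by auto
  show ?thesis using tendsto_uniform_limitI[OF r(2), of \<zeta>] r(1) by simp
 qed
 have lip: "(2 * C)-lipschitz_on UNIV \<psi>"
 proof (rule lipschitz_onI)
  fix v w :: complex
  define R where "R = cmod v + cmod w + 1"
  have R: "0 < R" "v \<in> ball 0 R" "w \<in> ball 0 R" by (auto simp: R_def add_nonneg_pos add_strict_increasing)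
  obtain N where N: "!!i. i >= N ==> (2 * C)-lipschitz_on (ball 0 R) (sphere_value (G i))" using good[OF R(1)] by blast
  have ev: "dist (sphere_value (G (s i)) v) (sphere_value (G (s i)) w) <= 2 * C * dist v w" if "i >= N" for i
   using lipschitz_onD[OF N R(2,3)] that si[of i] by simp
  show "dist (\<psi> v) (\<psi> w) <= 2 * C * dist v w"
   by (rule LIMSEQ_le_const2[OF tendsto_dist[OF pt pt]]) (use ev in blast)
 qed (use C in simp)
 have con: "continuous_on S \<psi>" for S using lipschitz_on_continuous_on[OF lip] continuous_on_subset by blast
 have sone: "sphderiv (G i) 0 = 1" for i
 proof -
  have "z i \<in> D" using z[of i] sub[of i] by auto
  hence "fs i nicely_meromorphic_on {z i + of_real (\<rho> i) * 0}" using fm(1)[of i] by (auto intro: nicely_meromorphic_on_subset)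
  from sphderiv_rescale[OF this \<rho>] show ?thesis using one[of i] by (simp add: G_def \<rho>_def)
 qed
 obtain r0 N0' where c0: "0 < r0" "!!i. i >= N0' ==> G (s i) nicely_meromorphic_on ball 0 r0"
  "uniform_limit (ball 0 r0) (%i. sphere_value (G (s i))) \<psi> sequentially" using conv[of 0] by blast
 have notinf: "~ (\<forall>\<zeta>\<in>UNIV. \<psi> \<zeta> = sphere_infinity)"
 proof
  assume inf: "\<forall>\<zeta>\<in>UNIV. \<psi> \<zeta> = sphere_infinity"
  hence p0: "\<psi> 0 = sphere_infinity" by simp
  obtain r' F N' where r': "0 < r'" "r' <= r0" "F holomorphic_on ball 0 r'"
   "!!i. i >= N' ==> (%w. inverse (G (s i) w)) holomorphic_on ball 0 r'"
   "!!i \<zeta>. i >= N' ==> \<zeta> \<in> ball 0 r' ==> is_pole (G (s i)) \<zeta> | G (s i) \<zeta> ~= 0"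
   "uniform_limit (ball 0 r') (%i w. inverse (G (s i) w)) F sequentially"
   "!!\<zeta>. \<zeta> \<in> ball 0 r' ==> \<psi> \<zeta> = sphere_reflection (stereographic (F \<zeta>))"
   by (rule infinite_limit[OF c0 con p0]) (assumption, rule that)
  have F0: "F \<zeta> = 0" if "\<zeta> \<in> ball 0 r'" for \<zeta>
   using r'(7)[OF that] inf sphere_reflection_stereographic[of "F \<zeta>"] by (metis UNIV_I stereographic_ne_infinity)
  obtain M where M: "!!i. i >= M ==> sphderiv (%w. inverse (G (s i) w)) 0 < 1"
   using sphderiv_small_near_constant_limit[OF r'(1,4,6,3) F0] by blast
  define i where "i = Max {M, N', N0'}"
  have i: "M <= i" "N' <= i" "N0' <= i" by (auto simp: i_def)
  have "G (s i) nicely_meromorphic_on {0}" using c0(2)[OF i(3)] c0(1) by (auto intro: nicely_meromorphic_on_subset)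
  hence "sphderiv (%w. inverse (G (s i) w)) 0 = sphderiv (G (s i)) 0"
   using r'(5)[OF i(2), of 0] r'(1) by (intro sphderiv_inverse) auto
  thus False using M[OF i(1)] sone by simp
 qed
 have "\<exists>g. g nicely_meromorphic_on UNIV & (\<forall>\<zeta>\<in>UNIV. \<psi> \<zeta> = sphere_value g \<zeta>)"
 proof -
  have "\<exists>r>0. ball \<zeta> r \<subseteq> UNIV & (\<exists>N. \<forall>i\<ge>N. G (s i) nicely_meromorphic_on ball \<zeta> r) &
    uniform_limit (ball \<zeta> r) (%i. sphere_value (G (s i))) \<psi> sequentially" if "\<zeta> \<in> UNIV" for \<zeta>
   using conv[of \<zeta>] by blast
  from limit_meromorphic[OF open_UNIV connected_UNIV con this] show ?thesis using notinf by blast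
 qed
 then obtain g where g: "g nicely_meromorphic_on UNIV" "!!\<zeta>. \<psi> \<zeta> = sphere_value g \<zeta>" by blast
 have \<psi>g: "\<psi> = sphere_value g" using g(2) by blast
 have fin: "\<exists>r>0. \<exists>N. g holomorphic_on ball \<zeta> r & (\<forall>i\<ge>N. G (s i) holomorphic_on ball \<zeta> r) &
   uniform_limit (ball \<zeta> r) (%i. G (s i)) g sequentially &
   (\<forall>i\<ge>N. \<forall>\<xi>\<in>ball \<zeta> r. z (s i) + of_real (\<rho> (s i)) * \<xi> \<in> D & fs (s i) analytic_on {z (s i) + of_real (\<rho> (s i)) * \<xi>})"
  if np: "~ is_pole g \<zeta>" for \<zeta>
 proof -
  obtain r N where c: "0 < r" "!!i. i >= N ==> G (s i) nicely_meromorphic_on ball \<zeta> r"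
   "!!i \<xi>. i >= N ==> \<xi> \<in> ball \<zeta> r ==> z (s i) + of_real (\<rho> (s i)) * \<xi> \<in> D"
   "uniform_limit (ball \<zeta> r) (%i. sphere_value (G (s i))) \<psi> sequentially" using conv[of \<zeta>] by blast
  have "\<psi> \<zeta> ~= sphere_infinity" using np by (simp add: g(2) sphere_value_def)
  then obtain r' F B N' where r': "0 < r'" "r' <= r" "F holomorphic_on ball \<zeta> r'"
   "!!i. i >= N' ==> G (s i) holomorphic_on ball \<zeta> r'"
   "uniform_limit (ball \<zeta> r') (%i. G (s i)) F sequentially" "!!\<xi>. \<xi> \<in> ball \<zeta> r' ==> \<psi> \<xi> = stereographic (F \<xi>)"
   using finite_limit[OF c(1,2,4) con] by metis
  have gF: "g \<xi> = F \<xi>" if "\<xi> \<in> ball \<zeta> r'" for \<xi>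
  proof -
   have A: "sphere_value g \<xi> = stereographic (F \<xi>)" using r'(6)[OF that] g(2) by simp
   hence "~ is_pole g \<xi>" by (metis sphere_value_def stereographic_ne_infinity)
   hence "stereographic (g \<xi>) = stereographic (F \<xi>)" using A by (simp add: sphere_value_def)
   thus ?thesis by (metis unproject_stereographic)
  qed
  have 1: "g holomorphic_on ball \<zeta> r'" using r'(3) by (rule holomorphic_transform) (simp add: gF)
  have 2: "uniform_limit (ball \<zeta> r') (%i. G (s i)) g sequentially"
   using uniform_limit_cong'[of "ball \<zeta> r'" "%i. G (s i)" "%i. G (s i)" g F sequentially] gF r'(5) by simp
  have 3: "z (s i) + of_real (\<rho> (s i)) * \<xi> \<in> D & fs (s i) analytic_on {z (s i) + of_real (\<rho> (s i)) * \<xi>}"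
   if i: "i >= max N N'" and \<xi>: "\<xi> \<in> ball \<zeta> r'" for i \<xi>
  proof -
   have wD: "z (s i) + of_real (\<rho> (s i)) * \<xi> \<in> D" using c(3)[of i \<xi>] i \<xi> r'(2) by auto
   have "~ is_pole (G (s i)) \<xi>" using not_is_pole_holomorphic[OF open_ball \<xi> r'(4)[of i]] i by simp
   hence "~ is_pole (fs (s i)) (z (s i) + of_real (\<rho> (s i)) * \<xi>)"
    using is_pole_affine[OF nz(1)[of "s i"] nz(2)[of "s i"], of "fs (s i)" "z (s i)" \<xi>] by (simp add: G_def)
   thus ?thesis using nicely_meromorphic_on_imp_analytic_at[OF fm(1) wD] wD by blast
  qed
  show ?thesis using r'(1,4) 1 2 3 by (intro exI[of _ r'] conjI exI[of _ "max N N'"]) auto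
 qed
 have zg: "zeros_mult_ge UNIV p g"
  unfolding zeros_mult_ge_def
 proof (intro ballI impI)
  fix \<zeta> :: complex assume iz: "isolated_zero g \<zeta>"
  hence "~ is_pole g \<zeta>" using pole_is_not_zero by blast
  then obtain r N where c: "0 < r" "g holomorphic_on ball \<zeta> r" "!!i. i >= N ==> G (s i) holomorphic_on ball \<zeta> r"
   "uniform_limit (ball \<zeta> r) (%i. G (s i)) g sequentially"
   "!!i \<xi>. i >= N ==> \<xi> \<in> ball \<zeta> r ==> z (s i) + of_real (\<rho> (s i)) * \<xi> \<in> D" using fin by blast
  show "int p <= zorder g \<zeta>"
  proof (rule limit_zero_multiplicity[OF c(1,3,4,2) iz])
   fix i w assume a: "i >= N" "w \<in> ball \<zeta> r" "isolated_zero (G (s i)) w"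
   have "zeros_mult_ge {\<xi>. z (s i) + of_real (\<rho> (s i)) * \<xi> \<in> D} p (G (s i))"
    unfolding G_def by (rule zeros_mult_ge_affine[OF fm(3,2) nz])
   thus "int p <= zorder (G (s i)) w" using a c(5)[OF a(1,2)] by (auto simp: zeros_mult_ge_def)
  qed
 qed
 have nonconst: "~ (\<exists>w. \<forall>\<zeta>. g \<zeta> = w)"
 proof
  assume "\<exists>w. \<forall>\<zeta>. g \<zeta> = w"
  then obtain w where w: "!!\<zeta>. g \<zeta> = w" by blast
  hence "g = (%_. w)" by blast
  hence "~ is_pole g 0" by (simp add: analytic_at_imp_no_pole)
  then obtain r N where c: "0 < r" "g holomorphic_on ball 0 r" "!!i. i >= N ==> G (s i) holomorphic_on ball 0 r"
   "uniform_limit (ball 0 r) (%i. G (s i)) g sequentially" using fin by blast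
  obtain M where "!!i. i >= M ==> sphderiv (G (s i)) 0 < 1"
   using sphderiv_small_near_constant_limit[OF c(1,3,4,2) w] by blast
  from this[of M] show False using sone by simp
 qed
 show ?thesis
 proof (rule that[of "%i. s i + N0" "%i. z (s i)" "%i. \<rho> (s i)" g])
  show "strict_mono (%i. s i + N0)" using s by (simp add: strict_mono_def)
  show "(%i. z (s i)) \<longlonglongrightarrow> z0" using LIMSEQ_subseq_LIMSEQ[OF z0 s] by (simp add: o_def)
  show "~ (\<exists>w. \<forall>\<zeta>. g \<zeta> = w)" by (rule nonconst)
  show "blowup D \<alpha> p (%i. f (s i + N0)) (%i. z (s i)) (%i. \<rho> (s i)) g"
   unfolding blowup_def
  proof (intro conjI allI impI)
   show "0 < \<rho> (s i)" for i by (rule \<rho>)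
   show "(%i. \<rho> (s i)) \<longlonglongrightarrow> 0" using LIMSEQ_subseq_LIMSEQ[OF \<rho>0 s] by (simp add: o_def)
   show "\<exists>L. L-lipschitz_on UNIV (sphere_value g)" using lip \<psi>g by blast
  qed (use g(1) zg fin in \<open>auto simp: G_def fs_def\<close>)
 qed
qed

section \<open>Values omitted by the rescaled limit\<close>

lemma blowup_subsequence:
 assumes b: "blowup D \<alpha> p f z \<rho> g" and s: "strict_mono (s :: nat => nat)"
 shows "blowup D \<alpha> p (%i. f (s i)) (%i. z (s i)) (%i. \<rho> (s i)) g"
 unfolding blowup_def
proof (intro conjI allI impI)
 show "0 < \<rho> (s i)" for i using b by (simp add: blowup_def)
 have "\<rho> \<longlonglongrightarrow> 0" using b by (simp add: blowup_def)
 from LIMSEQ_subseq_LIMSEQ[OF this s] show "(%i. \<rho> (s i)) \<longlonglongrightarrow> 0" by (simp add: o_def)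
 fix \<zeta> assume "~ is_pole g \<zeta>"
 then obtain r N where r: "0 < r" "g holomorphic_on ball \<zeta> r"
  "!!i. i >= N ==> (%\<xi>. of_real (\<rho> i powr - \<alpha>) * f i (z i + of_real (\<rho> i) * \<xi>)) holomorphic_on ball \<zeta> r"
  "uniform_limit (ball \<zeta> r) (%i \<xi>. of_real (\<rho> i powr - \<alpha>) * f i (z i + of_real (\<rho> i) * \<xi>)) g sequentially"
  "!!i \<xi>. i >= N ==> \<xi> \<in> ball \<zeta> r ==> z i + of_real (\<rho> i) * \<xi> \<in> D & f i analytic_on {z i + of_real (\<rho> i) * \<xi>}"
  using b unfolding blowup_def by blast
 have si: "N <= s i" if "N <= i" for i using seq_suble[OF s, of i] that by linarith
 have "uniform_limit (ball \<zeta> r) (%i \<xi>. of_real (\<rho> (s i) powr - \<alpha>) * f (s i) (z (s i) + of_real (\<rho> (s i)) * \<xi>)) g sequentially"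
  using filterlim_compose[OF r(4) filterlim_subseq[OF s]] .
 thus "\<exists>r>0. \<exists>N. g holomorphic_on ball \<zeta> r &
    (\<forall>i\<ge>N. (%\<xi>. of_real (\<rho> (s i) powr - \<alpha>) * f (s i) (z (s i) + of_real (\<rho> (s i)) * \<xi>)) holomorphic_on ball \<zeta> r) &
    uniform_limit (ball \<zeta> r) (%i \<xi>. of_real (\<rho> (s i) powr - \<alpha>) * f (s i) (z (s i) + of_real (\<rho> (s i)) * \<xi>)) g sequentially &
    (\<forall>i\<ge>N. \<forall>\<xi>\<in>ball \<zeta> r. z (s i) + of_real (\<rho> (s i)) * \<xi> \<in> D & f (s i) analytic_on {z (s i) + of_real (\<rho> (s i)) * \<xi>})"
  using r si by (intro exI[of _ r] conjI exI[of _ N]) auto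
qed (use b in \<open>auto simp: blowup_def\<close>)

lemma bounded_mult_image:
 fixes f g :: "'a => complex"
 assumes "bounded (f ` S)" "bounded (g ` S)"
 shows "bounded ((%x. f x * g x) ` S)"
proof -
 obtain A B where "\<forall>y\<in>f ` S. cmod y <= A" "\<forall>y\<in>g ` S. cmod y <= B" using assms unfolding bounded_iff by blast
 hence AB: "cmod (f x) <= A" "cmod (g x) <= B" if "x \<in> S" for x using that by blast+
 have "cmod (f x * g x) <= A * B" if "x \<in> S" for x
  unfolding norm_mult by (rule mult_mono[OF AB[OF that] order_trans[OF norm_ge_zero AB(1)[OF that]] norm_ge_zero])
 thus ?thesis unfolding bounded_iff by blast
qed

lemma uniform_limit_pow:
 fixes f :: "nat => complex => complex"
 assumes u: "uniform_limit S f l sequentially" and b: "bounded (l ` S)"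
 shows "uniform_limit S (%i x. f i x ^ j) (%x. l x ^ j) sequentially & bounded ((%x. l x ^ j) ` S)"
proof (induction j)
 case 0
 have "uniform_limit S (%i x. f i x ^ 0) (%x. l x ^ 0) sequentially" by (rule uniform_limitI) simp
 moreover have "bounded ((%x. l x ^ 0) ` S)" unfolding bounded_iff by (rule exI[of _ 1]) auto
 ultimately show ?case ..
next
 case (Suc j)
 have "uniform_limit S (%i x. f i x * f i x ^ j) (%x. l x * l x ^ j) sequentially"
  using Suc by (intro uniform_lim_mult u b) auto
 moreover have "bounded ((%x. l x * l x ^ j) ` S)"
  by (rule bounded_mult_image) (use b Suc in auto)
 ultimately show ?case by simp
qed

lemma diff_monomial_uniform_limit:
 assumes u: "uniform_limit (ball z r) f g sequentially" and f: "!!i. i >= N ==> f i holomorphic_on ball z r"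
  and g: "g holomorphic_on ball z r" and r: "0 < r"
 shows "uniform_limit (cball z (r/4)) (%i. diff_monomial k n (f i)) (diff_monomial k n g) sequentially"
  and "bounded (diff_monomial k n g ` cball z (r/4))"
proof -
 let ?S = "cball z (r/4)"
 have S: "?S \<subseteq> ball z (r/2)" "?S \<subseteq> ball z r" using r by auto
 have ud: "uniform_limit ?S (%i. (deriv ^^ j) (f i)) ((deriv ^^ j) g) sequentially" for j
  using uniform_limit_on_subset[OF higher_deriv_uniform_limit[OF u f g r] S(1)] by simp
 have bd: "bounded ((deriv ^^ j) g ` ?S)" for j
 proof -
  have "(deriv ^^ j) g holomorphic_on ball z r" using g by (rule holomorphic_higher_deriv) simp
  hence "continuous_on ?S ((deriv ^^ j) g)" using S(2) holomorphic_on_imp_continuous_on continuous_on_subset by blast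
  thus ?thesis by (intro compact_imp_bounded compact_continuous_image) auto
 qed
 have "uniform_limit ?S (%i x. \<Prod>j\<le>K. ((deriv ^^ j) (f i) x) ^ n j) (%x. \<Prod>j\<le>K. ((deriv ^^ j) g x) ^ n j) sequentially &
    bounded ((%x. \<Prod>j\<le>K. ((deriv ^^ j) g x) ^ n j) ` ?S)" for K
 proof (induction K)
  case 0
  thus ?case using uniform_limit_pow[OF ud[of 0] bd[of 0], of "n 0"] by simp
 next
  case (Suc K)
  have p: "uniform_limit ?S (%i x. ((deriv ^^ Suc K) (f i) x) ^ n (Suc K)) (%x. ((deriv ^^ Suc K) g x) ^ n (Suc K)) sequentially"
    "bounded ((%x. ((deriv ^^ Suc K) g x) ^ n (Suc K)) ` ?S)"
   using uniform_limit_pow[OF ud[of "Suc K"] bd[of "Suc K"], of "n (Suc K)"] by blast+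
  have "uniform_limit ?S (%i x. (\<Prod>j\<le>K. ((deriv ^^ j) (f i) x) ^ n j) * ((deriv ^^ Suc K) (f i) x) ^ n (Suc K))
    (%x. (\<Prod>j\<le>K. ((deriv ^^ j) g x) ^ n j) * ((deriv ^^ Suc K) g x) ^ n (Suc K)) sequentially"
   using Suc p by (intro uniform_lim_mult) auto
  moreover have "bounded ((%x. (\<Prod>j\<le>K. ((deriv ^^ j) g x) ^ n j) * ((deriv ^^ Suc K) g x) ^ n (Suc K)) ` ?S)"
   using Suc p by (intro bounded_mult_image) auto
  ultimately show ?case by (simp only: prod.atMost_Suc)
 qed
 from this[of k] show "uniform_limit (cball z (r/4)) (%i. diff_monomial k n (f i)) (diff_monomial k n g) sequentially"
  and "bounded (diff_monomial k n g ` cball z (r/4))"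
  by (simp_all add: diff_monomial_def[abs_def])
qed

lemma hurwitz_ball:
 assumes r: "0 < r" and H: "!!i. i >= N ==> H i holomorphic_on ball \<zeta> r" "!!i \<xi>. i >= N ==> \<xi> \<in> ball \<zeta> r ==> H i \<xi> ~= 0"
  and u: "uniform_limit (ball \<zeta> r) H v sequentially" and v: "v holomorphic_on ball \<zeta> r" "v \<zeta> = 0"
  and \<xi>: "\<xi> \<in> ball \<zeta> r"
 shows "v \<xi> = 0"
proof (rule ccontr)
 assume nz: "v \<xi> ~= 0"
 have "v \<zeta> ~= 0"
 proof (rule Hurwitz_no_zeros[of "ball \<zeta> r" "%i. H (i + N)" v])
  show "uniform_limit K (%i. H (i + N)) v sequentially" if "compact K" "K \<subseteq> ball \<zeta> r" for K
  proof -
   have "uniform_limit K H v sequentially" using uniform_limit_on_subset[OF u that(2)] .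
   thus ?thesis by (rule filterlim_compose) (rule filterlim_add_const_nat_at_top)
  qed
  show "~ v constant_on ball \<zeta> r"
   unfolding constant_on_def using nz v(2) r \<xi> by (metis centre_in_ball)
 qed (use r H v in auto)
 thus False using v(2) by simp
qed

lemma diff_monomial_scaled:
 assumes x: "0 < x" and \<alpha>: "\<alpha> * real (\<Sum>j\<le>k. n j) = real (\<Sum>j\<le>k. j * n j) + real t"
  and f: "f analytic_on {a + of_real x * \<zeta>}"
 shows "diff_monomial k n (%\<zeta>. of_real (x powr - \<alpha>) * f (a + of_real x * \<zeta>)) \<zeta> * of_real x ^ t =
     diff_monomial k n f (a + of_real x * \<zeta>)"
proof -
 define \<gamma> where "\<gamma> = (\<Sum>j\<le>k. n j)"
 define \<Gamma> where "\<Gamma> = (\<Sum>j\<le>k. j * n j)"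
 have e: "- \<alpha> * real \<gamma> + real \<Gamma> + real t = 0" using \<alpha> by (simp add: \<gamma>_def \<Gamma>_def)
 have "(x powr - \<alpha>) ^ \<gamma> * x ^ \<Gamma> * x ^ t = x powr (- \<alpha> * real \<gamma> + real \<Gamma> + real t)"
  using x by (simp only: powr_add powr_realpow powr_powr[symmetric] powr_gt_zero)
 also have "... = 1" unfolding e using x by simp
 finally have "(x powr - \<alpha>) ^ \<gamma> * x ^ \<Gamma> * x ^ t = 1" .
 hence "complex_of_real ((x powr - \<alpha>) ^ \<gamma> * x ^ \<Gamma> * x ^ t) = 1" by (simp only: of_real_1)
 hence one: "complex_of_real (x powr - \<alpha>) ^ \<gamma> * of_real x ^ \<Gamma> * of_real x ^ t = 1"
  by (simp only: of_real_mult of_real_power)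
 have "diff_monomial k n (%\<zeta>. of_real (x powr - \<alpha>) * f (a + of_real x * \<zeta>)) \<zeta> =
   of_real (x powr - \<alpha>) ^ \<gamma> * of_real x ^ \<Gamma> * diff_monomial k n f (a + of_real x * \<zeta>)"
  unfolding \<gamma>_def \<Gamma>_def by (rule diff_monomial_affine[OF f])
 hence "diff_monomial k n (%\<zeta>. of_real (x powr - \<alpha>) * f (a + of_real x * \<zeta>)) \<zeta> * of_real x ^ t =
   (of_real (x powr - \<alpha>) ^ \<gamma> * of_real x ^ \<Gamma> * of_real x ^ t) * diff_monomial k n f (a + of_real x * \<zeta>)"
  by (simp only: mult_ac)
 thus ?thesis unfolding one by simp
qed

text \<open>
 The scaling exponent makes the factors cancel: M[f i] = (x - e i)^t * b i at \<open>x = z i + \<rho> i * \<zeta>\<close> says that the monomial of the rescaled function is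
 \<open>(\<zeta> + (z i - e i) / \<rho> i)^t * b i\<close>. Hurwitz's theorem carries omission to the limit g, and the identity theorem
 spreads a single coincidence over the plane minus the poles.
\<close>

theorem blowup_constant:
 fixes k m t :: nat and n :: "nat => nat"
 assumes bl: "blowup D \<alpha> (k + m + 1) f z \<rho> g" and kn: "1 <= k" "2 <= n 0" "1 <= n k" and m: "1 <= m" and t: "t <= m"
  and \<alpha>: "\<alpha> * real (\<Sum>j\<le>k. n j) = real (\<Sum>j\<le>k. j * n j) + real t"
  and z: "z \<longlonglongrightarrow> z0" and D: "open D" "z0 \<in> D"
  and b: "!!i. b i holomorphic_on D" "uniform_limit D b b0 sequentially" "b0 holomorphic_on D" "b0 z0 ~= 0"
  and y: "(%i. (z i - e i) / of_real (\<rho> i)) \<longlonglongrightarrow> w"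
  and eq: "!!i x. x \<in> D ==> x ~= e i ==> ~ is_pole (f i) x ==> (diff_monomial k n (f i) x = (x - e i) ^ t * b i x) = eqn"
 shows "\<exists>v. \<forall>\<zeta>. g \<zeta> = v"
proof -
 define c where "c = b0 z0"
 define v where "v = (%\<zeta>. diff_monomial k n g \<zeta> - c * (\<zeta> - (- w)) ^ t)"
 have c: "c ~= 0" using b(4) by (simp add: c_def)
 have \<rho>: "0 < \<rho> i" "complex_of_real (\<rho> i) ~= 0" for i using bl by (auto simp: blowup_def less_imp_neq[symmetric])
 have \<rho>0: "\<rho> \<longlonglongrightarrow> 0" and g: "g nicely_meromorphic_on UNIV" "zeros_mult_ge UNIV (k + m + 1) g" using bl by (auto simp: blowup_def)
 obtain L where L: "L-lipschitz_on UNIV (sphere_value g)" using bl by (auto simp: blowup_def)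
 define Y where "Y = (%i. (z i - e i) / of_real (\<rho> i))"
 have Y: "Y \<longlonglongrightarrow> w" using y by (simp add: Y_def)
 have xe: "z i + of_real (\<rho> i) * \<xi> - e i = of_real (\<rho> i) * (\<xi> + Y i)" for i \<xi>
  using \<rho>(2)[of i] by (simp add: Y_def field_simps)
 have key: "\<exists>r>0. v holomorphic_on ball \<zeta> r & ball \<zeta> r \<subseteq> {x. ~ is_pole g x} & (v \<zeta> = 0 --> (\<forall>\<xi>\<in>ball \<zeta> r. v \<xi> = 0)) & (eqn --> v \<zeta> = 0)"
  if np: "~ is_pole g \<zeta>" and ne: "\<zeta> ~= - w" for \<zeta>
 proof -
  define G where "G = (%i \<xi>. complex_of_real (\<rho> i powr - \<alpha>) * f i (z i + of_real (\<rho> i) * \<xi>))"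
  obtain r N where r: "0 < r" "g holomorphic_on ball \<zeta> r" "!!i. i >= N ==> G i holomorphic_on ball \<zeta> r"
   "uniform_limit (ball \<zeta> r) G g sequentially"
   "!!i \<xi>. i >= N ==> \<xi> \<in> ball \<zeta> r ==> z i + of_real (\<rho> i) * \<xi> \<in> D & f i analytic_on {z i + of_real (\<rho> i) * \<xi>}"
   using bl np unfolding blowup_def G_def by blast
  define r2 where "r2 = min (r/4) (dist \<zeta> (- w) / 2)"
  have r2: "0 < r2" "r2 <= r" "ball \<zeta> r2 \<subseteq> cball \<zeta> (r/4)" "ball \<zeta> r2 \<subseteq> ball \<zeta> r" using r(1) ne by (auto simp: r2_def)
  let ?S = "ball \<zeta> r2"
  have "\<forall>\<^sub>F i in sequentially. dist (Y i) w < dist \<zeta> (- w) / 2" using Y ne by (intro tendstoD) auto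
  then obtain N1 where N1: "!!i. i >= N1 ==> dist (Y i) w < dist \<zeta> (- w) / 2" unfolding eventually_sequentially by blast
  have neY: "\<xi> + Y i ~= 0" if "i >= N1" "\<xi> \<in> ?S" for i \<xi>
  proof
   assume "\<xi> + Y i = 0"
   hence "\<xi> = - Y i" by (simp add: eq_neg_iff_add_eq_0)
   hence "dist \<xi> (- w) = dist (Y i) w" by (simp add: dist_minus)
   hence "dist \<zeta> (- w) < r2 + dist \<zeta> (- w) / 2"
    using dist_triangle[of \<zeta> "- w" \<xi>] that N1[of i] by auto
   thus False by (auto simp: r2_def)
  qed
  define M where "M = max N N1"
  have M: "N <= i" "N1 <= i" if "M <= i" for i using that by (auto simp: M_def)
  define E where "E = (%i \<xi>. diff_monomial k n (G i) \<xi> - b i (z i + of_real (\<rho> i) * \<xi>) * (\<xi> + Y i) ^ t)"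
  have E0: "(E i \<xi> = 0) = eqn" if i: "i >= M" and \<xi>: "\<xi> \<in> ?S" for i \<xi>
  proof -
   have xi: "\<xi> \<in> ball \<zeta> r" using \<xi> r2 by blast
   let ?x = "z i + of_real (\<rho> i) * \<xi>"
   have x: "?x \<in> D" "f i analytic_on {?x}" using r(5)[OF M(1)[OF i] xi] by auto
   have "~ is_pole (f i) ?x" using x(2) by (rule analytic_at_imp_no_pole)
   moreover have "?x ~= e i" using xe[of i \<xi>] neY[OF M(2)[OF i] \<xi>] \<rho>(2)[of i] by auto
   ultimately have eq': "(diff_monomial k n (f i) ?x = (?x - e i) ^ t * b i ?x) = eqn" using eq x(1) by blast
   have s: "diff_monomial k n (G i) \<xi> * of_real (\<rho> i) ^ t = diff_monomial k n (f i) ?x"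
    unfolding G_def by (rule diff_monomial_scaled[OF \<rho>(1) \<alpha> x(2)])
   have "E i \<xi> = 0 \<longleftrightarrow> diff_monomial k n (G i) \<xi> * of_real (\<rho> i) ^ t = b i ?x * (\<xi> + Y i) ^ t * of_real (\<rho> i) ^ t"
    using \<rho>(2)[of i] by (simp add: E_def)
   also have "b i ?x * (\<xi> + Y i) ^ t * of_real (\<rho> i) ^ t = (?x - e i) ^ t * b i ?x"
    unfolding xe power_mult_distrib by (simp only: mult_ac)
   finally show ?thesis unfolding s eq' .
  qed
  have Eh: "E i holomorphic_on ?S" if i: "i >= M" for i
  proof -
   have "G i holomorphic_on ?S" using r(3)[OF M(1)[OF i]] r2(4) holomorphic_on_subset by blast
   hence 1: "diff_monomial k n (G i) holomorphic_on ?S" by (rule diff_monomial_holomorphic) simp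
   have "(b i \<circ> (%\<xi>. z i + of_real (\<rho> i) * \<xi>)) holomorphic_on ?S"
   proof (rule holomorphic_on_compose_gen[OF _ b(1)])
    show "(%\<xi>. z i + of_real (\<rho> i) * \<xi>) ` ?S \<subseteq> D" using r(5)[OF M(1)[OF i]] r2(4) by blast
   qed (intro holomorphic_intros)
   hence 2: "(%\<xi>. b i (z i + of_real (\<rho> i) * \<xi>)) holomorphic_on ?S" by (simp add: o_def)
   show ?thesis unfolding E_def by (intro holomorphic_intros 1 2)
  qed
  have vh: "v holomorphic_on ?S"
  proof -
   have "g holomorphic_on ?S" using r(2) r2(4) holomorphic_on_subset by blast
   hence "diff_monomial k n g holomorphic_on ?S" by (rule diff_monomial_holomorphic) simp
   thus ?thesis unfolding v_def by (intro holomorphic_intros)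
  qed
  have Eu: "uniform_limit ?S E v sequentially"
  proof -
   have 1: "uniform_limit ?S (%i. diff_monomial k n (G i)) (diff_monomial k n g) sequentially"
    using uniform_limit_on_subset[OF diff_monomial_uniform_limit(1)[OF r(4,3,2,1)] r2(3)] by simp
   have bdw: "bounded ((%\<xi>. \<xi> - (- w)) ` ?S)"
   proof -
    have "bounded ((%\<xi>. w + \<xi>) ` ?S)" by (intro bounded_translation bounded_ball)
    thus ?thesis by (simp add: add.commute)
   qed
   have "uniform_limit ?S (%i \<xi>. \<xi> + Y i) (%\<xi>. \<xi> - (- w)) sequentially"
   proof (rule uniform_limitI)
    fix \<epsilon> :: real assume "0 < \<epsilon>"
    hence "\<forall>\<^sub>F i in sequentially. dist (Y i) w < \<epsilon>" using Y by (intro tendstoD)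
    thus "\<forall>\<^sub>F i in sequentially. \<forall>\<xi>\<in>?S. dist (\<xi> + Y i) (\<xi> - (- w)) < \<epsilon>"
     by eventually_elim (simp add: dist_norm)
   qed
   from uniform_limit_pow[OF this bdw, of t]
   have 2: "uniform_limit ?S (%i \<xi>. (\<xi> + Y i) ^ t) (%\<xi>. (\<xi> - (- w)) ^ t) sequentially" "bounded ((%\<xi>. (\<xi> - (- w)) ^ t) ` ?S)" by blast+
   have 3: "uniform_limit ?S (%i \<xi>. b i (z i + of_real (\<rho> i) * \<xi>)) (%\<xi>. c) sequentially"
   proof (rule uniform_limitI)
    fix \<epsilon> :: real assume \<epsilon>: "0 < \<epsilon>"
    have "continuous (at z0) b0" using holomorphic_on_imp_continuous_on[OF b(3)] D by (simp add: continuous_on_eq_continuous_at)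
    then obtain d where d: "0 < d" "!!x. dist x z0 < d ==> dist (b0 x) (b0 z0) < \<epsilon> / 2"
     using \<epsilon> unfolding continuous_at_eps_delta by (meson half_gt_zero)
    have B: "0 < cmod \<zeta> + r2" using r2(1) by (simp add: add_nonneg_pos)
    have "\<forall>\<^sub>F i in sequentially. dist (z i) z0 < d / 2" using z d by (intro tendstoD) auto
    moreover have "\<forall>\<^sub>F i in sequentially. \<rho> i < d / 2 / (cmod \<zeta> + r2)" using \<rho>0 d B by (intro order_tendstoD(2)[of _ 0]) auto
    moreover have "\<forall>\<^sub>F i in sequentially. \<forall>x\<in>D. dist (b i x) (b0 x) < \<epsilon> / 2" using uniform_limitD[OF b(2), of "\<epsilon> / 2"] \<epsilon> by simp
    moreover have "\<forall>\<^sub>F i in sequentially. M <= i" by (rule eventually_ge_at_top)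
    ultimately show "\<forall>\<^sub>F i in sequentially. \<forall>\<xi>\<in>?S. dist (b i (z i + of_real (\<rho> i) * \<xi>)) c < \<epsilon>"
    proof eventually_elim
     case (elim i)
     show ?case
     proof
      fix \<xi> assume \<xi>: "\<xi> \<in> ?S"
      let ?x = "z i + of_real (\<rho> i) * \<xi>"
      have xD: "?x \<in> D" using r(5)[OF M(1)] elim(4) \<xi> r2(4) by blast
      have "cmod \<xi> <= cmod \<zeta> + r2" using \<xi> dist_triangle[of 0 \<xi> \<zeta>] by simp
      hence "\<rho> i * cmod \<xi> <= \<rho> i * (cmod \<zeta> + r2)" using \<rho>(1)[of i] by (intro mult_left_mono) auto
      also have "... < d / 2" using elim(2) by (simp only: pos_less_divide_eq[OF B])
      finally have "cmod (of_real (\<rho> i) * \<xi>) < d / 2" using \<rho>(1)[of i] by (simp add: norm_mult)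
      hence "dist ?x (z i) < d / 2" by (simp add: dist_norm)
      hence "dist ?x z0 < d" using dist_triangle[of ?x z0 "z i"] elim(1) by linarith
      hence "dist (b0 ?x) c < \<epsilon> / 2" using d(2) by (simp add: c_def)
      moreover have "dist (b i ?x) (b0 ?x) < \<epsilon> / 2" using elim(3) xD by blast
      ultimately show "dist (b i ?x) c < \<epsilon>" using dist_triangle[of "b i ?x" c "b0 ?x"] by linarith
     qed
    qed
   qed
   have "bounded ((%\<xi>. c) ` ?S)" unfolding bounded_iff by auto
   from uniform_lim_mult[OF 3 2(1) this 2(2)] 1 show ?thesis
    unfolding E_def v_def by (intro uniform_limit_minus) auto
  qed
  have hz: "v \<xi> = 0" if v0: "v \<zeta> = 0" and \<xi>: "\<xi> \<in> ?S" for \<xi>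
  proof (cases eqn)
   case True
   have "(%i. E i \<xi>) \<longlonglongrightarrow> v \<xi>" using tendsto_uniform_limitI[OF Eu \<xi>] .
   moreover have "(%i. E i \<xi>) \<longlonglongrightarrow> 0"
    by (rule tendsto_eventually) (use E0[OF _ \<xi>] True in \<open>auto intro!: eventually_sequentiallyI[of M]\<close>)
   ultimately show ?thesis by (rule LIMSEQ_unique)
  next
   case False
   show ?thesis by (rule hurwitz_ball[OF r2(1) Eh _ Eu vh v0 \<xi>]) (use E0 False in auto)
  qed
  have hq: "v \<zeta> = 0" if eqn
  proof -
   have zS: "\<zeta> \<in> ?S" using r2 by simp
   have "(%i. E i \<zeta>) \<longlonglongrightarrow> v \<zeta>" using tendsto_uniform_limitI[OF Eu zS] .
   moreover have "(%i. E i \<zeta>) \<longlonglongrightarrow> 0"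
    by (rule tendsto_eventually) (use E0[OF _ zS] that in \<open>auto intro!: eventually_sequentiallyI[of M]\<close>)
   ultimately show ?thesis by (rule LIMSEQ_unique)
  qed
  have "?S \<subseteq> {x. ~ is_pole g x}" using not_is_pole_holomorphic[OF open_ball _ r(2)] r2(4) by blast
  thus ?thesis using r2(1) vh hz hq by blast
 qed
 have alt: "(\<forall>z. z ~= - w --> ~ is_pole g z --> diff_monomial k n g z ~= c * (z - (- w)) ^ t) \<or>
    (\<forall>z. ~ is_pole g z --> diff_monomial k n g z = c * (z - (- w)) ^ t)"
 proof (cases "\<exists>\<zeta>. \<zeta> ~= - w & ~ is_pole g \<zeta> & v \<zeta> = 0")
  case True
  then obtain \<zeta> where \<zeta>: "\<zeta> ~= - w" "~ is_pole g \<zeta>" "v \<zeta> = 0" by blast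
  obtain r where r: "0 < r" "ball \<zeta> r \<subseteq> {x. ~ is_pole g x}" "!!\<xi>. \<xi> \<in> ball \<zeta> r ==> v \<xi> = 0"
   using key[OF \<zeta>(2,1)] \<zeta>(3) by blast
  define P where "P = {z. is_pole g z}"
  have gm: "g meromorphic_on UNIV" using g(1) by (simp add: nicely_meromorphic_on_def)
  have "\<forall>\<^sub>\<approx>z\<in>UNIV. ~ is_pole g z"
   using meromorphic_on_imp_analytic_cosparse[OF gm] by eventually_elim (rule analytic_at_imp_no_pole)
  hence sp: "P sparse_in UNIV" by (simp add: eventually_cosparse P_def)
  have con: "connected (UNIV - P)" using sp by (intro sparse_imp_connected) auto
  have op: "open (UNIV - P)" using sparse_in_UNIV_imp_closed[OF sp] by (simp add: open_Diff)
  have gh: "g holomorphic_on UNIV - P"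
  proof -
   have "g analytic_on UNIV - P"
    using nicely_meromorphic_on_imp_analytic_at[OF g(1)] analytic_on_analytic_at[of g "UNIV - P"] by (auto simp: P_def)
   thus ?thesis by (rule analytic_imp_holomorphic)
  qed
  have vh: "v holomorphic_on UNIV - P"
   unfolding v_def by (intro holomorphic_intros diff_monomial_holomorphic[OF gh op])
  have "v x = 0" if "x \<in> UNIV - P" for x
  proof (rule analytic_continuation_open[of "ball \<zeta> r" "UNIV - P" v "%_. 0"])
   show "ball \<zeta> r \<subseteq> UNIV - P" using r(2) by (auto simp: P_def)
   show "ball \<zeta> r ~= {}" using r(1) by simp
   show "v y = 0" if "y \<in> ball \<zeta> r" for y using r(3) that .
  qed (use op con vh that in auto)
  thus ?thesis by (auto simp: P_def v_def)
 next
  case False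
  thus ?thesis by (auto simp: v_def)
 qed
 show ?thesis by (rule value_distribution[OF g(1) L kn m t g(2) c alt])
qed

lemma exponent_bounds:
 assumes "1 <= k" "2 <= n 0" "1 <= n k" "t <= m"
 defines "\<alpha> \<equiv> (real (\<Sum>j\<le>k. j * n j) + real t) / real (\<Sum>j\<le>k. n j)"
 shows "\<alpha> * real (\<Sum>j\<le>k. n j) = real (\<Sum>j\<le>k. j * n j) + real t" "0 < \<alpha>" "\<alpha> < real (k + m + 1)"
proof -
 define \<gamma> where "\<gamma> = (\<Sum>j\<le>k. n j)"
 define \<Gamma> where "\<Gamma> = (\<Sum>j\<le>k. j * n j)"
 have b: "3 <= \<gamma>" "\<Gamma> + 2 * k <= k * \<gamma>" "k <= \<Gamma>" unfolding \<gamma>_def \<Gamma>_def using degree_weight_bound[OF assms(1-3)] by auto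
 have a: "\<alpha> = (real \<Gamma> + real t) / real \<gamma>" by (simp add: \<alpha>_def \<gamma>_def \<Gamma>_def)
 show "\<alpha> * real (\<Sum>j\<le>k. n j) = real (\<Sum>j\<le>k. j * n j) + real t"
  unfolding a \<gamma>_def[symmetric] \<Gamma>_def[symmetric] using b by simp
 show "0 < \<alpha>" unfolding a using b assms(1) by (intro divide_pos_pos add_pos_nonneg) auto
 have "m * 1 <= m * \<gamma>" using b by (intro mult_le_mono2) auto
 moreover have "(k + m + 1) * \<gamma> = k * \<gamma> + m * \<gamma> + \<gamma>" by (simp add: algebra_simps)
 ultimately have "\<Gamma> + t < (k + m + 1) * \<gamma>" using b assms(1,4) by linarith
 hence "real (\<Gamma> + t) < real ((k + m + 1) * \<gamma>)" by (simp only: of_nat_less_iff)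
 thus "\<alpha> < real (k + m + 1)" unfolding a using b by (simp add: divide_less_eq algebra_simps)
qed

text \<open>
 The case t = 0. It is needed for varying b i, since it is applied to rescaled functions; choosing e = z is harmless for exponent 0.
\<close>

theorem locally_bounded_of_omission:
 fixes k m :: nat and n :: "nat => nat"
 assumes kn: "1 <= k" "2 <= n 0" "1 <= n k" and m: "1 <= m" and D: "open D" "z0 \<in> D"
  and f: "!!i. f i nicely_meromorphic_on D" and zm: "!!i. zeros_mult_ge D (k + m + 1) (f i)"
  and b: "!!i. b i holomorphic_on D" "uniform_limit D b b0 sequentially" "b0 holomorphic_on D" "b0 z0 ~= 0"
  and eq: "!!i x. x \<in> D ==> ~ is_pole (f i) x ==> (diff_monomial k n (f i) x = b i x) = eqn"
 obtains r L N where "0 < r" "ball z0 r \<subseteq> D" "!!i x. i >= N ==> x \<in> ball z0 r ==> sphderiv (f i) x <= L"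
proof (rule ccontr)
 assume no: "~ thesis"
 obtain d where d: "0 < d" "ball z0 d \<subseteq> D" using D open_contains_ball by blast
 have "\<exists>j\<ge>i. \<exists>x\<in>ball z0 (1 / real (Suc i)). real i < sphderiv (f j) x" for i
 proof (rule ccontr)
  assume a: "~ ?thesis"
  define r where "r = min d (1 / real (Suc i))"
  have "0 < r" "ball z0 r \<subseteq> D" using d by (auto simp: r_def)
  moreover have "sphderiv (f j) x <= real i" if "j >= i" "x \<in> ball z0 r" for j x
  proof (rule ccontr)
   assume "~ ?thesis"
   hence "real i < sphderiv (f j) x" by simp
   moreover have "x \<in> ball z0 (1 / real (Suc i))" using that(2) by (simp add: r_def)
   ultimately show False using a that(1) by blast
  qed
  ultimately show False using no that by blast
 qed
 then obtain j x where jx: "!!i. i <= j i" "!!i. x i \<in> ball z0 (1 / real (Suc i))" "!!i. real i < sphderiv (f (j i)) (x i)" by metis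
 define \<alpha> where "\<alpha> = (real (\<Sum>j\<le>k. j * n j) + real 0) / real (\<Sum>j\<le>k. n j)"
 note \<alpha> = exponent_bounds[OF kn le0[of m], folded \<alpha>_def]
 obtain s z \<rho> g where s: "strict_mono s" "z \<longlonglongrightarrow> z0" "blowup D \<alpha> (k + m + 1) (%i. f (j (s i))) z \<rho> g" "~ (\<exists>w. \<forall>\<zeta>. g \<zeta> = w)"
  by (rule zalcman[where f = "%i. f (j i)" and x = x, OF D f zm \<alpha>(2,3) jx(2,3)]) (rule that)
 have js: "i <= j (s i)" for i using seq_suble[OF s(1), of i] jx(1)[of "s i"] by linarith
 have "filterlim (%i. j (s i)) at_top sequentially"
  by (rule filterlim_at_top_mono[OF filterlim_ident]) (simp add: js)
 hence ub: "uniform_limit D (%i. b (j (s i))) b0 sequentially" by (rule filterlim_compose[OF b(2)])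
 have "\<exists>v. \<forall>\<zeta>. g \<zeta> = v"
 proof (rule blowup_constant[OF s(3) kn m le0 \<alpha>(1) s(2) D b(1) ub b(3,4), where e = z and w = 0 and eqn = eqn])
  show "(%i. (z i - z i) / complex_of_real (\<rho> i)) \<longlonglongrightarrow> 0" by simp
  show "(diff_monomial k n (f (j (s i))) x = (x - z i) ^ 0 * b (j (s i)) x) = eqn" if "x \<in> D" "~ is_pole (f (j (s i))) x" for i x
   using eq[OF that] by simp
 qed
 thus False using s(4) by blast
qed

section \<open>Normality\<close>

lemma complex_sequence_cases:
 fixes y :: "nat => complex"
 obtains s w where "strict_mono (s :: nat => nat)" "(%i. y (s i)) \<longlonglongrightarrow> w" | "filterlim (%i. cmod (y i)) at_top sequentially"
proof (cases "filterlim (%i. cmod (y i)) at_top sequentially")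
 case False
 then obtain Z where Z: "~ (\<forall>\<^sub>F i in sequentially. Z <= cmod (y i))" unfolding filterlim_at_top by blast
 have "infinite {i. ~ Z <= cmod (y i)}"
 proof
  assume "finite {i. ~ Z <= cmod (y i)}"
  hence "\<forall>\<^sub>F i in cofinite. Z <= cmod (y i)" unfolding eventually_cofinite .
  thus False using Z unfolding cofinite_eq_sequentially by blast
 qed
 then obtain r :: "nat => nat" where r: "strict_mono r" "!!i. ~ Z <= cmod (y (r i))" using infinite_enumerate by blast
 have "bounded (range (%i. y (r i)))" unfolding bounded_iff using r(2) by (intro exI[of _ Z]) (auto simp: not_le less_imp_le)
 then obtain w q where q: "strict_mono (q :: nat => nat)" "((%i. y (r i)) \<circ> q) \<longlonglongrightarrow> w"
  using bounded_imp_convergent_subsequence by blast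
 show ?thesis
  by (rule that(1)[of "r \<circ> q" w]) (use q r in \<open>auto simp: o_def strict_mono_def\<close>)
qed (rule that(2))

lemma powr_rescale:
 fixes c x :: real
 assumes "0 < c" "0 < x"
 shows "(c / x) powr (\<alpha> - real j) * (c powr - \<alpha> * c ^ j) = x powr - \<alpha> * x ^ j"
proof -
 have a: "y powr - \<alpha> * y ^ j = y powr (real j - \<alpha>)" if "0 < y" for y
  using that by (simp only: powr_realpow[symmetric] powr_add[symmetric]) (simp add: algebra_simps)
 have "c powr (\<alpha> - real j) * c powr (real j - \<alpha>) = 1" using assms by (simp add: powr_add[symmetric])
 moreover have "(c / x) powr (\<alpha> - real j) = c powr (\<alpha> - real j) * x powr (real j - \<alpha>)"
  using assms by (simp add: powr_divide powr_minus_divide[of x "\<alpha> - real j", simplified])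
 ultimately show ?thesis unfolding a[OF assms(1)] a[OF assms(2)] by (simp add: mult.assoc mult.left_commute)
qed

text \<open>
 Rescale by \<open>c i = \<bar>z i - a\<bar>\<close> rather than by \<open>\<rho> i\<close>, and let H i be the result. Near the unit vector u its monomial avoids, or equals, a
 zero-free function, so the H i are equicontinuous there. If they stay away from infinity infinitely often, Cauchy's estimates show that the
 derivative of g of order k + m + 1 vanishes, since g arises from H i by a further dilation by \<open>R i \<rightarrow> \<infinity>\<close> and
 \<open>\<alpha> < k + m + 1\<close>. Otherwise the dilation drives g to infinity.
\<close>

theorem far_blowup_constant:
 fixes k m t :: nat and n :: "nat => nat"
 assumes bl: "blowup D \<alpha> (k + m + 1) f z \<rho> g" and kn: "1 <= k" "2 <= n 0" "1 <= n k" and m: "1 <= m"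
  and \<alpha>: "\<alpha> * real (\<Sum>j\<le>k. n j) = real (\<Sum>j\<le>k. j * n j) + real t" "0 < \<alpha>" "\<alpha> < real (k + m + 1)"
  and z: "z \<longlonglongrightarrow> a" and D: "open D" "a \<in> D"
  and f: "!!i. f i nicely_meromorphic_on D" and zm: "!!i. zeros_mult_ge D (k + m + 1) (f i)"
  and b: "b holomorphic_on D" "b a ~= 0"
  and eq: "!!i x. x \<in> D ==> x ~= a ==> ~ is_pole (f i) x ==> (diff_monomial k n (f i) x = (x - a) ^ t * b x) = eqn"
  and far: "filterlim (%i. cmod ((z i - a) / of_real (\<rho> i))) at_top sequentially"
  and dir: "(%i. (z i - a) / of_real (cmod (z i - a))) \<longlonglongrightarrow> u"
 shows "\<exists>v. \<forall>\<zeta>. g \<zeta> = v"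
proof -
 define p where "p = k + m + 1"
 define c where "c = (%i. cmod (z i - a))"
 define R where "R = (%i. c i / \<rho> i)"
 have \<rho>: "0 < \<rho> i" for i using bl by (auto simp: blowup_def)
 have g: "g nicely_meromorphic_on UNIV" "zeros_mult_ge UNIV p g" using bl by (auto simp: blowup_def p_def)
 have Rlim: "filterlim R at_top sequentially"
 proof -
  have "cmod ((z i - a) / of_real (\<rho> i)) = R i" for i using \<rho>[of i] by (simp add: R_def c_def norm_divide)
  thus ?thesis using far by simp
 qed
 have c0: "c \<longlonglongrightarrow> 0" unfolding c_def using z by (intro tendsto_norm_zero) (simp add: LIM_zero)
 have evpos: "\<forall>\<^sub>F i in sequentially. 0 < c i"
 proof -
  have "\<forall>\<^sub>F i in sequentially. 1 <= R i" using Rlim unfolding filterlim_at_top by blast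
  thus ?thesis
  proof eventually_elim
   case (elim i)
   have "c i ~= 0" using elim by (auto simp: R_def)
   thus ?case by (simp add: c_def)
  qed
 qed
 have u1: "cmod u = 1"
 proof -
  have "(%i. cmod ((z i - a) / of_real (cmod (z i - a)))) \<longlonglongrightarrow> cmod u" using dir by (rule tendsto_norm)
  moreover have "(%i. cmod ((z i - a) / of_real (cmod (z i - a)))) \<longlonglongrightarrow> 1"
   by (rule tendsto_eventually) (use evpos in \<open>auto elim!: eventually_mono simp: c_def norm_divide\<close>)
  ultimately show ?thesis by (rule LIMSEQ_unique)
 qed
 obtain d where d: "0 < d" "ball a d \<subseteq> D" using D open_contains_ball by blast
 have "\<forall>\<^sub>F i in sequentially. c i < d / 2" using order_tendstoD(2)[OF c0, of "d / 2"] d(1) by simp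
 hence "\<forall>\<^sub>F i in sequentially. 0 < c i & c i < d / 2" using evpos by eventually_elim simp
 then obtain N where N: "!!i. i >= N ==> 0 < c i & c i < d / 2" unfolding eventually_sequentially by blast
 define H where "H = (%i \<zeta>. complex_of_real (c i powr - \<alpha>) * f i (a + of_real (c i) * \<zeta>))"
 define S where "S = ball u (1/2)"
 have cnz: "complex_of_real (c i) ~= 0" "complex_of_real (c i powr - \<alpha>) ~= 0" if "i >= N" for i using N[OF that] by auto
 have Sin: "\<zeta> ~= 0 & a + of_real (c i) * \<zeta> \<in> D" if i: "i >= N" and \<zeta>: "\<zeta> \<in> S" for i \<zeta>
 proof -
  have A: "cmod (u - \<zeta>) < 1/2" using \<zeta> by (simp add: S_def dist_norm)
  have n1: "cmod \<zeta> <= 3/2" using A u1 norm_triangle_ineq3[of u \<zeta>] by linarith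
  have "\<zeta> ~= 0" using A u1 by auto
  moreover have "c i * cmod \<zeta> <= d / 2 * (3/2)" using N[OF i] n1 d(1) by (intro mult_mono) auto
  hence "dist a (a + of_real (c i) * \<zeta>) < d" using N[OF i] d(1) by (simp add: dist_norm norm_mult)
  ultimately show ?thesis using d(2) by auto
 qed
 have fm: "f i meromorphic_on D" for i using f by (simp add: nicely_meromorphic_on_def)
 have Hn: "H i nicely_meromorphic_on S" if i: "i >= N" for i
  unfolding H_def by (rule nicely_meromorphic_on_subset[OF nicely_meromorphic_affine[OF f cnz[OF i]]]) (use Sin[OF i] in auto)
 have Hz: "zeros_mult_ge S (k + m + 1) (H i)" if i: "i >= N" for i
 proof -
  have "zeros_mult_ge {\<zeta>. a + of_real (c i) * \<zeta> \<in> D} (k + m + 1) (H i)"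
   unfolding H_def by (rule zeros_mult_ge_affine[OF zm fm cnz[OF i]])
  thus ?thesis using Sin[OF i] by (auto simp: zeros_mult_ge_def)
 qed
 have Hpole: "is_pole (H i) \<zeta> \<longleftrightarrow> is_pole (f i) (a + of_real (c i) * \<zeta>)" if i: "i >= N" for i \<zeta>
  unfolding H_def by (rule is_pole_affine[OF cnz[OF i]])
 have bounded_near_u: "\<exists>r L M. 0 < r & ball u r \<subseteq> S & (\<forall>i\<ge>M. \<forall>x\<in>ball u r. sphderiv (H (i + N)) x <= L)"
 proof -
  have bh: "(%\<zeta>. \<zeta> ^ t * b (a + of_real (c (i + N)) * \<zeta>)) holomorphic_on S" for i
  proof -
   have "(b \<circ> (%\<zeta>. a + of_real (c (i + N)) * \<zeta>)) holomorphic_on S"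
   proof (rule holomorphic_on_compose_gen[OF _ b(1)])
    show "(%\<zeta>. a + of_real (c (i + N)) * \<zeta>) ` S \<subseteq> D" using Sin[of "i + N"] by auto
   qed (intro holomorphic_intros)
   hence "(%\<zeta>. b (a + of_real (c (i + N)) * \<zeta>)) holomorphic_on S" by (simp add: o_def)
   thus ?thesis by (intro holomorphic_intros)
  qed
  have bl0: "uniform_limit S (%i \<zeta>. b (a + of_real (c (i + N)) * \<zeta>)) (%_. b a) sequentially"
  proof (rule uniform_limitI)
   fix e :: real assume e: "0 < e"
   have "continuous (at a) b" using holomorphic_on_imp_continuous_on[OF b(1)] D by (simp add: continuous_on_eq_continuous_at)
   then obtain d1 where d1: "0 < d1" "!!x. dist x a < d1 ==> dist (b x) (b a) < e"
    using e unfolding continuous_at_eps_delta by blast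
   have "(%i. c (i + N)) \<longlonglongrightarrow> 0" using LIMSEQ_ignore_initial_segment[OF c0] .
   hence "\<forall>\<^sub>F i in sequentially. c (i + N) < d1 / 2" using d1(1) by (intro order_tendstoD(2)[of _ 0]) auto
   thus "\<forall>\<^sub>F i in sequentially. \<forall>\<zeta>\<in>S. dist (b (a + of_real (c (i + N)) * \<zeta>)) (b a) < e"
   proof eventually_elim
    case (elim i)
    show ?case
    proof
     fix \<zeta> assume \<zeta>: "\<zeta> \<in> S"
     have "cmod (u - \<zeta>) < 1/2" using \<zeta> by (simp add: S_def dist_norm)
     hence n1: "cmod \<zeta> <= 3/2" using u1 norm_triangle_ineq3[of u \<zeta>] by linarith
     have "c (i + N) * cmod \<zeta> <= d1 / 2 * (3/2)" using elim N[of "i + N"] n1 d1(1) by (intro mult_mono) auto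
     hence "dist (a + of_real (c (i + N)) * \<zeta>) a < d1" using N[of "i + N"] d1(1) by (simp add: dist_norm norm_mult)
     thus "dist (b (a + of_real (c (i + N)) * \<zeta>)) (b a) < e" by (rule d1(2))
    qed
   qed
  qed
  have "bounded ((%x :: complex. x) ` S)" by (simp add: S_def)
  from uniform_limit_pow[OF uniform_limit_const this, of t]
  have pw: "uniform_limit S (%i \<zeta>. \<zeta> ^ t) (%\<zeta>. \<zeta> ^ t) sequentially" "bounded ((%\<zeta>. \<zeta> ^ t) ` S)" by auto
  have "bounded ((%_. b a) ` S)" unfolding bounded_iff by auto
  hence ul: "uniform_limit S (%i \<zeta>. \<zeta> ^ t * b (a + of_real (c (i + N)) * \<zeta>)) (%\<zeta>. \<zeta> ^ t * b a) sequentially"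
   by (intro uniform_lim_mult pw bl0)
  have oS: "open S" "u \<in> S" by (auto simp: S_def)
  have b0h: "(%\<zeta>. \<zeta> ^ t * b a) holomorphic_on S" by (intro holomorphic_intros)
  have b0n: "u ^ t * b a ~= 0" using u1 b(2) by auto
  have eqH: "(diff_monomial k n (H (i + N)) x = x ^ t * b (a + of_real (c (i + N)) * x)) = eqn"
   if x: "x \<in> S" "~ is_pole (H (i + N)) x" for i x
  proof -
   let ?i = "i + N" let ?x = "a + of_real (c (i + N)) * x"
   have i: "N <= ?i" by simp
   have xD: "?x \<in> D" "?x ~= a" using Sin[OF i x(1)] cnz[OF i] by auto
   have np: "~ is_pole (f ?i) ?x" using x(2) Hpole[OF i] by simp
   have an: "f ?i analytic_on {?x}" using nicely_meromorphic_on_imp_analytic_at[OF f xD(1) np] .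
   have s: "diff_monomial k n (H ?i) x * of_real (c ?i) ^ t = diff_monomial k n (f ?i) ?x"
    unfolding H_def by (rule diff_monomial_scaled[OF _ \<alpha>(1) an]) (use N[OF i] in simp)
   have "diff_monomial k n (H ?i) x = x ^ t * b ?x \<longleftrightarrow>
     diff_monomial k n (H ?i) x * of_real (c ?i) ^ t = x ^ t * b ?x * of_real (c ?i) ^ t" using cnz(1)[OF i] by simp
   also have "x ^ t * b ?x * of_real (c ?i) ^ t = (?x - a) ^ t * b ?x" by (simp add: power_mult_distrib)
   finally show ?thesis unfolding s using eq[OF xD np] by simp
  qed
  have Hn': "H (i + N) nicely_meromorphic_on S" "zeros_mult_ge S (k + m + 1) (H (i + N))" for i using Hn Hz by simp_all
  obtain r L M where "0 < r" "ball u r \<subseteq> S" "!!i x. i >= M ==> x \<in> ball u r ==> sphderiv (H (i + N)) x <= L"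
   by (rule locally_bounded_of_omission[where f = "%i. H (i + N)" and eqn = eqn, OF kn m oS Hn' bh ul b0h b0n eqH]) (assumption, assumption, rule that)
  thus ?thesis by blast
 qed
 then obtain r L0 M0 where r: "0 < r" "ball u r \<subseteq> S" and L0: "!!i x. i >= M0 ==> x \<in> ball u r ==> sphderiv (H (i + N)) x <= L0" by blast
 define L where "L = max L0 1"
 define M where "M = M0 + N"
 have MN: "N <= i" if "M <= i" for i using that by (simp add: M_def)
 have L: "sphderiv (H i) x <= L" if "i >= M" "x \<in> ball u r" for i x
 proof -
  have "i - N + N = i" "M0 <= i - N" using that(1) by (auto simp: M_def)
  thus ?thesis using L0[of "i - N" x] that(2) by (simp add: L_def le_max_iff_disj)
 qed
 have L1: "1 <= L" by (simp add: L_def)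
 \<comment> \<open>On this disc the spherical values of \<open>H i\<close> vary by at most 1/4.\<close>
 define r' where "r' = min r (1 / (8 * L))"
 have r': "0 < r'" "r' <= r" "r' <= 1 / (8 * L)" "ball u r' \<subseteq> ball u r" using r L1 by (auto simp: r'_def)
 have near: "dist (sphere_value (H i) x) (sphere_value (H i) u) <= 1/4" if i: "i >= M" and x: "x \<in> ball u r'" for i x
 proof -
  have "H i nicely_meromorphic_on ball u r" using Hn[OF MN[OF i]] r(2) nicely_meromorphic_on_subset by blast
  hence "(2 * L)-lipschitz_on (ball u r) (sphere_value (H i))"
   using L[OF i] L1 by (intro sphderiv_bound_imp_lipschitz) auto
  hence "dist (sphere_value (H i) x) (sphere_value (H i) u) <= 2 * L * dist x u"
   using x r'(4) r(1) by (intro lipschitz_onD) auto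
  also have "... <= 2 * L * (1 / (8 * L))" using x r'(3) L1 by (intro mult_left_mono) (auto simp: dist_commute)
  also have "... = 1/4" using L1 by simp
  finally show ?thesis .
 qed
 have invR: "(%i. inverse (R i)) \<longlonglongrightarrow> 0" using Rlim by (rule tendsto_inverse_0_at_top)
 define P where "P = (%\<zeta> i. (z i - a) / of_real (c i) + \<zeta> * of_real (inverse (R i)))"
 have Plim: "P \<zeta> \<longlonglongrightarrow> u" for \<zeta>
 proof -
  have "(%i. (z i - a) / of_real (c i) + \<zeta> * of_real (inverse (R i))) \<longlonglongrightarrow> u + \<zeta> * of_real 0"
   using dir invR unfolding c_def by (intro tendsto_intros)
  thus ?thesis by (simp add: P_def)
 qed
 have Px: "a + of_real (c i) * P \<zeta> i = z i + of_real (\<rho> i) * \<zeta>" if i: "i >= N" for i \<zeta>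
 proof -
  have "complex_of_real (c i) ~= 0" "c i ~= 0" using cnz(1)[OF i] by auto
  thus ?thesis by (simp add: P_def R_def field_simps)
 qed
 have derivs: "cmod ((deriv ^^ j) (%\<xi>. of_real (\<rho> i powr - \<alpha>) * f i (z i + of_real (\<rho> i) * \<xi>)) \<zeta>) =
   R i powr (\<alpha> - real j) * cmod ((deriv ^^ j) (H i) (P \<zeta> i))"
  if i: "i >= N" and an: "f i analytic_on {z i + of_real (\<rho> i) * \<zeta>}" for i j \<zeta>
 proof -
  have 1: "(deriv ^^ j) (%\<xi>. of_real (\<rho> i powr - \<alpha>) * f i (z i + of_real (\<rho> i) * \<xi>)) \<zeta> =
    of_real (\<rho> i powr - \<alpha>) * of_real (\<rho> i) ^ j * (deriv ^^ j) (f i) (z i + of_real (\<rho> i) * \<zeta>)"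
   by (rule higher_deriv_affine[OF an])
  have an': "f i analytic_on {a + of_real (c i) * P \<zeta> i}" unfolding Px[OF i] by (rule an)
  have 2: "(deriv ^^ j) (H i) (P \<zeta> i) =
    of_real (c i powr - \<alpha>) * of_real (c i) ^ j * (deriv ^^ j) (f i) (z i + of_real (\<rho> i) * \<zeta>)"
   using higher_deriv_affine[OF an', of j "of_real (c i powr - \<alpha>)"] unfolding H_def Px[OF i] .
  have cp: "0 < c i" using N[OF i] by simp
  have "cmod (of_real (\<rho> i powr - \<alpha>) * of_real (\<rho> i) ^ j * w) = (\<rho> i powr - \<alpha> * \<rho> i ^ j) * cmod w" for w
   using \<rho>[of i] by (simp add: norm_mult norm_power)
  moreover have "cmod (of_real (c i powr - \<alpha>) * of_real (c i) ^ j * w) = (c i powr - \<alpha> * c i ^ j) * cmod w" for w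
   using cp by (simp add: norm_mult norm_power)
  ultimately show ?thesis unfolding 1 2 powr_rescale[OF cp \<rho>, of i \<alpha> j, symmetric] R_def by (simp only: mult.assoc)
 qed
 show ?thesis
 proof (cases "\<exists>\<^sub>F i in sequentially. 1/2 <= dist (sphere_value (H i) u) sphere_infinity")
  case True
  have "(deriv ^^ p) g \<zeta> = 0" if np: "~ is_pole g \<zeta>" for \<zeta>
  proof (rule ccontr)
   assume nz: "(deriv ^^ p) g \<zeta> ~= 0"
   define G where "G = (%i \<xi>. complex_of_real (\<rho> i powr - \<alpha>) * f i (z i + of_real (\<rho> i) * \<xi>))"
   obtain s N3 where s: "0 < s" "g holomorphic_on ball \<zeta> s" "!!i. i >= N3 ==> G i holomorphic_on ball \<zeta> s"
    "uniform_limit (ball \<zeta> s) G g sequentially"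
    "!!i \<xi>. i >= N3 ==> \<xi> \<in> ball \<zeta> s ==> f i analytic_on {z i + of_real (\<rho> i) * \<xi>}"
    using bl np unfolding blowup_def G_def by blast
   have "(%i. (deriv ^^ p) (G i) \<zeta>) \<longlonglongrightarrow> (deriv ^^ p) g \<zeta>"
    by (rule tendsto_uniform_limitI[OF higher_deriv_uniform_limit[OF s(4,3,2,1)]]) (use s(1) in simp_all)
   hence "(%i. cmod ((deriv ^^ p) (G i) \<zeta>)) \<longlonglongrightarrow> cmod ((deriv ^^ p) g \<zeta>)" by (rule tendsto_norm)
   hence ev1: "\<forall>\<^sub>F i in sequentially. cmod ((deriv ^^ p) g \<zeta>) / 2 < cmod ((deriv ^^ p) (G i) \<zeta>)"
    using nz by (intro order_tendstoD(1)) auto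
   define K where "K = fact p * 8 / (r'/4) ^ p"
   have ap: "\<alpha> - real p < 0" using \<alpha>(3) by (simp add: p_def)
   have "(%i. R i powr (\<alpha> - real p) * K) \<longlonglongrightarrow> 0 * K"
    by (intro tendsto_mult tendsto_const tendsto_neg_powr[OF ap Rlim])
   hence ev2: "\<forall>\<^sub>F i in sequentially. R i powr (\<alpha> - real p) * K < cmod ((deriv ^^ p) g \<zeta>) / 2"
    using nz by (intro order_tendstoD(2)[of _ "0 * K"]) auto
   have ev3: "\<forall>\<^sub>F i in sequentially. dist (P \<zeta> i) u < r'/2" using Plim r'(1) by (intro tendstoD) auto
   have "\<forall>\<^sub>F i in sequentially. ~ 1/2 <= dist (sphere_value (H i) u) sphere_infinity"
    using ev1 ev2 ev3 eventually_ge_at_top[of M] eventually_ge_at_top[of N3]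
   proof eventually_elim
    case (elim i)
    show ?case
    proof
     assume far_i: "1/2 <= dist (sphere_value (H i) u) sphere_infinity"
     have iN: "N <= i" using MN elim by blast
     have bd: "~ is_pole (H i) x & cmod (H i x) <= 8" if x: "x \<in> ball u r'" for x
     proof -
      have "1/4 <= dist (sphere_value (H i) x) sphere_infinity"
       using far_i near[OF elim(4) x] dist_triangle[of "sphere_value (H i) u" sphere_infinity "sphere_value (H i) x"]
        dist_commute[of "sphere_value (H i) u" "sphere_value (H i) x"] by linarith
      from sphere_value_bounded[OF this] show ?thesis by simp
     qed
     have hol: "H i holomorphic_on ball u r'"
     proof (rule analytic_imp_holomorphic, subst analytic_on_analytic_at, intro ballI)
      fix x assume x: "x \<in> ball u r'"
      hence "x \<in> S" using r'(4) r(2) by blast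
      thus "H i analytic_on {x}" using nicely_meromorphic_on_imp_analytic_at[OF Hn[OF iN]] bd[OF x] by blast
     qed
     have sub: "cball (P \<zeta> i) (r'/4) \<subseteq> ball u r'"
     proof
      fix x assume "x \<in> cball (P \<zeta> i) (r'/4)"
      thus "x \<in> ball u r'" using elim(3) dist_triangle[of u x "P \<zeta> i"] r'(1) by (auto simp: dist_commute)
     qed
     have "cmod ((deriv ^^ p) (H i) (P \<zeta> i)) <= fact p * 8 / (r'/4) ^ p"
     proof (rule Cauchy_inequality)
      show "H i holomorphic_on ball (P \<zeta> i) (r'/4)" by (rule holomorphic_on_subset[OF hol]) (use sub ball_subset_cball in blast)
      show "continuous_on (cball (P \<zeta> i) (r'/4)) (H i)" using holomorphic_on_imp_continuous_on[OF hol] sub continuous_on_subset by blast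
      fix x assume "cmod (P \<zeta> i - x) = r'/4"
      hence "x \<in> ball u r'" using sub by (auto simp: dist_norm)
      thus "cmod (H i x) <= 8" using bd by blast
     qed (use r' in auto)
     hence KH: "cmod ((deriv ^^ p) (H i) (P \<zeta> i)) <= K" unfolding K_def .
     have "cmod ((deriv ^^ p) (G i) \<zeta>) = R i powr (\<alpha> - real p) * cmod ((deriv ^^ p) (H i) (P \<zeta> i))"
      unfolding G_def by (rule derivs[OF iN s(5)[OF elim(5)]]) (use s(1) in simp)
     also have "... <= R i powr (\<alpha> - real p) * K" by (rule mult_left_mono[OF KH]) simp
     finally show False using elim(1,2) by linarith
    qed
   qed
   thus False using True by (simp add: frequently_def)
  qed
  thus ?thesis by (rule vanishing_derivative_imp_constant[OF g order_refl])
 next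
  case False
  hence ev: "\<forall>\<^sub>F i in sequentially. dist (sphere_value (H i) u) sphere_infinity < 1/2"
   by (simp add: frequently_def not_le)
  have gm: "g meromorphic_on UNIV" using g(1) by (simp add: nicely_meromorphic_on_def)
  have "\<forall>\<^sub>\<approx>z\<in>UNIV. ~ is_pole g z"
   using meromorphic_on_imp_analytic_cosparse[OF gm] by eventually_elim (rule analytic_at_imp_no_pole)
  then obtain \<zeta> where np: "~ is_pole g \<zeta>" using cosparse_exists by blast
  define G where "G = (%i \<xi>. complex_of_real (\<rho> i powr - \<alpha>) * f i (z i + of_real (\<rho> i) * \<xi>))"
  obtain s N3 where s: "0 < s" "uniform_limit (ball \<zeta> s) G g sequentially"
    "!!i \<xi>. i >= N3 ==> \<xi> \<in> ball \<zeta> s ==> f i analytic_on {z i + of_real (\<rho> i) * \<xi>}"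
   using bl np unfolding blowup_def G_def by blast
  have "(%i. G i \<zeta>) \<longlonglongrightarrow> g \<zeta>" using tendsto_uniform_limitI[OF s(2)] s(1) by simp
  hence "(%i. cmod (G i \<zeta>)) \<longlonglongrightarrow> cmod (g \<zeta>)" by (rule tendsto_norm)
  hence ev1: "\<forall>\<^sub>F i in sequentially. cmod (G i \<zeta>) < cmod (g \<zeta>) + 1" by (rule order_tendstoD(2)) simp
  define B where "B = cmod (g \<zeta>) + 1"
  have B: "0 < B" by (simp add: B_def add_nonneg_pos)
  have ev2: "\<forall>\<^sub>F i in sequentially. B powr (1 / \<alpha>) <= R i" using Rlim unfolding filterlim_at_top by blast
  have ev3: "\<forall>\<^sub>F i in sequentially. dist (P \<zeta> i) u < r'" using Plim r'(1) by (intro tendstoD) auto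
  have "\<forall>\<^sub>F i in sequentially. False"
   using ev ev1 ev2 ev3 eventually_ge_at_top[of M] eventually_ge_at_top[of N3]
  proof eventually_elim
   case (elim i)
   have iN: "N <= i" using MN elim by blast
   have an: "f i analytic_on {z i + of_real (\<rho> i) * \<zeta>}" using s(3)[OF elim(6)] s(1) by simp
   have x: "P \<zeta> i \<in> ball u r'" using elim(4) by (simp add: dist_commute)
   have "dist (sphere_value (H i) (P \<zeta> i)) sphere_infinity < 1"
    using elim(1) near[OF elim(5) x] dist_triangle[of "sphere_value (H i) (P \<zeta> i)" sphere_infinity "sphere_value (H i) u"] by linarith
   hence "is_pole (H i) (P \<zeta> i) | 1 < cmod (H i (P \<zeta> i))" by (rule sphere_value_large)
   moreover have "~ is_pole (H i) (P \<zeta> i)"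
    unfolding Hpole[OF iN] Px[OF iN] using an by (rule analytic_at_imp_no_pole)
   ultimately have big: "1 < cmod (H i (P \<zeta> i))" by blast
   have e: "cmod (G i \<zeta>) = R i powr \<alpha> * cmod (H i (P \<zeta> i))" using derivs[OF iN an, of 0] by (simp add: G_def)
   have "B = (B powr (1 / \<alpha>)) powr \<alpha>" using B \<alpha>(2) by (simp add: powr_powr)
   also have "... <= R i powr \<alpha>" using elim(3) \<alpha>(2) by (intro powr_mono2) auto
   also have "R i powr \<alpha> * 1 <= R i powr \<alpha> * cmod (H i (P \<zeta> i))" using big by (intro mult_left_mono) auto
   finally show False using elim(2) unfolding e[symmetric] B_def by simp
  qed
  thus ?thesis by simp
 qed
qed

theorem locally_bounded_of_sharing:
 fixes k m t :: nat and n :: "nat => nat" and F :: "(complex => complex) set"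
 assumes kn: "1 <= k" "2 <= n 0" "1 <= n k" and m: "1 <= m" and t: "t <= m" and D: "open D" "a \<in> D"
  and F: "!!f. f \<in> F ==> f nicely_meromorphic_on D" "!!f. f \<in> F ==> zeros_mult_ge D (k + m + 1) f"
  and b: "b holomorphic_on D" "b a ~= 0"
  and eq: "!!f x. f \<in> F ==> x \<in> D ==> x ~= a ==> ~ is_pole f x ==> (diff_monomial k n f x = (x - a) ^ t * b x) = eqn"
 shows "\<exists>r>0. \<exists>L. ball a r \<subseteq> D & (\<forall>f\<in>F. \<forall>x\<in>ball a r. sphderiv f x <= L)"
proof (rule ccontr)
 assume no: "~ ?thesis"
 obtain d where d: "0 < d" "ball a d \<subseteq> D" using D open_contains_ball by blast
 have "\<exists>f\<in>F. \<exists>x\<in>ball a (1 / real (Suc i)). real i < sphderiv f x" for i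
 proof (rule ccontr)
  assume c: "~ ?thesis"
  define r where "r = min d (1 / real (Suc i))"
  have "0 < r" "ball a r \<subseteq> D" using d by (auto simp: r_def)
  moreover have "sphderiv f x <= real i" if "f \<in> F" "x \<in> ball a r" for f x
  proof (rule ccontr)
   assume "~ ?thesis"
   hence "real i < sphderiv f x" by simp
   moreover have "x \<in> ball a (1 / real (Suc i))" using that(2) by (simp add: r_def)
   ultimately show False using c that(1) by blast
  qed
  ultimately show False using no by blast
 qed
 then obtain f x where fx: "!!i. f i \<in> F" "!!i. x i \<in> ball a (1 / real (Suc i))" "!!i. real i < sphderiv (f i) (x i)" by metis
 define \<alpha> where "\<alpha> = (real (\<Sum>j\<le>k. j * n j) + real t) / real (\<Sum>j\<le>k. n j)"
 note \<alpha> = exponent_bounds[OF kn t, folded \<alpha>_def]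
 have f: "f i nicely_meromorphic_on D" "zeros_mult_ge D (k + m + 1) (f i)" for i using F fx(1) by auto
 obtain s z \<rho> g where s: "strict_mono s" "z \<longlonglongrightarrow> a" "blowup D \<alpha> (k + m + 1) (%i. f (s i)) z \<rho> g" "~ (\<exists>w. \<forall>\<zeta>. g \<zeta> = w)"
  by (rule zalcman[where f = f and x = x, OF D f \<alpha>(2,3) fx(2,3)]) (rule that)
 have "\<exists>v. \<forall>\<zeta>. g \<zeta> = v"
 proof (cases "%i. (z i - a) / complex_of_real (\<rho> i)" rule: complex_sequence_cases)
  case (1 q w)
  have "(%i. z (q i)) \<longlonglongrightarrow> a" using LIMSEQ_subseq_LIMSEQ[OF s(2) 1(1)] by (simp add: o_def)
  moreover have "uniform_limit D (%i. b) b sequentially" by (rule uniform_limit_const)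
  ultimately show ?thesis
   by (rule blowup_constant[OF blowup_subsequence[OF s(3) 1(1)] kn m t \<alpha>(1) _ D b(1) _ b 1(2), where eqn = eqn])
     (use eq fx(1) in blast)
 next
  case 2
  have "bounded (range (%i. (z i - a) / of_real (cmod (z i - a))))"
   unfolding bounded_iff by (intro exI[of _ 1]) (auto simp: norm_divide)
  then obtain u q where q: "strict_mono (q :: nat => nat)" "((%i. (z i - a) / of_real (cmod (z i - a))) \<circ> q) \<longlonglongrightarrow> u"
   using bounded_imp_convergent_subsequence by blast
  have dir: "(%i. (z (q i) - a) / of_real (cmod (z (q i) - a))) \<longlonglongrightarrow> u" using q(2) by (simp add: o_def)
  have zq: "(%i. z (q i)) \<longlonglongrightarrow> a" using LIMSEQ_subseq_LIMSEQ[OF s(2) q(1)] by (simp add: o_def)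
  have far: "filterlim (%i. cmod ((z (q i) - a) / of_real (\<rho> (q i)))) at_top sequentially"
   using filterlim_compose[OF 2 filterlim_subseq[OF q(1)]] .
  have eq': "(diff_monomial k n (f (s (q i))) x = (x - a) ^ t * b x) = eqn"
   if "x \<in> D" "x ~= a" "~ is_pole (f (s (q i))) x" for i x using eq[OF fx(1) that] .
  show ?thesis
   by (rule far_blowup_constant[OF blowup_subsequence[OF s(3) q(1)] kn m \<alpha> zq D f b eq' far dir])
 qed
 thus False using s(4) by blast
qed

theorem normal_of_locally_bounded:
 assumes D: "open D" "connected D" and F: "!!f. f \<in> F ==> f nicely_meromorphic_on D"
  and bd: "!!a. a \<in> D ==> \<exists>r>0. \<exists>L. ball a r \<subseteq> D & (\<forall>f\<in>F. \<forall>x\<in>ball a r. sphderiv f x <= L)"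
 shows "normal_family D F"
 unfolding normal_family_def
proof (intro allI impI)
 fix f :: "nat => complex => complex" assume "range f \<subseteq> F"
 hence f: "f i \<in> F" for i by blast
 have lip: "\<exists>r>0. \<exists>L. ball a r \<subseteq> D & (\<forall>i. L-lipschitz_on (ball a r) (sphere_value (f i)))" if a: "a \<in> D" for a
 proof -
  obtain r L where r: "0 < r" "ball a r \<subseteq> D" "!!g x. g \<in> F ==> x \<in> ball a r ==> sphderiv g x <= L" using bd[OF a] by blast
  have "(2 * max L 0)-lipschitz_on (ball a r) (sphere_value (f i))" for i
  proof (rule sphderiv_bound_imp_lipschitz[OF nicely_meromorphic_on_subset[OF F[OF f] r(2)] convex_ball])
   show "sphderiv (f i) x <= max L 0" if "x \<in> ball a r" for x using r(3)[OF f that] by (simp add: le_max_iff_disj)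
  qed simp
  thus ?thesis using r by blast
 qed
 obtain s \<psi> where s: "strict_mono s"
  and \<psi>: "!!a. a \<in> D ==> \<exists>r>0. cball a r \<subseteq> D & uniform_limit (cball a r) (%i. sphere_value (f (s i))) \<psi> sequentially"
 proof (rule lipschitz_subsequence[of "%i. sphere_value (f i)" 3 D])
  show "norm (sphere_value (f i) x) <= 3" for i x by (rule norm_sphere_value_le)
  show "\<exists>r>0. \<exists>L N. ball a r \<subseteq> D & (\<forall>i\<ge>N. L-lipschitz_on (ball a r) (sphere_value (f i)))" if "a \<in> D" for a
   using lip[OF that] by blast
 qed (rule that)
 have con: "continuous_on D \<psi>"
 proof (rule continuous_on_local)
  fix a assume a: "a \<in> D"
  obtain r where r: "0 < r" "uniform_limit (cball a r) (%i. sphere_value (f (s i))) \<psi> sequentially" using \<psi>[OF a] by blast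
  obtain q L where q: "0 < q" "!!i. L-lipschitz_on (ball a q) (sphere_value (f i))" using lip[OF a] by blast
  define e where "e = min r q"
  have e: "0 < e" "ball a e \<subseteq> cball a r" "ball a e \<subseteq> ball a q" using r q by (auto simp: e_def)
  have "L-lipschitz_on (ball a e) \<psi>"
   by (rule uniform_limit_lipschitz[OF uniform_limit_on_subset[OF r(2) e(2)]]) (rule lipschitz_on_subset[OF q(2) e(3)])
  hence "continuous_on (D Int ball a e) \<psi>" using lipschitz_on_continuous_on continuous_on_subset by blast
  thus "\<exists>U. open U & a \<in> U & continuous_on (D Int U) \<psi>" using e(1) by (intro exI[of _ "ball a e"]) auto
 qed
 have tr: "spherical_locally_uniform_limit D (f \<circ> s) \<phi>" if \<phi>: "!!x. x \<in> D ==> \<psi> x = \<phi> x" for \<phi>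
  unfolding spherical_locally_uniform_limit_def
 proof
  fix a assume "a \<in> D"
  then obtain r where r: "0 < r" "cball a r \<subseteq> D" "uniform_limit (cball a r) (%i. sphere_value (f (s i))) \<psi> sequentially" using \<psi> by blast
  have "uniform_limit (cball a r) (%i. sphere_value ((f \<circ> s) i)) \<phi> sequentially"
   using r(3) \<phi> r(2) uniform_limit_cong'[of "cball a r" "%i. sphere_value (f (s i))" "%i. sphere_value ((f \<circ> s) i)" \<psi> \<phi> sequentially]
   by (simp add: subset_iff)
  thus "\<exists>r>0. cball a r \<subseteq> D & uniform_limit (cball a r) (%i. sphere_value ((f \<circ> s) i)) \<phi> sequentially"
   using r by blast
 qed
 have "\<exists>r>0. ball a r \<subseteq> D & (\<exists>N. \<forall>i\<ge>N. f (s i) nicely_meromorphic_on ball a r) &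
    uniform_limit (ball a r) (%i. sphere_value (f (s i))) \<psi> sequentially" if a: "a \<in> D" for a
 proof -
  obtain r where r: "0 < r" "cball a r \<subseteq> D" "uniform_limit (cball a r) (%i. sphere_value (f (s i))) \<psi> sequentially" using \<psi>[OF a] by blast
  have "ball a r \<subseteq> D" using r(2) ball_subset_cball by blast
  thus ?thesis using r uniform_limit_on_subset[OF r(3) ball_subset_cball] nicely_meromorphic_on_subset[OF F[OF f]] by blast
 qed
 from limit_meromorphic[OF D con this]
 consider "!!x. x \<in> D ==> \<psi> x = sphere_infinity" | g where "g nicely_meromorphic_on D" "!!x. x \<in> D ==> \<psi> x = sphere_value g x" by blast
 hence "(\<exists>g. g nicely_meromorphic_on D & spherical_locally_uniform_limit D (f \<circ> s) (sphere_value g)) \<or>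
   spherical_locally_uniform_limit D (f \<circ> s) (%_. sphere_infinity)"
 proof cases
  case 1
  thus ?thesis using tr[of "%_. sphere_infinity"] by blast
 next
  case (2 g)
  thus ?thesis using tr[of "sphere_value g"] by blast
 qed
 thus "\<exists>s. strict_mono s & ((\<exists>g. g nicely_meromorphic_on D & spherical_locally_uniform_limit D (f \<circ> s) (sphere_value g)) \<or>
   spherical_locally_uniform_limit D (f \<circ> s) (%_. sphere_infinity))" using s by blast
qed

lemma zeros_in_iff:
 assumes kn: "1 <= k" "2 <= n 0" "1 <= n k" and D: "open D" "x \<in> D" and f: "f nicely_meromorphic_on D" and h: "h holomorphic_on D"
 shows "x \<in> zeros_in D (%z. diff_monomial k n f z - h z) \<longleftrightarrow> ~ is_pole f x & diff_monomial k n f x = h x"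
proof (cases "is_pole f x")
 case True
 have fm: "f meromorphic_on {x}" using f D by (auto simp: nicely_meromorphic_on_def intro: meromorphic_on_subset)
 have fr: "\<exists>\<^sub>F w in at x. f w ~= 0" using eventually_frequently[OF _ non_zero_neighbour_pole[OF True]] by simp
 have zo: "zorder f x < 0" using isolated_pole_imp_neg_zorder[OF _ True] fm by (simp add: meromorphic_at_iff)
 note Z = zorder_diff_monomial[OF fm fr disjI1[OF zo], where k = k and n = n]
 have "0 < (\<Sum>j\<le>k. n j)" using degree_weight_bound(1)[OF kn] by linarith
 hence "0 < int (\<Sum>j\<le>k. n j)" unfolding of_nat_0_less_iff .
 hence "int (\<Sum>j\<le>k. n j) * zorder f x < 0" using zo by (rule mult_pos_neg)
 hence neg: "zorder (diff_monomial k n f) x < 0" unfolding Z(1) by linarith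
 have Mm: "diff_monomial k n f meromorphic_on {x}" using fm by (rule meromorphic_diff_monomial)
 have "\<exists>\<^sub>F w in at x. diff_monomial k n f w ~= 0" using eventually_frequently[OF _ Z(2)] by simp
 hence pole: "is_pole (diff_monomial k n f) x"
  using neg_zorder_imp_is_pole[OF _ _ neg] Mm by (simp add: meromorphic_at_iff)
 have "isCont h x" using holomorphic_on_imp_continuous_on[OF h] D by (simp add: continuous_on_eq_continuous_at)
 hence "((%w. - h w) \<longlongrightarrow> - h x) (at x)" by (intro tendsto_minus) (simp add: isCont_def)
 hence "is_pole (%z. diff_monomial k n f z + - h z) x"
  using pole unfolding is_pole_def by (intro tendsto_add_filterlim_at_infinity')
 thus ?thesis using True by (simp add: zeros_in_def)
next
 case False
 have "f analytic_on {x}" using nicely_meromorphic_on_imp_analytic_at[OF f D(2) False] .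
 hence "diff_monomial k n f analytic_on {x}" by (rule diff_monomial_analytic)
 moreover have "h analytic_on {x}" using h D analytic_at by blast
 ultimately have "(%z. diff_monomial k n f z - h z) analytic_on {x}" by (intro analytic_intros)
 hence "~ is_pole (%z. diff_monomial k n f z - h z) x" by (rule analytic_at_imp_no_pole)
 thus ?thesis using False D by (simp add: zeros_in_def)
qed

lemma shared_zeros_near_point:
 assumes kn: "1 <= k" "2 <= n 0" "1 <= n k" and D: "open D" "a \<in> D" and f: "f nicely_meromorphic_on D" and h: "h holomorphic_on D"
 obtains eqn where "\<forall>\<^sub>F x in at a. (x \<in> zeros_in D (%z. diff_monomial k n f z - h z)) = eqn"
proof -
 define v where "v = (%z. diff_monomial k n f z - h z)"
 have fm: "f meromorphic_on {a}" using f D by (auto simp: nicely_meromorphic_on_def intro: meromorphic_on_subset)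
 have "h analytic_on {a}" using h D analytic_at by blast
 hence vm: "v meromorphic_on {a}"
  unfolding v_def by (intro meromorphic_intros meromorphic_diff_monomial fm analytic_on_imp_meromorphic_on)
 obtain e where e: "0 < e" "f analytic_on ball a e - {a}" using fm by (auto simp: meromorphic_at_iff isolated_singularity_at_def)
 have "\<forall>\<^sub>F x in at a. x \<in> ball a e - {a}" using e(1) by (intro eventually_at_in_open) auto
 moreover have "\<forall>\<^sub>F x in at a. x \<in> D" using D by (intro eventually_at_in_open') auto
 ultimately have iff: "\<forall>\<^sub>F x in at a. x \<in> zeros_in D v \<longleftrightarrow> v x = 0"
 proof eventually_elim
  case (elim x)
  have "f analytic_on {x}" by (rule analytic_on_subset[OF e(2)]) (use elim in simp)
  hence "~ is_pole f x" by (rule analytic_at_imp_no_pole)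
  thus ?case using zeros_in_iff[OF kn D(1) elim(2) f h] by (simp add: v_def)
 qed
 show ?thesis
 proof (cases "\<exists>\<^sub>F x in at a. v x ~= 0")
  case True
  have "\<forall>\<^sub>F x in at a. (x \<in> zeros_in D v) = False"
   using frequently_nonzero_imp_eventually[OF vm True] iff by eventually_elim simp
  thus ?thesis using that unfolding v_def by blast
 next
  case False
  hence "\<forall>\<^sub>F x in at a. v x = 0" by (simp add: frequently_def)
  hence "\<forall>\<^sub>F x in at a. (x \<in> zeros_in D v) = True" using iff by eventually_elim simp
  thus ?thesis using that unfolding v_def by blast
 qed
qed

theorem theorem8:
  fixes D :: "complex set" and k m :: nat and n :: "nat \<Rightarrow> nat"
    and h :: "complex \<Rightarrow> complex" and F :: "(complex \<Rightarrow> complex) set"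
  assumes "open D" and "connected D" and "D \<noteq> {}"
    and "k \<ge> 1" and "n 0 \<ge> 2" and "n k \<ge> 1"
    and "m \<ge> 1"
    and "h holomorphic_on D" and "\<exists>z\<in>D. h z \<noteq> 0"
    and "\<And>z. z \<in> D \<Longrightarrow> h z = 0 \<Longrightarrow> zorder h z \<le> int m"
    and "\<And>f. f \<in> F \<Longrightarrow> f nicely_meromorphic_on D"
    and "\<And>f. f \<in> F \<Longrightarrow> zeros_mult_ge D (k + m + 1) f"
    and "\<And>f g. f \<in> F \<Longrightarrow> g \<in> F \<Longrightarrow>
           share_function D h (diff_monomial k n f) (diff_monomial k n g)"
  shows "normal_family D F"
proof (rule normal_of_locally_bounded[OF assms(1,2,11)])
 fix a assume a: "a \<in> D"
 note kn = assms(4,5,6)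
 show "\<exists>r>0. \<exists>L. ball a r \<subseteq> D & (\<forall>f\<in>F. \<forall>x\<in>ball a r. sphderiv f x <= L)"
 proof (cases "F = {}")
  case True
  thus ?thesis using assms(1) a open_contains_ball by blast
 next
  case False
  then obtain f1 where f1: "f1 \<in> F" by blast
  define b where "b = zor_poly h a"
  define t where "t = nat (zorder h a)"
  have zz: "(if h a = 0 then 0 < zorder h a else zorder h a = 0)"
   "\<exists>r>0. cball a r \<subseteq> D & b holomorphic_on cball a r & (\<forall>w\<in>cball a r. h w = b w * (w - a) ^ t & b w ~= 0)"
   using zorder_exist_zero[OF assms(8,1,2) a assms(9)] unfolding b_def t_def by blast+
  then obtain r where r: "0 < r" "cball a r \<subseteq> D" "b holomorphic_on cball a r" "!!w. w \<in> cball a r ==> h w = b w * (w - a) ^ t & b w ~= 0"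
   by blast
  have t: "t <= m" using zz(1) assms(10)[OF a] by (cases "h a = 0") (auto simp: t_def)
  obtain eqn where ev: "\<forall>\<^sub>F x in at a. (x \<in> zeros_in D (%z. diff_monomial k n f1 z - h z)) = eqn"
   by (rule shared_zeros_near_point[OF kn assms(1) a assms(11)[OF f1] assms(8)])
  then obtain e where e: "0 < e" "!!x. x ~= a ==> dist x a < e ==> (x \<in> zeros_in D (%z. diff_monomial k n f1 z - h z)) = eqn"
   unfolding eventually_at by blast
  define D' where "D' = ball a (min r e)"
  have D': "open D'" "a \<in> D'" "D' \<subseteq> cball a r" "D' \<subseteq> D" using r(1,2) e(1) by (auto simp: D'_def subset_iff)
  have "\<exists>r>0. \<exists>L. ball a r \<subseteq> D' & (\<forall>f\<in>F. \<forall>x\<in>ball a r. sphderiv f x <= L)"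
  proof (rule locally_bounded_of_sharing[OF kn assms(7) t D'(1,2), where b = b and eqn = eqn])
   show "f nicely_meromorphic_on D'" if "f \<in> F" for f using assms(11)[OF that] D'(4) by (rule nicely_meromorphic_on_subset)
   show "zeros_mult_ge D' (k + m + 1) f" if "f \<in> F" for f using assms(12)[OF that] D'(4) by (auto simp: zeros_mult_ge_def)
   show "b holomorphic_on D'" using r(3) D'(3) by (rule holomorphic_on_subset)
   show "b a ~= 0" using r(1,4) by simp
   fix f x assume f: "f \<in> F" and x: "x \<in> D'" "x ~= a" "~ is_pole f x"
   have xD: "x \<in> D" "x \<in> cball a r" using x(1) D' by blast+
   have "zeros_in D (%z. diff_monomial k n f z - h z) = zeros_in D (%z. diff_monomial k n f1 z - h z)"
    using assms(13)[OF f f1] by (simp add: share_function_def)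
   moreover have "(x \<in> zeros_in D (%z. diff_monomial k n f1 z - h z)) = eqn"
    using e(2)[OF x(2)] x(1) by (simp add: D'_def dist_commute)
   ultimately have "(diff_monomial k n f x = h x) = eqn"
    using zeros_in_iff[OF kn assms(1) xD(1) assms(11)[OF f] assms(8)] x(3) by simp
   thus "(diff_monomial k n f x = (x - a) ^ t * b x) = eqn" using r(4)[OF xD(2)] by (simp add: mult.commute)
  qed
  thus ?thesis using D'(4) by (meson order_trans)
 qed
qed

end
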